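(* Let $m\in(0,1)\cup\mathbb{N}$, $0<\alpha<2m<n$, $\frac{n-\alpha}{n-2m}<p<\infty$, $q_c=\frac{n(p-1)}{2m-\alpha}$. Let $F:\mathbb{R}\to\mathbb{R}$ satisfy $F(0)=0$, $|F(a)-F(b)|\le C|a-b|(|a|^{p-1}+|b|^{p-1})$ for some constant $C>0$ and all $a,b\in\mathbb{R}$, and the homogeneity property $F(\lambda a)=\lambda^pF(a)$ for all $\lambda>0$, $a\in\mathbb{R}$. Consider the integral equation $$u(t)=e^{-t(-\Delta)^m}u_0+\int_0^t e^{-(t-\tau)(-\Delta)^m}|\cdot|^{-\alpha}F(u(\tau))\,d\tau,\qquad t>0. \tag{I}$$ There exist $\varepsilon>0$ and $\vartheta>0$ such that if $u_0\in L^{q_c,\infty}(\mathbb{R}^n)$ is homogeneous of degree $-\frac{2m-\alpha}{p-1}$ and $\|u_0\|_{L^{q_c,\infty}}<\varepsilon$, then there exists a unique solution $u\in C_b([0,\infty);L^{q_c,\infty}(\mathbb{R}^n))$ of (I) with $[u]_{L^{q_c,\infty}}\le2\vartheta$, and it satisfies $u=u_\sigma$ a.e. on $\mathbb{R}^n\times[0,\infty)$ for every $\sigma>0$, where $u_\sigma(x,t)=\sigma^{\frac{2m-\alpha}{p-1}}u(\sigma x,\sigma^{2m}t)$. Moreover, suppose in addition that $2m+\alpha<n$, $p<\frac{2m}{\alpha}$ and $q_c<q<\frac{np(p-1)}{2m-\alpha p}$, and put $\delta=\frac n{2m}\left(\frac1{q_c}-\frac1q\right)$. There exist $\varepsilon_q\in(0,\varepsilon)$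 and $\vartheta_q>0$ such that, if also $\|u_0\|_{L^{q_c,\infty}}<\varepsilon_q$, then the corresponding solution $u$ of (I) in $S_q^\delta$ (the unique one with $\|u\|_{S_q^\delta}\le2\vartheta_q$) is self-similar, i.e. $u=u_\sigma$ for every $\sigma>0$.
   Context: $e^{-t(-\Delta)^m}$ is convolution with the kernel $g_m(\cdot,t)$, $\widehat{g_m}(\xi,t)=e^{-t|\xi|^{2m}}$. For measurable $f$ on $\mathbb{R}^n$ let $f^*(\lambda)=\inf\{\tau>0:|\{|f|>\tau\}|\le\lambda\}$ and $f^{**}(s)=\frac1s\int_0^s f^*(\lambda)\,d\lambda$; for $1<q<\infty$, $\|f\|_{L^{q,\infty}}=\sup_{s>0}s^{1/q}f^{**}(s)$. $C_b([0,\infty);\mathcal X)$ is the space of bounded continuous functions with values in $\mathcal X$, with $[u]_{\mathcal X}=\sup_{t>0}\|u(t)\|_{\mathcal X}$; for weak-Lebesgue spaces the convergence $u(t)\to u_0$ as $t\to0^+$ (continuity at $t=0$) is in the weak-$\star$ sense. $S_q^\delta=\{u\in C_b([0,\infty);L^{q_c,\infty}(\mathbb{R}^n)):t^\delta u\in C_b((0,\infty);L^{q,\infty}(\mathbb{R}^n))\}$ with norm $\|u\|_{S_q^\delta}=[u]_{L^{q_c,\infty}}+\sup_{t>0}t^\delta\|u(t)\|_{L^{q,\infty}}$. A function $u_0$ is homogeneous of degree $-\gamma$ if $u_0(\sigma x)=\sigma^{-\gamma}u_0(x)$ for all $\sigma>0$. *)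

theory Defs
  imports "HOL-Analysis.Analysis"
begin

text \<open>
  Functions on $R^n$ are represented by representatives of their a.e.-classes; the norms are
  \<open>ennreal\<close>-valued, so that they are defined (possibly \<open>\<infinity>\<close>) for every function.
\<close>

definition rearrangement :: "(real^'n \<Rightarrow> real) \<Rightarrow> real \<Rightarrow> ennreal" where
  "rearrangement f l =
     (INF \<tau>\<in>{\<tau>. 0 < \<tau> \<and> emeasure lebesgue {x. \<tau> < \<bar>f x\<bar>} \<le> ennreal l}. ennreal \<tau>)"

definition max_rearrangement :: "(real^'n \<Rightarrow> real) \<Rightarrow> real \<Rightarrow> ennreal" where
  "max_rearrangement f s = ennreal (1 / s) * (\<integral>\<^sup>+l\<in>{0<..<s}. rearrangement f l \<partial>lborel)"

definition weak_norm :: "real \<Rightarrow> (real^'n \<Rightarrow> real) \<Rightarrow> ennreal" where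
  "weak_norm q f = (SUP s\<in>{0<..}. ennreal (s powr (1 / q)) * max_rearrangement f s)"

definition weak_Lebesgue :: "real \<Rightarrow> (real^'n \<Rightarrow> real) set" where
  "weak_Lebesgue q = {f \<in> borel_measurable lebesgue. weak_norm q f < \<infinity>}"

text \<open>
  The Lorentz space $L^{r,1}$. For $1 < q < \infty$ the space $L^{q,\infty}$ is the dual of
  $L^{q',1}$ with $q' = q/(q-1)$, which is what its weak-$\star$ topology refers to.
\<close>

definition Lorentz_one :: "real \<Rightarrow> (real^'n \<Rightarrow> real) set" where
  "Lorentz_one r = {f \<in> borel_measurable lebesgue.
     (\<integral>\<^sup>+s\<in>{0<..}. ennreal (s powr (1 / r - 1)) * max_rearrangement f s \<partial>lborel) < \<infinity>}"

definition weak_star_tendsto ::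
    "real \<Rightarrow> ('b \<Rightarrow> real^'n \<Rightarrow> real) \<Rightarrow> (real^'n \<Rightarrow> real) \<Rightarrow> 'b filter \<Rightarrow> bool" where
  "weak_star_tendsto q f g G \<longleftrightarrow>
     (\<forall>\<phi>\<in>Lorentz_one (q / (q - 1)).
        ((\<lambda>i. \<integral>x. f i x * \<phi> x \<partial>lebesgue) \<longlongrightarrow> (\<integral>x. g x * \<phi> x \<partial>lebesgue)) G)"

text \<open>
  A curve is written \<open>u t x\<close>; its values at negative times are irrelevant.
\<close>

definition sup_norm :: "real \<Rightarrow> (real \<Rightarrow> real^'n \<Rightarrow> real) \<Rightarrow> ennreal" where
  "sup_norm q u = (SUP t\<in>{0<..}. weak_norm q (u t))"

text \<open>$C_b((0,\infty); L^{q,\infty})$, with norm continuity.\<close>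

definition Cb_pos :: "real \<Rightarrow> (real \<Rightarrow> real^'n \<Rightarrow> real) set" where
  "Cb_pos q = {u. (\<forall>t>0. u t \<in> weak_Lebesgue q) \<and> sup_norm q u < \<infinity> \<and>
     (\<forall>s>0. ((\<lambda>t. weak_norm q (\<lambda>x. u t x - u s x)) \<longlongrightarrow> 0) (at s))}"

text \<open>$C_b([0,\infty); L^{q,\infty})$: continuity at $t = 0$ is weak-$\star$ only.\<close>

definition Cb :: "real \<Rightarrow> (real \<Rightarrow> real^'n \<Rightarrow> real) set" where
  "Cb q = {u \<in> Cb_pos q. u 0 \<in> weak_Lebesgue q \<and> weak_star_tendsto q u (u 0) (at_right 0)}"

definition S_space :: "real \<Rightarrow> real \<Rightarrow> real \<Rightarrow> (real \<Rightarrow> real^'n \<Rightarrow> real) set" where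
  "S_space qc q \<delta> = {u \<in> Cb qc. (\<lambda>t x. t powr \<delta> * u t x) \<in> Cb_pos q}"

definition S_norm :: "real \<Rightarrow> real \<Rightarrow> real \<Rightarrow> (real \<Rightarrow> real^'n \<Rightarrow> real) \<Rightarrow> ennreal" where
  "S_norm qc q \<delta> u =
     sup_norm qc u + (SUP t\<in>{0<..}. ennreal (t powr \<delta>) * weak_norm q (u t))"

text \<open>Equality of two curves as maps from $[0,\infty)$ into a space of a.e.-classes.\<close>

definition same_curve ::
    "(real \<Rightarrow> real^'n \<Rightarrow> real) \<Rightarrow> (real \<Rightarrow> real^'n \<Rightarrow> real) \<Rightarrow> bool" where
  "same_curve u v \<longleftrightarrow> (\<forall>t\<ge>0. AE x in lebesgue. u t x = v t x)"

text \<open>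
  The Fourier transform is normalised as $\hat g(\xi) = \int e^{-i x\cdot\xi} g(x)\,dx$, the
  convention for which $-\Delta$ has symbol $|\xi|^2$; hence the factor $(2\pi)^{-n}$ below.
\<close>

definition inverse_Fourier :: "(real^'n \<Rightarrow> complex) \<Rightarrow> real^'n \<Rightarrow> complex" where
  "inverse_Fourier h x =
     (\<integral>\<xi>. exp (\<i> * complex_of_real (x \<bullet> \<xi>)) * h \<xi> \<partial>lebesgue) / (2 * pi) ^ CARD('n)"

text \<open>The symbol is even, so its inverse transform is real and \<open>Re\<close> only changes the type.\<close>

definition heat_kernel :: "real \<Rightarrow> real \<Rightarrow> real^'n \<Rightarrow> real" where
  "heat_kernel m t x =
     Re (inverse_Fourier (\<lambda>\<xi>. complex_of_real (exp (- t * norm \<xi> powr (2 * m)))) x)"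

definition heat_semigroup :: "real \<Rightarrow> real \<Rightarrow> (real^'n \<Rightarrow> real) \<Rightarrow> real^'n \<Rightarrow> real" where
  "heat_semigroup m t f x = (\<integral>y. heat_kernel m t (x - y) * f y \<partial>lebesgue)"

text \<open>
  The initial value is attained at $t = 0$, and the equation holds for every $t > 0$ and a.e. $x$,
  the time integral being absolutely convergent (otherwise the library integral would be 0).
\<close>

definition solves_integral_equation ::
    "real \<Rightarrow> real \<Rightarrow> (real \<Rightarrow> real) \<Rightarrow> (real^'n \<Rightarrow> real) \<Rightarrow> (real \<Rightarrow> real^'n \<Rightarrow> real) \<Rightarrow> bool" where
  "solves_integral_equation m \<alpha> F u0 u \<longleftrightarrow>
     (AE x in lebesgue. u 0 x = u0 x) \<and>
     (\<forall>t>0. AE x in lebesgue.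
        set_integrable lebesgue {0<..<t}
          (\<lambda>\<tau>. heat_semigroup m (t - \<tau>) (\<lambda>y. norm y powr (- \<alpha>) * F (u \<tau> y)) x) \<and>
        u t x = heat_semigroup m t u0 x +
          (LINT \<tau>:{0<..<t}|lebesgue.
             heat_semigroup m (t - \<tau>) (\<lambda>y. norm y powr (- \<alpha>) * F (u \<tau> y)) x))"

text \<open>
  Homogeneity is a property of the a.e.-class: for each \<open>\<sigma>\<close> the identity may fail on a null set.
\<close>

definition homogeneous :: "real \<Rightarrow> (real^'n \<Rightarrow> real) \<Rightarrow> bool" where
  "homogeneous d f \<longleftrightarrow> (\<forall>\<sigma>>0. AE x in lebesgue. f (\<sigma> *\<^sub>R x) = \<sigma> powr d * f x)"

definition rescale ::
    "real \<Rightarrow> real \<Rightarrow> real \<Rightarrow> real \<Rightarrow> (real \<Rightarrow> real^'n \<Rightarrow> real) \<Rightarrow> real \<Rightarrow> real^'n \<Rightarrow> real" where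
  "rescale m \<alpha> p \<sigma> u t x =
     \<sigma> powr ((2 * m - \<alpha>) / (p - 1)) * u (\<sigma> powr (2 * m) * t) (\<sigma> *\<^sub>R x)"

end

theory Submission
  imports Defs "HOL-Probability.Characteristic_Functions" "HOL-Complex_Analysis.Complex_Analysis"
begin

text \<open>
  The equation is invariant under \<open>u \<mapsto> u\<^sub>\<sigma>\<close>, and for homogeneous initial data so is the whole
  problem. A solution that is unique among small ones is therefore self-similar. The proof below
  turns this around. A self-similar curve is determined by its profile \<open>U\<close> at time 1, and since the
  integral operator commutes with the scaling (\<open>selfsim_profile_map\<close>), the equation for the curve
  is the fixed point equation \<open>U = profile_map u0 U\<close>. Picard iteration solves it for small data
  (\<open>selfsimilar_solution_exists\<close>). The solution so obtained satisfies the scaling identity at every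
  point with \<open>t > 0\<close>, and any other small solution agrees with it (\<open>mild_solution_unique\<close>).

  Everything rests on one critical estimate: the Duhamel integral is bounded on \<open>L^(qc,\<infinity>)\<close>
  uniformly in time. The nonlinearity maps \<open>L^(q,\<infinity>)\<close>, with \<open>p - 1\<close> factors from \<open>L^(qc,\<infinity>)\<close>, into
  \<open>L^(r,\<infinity>)\<close> with \<open>1/r = 1/q + 2m/n\<close>, by Hoelder's inequality in weak spaces (\<open>nonlin_diff_bound\<close>).
  The smoothing estimate from \<open>r\<close> back to \<open>q\<close> costs \<open>(t - \<tau>)^(-1)\<close>, which is not integrable. The way
  out is to use the norm of \<open>L^(q,\<infinity>)\<close> in the form \<open>\<integral>\<^sub>E |f| \<le> M |E|^(1 - 1/q)\<close> and to integrate over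
  time for fixed \<open>E\<close>, choosing for each \<open>E\<close> the better of two kernel bounds according to whether
  \<open>t - \<tau>\<close> is below or above \<open>|E|^(2m/n)\<close> (\<open>smoothing_integral\<close>). A time weight
  \<open>t^(-\<delta>)\<close> with \<open>\<delta> < 1\<close> survives this argument (\<open>duhamel_bound\<close>).

  This uses the kernel only through self-similarity, continuity, boundedness, integrability and
  mass one (\<open>kernel_family\<close>). For the kernel of \<open>exp (- t (-\<Delta>)^m)\<close> the integrability is the hard part,
  as \<open>exp (- |\<xi>|^(2m))\<close> is in general not smooth at 0. An \<open>N\<close>-th difference of the symbol with
  step \<open>h\<close>, where \<open>x \<bullet> h = \<pi>\<close>, multiplies the transform at \<open>x\<close> by \<open>2^N\<close>. Away from the origin the
  symbol extends holomorphically along lines to discs of radius comparable to \<open>|\<xi>| / |h|\<close>, so that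
  Cauchy's estimates bound the differences (\<open>heat_symbol_far\<close>); near the origin they are trivially
  \<open>O(|h|^(2m))\<close>. The result is the decay \<open>|x|^(-n-2m)\<close> (\<open>fourier_heat_decay\<close>).

  At \<open>t = 0\<close> the solution attains the initial value weakly-\<open>\<star>\<close>: it converges in \<open>L^1\<close> on sets of
  finite measure, and for functions bounded in \<open>L^(qc,\<infinity>)\<close> this implies convergence of the pairings
  with the Lorentz space \<open>L^(qc',1)\<close>, again by layer cake (\<open>weak_bound_Lorentz_pairing\<close>).

  For the second half of the theorem the same iteration is carried out in \<open>L^(qc,\<infinity>)\<close> and
  \<open>L^(q,\<infinity>)\<close> at once. The upper bound on \<open>q\<close> there means precisely \<open>\<delta> < 1/p\<close>. Uniqueness in the
  smaller space is inherited from uniqueness in \<open>C\<^sub>b([0,\<infinity>); L^(qc,\<infinity>))\<close>.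
\<close>

section \<open>Weak Lebesgue bounds\<close>

lemma nn_integral_powr_from_0:
  fixes c b :: real
  assumes "-1 < c" "0 \<le> b"
  shows "(\<integral>\<^sup>+x\<in>{0<..<b}. ennreal (x powr c) \<partial>lborel) = ennreal (b powr (c + 1) / (c + 1))"
proof -
  have "(\<integral>\<^sup>+x\<in>{0<..<b}. ennreal (x powr c) \<partial>lborel)
      = (\<integral>\<^sup>+x. ennreal (indicator {0..b} x * x powr c) \<partial>lborel)"
  proof (rule nn_integral_cong_AE)
    show "AE x in lborel. ennreal (x powr c) * indicator {0<..<b} x
        = ennreal (indicator {0..b} x * x powr c)"
      using AE_lborel_singleton[of 0] AE_lborel_singleton[of b]
      by eventually_elim (auto simp: indicator_def)
  qed
  also have "\<dots> = ennreal (b powr (c + 1) / (c + 1))"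
    by (rule nn_integral_has_integral_lebesgue[OF _ has_integral_powr_from_0])
       (use assms in auto)
  finally show ?thesis .
qed

lemma nn_integral_powr_to_inf:
  fixes c b :: real
  assumes "c < -1" "0 < b"
  shows "(\<integral>\<^sup>+x\<in>{b..}. ennreal (x powr c) \<partial>lborel) = ennreal (b powr (c + 1) / (- c - 1))"
proof -
  have "(\<integral>\<^sup>+x\<in>{b..}. ennreal (x powr c) \<partial>lborel)
      = (\<integral>\<^sup>+x. ennreal (indicator {b..} x * x powr c) \<partial>lborel)"
    by (rule nn_integral_cong) (auto simp: indicator_def)
  also have "\<dots> = ennreal (- (b powr (c + 1)) / (c + 1))"
    by (rule nn_integral_has_integral_lebesgue[OF _ has_integral_powr_to_inf])
       (use assms in auto)
  also have "- (b powr (c + 1)) / (c + 1) = b powr (c + 1) / (- c - 1)"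
    using assms by (simp add: field_simps)
  finally show ?thesis .
qed

lemma layer_cake:
  fixes k :: "'a::euclidean_space \<Rightarrow> real" and w :: "'a \<Rightarrow> ennreal"
  assumes [measurable]: "k \<in> borel_measurable borel" "w \<in> borel_measurable borel"
  shows "(\<integral>\<^sup>+x. ennreal \<bar>k x\<bar> * w x \<partial>lborel)
       = (\<integral>\<^sup>+l\<in>{0<..}. (\<integral>\<^sup>+x\<in>{x. l < \<bar>k x\<bar>}. w x \<partial>lborel) \<partial>lborel)"
proof -
  have "ennreal \<bar>k x\<bar> * w x = (\<integral>\<^sup>+l. (if 0 < l \<and> l < \<bar>k x\<bar> then w x else 0) \<partial>lborel)" for x
  proof -
    have "(\<integral>\<^sup>+l. (if 0 < l \<and> l < \<bar>k x\<bar> then w x else 0) \<partial>lborel)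
        = (\<integral>\<^sup>+l. w x * indicator {0<..<\<bar>k x\<bar>} l \<partial>lborel)"
      by (rule nn_integral_cong) (auto simp: indicator_def)
    then show ?thesis by (simp add: nn_integral_cmult mult.commute)
  qed
  then have "(\<integral>\<^sup>+x. ennreal \<bar>k x\<bar> * w x \<partial>lborel)
     = (\<integral>\<^sup>+x. (\<integral>\<^sup>+l. (if 0 < l \<and> l < \<bar>k x\<bar> then w x else 0) \<partial>lborel) \<partial>lborel)" by simp
  also have "\<dots> = (\<integral>\<^sup>+l. (\<integral>\<^sup>+x. (if 0 < l \<and> l < \<bar>k x\<bar> then w x else 0) \<partial>lborel) \<partial>lborel)"
    by (rule lborel_pair.Fubini') measurable
  also have "\<dots> = (\<integral>\<^sup>+l\<in>{0<..}. (\<integral>\<^sup>+x\<in>{x. l < \<bar>k x\<bar>}. w x \<partial>lborel) \<partial>lborel)"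
    by (rule nn_integral_cong) (auto simp: indicator_def intro!: nn_integral_cong)
  finally show ?thesis .
qed

text \<open>
  The bound \<open>\<integral>\<^sub>E |f| \<le> M |E|^(1 - 1/q)\<close> on sets \<open>E\<close> of finite measure says that \<open>s^(1/q) f^** s \<le> M\<close> for
  all \<open>s\<close>, because \<open>s f^** s\<close> is the supremum of \<open>\<integral>\<^sub>E |f|\<close> over sets of measure at most \<open>s\<close>. It is
  the convenient form of the norm of \<open>L^(q,\<infinity>)\<close>: it is subadditive, it passes to limits and time
  integrals by monotone convergence and Tonelli, and it never mentions a rearrangement.
\<close>

definition weak_bound :: "real \<Rightarrow> real \<Rightarrow> ('a::euclidean_space \<Rightarrow> real) \<Rightarrow> bool" where
  "weak_bound q M f \<longleftrightarrow> 0 \<le> M \<and> f \<in> borel_measurable borel \<and>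
     (\<forall>E\<in>sets borel. emeasure lborel E < \<infinity> \<longrightarrow>
        (\<integral>\<^sup>+x\<in>E. ennreal \<bar>f x\<bar> \<partial>lborel) \<le> ennreal (M * measure lborel E powr (1 - 1 / q)))"

text \<open>
  The quasi-norm of \<open>L^(q,\<infinity>)\<close> in terms of the distribution function. It is not subadditive, but it
  behaves well under products and powers, where \<^const>\<open>weak_bound\<close> does not.
\<close>

definition level_bound :: "real \<Rightarrow> real \<Rightarrow> ('a::euclidean_space \<Rightarrow> real) \<Rightarrow> bool" where
  "level_bound q A f \<longleftrightarrow> 0 < A \<and> f \<in> borel_measurable borel \<and>
     (\<forall>l>0. emeasure lborel {x. l < \<bar>f x\<bar>} \<le> ennreal ((A / l) powr q))"

lemma weak_boundD:
  assumes "weak_bound q M f"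
  shows "0 \<le> M" "f \<in> borel_measurable borel"
    and "\<And>E. E \<in> sets borel \<Longrightarrow> emeasure lborel E < \<infinity> \<Longrightarrow>
      (\<integral>\<^sup>+x\<in>E. ennreal \<bar>f x\<bar> \<partial>lborel) \<le> ennreal (M * measure lborel E powr (1 - 1 / q))"
  using assms by (auto simp: weak_bound_def)

lemma weak_bound_mono: "weak_bound q M f \<Longrightarrow> M \<le> N \<Longrightarrow> weak_bound q N f"
  unfolding weak_bound_def by (fastforce intro: order_trans ennreal_leI mult_right_mono)

lemma weak_bound_dominated:
  assumes "weak_bound q M f" "g \<in> borel_measurable borel" "AE x in lborel. \<bar>g x\<bar> \<le> \<bar>f x\<bar>"
  shows "weak_bound q M g"
  unfolding weak_bound_def
proof (intro conjI ballI impI)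
  fix E :: "'a set" assume E: "E \<in> sets borel" "emeasure lborel E < \<infinity>"
  have "(\<integral>\<^sup>+x\<in>E. ennreal \<bar>g x\<bar> \<partial>lborel) \<le> (\<integral>\<^sup>+x\<in>E. ennreal \<bar>f x\<bar> \<partial>lborel)"
    by (rule nn_integral_mono_AE) (use assms(3) in \<open>auto simp: indicator_def ennreal_leI\<close>)
  also have "\<dots> \<le> ennreal (M * measure lborel E powr (1 - 1 / q))"
    using weak_boundD(3)[OF assms(1) E] .
  finally show "(\<integral>\<^sup>+x\<in>E. ennreal \<bar>g x\<bar> \<partial>lborel) \<le> ennreal (M * measure lborel E powr (1 - 1 / q))" .
qed (use assms(2) weak_boundD(1)[OF assms(1)] in auto)

lemma weak_bound_AE_cong:
  assumes "weak_bound q M f" "g \<in> borel_measurable borel" "AE x in lborel. f x = g x"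
  shows "weak_bound q M g"
  by (rule weak_bound_dominated[OF assms(1,2)]) (use assms(3) in auto)

lemma weak_bound_add:
  assumes "weak_bound q M f" "weak_bound q N g"
  shows "weak_bound q (M + N) (\<lambda>x. f x + g x)"
  unfolding weak_bound_def
proof (intro conjI ballI impI)
  note [measurable] = weak_boundD(2)[OF assms(1)] weak_boundD(2)[OF assms(2)]
  show "(\<lambda>x. f x + g x) \<in> borel_measurable borel" by measurable
  fix E :: "'a set" assume E: "E \<in> sets borel" "emeasure lborel E < \<infinity>"
  note E(1)[measurable]
  have "(\<integral>\<^sup>+x\<in>E. ennreal \<bar>f x + g x\<bar> \<partial>lborel)
      \<le> (\<integral>\<^sup>+x. ennreal \<bar>f x\<bar> * indicator E x + ennreal \<bar>g x\<bar> * indicator E x \<partial>lborel)"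
    by (rule nn_integral_mono)
       (auto simp: indicator_def ennreal_leI abs_triangle_ineq simp flip: ennreal_plus)
  also have "\<dots> = (\<integral>\<^sup>+x\<in>E. ennreal \<bar>f x\<bar> \<partial>lborel) + (\<integral>\<^sup>+x\<in>E. ennreal \<bar>g x\<bar> \<partial>lborel)"
    by (rule nn_integral_add) auto
  also have "\<dots> \<le> ennreal (M * measure lborel E powr (1 - 1 / q))
      + ennreal (N * measure lborel E powr (1 - 1 / q))"
    using weak_boundD(3)[OF assms(1) E] weak_boundD(3)[OF assms(2) E] by (rule add_mono)
  also have "\<dots> = ennreal ((M + N) * measure lborel E powr (1 - 1 / q))"
    using weak_boundD(1)[OF assms(1)] weak_boundD(1)[OF assms(2)]
    by (simp add: distrib_right flip: ennreal_plus)
  finally show "(\<integral>\<^sup>+x\<in>E. ennreal \<bar>f x + g x\<bar> \<partial>lborel)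
      \<le> ennreal ((M + N) * measure lborel E powr (1 - 1 / q))" .
qed (use weak_boundD(1)[OF assms(1)] weak_boundD(1)[OF assms(2)] in simp)

lemma weak_bound_cmult:
  assumes "weak_bound q M f"
  shows "weak_bound q (\<bar>c\<bar> * M) (\<lambda>x. c * f x)"
  unfolding weak_bound_def
proof (intro conjI ballI impI)
  note [measurable] = weak_boundD(2)[OF assms(1)]
  show "(\<lambda>x. c * f x) \<in> borel_measurable borel" by measurable
  fix E :: "'a set" assume E: "E \<in> sets borel" "emeasure lborel E < \<infinity>"
  note E(1)[measurable]
  have "(\<integral>\<^sup>+x\<in>E. ennreal \<bar>c * f x\<bar> \<partial>lborel) = ennreal \<bar>c\<bar> * (\<integral>\<^sup>+x\<in>E. ennreal \<bar>f x\<bar> \<partial>lborel)"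
    by (subst nn_integral_cmult[symmetric])
       (auto intro!: nn_integral_cong simp: abs_mult ennreal_mult mult.assoc)
  also have "\<dots> \<le> ennreal \<bar>c\<bar> * ennreal (M * measure lborel E powr (1 - 1 / q))"
    using weak_boundD(3)[OF assms(1) E] by (rule mult_left_mono) auto
  also have "\<dots> = ennreal (\<bar>c\<bar> * M * measure lborel E powr (1 - 1 / q))"
    using weak_boundD(1)[OF assms(1)] by (simp add: mult.assoc flip: ennreal_mult)
  finally show "(\<integral>\<^sup>+x\<in>E. ennreal \<bar>c * f x\<bar> \<partial>lborel)
      \<le> ennreal (\<bar>c\<bar> * M * measure lborel E powr (1 - 1 / q))" .
qed (use weak_boundD(1)[OF assms(1)] in simp)

lemma weak_bound_diff:
  assumes "weak_bound q M f" "weak_bound q N g"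
  shows "weak_bound q (M + N) (\<lambda>x. f x - g x)"
  using weak_bound_add[OF assms(1) weak_bound_cmult[OF assms(2), of "-1"]] by simp

lemma weak_bound_zero: "weak_bound q 0 (\<lambda>x. 0)"
  by (simp add: weak_bound_def)

lemma weak_bound_inf:
  assumes "\<And>e. 0 < e \<Longrightarrow> weak_bound q (M + e) f" "0 \<le> M"
  shows "weak_bound q M f"
  unfolding weak_bound_def
proof (intro conjI ballI impI)
  fix E :: "'a set" assume E: "E \<in> sets borel" "emeasure lborel E < \<infinity>"
  define a where "a = measure lborel E powr (1 - 1 / q)"
  have a: "0 \<le> a" by (simp add: a_def)
  show "(\<integral>\<^sup>+x\<in>E. ennreal \<bar>f x\<bar> \<partial>lborel) \<le> ennreal (M * measure lborel E powr (1 - 1 / q))"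
  proof (rule ennreal_le_epsilon)
    fix e :: real assume e: "0 < e"
    have pos: "0 < e / (a + 1)" using e a by simp
    have "(\<integral>\<^sup>+x\<in>E. ennreal \<bar>f x\<bar> \<partial>lborel) \<le> ennreal ((M + e / (a + 1)) * a)"
      using weak_boundD(3)[OF assms(1)[OF pos] E] by (simp add: a_def)
    also have "(M + e / (a + 1)) * a \<le> M * a + e"
      using e a by (simp add: field_simps)
    finally show "(\<integral>\<^sup>+x\<in>E. ennreal \<bar>f x\<bar> \<partial>lborel)
        \<le> ennreal (M * measure lborel E powr (1 - 1 / q)) + ennreal e"
      using assms(2) e a by (simp add: a_def ennreal_leI flip: ennreal_plus)
  qed
qed (use assms weak_boundD(2)[OF assms(1)[of 1]] in auto)

lemma emeasure_ball_lt_top [simp]: "emeasure lborel (ball (a::'a::euclidean_space) r) < top"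
  using emeasure_lborel_ball_finite[of a r] by (simp add: top.not_eq_extremum)

lemma weak_bound_zero_AE:
  assumes "weak_bound q 0 f"
  shows "AE x in lborel. f x = 0"
proof -
  note [measurable] = weak_boundD(2)[OF assms(1)]
  have "AE x in lborel. \<forall>n::nat. x \<in> ball 0 (real n) \<longrightarrow> f x = 0"
    unfolding AE_all_countable
  proof
    fix n :: nat
    have [measurable]: "ball (0::'a) (real n) \<in> sets borel" by simp
    have "(\<integral>\<^sup>+x\<in>ball 0 (real n). ennreal \<bar>f x\<bar> \<partial>lborel) = 0"
      using weak_boundD(3)[OF assms, of "ball 0 (real n)"] by simp
    then have "AE x in lborel. ennreal \<bar>f x\<bar> * indicator (ball 0 (real n)) x = 0"
      by (subst (asm) nn_integral_0_iff_AE) auto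
    then show "AE x in lborel. x \<in> ball 0 (real n) \<longrightarrow> f x = 0"
      by eventually_elim (auto simp: indicator_def split: if_splits)
  qed
  then show ?thesis
    by eventually_elim (use reals_Archimedean2 in \<open>auto simp: dist_norm\<close>)
qed

text \<open>
  Layer cake for \<open>k\<close>: the level set \<open>{|k| > l}\<close> has measure at most \<open>a / l\<close> by Markov and is empty
  for \<open>l \<ge> b\<close>, so the pairing is at most \<open>M \<integral>\<^sub>0\<^sup>b (a / l)^(1 - 1/r) dl\<close>. This is the duality between
  \<open>L^(r,\<infinity>)\<close> and \<open>L\<^sup>1 \<inter> L\<^sup>\<infinity>\<close> with the interpolated constant, and the source of every smoothing
  estimate below.
\<close>

lemma weak_pairing:
  assumes r: "1 < r" and f: "weak_bound r M f" and k[measurable]: "k \<in> borel_measurable borel"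
    and a: "(\<integral>\<^sup>+x. ennreal \<bar>k x\<bar> \<partial>lborel) \<le> ennreal a" "0 \<le> a"
    and b: "\<And>x. \<bar>k x\<bar> \<le> b"
  shows "(\<integral>\<^sup>+x. ennreal \<bar>k x\<bar> * ennreal \<bar>f x\<bar> \<partial>lborel)
      \<le> ennreal (r * M * a powr (1 - 1 / r) * b powr (1 / r))"
proof -
  note [measurable] = weak_boundD(2)[OF f]
  have b0: "0 \<le> b" using b[of 0] by linarith
  have M0: "0 \<le> M" using weak_boundD(1)[OF f] .
  have lev: "(\<integral>\<^sup>+x\<in>{x. l < \<bar>k x\<bar>}. ennreal \<bar>f x\<bar> \<partial>lborel)
      \<le> ennreal (M * a powr (1 - 1 / r)) * (ennreal (l powr (1 / r - 1)) * indicator {0<..<b} l)"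
    if l: "0 < l" for l
  proof (cases "l < b")
    case True
    let ?E = "{x. l < \<bar>k x\<bar>}"
    have E[measurable]: "?E \<in> sets borel" by measurable
    have "emeasure lborel ?E \<le> emeasure lborel {x\<in>space lborel. 1 \<le> ennreal (1 / l) * ennreal \<bar>k x\<bar>}"
      using l by (intro emeasure_mono)
       (auto simp flip: ennreal_mult ennreal_1 simp del: ennreal_1 intro!: ennreal_leI simp: field_simps)
    also have "\<dots> \<le> ennreal (1 / l) * (\<integral>\<^sup>+x\<in>UNIV. ennreal \<bar>k x\<bar> \<partial>lborel)"
      using nn_integral_Markov_inequality[where u = "\<lambda>x. ennreal \<bar>k x\<bar>" and M = lborel and A = UNIV and c = "ennreal (1 / l)"]
      by simp
    also have "\<dots> \<le> ennreal (1 / l) * ennreal a"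
      using a by (auto intro!: mult_left_mono)
    also have "\<dots> = ennreal (a / l)"
      using l a by (simp flip: ennreal_mult)
    finally have le: "emeasure lborel ?E \<le> ennreal (a / l)" .
    then have fin: "emeasure lborel ?E < \<infinity>" by (rule le_less_trans) simp
    have "measure lborel ?E \<le> a / l"
      using le l a by (simp add: measure_def enn2real_leI)
    then have "measure lborel ?E powr (1 - 1 / r) \<le> (a / l) powr (1 - 1 / r)"
      using r by (intro powr_mono2) auto
    also have "\<dots> = a powr (1 - 1 / r) * l powr (1 / r - 1)"
      using l a by (simp add: powr_divide powr_diff field_simps)
    finally have "M * measure lborel ?E powr (1 - 1 / r) \<le> M * a powr (1 - 1 / r) * l powr (1 / r - 1)"
      using M0 by (simp add: mult_left_mono mult.assoc)
    then have "ennreal (M * measure lborel ?E powr (1 - 1 / r)) \<le> ennreal (M * a powr (1 - 1 / r) * l powr (1 / r - 1))"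
      by (rule ennreal_leI)
    with weak_boundD(3)[OF f E fin]
    have "(\<integral>\<^sup>+x\<in>?E. ennreal \<bar>f x\<bar> \<partial>lborel) \<le> ennreal (M * a powr (1 - 1 / r) * l powr (1 / r - 1))"
      by (rule order_trans)
    then show ?thesis
      using M0 True l by (simp add: ennreal_mult)
  next
    case False
    then have "{x. l < \<bar>k x\<bar>} = {}" using b by (auto simp: not_less) (meson leD order_trans)
    then show ?thesis by simp
  qed
  have "(\<integral>\<^sup>+x. ennreal \<bar>k x\<bar> * ennreal \<bar>f x\<bar> \<partial>lborel)
      = (\<integral>\<^sup>+l\<in>{0<..}. (\<integral>\<^sup>+x\<in>{x. l < \<bar>k x\<bar>}. ennreal \<bar>f x\<bar> \<partial>lborel) \<partial>lborel)"
    by (rule layer_cake) auto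
  also have "\<dots> \<le> (\<integral>\<^sup>+l. ennreal (M * a powr (1 - 1 / r)) * (ennreal (l powr (1 / r - 1)) * indicator {0<..<b} l) \<partial>lborel)"
    by (rule nn_integral_mono) (use lev in \<open>auto simp: indicator_def split: if_splits\<close>)
  also have "\<dots> = ennreal (M * a powr (1 - 1 / r)) * (\<integral>\<^sup>+l\<in>{0<..<b}. ennreal (l powr (1 / r - 1)) \<partial>lborel)"
    by (rule nn_integral_cmult) auto
  also have "(\<integral>\<^sup>+l\<in>{0<..<b}. ennreal (l powr (1 / r - 1)) \<partial>lborel) = ennreal (b powr (1 / r) * r)"
    by (subst nn_integral_powr_from_0) (use r b0 in auto)
  also have "ennreal (M * a powr (1 - 1 / r)) * ennreal (b powr (1 / r) * r)
      = ennreal (r * M * a powr (1 - 1 / r) * b powr (1 / r))"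
    using M0 r by (simp add: mult_ac flip: ennreal_mult)
  finally show ?thesis .
qed

text \<open>
  Test the bound on the level set itself, cut off by balls because its measure is not known to be
  finite beforehand.
\<close>

lemma weak_bound_imp_level_bound:
  assumes q: "1 < q" and f: "weak_bound q M f" and M: "0 < M"
  shows "level_bound q M f"
  unfolding level_bound_def
proof (intro conjI allI impI)
  note [measurable] = weak_boundD(2)[OF f]
  show "f \<in> borel_measurable borel" by fact
  fix l :: real assume l: "0 < l"
  \<comment> \<open>Finite measure has to be known before the level set may be used as a test set.\<close>
  define E where "E n = {x. l < \<bar>f x\<bar>} \<inter> ball 0 (real n)" for n :: nat
  have Em[measurable]: "E n \<in> sets borel" for n unfolding E_def by measurable
  have fin: "emeasure lborel (E n) < \<infinity>" for n
    by (rule le_less_trans[OF emeasure_mono]) (auto simp: E_def infinity_ennreal_def intro: emeasure_ball_lt_top[of 0 "real n", unfolded infinity_ennreal_def])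
  have en: "emeasure lborel (E n) \<le> ennreal ((M / l) powr q)" for n
  proof -
    define s where "s = measure lborel (E n)"
    have es: "emeasure lborel (E n) = ennreal s"
      using fin[of n] by (simp add: s_def emeasure_eq_ennreal_measure)
    have s0: "0 \<le> s" by (simp add: s_def)
    have "ennreal l * emeasure lborel (E n) = (\<integral>\<^sup>+x\<in>E n. ennreal l \<partial>lborel)"
      by (simp add: nn_integral_cmult_indicator)
    also have "\<dots> \<le> (\<integral>\<^sup>+x\<in>E n. ennreal \<bar>f x\<bar> \<partial>lborel)"
      by (rule nn_integral_mono) (auto simp: indicator_def E_def intro!: ennreal_leI)
    also have "\<dots> \<le> ennreal (M * s powr (1 - 1 / q))"
      using weak_boundD(3)[OF f Em fin] by (simp add: s_def)
    finally have ls: "l * s \<le> M * s powr (1 - 1 / q)"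
      using l s0 M by (simp add: es flip: ennreal_mult)
    have "s \<le> (M / l) powr q"
    proof (cases "s = 0")
      case False
      then have sp: "0 < s" using s0 by simp
      have "l * s powr (1 / q) \<le> M"
      proof -
        have "s powr (1 / q) * s powr (1 - 1 / q) = s"
          using sp by (simp flip: powr_add)
        then have "(l * s powr (1 / q)) * s powr (1 - 1 / q) \<le> M * s powr (1 - 1 / q)"
          using ls by (simp add: mult.assoc)
        then show ?thesis using sp by simp
      qed
      then have "s powr (1 / q) \<le> M / l" using l by (simp add: field_simps)
      then have "(s powr (1 / q)) powr q \<le> (M / l) powr q"
        using q by (intro powr_mono2) auto
      then show ?thesis using q sp by (simp add: powr_powr)
    qed simp
    then show ?thesis by (simp add: es ennreal_leI)
  qed
  have "{x. l < \<bar>f x\<bar>} = (\<Union>n. E n)"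
    unfolding E_def using reals_Archimedean2 by (auto simp: dist_norm)
  moreover have "(SUP n. emeasure lborel (E n)) = emeasure lborel (\<Union>n. E n)"
    by (rule SUP_emeasure_incseq) (auto simp: incseq_def E_def)
  ultimately show "emeasure lborel {x. l < \<bar>f x\<bar>} \<le> ennreal ((M / l) powr q)"
    using en by (metis SUP_least)
qed (use M in auto)

text \<open>
  Layer cake on \<open>E\<close>: below the height \<open>T\<close> with \<open>(A / T)\<^sup>q = |E|\<close> the measure of \<open>E\<close> is the better
  bound for the level sets, above it the level bound is.
\<close>

lemma level_bound_imp_weak_bound:
  assumes q: "1 < q" and f: "level_bound q A f"
  shows "weak_bound q (q / (q - 1) * A) f"
  unfolding weak_bound_def
proof (intro conjI ballI impI)
  have A: "0 < A" using f by (simp add: level_bound_def)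
  show "0 \<le> q / (q - 1) * A" using q A by simp
  show fm[measurable]: "f \<in> borel_measurable borel" using f by (simp add: level_bound_def)
  fix E :: "'a set" assume E: "E \<in> sets borel" "emeasure lborel E < \<infinity>"
  note [measurable] = E(1)
  define s where "s = measure lborel E"
  have es: "emeasure lborel E = ennreal s" using E by (simp add: s_def emeasure_eq_ennreal_measure)
  show "(\<integral>\<^sup>+x\<in>E. ennreal \<bar>f x\<bar> \<partial>lborel) \<le> ennreal (q / (q - 1) * A * measure lborel E powr (1 - 1 / q))"
  proof (cases "s = 0")
    case True
    then have "E \<in> null_sets lborel" using es E by auto
    then show ?thesis by (simp add: nn_integral_null_set)
  next
    case False
    then have s: "0 < s" by (simp add: s_def less_le)
    \<comment> \<open>The height at which the two available bounds for the level sets, \<open>s\<close> and \<open>(A / l)^q\<close>, agree.\<close>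
    define T where "T = A * s powr (- 1 / q)"
    have T: "0 < T" using A s by (simp add: T_def)
    have lev: "(\<integral>\<^sup>+x\<in>{x. l < \<bar>f x\<bar>}. indicator E x \<partial>lborel)
       \<le> ennreal s * indicator {0<..<T} l + ennreal (A powr q) * (ennreal (l powr (- q)) * indicator {T..} l)"
      if l: "0 < l" for l
    proof -
      have eq: "(\<integral>\<^sup>+x\<in>{x. l < \<bar>f x\<bar>}. indicator E x \<partial>lborel) = emeasure lborel (E \<inter> {x. l < \<bar>f x\<bar>})"
        by (simp flip: indicator_inter_arith)
      show ?thesis
      proof (cases "l < T")
        case True
        have "emeasure lborel (E \<inter> {x. l < \<bar>f x\<bar>}) \<le> emeasure lborel E"
          by (rule emeasure_mono) auto
        then show ?thesis using True l by (simp add: eq es)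
      next
        case False
        have "emeasure lborel (E \<inter> {x. l < \<bar>f x\<bar>}) \<le> emeasure lborel {x. l < \<bar>f x\<bar>}"
          by (rule emeasure_mono) auto
        also have "\<dots> \<le> ennreal ((A / l) powr q)" using f l by (simp add: level_bound_def)
        also have "(A / l) powr q = A powr q * l powr (- q)"
          using A l by (simp add: powr_divide powr_minus field_simps)
        finally show ?thesis using False l by (simp add: eq ennreal_mult)
      qed
    qed
    have "(\<integral>\<^sup>+x\<in>E. ennreal \<bar>f x\<bar> \<partial>lborel)
        = (\<integral>\<^sup>+l\<in>{0<..}. (\<integral>\<^sup>+x\<in>{x. l < \<bar>f x\<bar>}. indicator E x \<partial>lborel) \<partial>lborel)"
      by (rule layer_cake) auto
    also have "\<dots> \<le> (\<integral>\<^sup>+l. ennreal s * indicator {0<..<T} l + ennreal (A powr q) * (ennreal (l powr (- q)) * indicator {T..} l) \<partial>lborel)"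
      by (rule nn_integral_mono) (use lev in \<open>auto simp: indicator_def split: if_splits\<close>)
    also have "\<dots> = ennreal s * ennreal T + ennreal (A powr q) * (\<integral>\<^sup>+l\<in>{T..}. ennreal (l powr (- q)) \<partial>lborel)"
      using T by (subst nn_integral_add) (auto simp: nn_integral_cmult)
    also have "(\<integral>\<^sup>+l\<in>{T..}. ennreal (l powr (- q)) \<partial>lborel) = ennreal (T powr (- q + 1) / (q - 1))"
      by (subst nn_integral_powr_to_inf) (use q T in auto)
    also have "ennreal s * ennreal T + ennreal (A powr q) * ennreal (T powr (- q + 1) / (q - 1))
      = ennreal (s * T + A powr q * (T powr (- q + 1) / (q - 1)))"
      using s T A q by (simp flip: ennreal_mult ennreal_plus)
    also have "s * T + A powr q * (T powr (- q + 1) / (q - 1)) = q / (q - 1) * A * s powr (1 - 1 / q)"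
    proof -
      have "T powr (- q + 1) = A powr (- q + 1) * s powr (1 - 1 / q)"
      proof -
        have e: "- 1 / q * (- q + 1) = 1 - 1 / q" using q by (simp add: field_simps)
        show ?thesis unfolding T_def using A s by (simp only: powr_mult powr_powr e less_imp_le powr_ge_zero)
      qed
      moreover have "A powr q * A powr (- q + 1) = A" using A by (simp flip: powr_add)
      moreover have "s * T = A * s powr (1 - 1 / q)"
      proof -
        have "s * s powr (- 1 / q) = s powr (1 - 1 / q)"
          using s powr_add[of s 1 "- 1 / q"] by simp
        then show ?thesis unfolding T_def by (metis mult.left_commute)
      qed
      ultimately have "s * T + A powr q * (T powr (- q + 1) / (q - 1)) = A * s powr (1 - 1 / q) + A * s powr (1 - 1 / q) / (q - 1)"
        by (simp add: mult.assoc[symmetric])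
      then show ?thesis using q by (simp add: field_simps)
    qed
    finally show ?thesis by (simp add: s_def)
  qed
qed

text \<open>
  Hoelder's inequality for weak spaces. If \<open>|f g| > l\<^sub>1 l\<^sub>2\<close> then \<open>|f| > l\<^sub>1\<close> or \<open>|g| > l\<^sub>2\<close>; the
  heights are chosen so that both level sets get the same bound \<open>X\<close>.
\<close>

lemma level_bound_mult:
  assumes q: "0 < q1" "0 < q2" and f: "level_bound q1 A f" and g: "level_bound q2 B g"
    and r: "1 / r = 1 / q1 + 1 / q2"
  shows "level_bound r (2 powr (1 / r) * (A * B)) (\<lambda>x. f x * g x)"
  unfolding level_bound_def
proof (intro conjI allI impI)
  have A: "0 < A" and B: "0 < B" using f g by (auto simp: level_bound_def)
  have r0: "0 < r" using q r by (metis add_pos_pos zero_less_divide_1_iff)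
  note [measurable] = conjunct1[OF conjunct2[OF f[unfolded level_bound_def]]]
    conjunct1[OF conjunct2[OF g[unfolded level_bound_def]]]
  show "0 < 2 powr (1 / r) * (A * B)" using A B by simp
  show "(\<lambda>x. f x * g x) \<in> borel_measurable borel" by measurable
  fix l :: real assume l: "0 < l"
  \<comment> \<open>The common bound for both level sets; it forces \<open>l1 * l2 = l\<close>.\<close>
  define X where "X = (A * B / l) powr r"
  have X: "0 < X" using A B l by (simp add: X_def)
  define l1 where "l1 = A * X powr (- 1 / q1)"
  define l2 where "l2 = B * X powr (- 1 / q2)"
  have pos: "0 < l1" "0 < l2" using A B X by (auto simp: l1_def l2_def)
  have "X powr (- 1 / q1) * X powr (- 1 / q2) = X powr (- 1 / r)"
    using X r by (simp add: field_simps flip: powr_add)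
  also have "\<dots> = l / (A * B)"
    using r0 A B l by (simp add: X_def powr_powr powr_minus)
  finally have "l1 * l2 = (A * B) * (l / (A * B))" by (simp add: l1_def l2_def mult_ac)
  then have ll: "l1 * l2 = l" using A B by simp
  have "emeasure lborel {x. l < \<bar>f x * g x\<bar>} \<le> emeasure lborel ({x. l1 < \<bar>f x\<bar>} \<union> {x. l2 < \<bar>g x\<bar>})"
  proof (rule emeasure_mono)
    show "{x. l < \<bar>f x * g x\<bar>} \<subseteq> {x. l1 < \<bar>f x\<bar>} \<union> {x. l2 < \<bar>g x\<bar>}"
    proof
      fix x assume x: "x \<in> {x. l < \<bar>f x * g x\<bar>}"
      show "x \<in> {x. l1 < \<bar>f x\<bar>} \<union> {x. l2 < \<bar>g x\<bar>}"
      proof (rule ccontr)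
        assume "x \<notin> {x. l1 < \<bar>f x\<bar>} \<union> {x. l2 < \<bar>g x\<bar>}"
        then have "\<bar>f x\<bar> * \<bar>g x\<bar> \<le> l1 * l2" using pos by (intro mult_mono) auto
        then show False using x ll by (simp add: abs_mult)
      qed
    qed
  qed simp
  also have "\<dots> \<le> emeasure lborel {x. l1 < \<bar>f x\<bar>} + emeasure lborel {x. l2 < \<bar>g x\<bar>}"
    by (rule emeasure_subadditive) auto
  also have "\<dots> \<le> ennreal ((A / l1) powr q1) + ennreal ((B / l2) powr q2)"
    using f g pos by (intro add_mono) (auto simp: level_bound_def)
  also have "(A / l1) powr q1 = X" unfolding l1_def using A X q by (simp add: powr_minus powr_powr powr_divide field_simps)
  also have "(B / l2) powr q2 = X" unfolding l2_def using B X q by (simp add: powr_minus powr_powr powr_divide field_simps)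
  also have "ennreal X + ennreal X = ennreal (2 * X)" using X by (simp flip: ennreal_plus)
  also have "2 * X = ((2 powr (1 / r) * (A * B)) / l) powr r"
    unfolding X_def using A B l r0 by (simp add: powr_mult powr_powr powr_divide)
  finally show "emeasure lborel {x. l < \<bar>f x * g x\<bar>} \<le> ennreal (((2 powr (1 / r) * (A * B)) / l) powr r)" .
qed

lemma level_bound_powr:
  assumes f: "level_bound q A f" and s: "0 < s"
  shows "level_bound (q / s) (A powr s) (\<lambda>x. \<bar>f x\<bar> powr s)"
  unfolding level_bound_def
proof (intro conjI allI impI)
  have A: "0 < A" using f by (auto simp: level_bound_def)
  note [measurable] = conjunct1[OF conjunct2[OF f[unfolded level_bound_def]]]
  show "0 < A powr s" using A by simp
  show "(\<lambda>x. \<bar>f x\<bar> powr s) \<in> borel_measurable borel" by measurable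
  fix l :: real assume l: "0 < l"
  have "{x. l < \<bar>\<bar>f x\<bar> powr s\<bar>} \<subseteq> {x. l powr (1 / s) < \<bar>f x\<bar>}"
  proof
    fix x assume "x \<in> {x. l < \<bar>\<bar>f x\<bar> powr s\<bar>}"
    then have "l powr (1 / s) < (\<bar>f x\<bar> powr s) powr (1 / s)"
      using l s by (intro powr_less_mono2) auto
    then show "x \<in> {x. l powr (1 / s) < \<bar>f x\<bar>}" using s by (simp add: powr_powr)
  qed
  then have "emeasure lborel {x. l < \<bar>\<bar>f x\<bar> powr s\<bar>} \<le> emeasure lborel {x. l powr (1 / s) < \<bar>f x\<bar>}"
    by (intro emeasure_mono) auto
  also have "\<dots> \<le> ennreal ((A / l powr (1 / s)) powr q)" using f l by (simp add: level_bound_def)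
  also have "(A / l powr (1 / s)) powr q = (A powr s / l) powr (q / s)"
    using A l s by (simp add: powr_divide powr_powr)
  finally show "emeasure lborel {x. l < \<bar>\<bar>f x\<bar> powr s\<bar>} \<le> ennreal ((A powr s / l) powr (q / s))" .
qed

text \<open>
  The level sets are balls; this is what makes the weight \<open>|x|^(-\<alpha>)\<close> of the equation a member of
  \<open>L^(n/\<alpha>,\<infinity>)\<close>.
\<close>

lemma level_bound_norm_powr:
  assumes a: "0 < a"
  shows "level_bound (real DIM('a) / a) (unit_ball_vol (real DIM('a)) powr (a / real DIM('a)))
           (\<lambda>x::'a::euclidean_space. norm x powr (- a))"
  unfolding level_bound_def
proof (intro conjI allI impI)
  have w: "0 < unit_ball_vol (real DIM('a))" by (rule unit_ball_vol_pos) simp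
  then show "0 < unit_ball_vol (real DIM('a)) powr (a / real DIM('a))"
    by (metis powr_gt_zero less_irrefl)
  show "(\<lambda>x::'a. norm x powr (- a)) \<in> borel_measurable borel" by measurable
  fix l :: real assume l: "0 < l"
  have "{x::'a. l < \<bar>norm x powr (- a)\<bar>} \<subseteq> ball 0 (l powr (- 1 / a))"
  proof
    fix x :: 'a assume x: "x \<in> {x. l < \<bar>norm x powr (- a)\<bar>}"
    then have nx: "norm x \<noteq> 0" using l by auto
    have "l powr (1 / a) < (norm x powr (- a)) powr (1 / a)"
      using x l a by (intro powr_less_mono2) auto
    also have "(norm x powr (- a)) powr (1 / a) = norm x powr (- 1)" using a by (simp add: powr_powr)
    also have "\<dots> = 1 / norm x" using nx powr_minus_divide[of "norm x" 1] by simp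
    finally have "l powr (1 / a) < 1 / norm x" .
    then show "x \<in> ball 0 (l powr (- 1 / a))"
      using l nx by (simp add: powr_minus field_simps)
  qed
  then have "emeasure lborel {x::'a. l < \<bar>norm x powr (- a)\<bar>} \<le> emeasure lborel (ball (0::'a) (l powr (- 1 / a)))"
    by (intro emeasure_mono) auto
  also have "\<dots> = ennreal (unit_ball_vol (real DIM('a)) * (l powr (- 1 / a)) ^ DIM('a))"
    by (rule emeasure_ball) simp
  also have "unit_ball_vol (real DIM('a)) * (l powr (- 1 / a)) ^ DIM('a)
      = (unit_ball_vol (real DIM('a)) powr (a / real DIM('a)) / l) powr (real DIM('a) / a)"
  proof -
    have "v * (l powr (- 1 / a)) ^ DIM('a) = (v powr (a / real DIM('a)) / l) powr (real DIM('a) / a)"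
      if "0 < v" for v :: real
      using that l a by (simp add: powr_divide powr_powr powr_minus field_simps flip: powr_realpow)
    then show ?thesis using w by blast
  qed
  finally show "emeasure lborel {x::'a. l < \<bar>norm x powr (- a)\<bar>}
     \<le> ennreal ((unit_ball_vol (real DIM('a)) powr (a / real DIM('a)) / l) powr (real DIM('a) / a))" .
qed

section \<open>Rearrangements and the pairing with Lorentz functions\<close>

text \<open>
  The heights at which the distribution function exceeds \<open>s\<close> all lie below any \<open>\<tau>\<close> competing in the
  infimum that defines the rearrangement.
\<close>

lemma superlevel_le_rearrangement:
  fixes f :: "real^'n \<Rightarrow> real"
  assumes [measurable]: "f \<in> borel_measurable borel"
  shows "(\<integral>\<^sup>+l. (if 0 < l \<and> ennreal s < emeasure lborel {x. l < \<bar>f x\<bar>} then 1 else 0) \<partial>lborel)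
       \<le> rearrangement f s"
  unfolding rearrangement_def
proof (rule INF_greatest)
  fix \<tau> assume "\<tau> \<in> {\<tau>. 0 < \<tau> \<and> emeasure lebesgue {x. \<tau> < \<bar>f x\<bar>} \<le> ennreal s}"
  then have \<tau>: "0 < \<tau>" "emeasure lborel {x. \<tau> < \<bar>f x\<bar>} \<le> ennreal s" by auto
  have "(\<integral>\<^sup>+l. (if 0 < l \<and> ennreal s < emeasure lborel {x. l < \<bar>f x\<bar>} then 1 else 0) \<partial>lborel)
     \<le> (\<integral>\<^sup>+l. indicator {0<..<\<tau>} l \<partial>lborel)"
  proof (rule nn_integral_mono)
    fix l :: real
    have "emeasure lborel {x. l < \<bar>f x\<bar>} \<le> ennreal s" if "\<tau> \<le> l"
    proof -
      have "emeasure lborel {x. l < \<bar>f x\<bar>} \<le> emeasure lborel {x. \<tau> < \<bar>f x\<bar>}"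
        using that by (intro emeasure_mono) auto
      with \<tau> show ?thesis by (meson order_trans)
    qed
    then show "(if 0 < l \<and> ennreal s < emeasure lborel {x. l < \<bar>f x\<bar>} then 1 else 0)
        \<le> (indicator {0<..<\<tau>} l :: ennreal)"
      by (auto simp: indicator_def not_le[symmetric])
  qed
  also have "\<dots> = ennreal \<tau>" using \<tau> by simp
  finally show "(\<integral>\<^sup>+l. (if 0 < l \<and> ennreal s < emeasure lborel {x. l < \<bar>f x\<bar>} then 1 else 0) \<partial>lborel)
     \<le> ennreal \<tau>" .
qed

lemma measurable_distribution [measurable]:
  fixes f :: "'a::euclidean_space \<Rightarrow> real"
  assumes [measurable]: "f \<in> borel_measurable borel"
  shows "(\<lambda>l. emeasure lborel {x. l < \<bar>f x\<bar>}) \<in> borel_measurable borel"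
proof -
  have "(\<lambda>l. \<integral>\<^sup>+x. (if l < \<bar>f x\<bar> then 1 else 0) \<partial>lborel) \<in> borel_measurable borel"
    by measurable
  moreover have "(\<integral>\<^sup>+x. (if l < \<bar>f x\<bar> then 1 else 0) \<partial>lborel) = emeasure lborel {x. l < \<bar>f x\<bar>}" for l
  proof -
    have "(\<integral>\<^sup>+x. (if l < \<bar>f x\<bar> then 1 else 0) \<partial>lborel) = (\<integral>\<^sup>+x. indicator {x. l < \<bar>f x\<bar>} x \<partial>lborel)"
      by (rule nn_integral_cong) (auto simp: indicator_def)
    then show ?thesis by simp
  qed
  ultimately show ?thesis by simp
qed

text \<open>
  The integral of \<open>|f|\<close> over \<open>E\<close> is at most that of \<open>f\<^sup>*\<close> over \<open>(0, |E|)\<close>: write both as double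
  integrals over height and measure. The constant is 1, so a bound on the norm is carried over as it
  stands.
\<close>

lemma weak_bound_of_weak_norm:
  fixes f :: "real^'n \<Rightarrow> real"
  assumes f[measurable]: "f \<in> borel_measurable borel" and N: "weak_norm q f \<le> ennreal M" and M: "0 \<le> M"
  shows "weak_bound q M f"
  unfolding weak_bound_def
proof (intro conjI ballI impI)
  fix E :: "(real^'n) set" assume E: "E \<in> sets borel" "emeasure lborel E < \<infinity>"
  note [measurable] = E(1)
  define s where "s = measure lborel E"
  have es: "emeasure lborel E = ennreal s" using E by (simp add: s_def emeasure_eq_ennreal_measure)
  show "(\<integral>\<^sup>+x\<in>E. ennreal \<bar>f x\<bar> \<partial>lborel) \<le> ennreal (M * measure lborel E powr (1 - 1 / q))"
  proof (cases "s = 0")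
    case True
    then have "E \<in> null_sets lborel" using es E by auto
    then show ?thesis by (simp add: nn_integral_null_set)
  next
    case False
    then have s: "0 < s" by (simp add: s_def less_le)
    have lev: "(\<integral>\<^sup>+x\<in>{x. l < \<bar>f x\<bar>}. indicator E x \<partial>lborel)
      \<le> (\<integral>\<^sup>+\<sigma>. (if 0 < \<sigma> \<and> \<sigma> < s \<and> ennreal \<sigma> < emeasure lborel {x. l < \<bar>f x\<bar>} then 1 else 0) \<partial>lborel)" for l
    proof -
      let ?A = "{x. l < \<bar>f x\<bar>}"
      have "(\<integral>\<^sup>+x\<in>?A. indicator E x \<partial>lborel) = emeasure lborel (E \<inter> ?A)"
        by (simp flip: indicator_inter_arith)
      also have "\<dots> \<le> min (emeasure lborel E) (emeasure lborel ?A)"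
        by (intro min.boundedI emeasure_mono) auto
      finally have 1: "(\<integral>\<^sup>+x\<in>?A. indicator E x \<partial>lborel) \<le> min (ennreal s) (emeasure lborel ?A)"
        by (simp add: es)
      define m where "m = enn2real (min (ennreal s) (emeasure lborel ?A))"
      have "min (ennreal s) (emeasure lborel ?A) < top" by (simp add: min_less_iff_disj)
      then have m: "ennreal m = min (ennreal s) (emeasure lborel ?A)" by (simp add: m_def)
      have "0 \<le> m" by (simp add: m_def)
      then have "ennreal m = (\<integral>\<^sup>+\<sigma>. indicator {0<..<m} \<sigma> \<partial>lborel)" by simp
      also have "\<dots> \<le> (\<integral>\<^sup>+\<sigma>. (if 0 < \<sigma> \<and> \<sigma> < s \<and> ennreal \<sigma> < emeasure lborel ?A then 1 else 0) \<partial>lborel)"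
      proof (rule nn_integral_mono)
        fix \<sigma> :: real
        have "\<sigma> < s \<and> ennreal \<sigma> < emeasure lborel ?A" if "0 < \<sigma>" "\<sigma> < m"
        proof -
          have "ennreal \<sigma> < ennreal m" using that by (simp add: ennreal_less_iff)
          then have "ennreal \<sigma> < ennreal s" "ennreal \<sigma> < emeasure lborel ?A" by (auto simp: m)
          then show ?thesis using that by (simp add: ennreal_less_iff)
        qed
        then show "indicator {0<..<m} \<sigma> \<le> (if 0 < \<sigma> \<and> \<sigma> < s \<and> ennreal \<sigma> < emeasure lborel ?A then 1 else (0::ennreal))"
          by (auto simp: indicator_def)
      qed
      finally show ?thesis using order_trans[OF 1] by (simp only: m)
    qed
    have "(\<integral>\<^sup>+x\<in>E. ennreal \<bar>f x\<bar> \<partial>lborel)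
        = (\<integral>\<^sup>+l\<in>{0<..}. (\<integral>\<^sup>+x\<in>{x. l < \<bar>f x\<bar>}. indicator E x \<partial>lborel) \<partial>lborel)"
      by (rule layer_cake) auto
    also have "\<dots> \<le> (\<integral>\<^sup>+l. (\<integral>\<^sup>+\<sigma>. (if 0 < l \<and> 0 < \<sigma> \<and> \<sigma> < s \<and> ennreal \<sigma> < emeasure lborel {x. l < \<bar>f x\<bar>} then 1 else 0) \<partial>lborel) \<partial>lborel)"
    proof (rule nn_integral_mono)
      fix l :: real
      show "(\<integral>\<^sup>+x\<in>{x. l < \<bar>f x\<bar>}. indicator E x \<partial>lborel) * indicator {0<..} l
        \<le> (\<integral>\<^sup>+\<sigma>. (if 0 < l \<and> 0 < \<sigma> \<and> \<sigma> < s \<and> ennreal \<sigma> < emeasure lborel {x. l < \<bar>f x\<bar>} then 1 else 0) \<partial>lborel)"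
        using lev[of l] by (cases "0 < l") auto
    qed
    also have "\<dots> = (\<integral>\<^sup>+\<sigma>. (\<integral>\<^sup>+l. (if 0 < l \<and> 0 < \<sigma> \<and> \<sigma> < s \<and> ennreal \<sigma> < emeasure lborel {x. l < \<bar>f x\<bar>} then 1 else 0) \<partial>lborel) \<partial>lborel)"
      by (rule lborel_pair.Fubini') measurable
    also have "\<dots> \<le> (\<integral>\<^sup>+\<sigma>\<in>{0<..<s}. rearrangement f \<sigma> \<partial>lborel)"
    proof (rule nn_integral_mono)
      fix \<sigma> :: real
      show "(\<integral>\<^sup>+l. (if 0 < l \<and> 0 < \<sigma> \<and> \<sigma> < s \<and> ennreal \<sigma> < emeasure lborel {x. l < \<bar>f x\<bar>} then 1 else 0) \<partial>lborel)
        \<le> rearrangement f \<sigma> * indicator {0<..<s} \<sigma>"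
        using superlevel_le_rearrangement[OF f, of \<sigma>] by (cases "0 < \<sigma> \<and> \<sigma> < s") auto
    qed
    finally have *: "(\<integral>\<^sup>+x\<in>E. ennreal \<bar>f x\<bar> \<partial>lborel) \<le> (\<integral>\<^sup>+\<sigma>\<in>{0<..<s}. rearrangement f \<sigma> \<partial>lborel)" .
    have "ennreal (s powr (1 / q)) * max_rearrangement f s \<le> weak_norm q f"
      unfolding weak_norm_def using s by (intro SUP_upper) auto
    then have **: "ennreal (s powr (1 / q)) * (ennreal (1 / s) * (\<integral>\<^sup>+\<sigma>\<in>{0<..<s}. rearrangement f \<sigma> \<partial>lborel)) \<le> ennreal M"
      using N by (auto simp: max_rearrangement_def)
    have "ennreal (s powr (1 - 1 / q)) * ennreal (s powr (1 / q)) * ennreal (1 / s) = 1"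
      using s by (simp flip: ennreal_mult powr_add)
    then have "(\<integral>\<^sup>+\<sigma>\<in>{0<..<s}. rearrangement f \<sigma> \<partial>lborel)
       = ennreal (s powr (1 - 1 / q)) * (ennreal (s powr (1 / q)) * (ennreal (1 / s) * (\<integral>\<^sup>+\<sigma>\<in>{0<..<s}. rearrangement f \<sigma> \<partial>lborel)))"
      by (simp flip: mult.assoc)
    also have "\<dots> \<le> ennreal (s powr (1 - 1 / q)) * ennreal M"
      using ** by (rule mult_left_mono) simp
    also have "\<dots> = ennreal (M * s powr (1 - 1 / q))" using M by (simp add: mult.commute flip: ennreal_mult)
    finally show ?thesis using * by (simp add: s_def)
  qed
qed (use M in auto)

text \<open>
  The level bound says \<open>f\<^sup>* l \<le> A l^(-1/q)\<close>, and averaging this power produces the factor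
  \<open>q / (q - 1)\<close>.
\<close>

lemma weak_norm_le_level:
  fixes f :: "real^'n \<Rightarrow> real"
  assumes q: "1 < q" and f: "level_bound q A f"
  shows "weak_norm q f \<le> ennreal (q / (q - 1) * A)"
  unfolding weak_norm_def
proof (rule SUP_least)
  have A: "0 < A" and [measurable]: "f \<in> borel_measurable borel" using f by (auto simp: level_bound_def)
  fix s :: real assume "s \<in> {0<..}"
  then have s: "0 < s" by simp
  have re: "rearrangement f l \<le> ennreal A * ennreal (l powr (- 1 / q))" if l: "0 < l" for l
  proof -
    define \<tau> where "\<tau> = A * l powr (- 1 / q)"
    have \<tau>: "0 < \<tau>" using A l by (simp add: \<tau>_def)
    have "emeasure lborel {x. \<tau> < \<bar>f x\<bar>} \<le> ennreal ((A / \<tau>) powr q)"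
      using f \<tau> by (simp add: level_bound_def)
    also have "A / \<tau> = l powr (1 / q)" using A l by (simp add: \<tau>_def powr_minus field_simps)
    also have "(l powr (1 / q)) powr q = l" using l q by (simp add: powr_powr)
    finally have "rearrangement f l \<le> ennreal \<tau>"
      unfolding rearrangement_def using \<tau> by (intro INF_lower) simp
    then show ?thesis using A by (simp add: \<tau>_def ennreal_mult)
  qed
  have "(\<integral>\<^sup>+l\<in>{0<..<s}. rearrangement f l \<partial>lborel)
      \<le> (\<integral>\<^sup>+l. ennreal A * (ennreal (l powr (- 1 / q)) * indicator {0<..<s} l) \<partial>lborel)"
    by (rule nn_integral_mono) (use re in \<open>auto simp: indicator_def\<close>)
  also have "\<dots> = ennreal A * (\<integral>\<^sup>+l\<in>{0<..<s}. ennreal (l powr (- 1 / q)) \<partial>lborel)"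
    by (rule nn_integral_cmult) auto
  also have "(\<integral>\<^sup>+l\<in>{0<..<s}. ennreal (l powr (- 1 / q)) \<partial>lborel) = ennreal (s powr (- 1 / q + 1) / (- 1 / q + 1))"
    by (rule nn_integral_powr_from_0) (use q s in auto)
  finally have "max_rearrangement f s \<le> ennreal (1 / s) * (ennreal A * ennreal (s powr (- 1 / q + 1) / (- 1 / q + 1)))"
    unfolding max_rearrangement_def by (intro mult_left_mono) auto
  then have "ennreal (s powr (1 / q)) * max_rearrangement f s
     \<le> ennreal (s powr (1 / q)) * (ennreal (1 / s) * (ennreal A * ennreal (s powr (- 1 / q + 1) / (- 1 / q + 1))))"
    by (rule mult_left_mono) simp
  also have "\<dots> = ennreal (s powr (1 / q) * (1 / s * (A * (s powr (- 1 / q + 1) / (- 1 / q + 1)))))"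
    using s A q by (simp flip: ennreal_mult)
  also have "s powr (1 / q) * (1 / s * (A * (s powr (- 1 / q + 1) / (- 1 / q + 1)))) = q / (q - 1) * A"
  proof -
    have e: "- 1 / q + 1 = (q - 1) / q" using q by (simp add: field_simps)
    have "s powr (- 1 / q + 1) * s powr (1 / q) = s powr (- 1 / q + 1 + 1 / q)" by (rule powr_add[symmetric])
    also have "- 1 / q + 1 + 1 / q = 1" by simp
    finally have X: "s powr (- 1 / q + 1) = s / s powr (1 / q)" using s by (simp add: eq_divide_eq)
    have "0 < s powr (1 / q)" using s by simp
    then show ?thesis unfolding X unfolding e using s q by (simp add: field_simps)
  qed
  finally show "ennreal (s powr (1 / q)) * max_rearrangement f s \<le> ennreal (q / (q - 1) * A)" .
qed

lemma weak_norm_le: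
  fixes f :: "real^'n \<Rightarrow> real"
  assumes q: "1 < q" and f: "weak_bound q M f"
  shows "weak_norm q f \<le> ennreal (q / (q - 1) * M)"
proof (rule ennreal_le_epsilon)
  fix e :: real assume e: "0 < e"
  define d where "d = (q - 1) / q * e"
  have d: "0 < d" using e q by (simp add: d_def)
  have M: "0 \<le> M" using weak_boundD(1)[OF f] .
  have "weak_norm q f \<le> ennreal (q / (q - 1) * (M + d))"
    by (rule weak_norm_le_level[OF q weak_bound_imp_level_bound[OF q]])
       (use weak_bound_mono[OF f] d M in auto)
  also have "q / (q - 1) * (M + d) = q / (q - 1) * M + e" using q by (simp add: d_def field_simps)
  also have "ennreal \<dots> = ennreal (q / (q - 1) * M) + ennreal e" using q M e by simp
  finally show "weak_norm q f \<le> ennreal (q / (q - 1) * M) + ennreal e" .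
qed

lemma antitone_rearrangement: "s \<le> t \<Longrightarrow> rearrangement f t \<le> rearrangement f s"
  unfolding rearrangement_def
  by (rule INF_superset_mono) (auto intro!: ennreal_leI elim!: order_trans)

text \<open>
  Membership in \<open>L^(r,1)\<close> amounts to \<open>\<integral> |{|\<phi>| > l}|^(1/r) dl < \<infinity>\<close>. With \<open>s\<close> running through measures,
  \<open>|{|\<phi>| > l}|^(1/r) = (1/r) \<integral> s^(1/r-1) ds\<close> over \<open>s < |{|\<phi>| > l}|\<close>, and exchanging the integrals leaves
  \<open>s^(1/r-1) \<phi>\<^sup>* s\<close>. The majorant \<open>\<psi>\<close> keeps the statement free of the case where a level set has
  infinite measure.
\<close>

lemma Lorentz_one_layer:
  fixes \<phi> :: "real^'n \<Rightarrow> real"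
  assumes [measurable]: "\<phi> \<in> borel_measurable borel" and L: "\<phi> \<in> Lorentz_one r" and r: "1 < r"
  obtains \<psi> :: "real \<Rightarrow> ennreal" where "\<psi> \<in> borel_measurable borel" "(\<integral>\<^sup>+l\<in>{0<..}. \<psi> l \<partial>lborel) < \<infinity>"
    "AE l in lborel. 0 < l \<longrightarrow> emeasure lborel {x. l < \<bar>\<phi> x\<bar>} < \<infinity> \<and>
        ennreal (measure lborel {x. l < \<bar>\<phi> x\<bar>} powr (1 / r)) \<le> \<psi> l"
proof -
  define mu where "mu l = emeasure lborel {x. l < \<bar>\<phi> x\<bar>}" for l
  have [measurable]: "mu \<in> borel_measurable borel" unfolding mu_def by measurable
  \<comment> \<open>This is \<open>mu l powr (1 / r)\<close>, with value \<open>\<infinity>\<close> where \<open>mu l = \<infinity>\<close>.\<close>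
  define \<psi> where "\<psi> l = ennreal (1 / r) *
     (\<integral>\<^sup>+s. (if 0 < s \<and> ennreal s < mu l then ennreal (s powr (1 / r - 1)) else 0) \<partial>lborel)" for l
  have \<psi>m[measurable]: "\<psi> \<in> borel_measurable borel" unfolding \<psi>_def by measurable
  have "(\<integral>\<^sup>+l\<in>{0<..}. (\<integral>\<^sup>+s. (if 0 < s \<and> ennreal s < mu l then ennreal (s powr (1 / r - 1)) else 0) \<partial>lborel) \<partial>lborel)
     = (\<integral>\<^sup>+l. (\<integral>\<^sup>+s. (if 0 < l \<and> 0 < s \<and> ennreal s < mu l then ennreal (s powr (1 / r - 1)) else 0) \<partial>lborel) \<partial>lborel)"
    by (rule nn_integral_cong) (auto simp: indicator_def intro!: nn_integral_cong)
  also have "\<dots> = (\<integral>\<^sup>+s. (\<integral>\<^sup>+l. (if 0 < l \<and> 0 < s \<and> ennreal s < mu l then ennreal (s powr (1 / r - 1)) else 0) \<partial>lborel) \<partial>lborel)"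
    by (rule lborel_pair.Fubini') measurable
  also have "\<dots> \<le> (\<integral>\<^sup>+s\<in>{0<..}. ennreal (s powr (1 / r - 1)) * max_rearrangement \<phi> s \<partial>lborel)"
  proof (rule nn_integral_mono)
    fix s :: real
    show "(\<integral>\<^sup>+l. (if 0 < l \<and> 0 < s \<and> ennreal s < mu l then ennreal (s powr (1 / r - 1)) else 0) \<partial>lborel)
      \<le> ennreal (s powr (1 / r - 1)) * max_rearrangement \<phi> s * indicator {0<..} s"
    proof (cases "0 < s")
      case True
      have "(\<integral>\<^sup>+l. (if 0 < l \<and> 0 < s \<and> ennreal s < mu l then ennreal (s powr (1 / r - 1)) else 0) \<partial>lborel)
        = ennreal (s powr (1 / r - 1)) * (\<integral>\<^sup>+l. (if 0 < l \<and> ennreal s < mu l then 1 else 0) \<partial>lborel)"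
        using True by (subst nn_integral_cmult[symmetric]) (auto intro!: nn_integral_cong)
      also have "\<dots> \<le> ennreal (s powr (1 / r - 1)) * rearrangement \<phi> s"
        by (intro mult_left_mono) (auto simp: mu_def superlevel_le_rearrangement)
      also have "rearrangement \<phi> s \<le> max_rearrangement \<phi> s"
      proof -
        have "rearrangement \<phi> s = ennreal (1 / s) * ennreal s * rearrangement \<phi> s"
          using True by (simp flip: ennreal_mult)
        also have "ennreal (1 / s) * ennreal s * rearrangement \<phi> s
            = ennreal (1 / s) * (\<integral>\<^sup>+l\<in>{0<..<s}. rearrangement \<phi> s \<partial>lborel)"
          using True by (simp add: nn_integral_cmult_indicator mult_ac)
        also have "\<dots> \<le> max_rearrangement \<phi> s"
          unfolding max_rearrangement_def
          by (intro mult_left_mono nn_integral_mono) (auto simp: indicator_def intro: antitone_rearrangement)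
        finally show ?thesis .
      qed
      finally show ?thesis using True by (simp add: mult_left_mono)
    qed simp
  qed
  also have "\<dots> < \<infinity>" using L by (simp add: Lorentz_one_def)
  finally have fin: "(\<integral>\<^sup>+l\<in>{0<..}. (\<integral>\<^sup>+s. (if 0 < s \<and> ennreal s < mu l then ennreal (s powr (1 / r - 1)) else 0) \<partial>lborel) \<partial>lborel) < \<infinity>" .
  have "(\<integral>\<^sup>+l\<in>{0<..}. \<psi> l \<partial>lborel) = ennreal (1 / r) *
     (\<integral>\<^sup>+l\<in>{0<..}. (\<integral>\<^sup>+s. (if 0 < s \<and> ennreal s < mu l then ennreal (s powr (1 / r - 1)) else 0) \<partial>lborel) \<partial>lborel)"
    unfolding \<psi>_def mult.assoc by (rule nn_integral_cmult) measurable
  also have "\<dots> < \<infinity>" using fin by (simp add: ennreal_mult_less_top)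
  finally have f\<psi>: "(\<integral>\<^sup>+l\<in>{0<..}. \<psi> l \<partial>lborel) < \<infinity>" .
  have lower: "ennreal (b powr (1 / r)) \<le> \<psi> l" if b: "0 \<le> b" "ennreal b \<le> mu l" for b l
  proof -
    have "ennreal (b powr (1 / r)) = ennreal (1 / r) * ennreal (b powr (1 / r - 1 + 1) / (1 / r - 1 + 1))"
      using r by (simp flip: ennreal_mult)
    also have "ennreal (b powr (1 / r - 1 + 1) / (1 / r - 1 + 1)) = (\<integral>\<^sup>+s\<in>{0<..<b}. ennreal (s powr (1 / r - 1)) \<partial>lborel)"
      by (rule nn_integral_powr_from_0[symmetric]) (use r b in auto)
    also have "ennreal (1 / r) * \<dots> \<le> \<psi> l"
      unfolding \<psi>_def
    proof (intro mult_left_mono nn_integral_mono)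
      fix s :: real
      have "ennreal s < mu l" if "0 < s" "s < b"
        using that b less_le_trans[of "ennreal s" "ennreal b" "mu l"] by (simp add: ennreal_less_iff)
      then show "ennreal (s powr (1 / r - 1)) * indicator {0<..<b} s
         \<le> (if 0 < s \<and> ennreal s < mu l then ennreal (s powr (1 / r - 1)) else 0)"
        by (auto simp: indicator_def)
    qed simp
    finally show ?thesis .
  qed
  have "AE l in lborel. \<psi> l * indicator {0<..} l \<noteq> \<infinity>"
    by (rule nn_integral_PInf_AE) (use f\<psi> in auto)
  then have ae: "AE l in lborel. 0 < l \<longrightarrow> mu l < \<infinity> \<and> ennreal (measure lborel {x. l < \<bar>\<phi> x\<bar>} powr (1 / r)) \<le> \<psi> l"
  proof eventually_elim
    case (elim l)
    show ?case
    proof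
      assume "0 < l"
      then have fl: "\<psi> l < top" using elim by (simp add: top.not_eq_extremum)
      have "mu l \<noteq> top"
      proof
        assume "mu l = top"
        then have "ennreal (((enn2real (\<psi> l) + 1) powr r) powr (1 / r)) \<le> \<psi> l"
          using lower[of "(enn2real (\<psi> l) + 1) powr r" l] by simp
        moreover have "((enn2real (\<psi> l) + 1) powr r) powr (1 / r) = enn2real (\<psi> l) + 1"
          using r enn2real_nonneg[of "\<psi> l"] by (simp add: powr_powr)
        moreover have "ennreal (enn2real (\<psi> l)) = \<psi> l" using fl by simp
        ultimately have "ennreal (enn2real (\<psi> l) + 1) \<le> ennreal (enn2real (\<psi> l))" by metis
        then show False by (simp add: ennreal_le_iff)
      qed
      then show "mu l < \<infinity> \<and> ennreal (measure lborel {x. l < \<bar>\<phi> x\<bar>} powr (1 / r)) \<le> \<psi> l"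
        using lower[of "measure lborel {x. l < \<bar>\<phi> x\<bar>}" l]
        by (simp add: mu_def emeasure_eq_ennreal_measure top.not_eq_extremum)
    qed
  qed
  show ?thesis by (rule that[OF \<psi>m f\<psi>]) (use ae in \<open>simp add: mu_def\<close>)
qed

text \<open>
  Slicing \<open>\<phi>\<close> into its level sets reduces the pairing to integrals of \<open>|h n|\<close> over sets of finite
  measure. The bound on \<open>h\<close> makes \<open>M \<psi>\<close> an integrable majorant, so convergence on each slice
  suffices. This is how the weak-\<open>\<star>\<close> convergence to the initial value is obtained from mere local
  convergence in \<open>L\<^sup>1\<close>.
\<close>

lemma weak_bound_Lorentz_pairing:
  fixes \<phi> :: "real^'n \<Rightarrow> real" and h :: "nat \<Rightarrow> real^'n \<Rightarrow> real"
  assumes q: "1 < q" and \<phi>[measurable]: "\<phi> \<in> borel_measurable borel" and L: "\<phi> \<in> Lorentz_one (q / (q - 1))"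
    and h: "\<And>n. weak_bound q M (h n)"
  shows "(\<integral>\<^sup>+x. ennreal \<bar>\<phi> x\<bar> * ennreal \<bar>h n x\<bar> \<partial>lborel) < \<infinity>"
    and "(\<And>E. E \<in> sets borel \<Longrightarrow> emeasure lborel E < \<infinity> \<Longrightarrow>
            (\<lambda>n. \<integral>\<^sup>+x\<in>E. ennreal \<bar>h n x\<bar> \<partial>lborel) \<longlonglongrightarrow> 0)
      \<Longrightarrow> (\<lambda>n. \<integral>\<^sup>+x. ennreal \<bar>\<phi> x\<bar> * ennreal \<bar>h n x\<bar> \<partial>lborel) \<longlonglongrightarrow> 0"
proof -
  note [measurable] = weak_boundD(2)[OF h]
  have M: "0 \<le> M" using weak_boundD(1)[OF h] .
  have r: "1 < q / (q - 1)" "1 / (q / (q - 1)) = 1 - 1 / q" using q by (auto simp: field_simps)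
  obtain \<psi> where [measurable]: "\<psi> \<in> borel_measurable borel" and fin: "(\<integral>\<^sup>+l\<in>{0<..}. \<psi> l \<partial>lborel) < \<infinity>"
    and ae: "AE l in lborel. 0 < l \<longrightarrow> emeasure lborel {x. l < \<bar>\<phi> x\<bar>} < \<infinity> \<and>
        ennreal (measure lborel {x. l < \<bar>\<phi> x\<bar>} powr (1 - 1 / q)) \<le> \<psi> l"
    by (rule Lorentz_one_layer[OF \<phi> L r(1), unfolded r(2)]) (rule that)
  define I where "I n l = (\<integral>\<^sup>+x\<in>{x. l < \<bar>\<phi> x\<bar>}. ennreal \<bar>h n x\<bar> \<partial>lborel) * indicator {0<..} l" for n l
  have Im: "I n \<in> borel_measurable lborel" for n
  proof -
    have "I n = (\<lambda>l. (\<integral>\<^sup>+x. (if l < \<bar>\<phi> x\<bar> then ennreal \<bar>h n x\<bar> else 0) \<partial>lborel) * indicator {0<..} l)"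
      unfolding I_def by (auto simp: indicator_def fun_eq_iff intro!: nn_integral_cong)
    then show ?thesis by simp
  qed
  have eq: "(\<integral>\<^sup>+x. ennreal \<bar>\<phi> x\<bar> * ennreal \<bar>h n x\<bar> \<partial>lborel) = (\<integral>\<^sup>+l. I n l \<partial>lborel)" for n
    unfolding I_def by (rule layer_cake) auto
  have bd: "AE l in lborel. I n l \<le> ennreal M * (\<psi> l * indicator {0<..} l)" for n
    using ae
  proof eventually_elim
    case (elim l)
    show ?case
    proof (cases "0 < l")
      case True
      have "{x. l < \<bar>\<phi> x\<bar>} \<in> sets borel" by measurable
      then have "I n l \<le> ennreal (M * measure lborel {x. l < \<bar>\<phi> x\<bar>} powr (1 - 1 / q))"
        using weak_boundD(3)[OF h, of "{x. l < \<bar>\<phi> x\<bar>}"] elim True by (simp add: I_def)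
      also have "\<dots> = ennreal M * ennreal (measure lborel {x. l < \<bar>\<phi> x\<bar>} powr (1 - 1 / q))"
        using M by (simp add: ennreal_mult)
      also have "\<dots> \<le> ennreal M * \<psi> l" using elim True by (intro mult_left_mono) auto
      finally show ?thesis using True by simp
    qed (simp add: I_def)
  qed
  have fin': "(\<integral>\<^sup>+l. ennreal M * (\<psi> l * indicator {0<..} l) \<partial>lborel) < \<infinity>"
    using fin by (subst nn_integral_cmult) (auto simp: ennreal_mult_less_top)
  show "(\<integral>\<^sup>+x. ennreal \<bar>\<phi> x\<bar> * ennreal \<bar>h n x\<bar> \<partial>lborel) < \<infinity>"
    unfolding eq using nn_integral_mono_AE[OF bd] fin' by (rule le_less_trans)
  assume lim: "\<And>E. E \<in> sets borel \<Longrightarrow> emeasure lborel E < \<infinity> \<Longrightarrow>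
            (\<lambda>n. \<integral>\<^sup>+x\<in>E. ennreal \<bar>h n x\<bar> \<partial>lborel) \<longlonglongrightarrow> 0"
  have "(\<lambda>n. \<integral>\<^sup>+l. I n l \<partial>lborel) \<longlonglongrightarrow> (\<integral>\<^sup>+l. 0 \<partial>(lborel::real measure))"
  proof (rule nn_integral_dominated_convergence[OF Im _ _ bd fin'])
    show "AE l in lborel. (\<lambda>n. I n l) \<longlonglongrightarrow> 0"
      using ae
    proof eventually_elim
      case (elim l)
      have "{x. l < \<bar>\<phi> x\<bar>} \<in> sets borel" by measurable
      then show ?case using elim lim[of "{x. l < \<bar>\<phi> x\<bar>}"] by (cases "0 < l") (auto simp: I_def)
    qed
  qed auto
  then show "(\<lambda>n. \<integral>\<^sup>+x. ennreal \<bar>\<phi> x\<bar> * ennreal \<bar>h n x\<bar> \<partial>lborel) \<longlonglongrightarrow> 0" by (simp add: eq)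
qed

section \<open>Affine changes of variables\<close>

lemma nn_integral_affine:
  fixes f :: "'a::euclidean_space \<Rightarrow> ennreal" and t :: 'a
  assumes [measurable]: "f \<in> borel_measurable borel" and c: "c \<noteq> 0"
  shows "(\<integral>\<^sup>+x. f x \<partial>lborel) = ennreal (\<bar>c\<bar> ^ DIM('a)) * (\<integral>\<^sup>+x. f (t + c *\<^sub>R x) \<partial>lborel)"
  by (subst lborel_affine[OF c, of t])
     (simp add: nn_integral_density nn_integral_distr nn_integral_cmult)

lemma lborel_integrable_affine_iff:
  fixes f :: "'a::euclidean_space \<Rightarrow> 'b::{banach, second_countable_topology}" and t :: 'a
  assumes [measurable]: "f \<in> borel_measurable borel" and c: "c \<noteq> 0"
  shows "integrable lborel (\<lambda>x. f (t + c *\<^sub>R x)) \<longleftrightarrow> integrable lborel f"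
proof -
  have "(\<integral>\<^sup>+x. ennreal (norm (f x)) \<partial>lborel) = ennreal (\<bar>c\<bar> ^ DIM('a)) * (\<integral>\<^sup>+x. ennreal (norm (f (t + c *\<^sub>R x))) \<partial>lborel)"
    by (rule nn_integral_affine[OF _ c]) measurable
  then show ?thesis
    using c by (auto simp: integrable_iff_bounded ennreal_mult_less_top)
qed

lemma lborel_integral_affine:
  fixes f :: "'a::euclidean_space \<Rightarrow> 'b::{banach, second_countable_topology}" and t :: 'a
  assumes [measurable]: "f \<in> borel_measurable borel" and c: "c \<noteq> 0"
  shows "(\<integral>x. f x \<partial>lborel) = \<bar>c\<bar> ^ DIM('a) *\<^sub>R (\<integral>x. f (t + c *\<^sub>R x) \<partial>lborel)"
  by (subst lborel_affine[OF c, of t]) (simp add: integral_density integral_distr)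

lemma AE_lborel_affine:
  fixes P :: "'a::euclidean_space \<Rightarrow> bool"
  assumes c: "c \<noteq> 0" and P: "AE x in lborel. P x"
  shows "AE x in lborel. P (t + c *\<^sub>R x)"
proof -
  obtain N where N: "N \<in> null_sets lborel" "\<And>x. x \<notin> N \<Longrightarrow> P x"
    using P by (rule AE_E3) auto
  have [measurable]: "N \<in> sets borel" using N by auto
  have "0 = (\<integral>\<^sup>+x. indicator N x \<partial>lborel)" using null_setsD1[OF N(1)] by simp
  also have "\<dots> = ennreal (\<bar>c\<bar> ^ DIM('a)) * (\<integral>\<^sup>+x. indicator N (t + c *\<^sub>R x) \<partial>lborel)"
    by (rule nn_integral_affine[OF _ c]) measurable
  finally have "ennreal (\<bar>c\<bar> ^ DIM('a)) = 0 \<or> (\<integral>\<^sup>+x. (indicator N (t + c *\<^sub>R x) :: ennreal) \<partial>lborel) = 0"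
    by simp
  moreover have "0 < \<bar>c\<bar> ^ DIM('a)" using c by simp
  ultimately have "(\<integral>\<^sup>+x. (indicator N (t + c *\<^sub>R x) :: ennreal) \<partial>lborel) = 0"
    by (metis ennreal_eq_0_iff not_le)
  then have "AE x in lborel. (indicator N (t + c *\<^sub>R x) :: ennreal) = 0"
    by (subst (asm) nn_integral_0_iff_AE) measurable
  then show ?thesis by eventually_elim (use N in \<open>auto simp: indicator_def split: if_splits\<close>)
qed

lemma nn_integral_reflect:
  fixes f :: "'a::euclidean_space \<Rightarrow> ennreal"
  assumes "f \<in> borel_measurable borel"
  shows "(\<integral>\<^sup>+y. f (x - y) \<partial>lborel) = (\<integral>\<^sup>+y. f y \<partial>lborel)"
  using nn_integral_affine[OF assms, of "-1" x] by simp

lemma nn_integral_shift: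
  fixes f :: "'a::euclidean_space \<Rightarrow> ennreal"
  assumes "f \<in> borel_measurable borel"
  shows "(\<integral>\<^sup>+x. f (x - y) \<partial>lborel) = (\<integral>\<^sup>+x. f x \<partial>lborel)"
  using nn_integral_affine[OF assms, of "1" "-y"] by simp

section \<open>Convolution with an integrable bounded kernel\<close>

definition conv :: "('a::euclidean_space \<Rightarrow> real) \<Rightarrow> ('a \<Rightarrow> real) \<Rightarrow> 'a \<Rightarrow> real" where
  "conv k f x = (\<integral>y. k (x - y) * f y \<partial>lborel)"

lemma weak_pairing_integrable:
  assumes r: "1 < r" and f: "weak_bound r M f" and k[measurable]: "k \<in> borel_measurable borel"
    and a: "(\<integral>\<^sup>+x. ennreal \<bar>k x\<bar> \<partial>lborel) \<le> ennreal a" "0 \<le> a"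
    and b: "\<And>x. \<bar>k x\<bar> \<le> b"
  shows "integrable lborel (\<lambda>y. k y * f y)"
    and "\<bar>\<integral>y. k y * f y \<partial>lborel\<bar> \<le> r * M * a powr (1 - 1 / r) * b powr (1 / r)"
proof -
  note [measurable] = weak_boundD(2)[OF f]
  have le: "(\<integral>\<^sup>+y. ennreal (norm (k y * f y)) \<partial>lborel) \<le> ennreal (r * M * a powr (1 - 1 / r) * b powr (1 / r))"
    using weak_pairing[OF r f k a b] by (simp add: abs_mult ennreal_mult)
  show int: "integrable lborel (\<lambda>y. k y * f y)"
    unfolding integrable_iff_bounded
  proof
    show "(\<integral>\<^sup>+y. ennreal (norm (k y * f y)) \<partial>lborel) < \<infinity>"
      using le by (rule le_less_trans) simp
  qed measurable
  have "ennreal \<bar>\<integral>y. k y * f y \<partial>lborel\<bar> \<le> (\<integral>\<^sup>+y. ennreal (norm (k y * f y)) \<partial>lborel)"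
    using integral_norm_bound_ennreal[OF int] by simp
  also note le
  finally show "\<bar>\<integral>y. k y * f y \<partial>lborel\<bar> \<le> r * M * a powr (1 - 1 / r) * b powr (1 / r)"
    by (subst (asm) ennreal_le_iff) (use r weak_boundD(1)[OF f] in auto)
qed

lemma conv_integrable:
  assumes r: "1 < r" and f: "weak_bound r M f" and k[measurable]: "k \<in> borel_measurable borel"
    and a: "(\<integral>\<^sup>+x. ennreal \<bar>k x\<bar> \<partial>lborel) \<le> ennreal a" "0 \<le> a"
    and b: "\<And>x. \<bar>k x\<bar> \<le> b"
  shows "integrable lborel (\<lambda>y. k (x - y) * f y)"
proof (rule weak_pairing_integrable(1)[OF r f _ _ a(2)])
  show "(\<integral>\<^sup>+y. ennreal \<bar>k (x - y)\<bar> \<partial>lborel) \<le> ennreal a"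
    using a(1) nn_integral_reflect[of "\<lambda>y. ennreal \<bar>k y\<bar>" x] by simp
  show "\<And>y. \<bar>k (x - y)\<bar> \<le> b" using b by simp
qed measurable

lemma borel_measurable_conv [measurable]:
  assumes [measurable]: "k \<in> borel_measurable borel" "f \<in> borel_measurable borel"
  shows "conv k f \<in> borel_measurable borel"
  unfolding conv_def by measurable

text \<open>
  Move the integral over \<open>E\<close> onto the kernel: by Tonelli \<open>\<integral>\<^sub>E |k * f|\<close> is the pairing of \<open>|f|\<close> with
  \<open>\<kappa> y = \<integral>\<^sub>E |k (x - y)| dx\<close>, whose integral is \<open>a |E|\<close> and whose supremum is at most
  \<open>min a (b |E|)\<close>. Keeping the minimum, instead of interpolating at once, is essential for the
  critical time integral.
\<close>

lemma conv_local_bound: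
  fixes k f :: "'a::euclidean_space \<Rightarrow> real"
  assumes r: "1 < r" and f: "weak_bound r M f" and k[measurable]: "k \<in> borel_measurable borel"
    and a: "(\<integral>\<^sup>+x. ennreal \<bar>k x\<bar> \<partial>lborel) \<le> ennreal a" "0 \<le> a"
    and b: "\<And>x. \<bar>k x\<bar> \<le> b"
    and E: "E \<in> sets borel" "emeasure lborel E < \<infinity>"
  shows "(\<integral>\<^sup>+x\<in>E. ennreal \<bar>conv k f x\<bar> \<partial>lborel)
     \<le> ennreal (r * M * (a * measure lborel E) powr (1 - 1 / r) * min a (b * measure lborel E) powr (1 / r))"
proof -
  note [measurable] = weak_boundD(2)[OF f] E(1)
  define s where "s = measure lborel E"
  have es: "emeasure lborel E = ennreal s" using E by (simp add: s_def emeasure_eq_ennreal_measure)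
  have s0: "0 \<le> s" by (simp add: s_def)
  have b0: "0 \<le> b" using b[of 0] by linarith
  define K where "K y = (\<integral>\<^sup>+x. indicator E x * ennreal \<bar>k (x - y)\<bar> \<partial>lborel)" for y
  have K1: "K y \<le> ennreal (min a (b * s))" for y
  proof -
    have "K y \<le> (\<integral>\<^sup>+x. ennreal \<bar>k (x - y)\<bar> \<partial>lborel)"
      unfolding K_def by (rule nn_integral_mono) (auto simp: indicator_def)
    also have "\<dots> = (\<integral>\<^sup>+x. ennreal \<bar>k x\<bar> \<partial>lborel)"
      by (rule nn_integral_shift) measurable
    finally have 1: "K y \<le> ennreal a" using a by (meson order_trans)
    have "K y \<le> (\<integral>\<^sup>+x. ennreal b * indicator E x \<partial>lborel)"
      unfolding K_def using b by (intro nn_integral_mono) (auto simp: indicator_def intro: ennreal_leI)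
    also have "\<dots> = ennreal (b * s)"
      using b0 s0 by (simp add: nn_integral_cmult_indicator es ennreal_mult)
    finally show ?thesis using 1 by (simp add: min_def)
  qed
  define \<kappa> where "\<kappa> y = enn2real (K y)" for y
  have "K y < top" for y using K1[of y] by (rule le_less_trans) simp
  then have \<kappa>: "K y = ennreal (\<kappa> y)" "0 \<le> \<kappa> y" for y by (simp_all add: \<kappa>_def)
  have Km[measurable]: "K \<in> borel_measurable borel" unfolding K_def by measurable
  have \<kappa>m: "\<kappa> \<in> borel_measurable borel" unfolding \<kappa>_def by measurable
  have intK: "(\<integral>\<^sup>+y. ennreal \<bar>\<kappa> y\<bar> \<partial>lborel) \<le> ennreal (a * s)"
  proof -
    have "(\<integral>\<^sup>+y. ennreal \<bar>\<kappa> y\<bar> \<partial>lborel) = (\<integral>\<^sup>+y. K y \<partial>lborel)"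
      using \<kappa> by simp
    also have "\<dots> = (\<integral>\<^sup>+x. (\<integral>\<^sup>+y. indicator E x * ennreal \<bar>k (x - y)\<bar> \<partial>lborel) \<partial>lborel)"
      unfolding K_def by (rule lborel_pair.Fubini') measurable
    also have "\<dots> = (\<integral>\<^sup>+x. (\<integral>\<^sup>+y. ennreal \<bar>k y\<bar> \<partial>lborel) * indicator E x \<partial>lborel)"
    proof (rule nn_integral_cong)
      fix x :: 'a
      have "(\<integral>\<^sup>+y. indicator E x * ennreal \<bar>k (x - y)\<bar> \<partial>lborel) = indicator E x * (\<integral>\<^sup>+y. ennreal \<bar>k (x - y)\<bar> \<partial>lborel)"
        by (rule nn_integral_cmult) measurable
      also have "(\<integral>\<^sup>+y. ennreal \<bar>k (x - y)\<bar> \<partial>lborel) = (\<integral>\<^sup>+y. ennreal \<bar>k y\<bar> \<partial>lborel)"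
        by (rule nn_integral_reflect) measurable
      finally show "(\<integral>\<^sup>+y. indicator E x * ennreal \<bar>k (x - y)\<bar> \<partial>lborel) = (\<integral>\<^sup>+y. ennreal \<bar>k y\<bar> \<partial>lborel) * indicator E x"
        by (simp add: mult.commute)
    qed
    also have "\<dots> = (\<integral>\<^sup>+y. ennreal \<bar>k y\<bar> \<partial>lborel) * ennreal s"
      by (simp add: nn_integral_cmult_indicator es)
    also have "\<dots> \<le> ennreal a * ennreal s" using a by (intro mult_right_mono) auto
    finally show ?thesis using a s0 by (simp add: ennreal_mult)
  qed
  have "(\<integral>\<^sup>+x\<in>E. ennreal \<bar>conv k f x\<bar> \<partial>lborel)
     \<le> (\<integral>\<^sup>+x. (\<integral>\<^sup>+y. indicator E x * ennreal \<bar>k (x - y)\<bar> * ennreal \<bar>f y\<bar> \<partial>lborel) \<partial>lborel)"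
  proof (rule nn_integral_mono)
    fix x :: 'a
    have "ennreal \<bar>conv k f x\<bar> \<le> (\<integral>\<^sup>+y. ennreal (norm (k (x - y) * f y)) \<partial>lborel)"
      unfolding conv_def using integral_norm_bound_ennreal[OF conv_integrable[OF r f k a b], of x] by simp
    also have "\<dots> = (\<integral>\<^sup>+y. ennreal \<bar>k (x - y)\<bar> * ennreal \<bar>f y\<bar> \<partial>lborel)"
      by (simp add: abs_mult ennreal_mult)
    finally show "ennreal \<bar>conv k f x\<bar> * indicator E x
       \<le> (\<integral>\<^sup>+y. indicator E x * ennreal \<bar>k (x - y)\<bar> * ennreal \<bar>f y\<bar> \<partial>lborel)"
      by (auto simp: indicator_def)
  qed
  also have "\<dots> = (\<integral>\<^sup>+y. (\<integral>\<^sup>+x. indicator E x * ennreal \<bar>k (x - y)\<bar> * ennreal \<bar>f y\<bar> \<partial>lborel) \<partial>lborel)"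
    by (rule lborel_pair.Fubini') measurable
  also have "\<dots> = (\<integral>\<^sup>+y. ennreal \<bar>\<kappa> y\<bar> * ennreal \<bar>f y\<bar> \<partial>lborel)"
  proof (rule nn_integral_cong)
    fix y :: 'a
    have "(\<integral>\<^sup>+x. indicator E x * ennreal \<bar>k (x - y)\<bar> * ennreal \<bar>f y\<bar> \<partial>lborel) = K y * ennreal \<bar>f y\<bar>"
      unfolding K_def by (rule nn_integral_multc) measurable
    then show "(\<integral>\<^sup>+x. indicator E x * ennreal \<bar>k (x - y)\<bar> * ennreal \<bar>f y\<bar> \<partial>lborel) = ennreal \<bar>\<kappa> y\<bar> * ennreal \<bar>f y\<bar>"
      using \<kappa> by simp
  qed
  also have "\<dots> \<le> ennreal (r * M * (a * s) powr (1 - 1 / r) * min a (b * s) powr (1 / r))"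
  proof (rule weak_pairing[OF r f \<kappa>m intK])
    show "0 \<le> a * s" using a s0 by simp
    fix y
    have "0 \<le> min a (b * s)" using a b0 s0 by simp
    then show "\<bar>\<kappa> y\<bar> \<le> min a (b * s)" using K1[of y] \<kappa>[of y] by (simp only: ennreal_le_iff abs_of_nonneg)
  qed
  finally show ?thesis by (simp add: s_def)
qed

text \<open>
  Young's inequality for weak spaces: interpolate the minimum of the local bound between its two
  arguments.
\<close>

lemma weak_bound_conv:
  fixes k f :: "'a::euclidean_space \<Rightarrow> real"
  assumes r: "1 < r" and f: "weak_bound r M f" and k[measurable]: "k \<in> borel_measurable borel"
    and a: "(\<integral>\<^sup>+x. ennreal \<bar>k x\<bar> \<partial>lborel) \<le> ennreal a" "0 \<le> a"
    and b: "\<And>x. \<bar>k x\<bar> \<le> b"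
    and \<theta>: "0 \<le> \<theta>" "\<theta> \<le> 1 / r" and q: "1 / q = 1 / r - \<theta>"
  shows "weak_bound q (r * M * (a powr (1 - \<theta>) * b powr \<theta>)) (conv k f)"
  unfolding weak_bound_def
proof (intro conjI ballI impI)
  have M: "0 \<le> M" using weak_boundD(1)[OF f] .
  have b0: "0 \<le> b" using b[of 0] by linarith
  note [measurable] = weak_boundD(2)[OF f]
  show "0 \<le> r * M * (a powr (1 - \<theta>) * b powr \<theta>)" using M r by simp
  show "conv k f \<in> borel_measurable borel" by measurable
  fix E :: "'a set" assume E: "E \<in> sets borel" "emeasure lborel E < \<infinity>"
  define s where "s = measure lborel E"
  have s0: "0 \<le> s" by (simp add: s_def)
  have mn: "0 \<le> min a (b * s)" using a b0 s0 by simp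
  have "min a (b * s) powr (1 / r) = min a (b * s) powr (1 / r - \<theta>) * min a (b * s) powr \<theta>"
    by (simp flip: powr_add)
  also have "\<dots> \<le> a powr (1 / r - \<theta>) * (b * s) powr \<theta>"
    using mn \<theta> by (intro mult_mono powr_mono2) auto
  finally have "(a * s) powr (1 - 1 / r) * min a (b * s) powr (1 / r)
     \<le> (a * s) powr (1 - 1 / r) * (a powr (1 / r - \<theta>) * (b * s) powr \<theta>)"
    by (rule mult_left_mono) simp
  also have "\<dots> = (a powr (1 - 1 / r) * a powr (1 / r - \<theta>)) * b powr \<theta> * (s powr (1 - 1 / r) * s powr \<theta>)"
    using a s0 b0 by (simp add: powr_mult)
  also have "a powr (1 - 1 / r) * a powr (1 / r - \<theta>) = a powr (1 - \<theta>)" by (simp flip: powr_add)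
  also have "s powr (1 - 1 / r) * s powr \<theta> = s powr (1 - 1 / r + \<theta>)" by (rule powr_add[symmetric])
  also have "1 - 1 / r + \<theta> = 1 - 1 / q" using q by simp
  finally have le: "(a * s) powr (1 - 1 / r) * min a (b * s) powr (1 / r) \<le> a powr (1 - \<theta>) * b powr \<theta> * s powr (1 - 1 / q)" .
  have "(\<integral>\<^sup>+x\<in>E. ennreal \<bar>conv k f x\<bar> \<partial>lborel)
     \<le> ennreal (r * M * (a * s) powr (1 - 1 / r) * min a (b * s) powr (1 / r))"
    unfolding s_def by (rule conv_local_bound[OF r f k a b E])
  also have "\<dots> \<le> ennreal (r * M * (a powr (1 - \<theta>) * b powr \<theta>) * s powr (1 - 1 / q))"
    using mult_left_mono[OF le, of "r * M"] M r by (intro ennreal_leI) (simp add: mult.assoc)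
  finally show "(\<integral>\<^sup>+x\<in>E. ennreal \<bar>conv k f x\<bar> \<partial>lborel)
     \<le> ennreal (r * M * (a powr (1 - \<theta>) * b powr \<theta>) * measure lborel E powr (1 - 1 / q))"
    by (simp add: s_def)
qed

section \<open>Integrals over time\<close>

text \<open>
  Minkowski's inequality. The hypothesis bounds the integral over each \<open>E\<close> with the time integral
  outside, which is weaker than integrating bounds of the norm at each time; the difference
  matters for the critical estimate.
\<close>

lemma weak_bound_time_integral:
  fixes k :: "real \<Rightarrow> 'a::euclidean_space \<Rightarrow> real"
  assumes k[measurable]: "(\<lambda>(s, x). k s x) \<in> borel_measurable (borel \<Otimes>\<^sub>M borel)" and B: "0 \<le> B"
    and bd: "\<And>E. E \<in> sets borel \<Longrightarrow> emeasure lborel E < \<infinity> \<Longrightarrow>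
      (\<integral>\<^sup>+s. (\<integral>\<^sup>+x\<in>E. ennreal \<bar>k s x\<bar> \<partial>lborel) \<partial>lborel) \<le> ennreal (B * measure lborel E powr (1 - 1 / q))"
  shows "AE x in lborel. integrable lborel (\<lambda>s. k s x)"
    and "weak_bound q B (\<lambda>x. \<integral>s. k s x \<partial>lborel)"
proof -
  have swap: "(\<integral>\<^sup>+x\<in>E. (\<integral>\<^sup>+s. ennreal \<bar>k s x\<bar> \<partial>lborel) \<partial>lborel) \<le> ennreal (B * measure lborel E powr (1 - 1 / q))"
    if E[measurable]: "E \<in> sets borel" and fE: "emeasure lborel E < \<infinity>" for E
  proof -
    have "(\<integral>\<^sup>+x\<in>E. (\<integral>\<^sup>+s. ennreal \<bar>k s x\<bar> \<partial>lborel) \<partial>lborel)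
       = (\<integral>\<^sup>+x. (\<integral>\<^sup>+s. ennreal \<bar>k s x\<bar> * indicator E x \<partial>lborel) \<partial>lborel)"
      by (rule nn_integral_cong) (rule nn_integral_multc[symmetric], measurable)
    also have "\<dots> = (\<integral>\<^sup>+s. (\<integral>\<^sup>+x. ennreal \<bar>k s x\<bar> * indicator E x \<partial>lborel) \<partial>lborel)"
      by (rule lborel_pair.Fubini') measurable
    finally show ?thesis using bd[OF E fE] by simp
  qed
  have "AE x in lborel. \<forall>n::nat. x \<in> ball 0 (real n) \<longrightarrow> (\<integral>\<^sup>+s. ennreal \<bar>k s x\<bar> \<partial>lborel) \<noteq> \<infinity>"
    unfolding AE_all_countable
  proof
    fix n :: nat
    have [measurable]: "ball (0::'a) (real n) \<in> sets borel" by simp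
    have "(\<integral>\<^sup>+x\<in>ball 0 (real n). (\<integral>\<^sup>+s. ennreal \<bar>k s x\<bar> \<partial>lborel) \<partial>lborel) \<noteq> \<infinity>"
      using swap[of "ball 0 (real n)"] by (auto simp: top_unique)
    then have "AE x in lborel. (\<integral>\<^sup>+s. ennreal \<bar>k s x\<bar> \<partial>lborel) * indicator (ball 0 (real n)) x \<noteq> \<infinity>"
      by (intro nn_integral_PInf_AE) measurable
    then show "AE x in lborel. x \<in> ball (0::'a) (real n) \<longrightarrow> (\<integral>\<^sup>+s. ennreal \<bar>k s x\<bar> \<partial>lborel) \<noteq> \<infinity>"
      by eventually_elim auto
  qed
  then show "AE x in lborel. integrable lborel (\<lambda>s. k s x)"
  proof eventually_elim
    case (elim x)
    obtain n :: nat where "norm x < real n" using reals_Archimedean2 by blast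
    then have "(\<integral>\<^sup>+s. ennreal \<bar>k s x\<bar> \<partial>lborel) \<noteq> \<infinity>" using elim by (auto simp: dist_norm)
    then show ?case by (simp add: integrable_iff_bounded top.not_eq_extremum)
  qed
  show "weak_bound q B (\<lambda>x. \<integral>s. k s x \<partial>lborel)"
    unfolding weak_bound_def
  proof (intro conjI ballI impI B)
    show "(\<lambda>x. \<integral>s. k s x \<partial>lborel) \<in> borel_measurable borel" by measurable
    fix E :: "'a set" assume E: "E \<in> sets borel" "emeasure lborel E < \<infinity>"
    have "(\<integral>\<^sup>+x\<in>E. ennreal \<bar>\<integral>s. k s x \<partial>lborel\<bar> \<partial>lborel) \<le> (\<integral>\<^sup>+x\<in>E. (\<integral>\<^sup>+s. ennreal \<bar>k s x\<bar> \<partial>lborel) \<partial>lborel)"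
    proof (rule nn_integral_mono)
      fix x
      have "ennreal \<bar>\<integral>s. k s x \<partial>lborel\<bar> \<le> (\<integral>\<^sup>+s. ennreal \<bar>k s x\<bar> \<partial>lborel)"
        using integral_norm_bound_ennreal[of lborel "\<lambda>s. k s x"]
        by (cases "integrable lborel (\<lambda>s. k s x)") (auto simp: not_integrable_integral_eq)
      then show "ennreal \<bar>\<integral>s. k s x \<partial>lborel\<bar> * indicator E x \<le> (\<integral>\<^sup>+s. ennreal \<bar>k s x\<bar> \<partial>lborel) * indicator E x"
        by (rule mult_right_mono) simp
    qed
    also note swap[OF E]
    finally show "(\<integral>\<^sup>+x\<in>E. ennreal \<bar>\<integral>s. k s x \<partial>lborel\<bar> \<partial>lborel) \<le> ennreal (B * measure lborel E powr (1 - 1 / q))" .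
  qed
qed

lemma antitone_integral_bound:
  fixes \<psi> :: "real \<Rightarrow> ennreal"
  assumes mono: "\<And>s s'. 0 < s \<Longrightarrow> s \<le> s' \<Longrightarrow> \<psi> s' \<le> \<psi> s" and a: "0 < a"
    and J: "(\<integral>\<^sup>+s\<in>{0<..}. \<psi> s \<partial>lborel) \<le> J"
  shows "ennreal a * \<psi> a \<le> J"
proof -
  have "ennreal a * \<psi> a = (\<integral>\<^sup>+s. \<psi> a * indicator {0<..<a} s \<partial>lborel)"
    using a by (simp add: nn_integral_cmult_indicator mult.commute)
  also have "\<dots> \<le> (\<integral>\<^sup>+s\<in>{0<..}. \<psi> s \<partial>lborel)"
    by (rule nn_integral_mono) (auto simp: indicator_def intro: mono)
  finally show ?thesis using J by simp
qed

text \<open>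
  Split at \<open>t / 2\<close>. On the first half the weight is at most \<open>(t / 2)^(-\<delta>)\<close>. On the second half \<open>\<psi>\<close>,
  being antitone with integral at most \<open>J\<close>, is at most \<open>2 J / t\<close>, and the weight is integrable
  because \<open>\<delta> < 1\<close>.
\<close>

lemma weighted_time_integral:
  fixes \<psi> :: "real \<Rightarrow> ennreal"
  assumes [measurable]: "\<psi> \<in> borel_measurable borel"
    and mono: "\<And>s s'. 0 < s \<Longrightarrow> s \<le> s' \<Longrightarrow> \<psi> s' \<le> \<psi> s"
    and J: "(\<integral>\<^sup>+s\<in>{0<..}. \<psi> s \<partial>lborel) \<le> ennreal J" "0 \<le> J"
    and \<delta>: "0 \<le> \<delta>" "\<delta> < 1" and t: "0 < t"
  shows "(\<integral>\<^sup>+s\<in>{0<..<t}. ennreal ((t - s) powr (- \<delta>)) * \<psi> s \<partial>lborel)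
      \<le> ennreal (2 * (1 + 1 / (1 - \<delta>)) * t powr (- \<delta>) * J)"
proof -
  define h where "h = t / 2"
  have h: "0 < h" using t by (simp add: h_def)
  have "(\<integral>\<^sup>+s\<in>{0<..<t}. ennreal ((t - s) powr (- \<delta>)) * \<psi> s \<partial>lborel)
     \<le> (\<integral>\<^sup>+s. ennreal (h powr (- \<delta>)) * (\<psi> s * indicator {0<..} s)
          + \<psi> h * (ennreal ((t - s) powr (- \<delta>)) * indicator {0<..<h} (t - s)) \<partial>lborel)"
  proof (rule nn_integral_mono_AE)
    show "AE s in lborel. ennreal ((t - s) powr (- \<delta>)) * \<psi> s * indicator {0<..<t} s
      \<le> ennreal (h powr (- \<delta>)) * (\<psi> s * indicator {0<..} s)
          + \<psi> h * (ennreal ((t - s) powr (- \<delta>)) * indicator {0<..<h} (t - s))"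
    proof (rule AE_I2)
      fix s :: real
      consider "s \<le> 0 \<or> t \<le> s" | "0 < s" "s \<le> h" | "h < s" "s < t" by linarith
      then show "ennreal ((t - s) powr (- \<delta>)) * \<psi> s * indicator {0<..<t} s
      \<le> ennreal (h powr (- \<delta>)) * (\<psi> s * indicator {0<..} s)
          + \<psi> h * (ennreal ((t - s) powr (- \<delta>)) * indicator {0<..<h} (t - s))"
      proof cases
        case 1
        then show ?thesis by (auto simp: indicator_def)
      next
        case 2
        have "(t - s) powr (- \<delta>) \<le> h powr (- \<delta>)"
          using 2 h \<delta> by (intro powr_mono2') (auto simp: h_def)
        then have "ennreal ((t - s) powr (- \<delta>)) * \<psi> s \<le> ennreal (h powr (- \<delta>)) * \<psi> s"
          by (intro mult_right_mono ennreal_leI) auto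
        with 2 h show ?thesis by (auto simp: indicator_def h_def intro: add_increasing2)
      next
        case 3
        have "ennreal ((t - s) powr (- \<delta>)) * \<psi> s \<le> \<psi> h * ennreal ((t - s) powr (- \<delta>))"
          using 3 h by (subst mult.commute) (intro mult_right_mono mono, auto)
        moreover have "indicator {0<..<h} (t - s) = (1::ennreal)" "indicator {0<..<t} s = (1::ennreal)"
          using 3 h by (auto simp: h_def)
        ultimately show ?thesis by (simp add: add_increasing)
      qed
    qed
  qed
  also have "\<dots> = ennreal (h powr (- \<delta>)) * (\<integral>\<^sup>+s\<in>{0<..}. \<psi> s \<partial>lborel)
      + \<psi> h * (\<integral>\<^sup>+s. ennreal ((t - s) powr (- \<delta>)) * indicator {0<..<h} (t - s) \<partial>lborel)"
    by (subst nn_integral_add) (auto simp: nn_integral_cmult)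
  also have "(\<integral>\<^sup>+s. ennreal ((t - s) powr (- \<delta>)) * indicator {0<..<h} (t - s) \<partial>lborel)
     = (\<integral>\<^sup>+s\<in>{0<..<h}. ennreal (s powr (- \<delta>)) \<partial>lborel)"
    by (rule nn_integral_reflect[of "\<lambda>s. ennreal (s powr (- \<delta>)) * indicator {0<..<h} s" t]) measurable
  also have "\<dots> = ennreal (h powr (- \<delta> + 1) / (- \<delta> + 1))"
    by (rule nn_integral_powr_from_0) (use \<delta> h in auto)
  also have "h powr (- \<delta> + 1) / (- \<delta> + 1) = h * (h powr (- \<delta>) / (1 - \<delta>))"
    using h powr_add[of h "- \<delta>" 1] by simp
  also have "ennreal \<dots> = ennreal h * ennreal (h powr (- \<delta>) / (1 - \<delta>))"
    using h \<delta> by (intro ennreal_mult) auto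
  also have "\<psi> h * \<dots> = ennreal h * \<psi> h * ennreal (h powr (- \<delta>) / (1 - \<delta>))" by (simp add: mult_ac)
  also have "ennreal (h powr (- \<delta>)) * (\<integral>\<^sup>+s\<in>{0<..}. \<psi> s \<partial>lborel)
      + ennreal h * \<psi> h * ennreal (h powr (- \<delta>) / (1 - \<delta>))
     \<le> ennreal (h powr (- \<delta>)) * ennreal J + ennreal J * ennreal (h powr (- \<delta>) / (1 - \<delta>))"
    using antitone_integral_bound[OF mono h J(1)] J(1) by (intro add_mono mult_left_mono mult_right_mono) auto
  also have "\<dots> = ennreal ((1 + 1 / (1 - \<delta>)) * h powr (- \<delta>) * J)"
    using J(2) \<delta> by (simp add: algebra_simps flip: ennreal_mult ennreal_plus)
  also have "\<dots> \<le> ennreal (2 * (1 + 1 / (1 - \<delta>)) * t powr (- \<delta>) * J)"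
  proof (rule ennreal_leI)
    have "h powr (- \<delta>) = t powr (- \<delta>) * 2 powr \<delta>"
      using t by (simp add: h_def powr_divide powr_minus field_simps)
    also have "\<dots> \<le> t powr (- \<delta>) * 2"
      using \<delta> powr_mono[of \<delta> 1 2] by (intro mult_left_mono) auto
    finally have "(1 + 1 / (1 - \<delta>)) * h powr (- \<delta>) \<le> (1 + 1 / (1 - \<delta>)) * (t powr (- \<delta>) * 2)"
      using \<delta> by (intro mult_left_mono) auto
    then have "(1 + 1 / (1 - \<delta>)) * h powr (- \<delta>) * J \<le> (1 + 1 / (1 - \<delta>)) * (t powr (- \<delta>) * 2) * J"
      using J(2) by (rule mult_right_mono)
    then show "(1 + 1 / (1 - \<delta>)) * h powr (- \<delta>) * J \<le> 2 * (1 + 1 / (1 - \<delta>)) * t powr (- \<delta>) * J"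
      by (simp add: algebra_simps)
  qed
  finally show ?thesis .
qed

section \<open>Continuity of translations\<close>

text \<open>
  The class of \<open>w\<close> with this property is linear and closed in \<open>L\<^sup>1\<close>, so indicators of open sets are
  enough by outer regularity. For open \<open>U\<close> the part of \<open>1\<^sub>U - 1\<^sub>U (\<cdot> - y)\<close> that is positive tends
  to 0 by dominated convergence, and the negative part has the same integral.
\<close>

lemma translation_continuous_L1:
  fixes w :: "'a::euclidean_space \<Rightarrow> real"
  assumes w: "integrable lborel w" and y: "y \<longlonglongrightarrow> (0::'a)"
  shows "(\<lambda>j. \<integral>\<^sup>+x. ennreal \<bar>w (x - y j) - w x\<bar> \<partial>lborel) \<longlonglongrightarrow> 0"
proof -
  define P where "P w = (\<lambda>j::nat. \<integral>\<^sup>+x. ennreal \<bar>w (x - y j) - w x\<bar> \<partial>lborel)" for w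
  have approx: "P w \<longlonglongrightarrow> 0"
    if w[measurable]: "w \<in> borel_measurable borel"
      and ap: "\<And>e. 0 < e \<Longrightarrow> \<exists>v\<in>borel_measurable borel. P v \<longlonglongrightarrow> 0 \<and> (\<integral>\<^sup>+x. ennreal \<bar>w x - v x\<bar> \<partial>lborel) \<le> ennreal e"
    for w :: "'a \<Rightarrow> real"
  proof (rule order_tendstoI)
    fix a :: ennreal assume "0 < a"
    then obtain e :: real where e: "0 < e" "ennreal (3 * e) < a"
    proof (cases a rule: ennreal_cases)
      case (real r)
      then have "0 < r" using \<open>0 < a\<close> by simp
      then show thesis using real by (intro that[of "r / 6"]) (auto simp: ennreal_less_iff)
    next
      case top
      then show thesis by (intro that[of 1]) auto
    qed
    obtain v where v[measurable]: "v \<in> borel_measurable borel" and v0: "P v \<longlonglongrightarrow> 0"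
      and vw: "(\<integral>\<^sup>+x. ennreal \<bar>w x - v x\<bar> \<partial>lborel) \<le> ennreal e" using ap[OF e(1)] by blast
    have "eventually (\<lambda>j. P v j < ennreal e) sequentially"
      by (rule order_tendstoD(2)[OF v0]) (use e in simp)
    then show "eventually (\<lambda>j. P w j < a) sequentially"
    proof eventually_elim
      case (elim j)
      have "P w j \<le> (\<integral>\<^sup>+x. ennreal \<bar>v (x - y j) - v x\<bar> + (ennreal \<bar>w (x - y j) - v (x - y j)\<bar> + ennreal \<bar>w x - v x\<bar>) \<partial>lborel)"
        unfolding P_def by (rule nn_integral_mono) (auto simp flip: ennreal_plus intro!: ennreal_leI)
      also have "\<dots> = P v j + ((\<integral>\<^sup>+x. ennreal \<bar>w (x - y j) - v (x - y j)\<bar> \<partial>lborel) + (\<integral>\<^sup>+x. ennreal \<bar>w x - v x\<bar> \<partial>lborel))"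
        unfolding P_def by (simp add: nn_integral_add)
      also have "(\<integral>\<^sup>+x. ennreal \<bar>w (x - y j) - v (x - y j)\<bar> \<partial>lborel) = (\<integral>\<^sup>+x. ennreal \<bar>w x - v x\<bar> \<partial>lborel)"
        by (rule nn_integral_shift) measurable
      also have "P v j + ((\<integral>\<^sup>+x. ennreal \<bar>w x - v x\<bar> \<partial>lborel) + (\<integral>\<^sup>+x. ennreal \<bar>w x - v x\<bar> \<partial>lborel)) \<le> ennreal e + (ennreal e + ennreal e)"
        using elim vw by (intro add_mono) auto
      also have "\<dots> = ennreal (3 * e)" using e by (simp flip: ennreal_plus)
      finally show ?case using e(2) by simp
    qed
  qed simp
  have P_open: "P (indicator U) \<longlonglongrightarrow> 0" if U: "open U" "emeasure lborel U < \<infinity>" for U :: "'a set"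
  proof -
    have [measurable]: "U \<in> sets borel" using U by simp
    define f where "f = (indicator U :: 'a \<Rightarrow> real)"
    have fm[measurable]: "f \<in> borel_measurable borel" unfolding f_def by measurable
    have fi: "integrable lborel f" unfolding f_def using U by simp
    have fj: "integrable lborel (\<lambda>x. f (x - y j))" "(\<integral>x. f (x - y j) \<partial>lborel) = (\<integral>x. f x \<partial>lborel)" for j
      using lborel_integrable_affine_iff[OF fm, of 1 "- y j"] lborel_integral_affine[OF fm, of 1 "- y j"] fi by simp_all
    have lim: "(\<lambda>j. \<integral>x. max 0 (f x - f (x - y j)) \<partial>lborel) \<longlonglongrightarrow> (\<integral>x. 0 \<partial>(lborel :: 'a measure))"
    proof (rule integral_dominated_convergence[where w = f])
      show "AE x in lborel. (\<lambda>j. max 0 (f x - f (x - y j))) \<longlonglongrightarrow> 0"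
      proof (rule AE_I2)
        fix x :: 'a
        show "(\<lambda>j. max 0 (f x - f (x - y j))) \<longlonglongrightarrow> 0"
        proof (cases "x \<in> U")
          case True
          have "(\<lambda>j. x - y j) \<longlonglongrightarrow> x - 0" by (intro tendsto_intros y)
          then have "eventually (\<lambda>j. x - y j \<in> U) sequentially"
            using U True by (auto dest: topological_tendstoD)
          then have "eventually (\<lambda>j. max 0 (f x - f (x - y j)) = 0) sequentially"
            by eventually_elim (use True in \<open>simp add: f_def\<close>)
          then show ?thesis by (rule tendsto_eventually)
        next
          case False
          then have "max 0 (f x - f (x - y j)) = 0" for j by (simp add: f_def)
          then show ?thesis by simp
        qed
      qed
      show "AE x in lborel. norm (max 0 (f x - f (x - y j))) \<le> f x" for j
        by (rule AE_I2) (auto simp: f_def indicator_def)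
    qed (use fi in auto)
    have "P f = (\<lambda>j. ennreal (2 * (\<integral>x. max 0 (f x - f (x - y j)) \<partial>lborel)))"
    proof
      fix j
      have i2: "integrable lborel (\<lambda>x. max 0 (f x - f (x - y j)))"
        using fi fj by (intro Bochner_Integration.integrable_max) auto
      have "(\<integral>x. \<bar>f (x - y j) - f x\<bar> \<partial>lborel) = (\<integral>x. (f (x - y j) - f x) + 2 * max 0 (f x - f (x - y j)) \<partial>lborel)"
        by (rule Bochner_Integration.integral_cong) (auto simp: max_def)
      also have "\<dots> = 2 * (\<integral>x. max 0 (f x - f (x - y j)) \<partial>lborel)"
        using fi fj i2 by simp
      finally have eq: "(\<integral>x. \<bar>f (x - y j) - f x\<bar> \<partial>lborel) = 2 * (\<integral>x. max 0 (f x - f (x - y j)) \<partial>lborel)" .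
      have "P f j = ennreal (\<integral>x. \<bar>f (x - y j) - f x\<bar> \<partial>lborel)"
        unfolding P_def using fi fj by (intro nn_integral_eq_integral) auto
      then show "P f j = ennreal (2 * (\<integral>x. max 0 (f x - f (x - y j)) \<partial>lborel))" by (simp add: eq)
    qed
    moreover have "(\<lambda>j. ennreal (2 * (\<integral>x. max 0 (f x - f (x - y j)) \<partial>lborel))) \<longlonglongrightarrow> ennreal (2 * 0)"
      using lim by (intro tendsto_ennrealI tendsto_mult tendsto_const) simp
    ultimately show ?thesis by (simp add: f_def)
  qed
  have "P w \<longlonglongrightarrow> 0"
    using w
  proof (induction rule: integrable_induct)
    case (base A c)
    then have A: "A \<in> sets borel" "emeasure lborel A < \<infinity>" by auto
    note [measurable] = A(1)
    have PA: "P (indicator A) \<longlonglongrightarrow> 0"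
    proof (rule approx)
      fix e :: real assume e: "0 < e"
      obtain U where U: "open U" "A \<subseteq> U" "emeasure lborel (U - A) < ennreal e"
        using outer_regular_lborel[OF A(1) e] by blast
      have [measurable]: "U \<in> sets borel" using U by simp
      have "emeasure lborel U \<le> emeasure lborel (A \<union> (U - A))" by (rule emeasure_mono) auto
      also have "\<dots> \<le> emeasure lborel A + emeasure lborel (U - A)" by (rule emeasure_subadditive) auto
      also have "\<dots> < \<infinity>" using A(2) U(3) by (simp add: less_top[symmetric]) (use top.not_eq_extremum in fastforce)
      finally have fU: "emeasure lborel U < \<infinity>" .
      have "(\<integral>\<^sup>+x. ennreal \<bar>indicator A x - indicator U x\<bar> \<partial>lborel) = (\<integral>\<^sup>+x. indicator (U - A) x \<partial>lborel)"
        by (rule nn_integral_cong) (use U(2) in \<open>auto simp: indicator_def\<close>)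
      also have "\<dots> \<le> ennreal e" using U(3) by simp
      finally have "(\<integral>\<^sup>+x. ennreal \<bar>indicator A x - indicator U x\<bar> \<partial>lborel) \<le> ennreal e" .
      then show "\<exists>v\<in>borel_measurable borel. P v \<longlonglongrightarrow> 0 \<and> (\<integral>\<^sup>+x. ennreal \<bar>indicator A x - v x\<bar> \<partial>lborel) \<le> ennreal e"
        using P_open[OF U(1) fU] by (intro bexI[of _ "indicator U"]) auto
    qed measurable
    have "P (\<lambda>x. indicator A x *\<^sub>R c) = (\<lambda>j. ennreal \<bar>c\<bar> * P (indicator A) j)"
    proof
      fix j
      have "P (\<lambda>x. indicator A x *\<^sub>R c) j = (\<integral>\<^sup>+x. ennreal \<bar>c\<bar> * ennreal \<bar>indicator A (x - y j) - indicator A x\<bar> \<partial>lborel)"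
        unfolding P_def by (rule nn_integral_cong) (auto simp: indicator_def)
      also have "\<dots> = ennreal \<bar>c\<bar> * P (indicator A) j" unfolding P_def by (rule nn_integral_cmult) measurable
      finally show "P (\<lambda>x. indicator A x *\<^sub>R c) j = ennreal \<bar>c\<bar> * P (indicator A) j" .
    qed
    moreover have "(\<lambda>j. ennreal \<bar>c\<bar> * P (indicator A) j) \<longlonglongrightarrow> ennreal \<bar>c\<bar> * 0"
      by (rule ennreal_tendsto_cmult) (use PA in auto)
    ultimately show ?case by simp
  next
    case (add f h)
    have [measurable]: "f \<in> borel_measurable borel" "h \<in> borel_measurable borel"
      using add by (auto dest: borel_measurable_integrable)
    have "(\<lambda>j. P f j + P h j) \<longlonglongrightarrow> 0 + 0" by (intro tendsto_add add)
    then have "(\<lambda>j. P f j + P h j) \<longlonglongrightarrow> 0" by simp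
    moreover have "P (\<lambda>x. f x + h x) j \<le> P f j + P h j" for j
    proof -
      have "P (\<lambda>x. f x + h x) j \<le> (\<integral>\<^sup>+x. ennreal \<bar>f (x - y j) - f x\<bar> + ennreal \<bar>h (x - y j) - h x\<bar> \<partial>lborel)"
        unfolding P_def by (rule nn_integral_mono) (auto simp flip: ennreal_plus intro!: ennreal_leI)
      also have "\<dots> = P f j + P h j" unfolding P_def by (rule nn_integral_add) measurable
      finally show ?thesis .
    qed
    ultimately have le: "P (\<lambda>x. f x + h x) j \<le> P f j + P h j" and z: "(\<lambda>j. P f j + P h j) \<longlonglongrightarrow> 0" for j
      by blast+
    show ?case
      by (rule tendsto_sandwich[OF _ _ tendsto_const z]) (simp_all add: le)
  next
    case (lim f s)
    have fm[measurable]: "f \<in> borel_measurable borel" and sm[measurable]: "\<And>i. s i \<in> borel_measurable borel"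
      using lim by (auto dest: borel_measurable_integrable)
    have "(\<lambda>i. \<integral>\<^sup>+x. ennreal (norm (f x - s i x)) \<partial>lborel) \<longlonglongrightarrow> 0"
    proof (rule nn_integral_dominated_convergence_norm[where w = "\<lambda>x. 2 * norm (f x)"])
      show "(\<integral>\<^sup>+x. ennreal (2 * norm (f x)) \<partial>lborel) < \<infinity>"
      proof -
        have "integrable lborel (\<lambda>x. 2 * norm (f x))" using \<open>integrable lborel f\<close> by simp
        then show ?thesis unfolding integrable_iff_bounded by (simp add: abs_mult)
      qed
    qed (use lim in auto)
    then have l0: "(\<lambda>i. \<integral>\<^sup>+x. ennreal \<bar>f x - s i x\<bar> \<partial>lborel) \<longlonglongrightarrow> 0" by simp
    show ?case
    proof (rule approx[OF fm])
      fix e :: real assume e: "0 < e"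
      have "eventually (\<lambda>i. (\<integral>\<^sup>+x. ennreal \<bar>f x - s i x\<bar> \<partial>lborel) < ennreal e) sequentially"
        by (rule order_tendstoD(2)[OF l0]) (use e in simp)
      then obtain i where "(\<integral>\<^sup>+x. ennreal \<bar>f x - s i x\<bar> \<partial>lborel) < ennreal e"
        by (auto simp: eventually_sequentially)
      then show "\<exists>v\<in>borel_measurable borel. P v \<longlonglongrightarrow> 0 \<and> (\<integral>\<^sup>+x. ennreal \<bar>f x - v x\<bar> \<partial>lborel) \<le> ennreal e"
        using lim.IH sm by (intro bexI[of _ "s i"]) auto
    qed
  qed
  then show ?thesis by (simp add: P_def)
qed

section \<open>Norm-continuous curves\<close>

text \<open>
  Continuity on \<open>(0, \<infinity>)\<close> in the norm of \<open>L^(r,\<infinity>)\<close>, with an implicit bound at each time only: the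
  curves that occur blow up like a power of \<open>t\<close> at 0 in some of the norms.
\<close>

definition cont_curve :: "real \<Rightarrow> (real \<Rightarrow> 'a::euclidean_space \<Rightarrow> real) \<Rightarrow> bool" where
  "cont_curve r f \<longleftrightarrow> (\<forall>\<tau>>0. \<exists>M. weak_bound r M (f \<tau>)) \<and>
     (\<forall>\<tau>>0. \<forall>e>0. \<exists>d>0. \<forall>\<tau>'>0. \<bar>\<tau>' - \<tau>\<bar> < d \<longrightarrow> weak_bound r e (\<lambda>y. f \<tau>' y - f \<tau> y))"

lemma cont_curve_bound: "cont_curve r f \<Longrightarrow> 0 < \<tau> \<Longrightarrow> \<exists>M. weak_bound r M (f \<tau>)"
  by (simp add: cont_curve_def)

lemma cont_curve_near:
  "cont_curve r f \<Longrightarrow> 0 < \<tau> \<Longrightarrow> 0 < e \<Longrightarrow>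
     \<exists>d>0. \<forall>\<tau>'>0. \<bar>\<tau>' - \<tau>\<bar> < d \<longrightarrow> weak_bound r e (\<lambda>y. f \<tau>' y - f \<tau> y)"
  by (simp add: cont_curve_def)

lemma cont_curve_diff:
  assumes f: "cont_curve r f" and f': "cont_curve r f'"
  shows "cont_curve r (\<lambda>\<tau> y. f \<tau> y - f' \<tau> y)"
  unfolding cont_curve_def
proof (intro conjI allI impI)
  fix \<tau> :: real assume t: "0 < \<tau>"
  obtain M M' where "weak_bound r M (f \<tau>)" "weak_bound r M' (f' \<tau>)"
    using cont_curve_bound[OF f t] cont_curve_bound[OF f' t] by blast
  then show "\<exists>M. weak_bound r M (\<lambda>y. f \<tau> y - f' \<tau> y)" using weak_bound_diff by blast
  fix e :: real assume e: "0 < e"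
  then have e2: "0 < e / 2" by simp
  obtain d where d: "0 < d" "\<And>\<tau>'. 0 < \<tau>' \<Longrightarrow> \<bar>\<tau>' - \<tau>\<bar> < d \<Longrightarrow> weak_bound r (e / 2) (\<lambda>y. f \<tau>' y - f \<tau> y)"
    using cont_curve_near[OF f t e2] by blast
  obtain d' where d': "0 < d'" "\<And>\<tau>'. 0 < \<tau>' \<Longrightarrow> \<bar>\<tau>' - \<tau>\<bar> < d' \<Longrightarrow> weak_bound r (e / 2) (\<lambda>y. f' \<tau>' y - f' \<tau> y)"
    using cont_curve_near[OF f' t e2] by blast
  show "\<exists>d>0. \<forall>\<tau>'>0. \<bar>\<tau>' - \<tau>\<bar> < d \<longrightarrow> weak_bound r e (\<lambda>y. f \<tau>' y - f' \<tau>' y - (f \<tau> y - f' \<tau> y))"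
  proof (intro exI[of _ "min d d'"] conjI allI impI)
    fix \<tau>' assume "0 < \<tau>'" "\<bar>\<tau>' - \<tau>\<bar> < min d d'"
    then have "weak_bound r (e / 2 + e / 2) (\<lambda>y. (f \<tau>' y - f \<tau> y) - (f' \<tau>' y - f' \<tau> y))"
      by (intro weak_bound_diff d d') auto
    then show "weak_bound r e (\<lambda>y. f \<tau>' y - f' \<tau>' y - (f \<tau> y - f' \<tau> y))" by (simp add: algebra_simps)
  qed (use d d' in auto)
qed

lemma cont_curve_uniform:
  assumes f: "cont_curve r f" and a: "0 < a" and e: "0 < e"
  shows "\<exists>d>0. \<forall>\<tau>\<in>{a..b}. \<forall>\<tau>'\<in>{a..b}. \<bar>\<tau>' - \<tau>\<bar> < d \<longrightarrow> weak_bound r e (\<lambda>y. f \<tau>' y - f \<tau> y)"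
proof (rule ccontr)
  assume neg: "\<not> ?thesis"
  have "\<exists>\<tau> \<tau>'. \<tau> \<in> {a..b} \<and> \<tau>' \<in> {a..b} \<and> \<bar>\<tau>' - \<tau>\<bar> < 1 / real (Suc n) \<and> \<not> weak_bound r e (\<lambda>y. f \<tau>' y - f \<tau> y)" for n
  proof -
    have "0 < 1 / real (Suc n)" by simp
    then show ?thesis using neg by blast
  qed
  then obtain s s' where s: "\<And>n. s n \<in> {a..b}" "\<And>n. s' n \<in> {a..b}" "\<And>n. \<bar>s' n - s n\<bar> < 1 / real (Suc n)"
    "\<And>n. \<not> weak_bound r e (\<lambda>y. f (s' n) y - f (s n) y)" by metis
  obtain l \<rho> where l: "l \<in> {a..b}" and \<rho>: "strict_mono \<rho>" "(s \<circ> \<rho>) \<longlonglongrightarrow> l"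
    using compact_Icc[of a b, unfolded compact_def] s(1) by blast
  have l0: "0 < l" using l a by auto
  have e2: "0 < e / 2" using e by simp
  obtain d where d: "0 < d" "\<And>\<tau>'. 0 < \<tau>' \<Longrightarrow> \<bar>\<tau>' - l\<bar> < d \<Longrightarrow> weak_bound r (e / 2) (\<lambda>y. f \<tau>' y - f l y)"
    using cont_curve_near[OF f l0 e2] by blast
  have "(\<lambda>n. 1 / real (Suc n)) \<longlonglongrightarrow> 0"
    using LIMSEQ_Suc[OF lim_1_over_n] by simp
  then have "eventually (\<lambda>n. 1 / real (Suc n) < d / 2) sequentially"
    by (rule order_tendstoD) (use d in simp)
  moreover have "eventually (\<lambda>n. dist ((s \<circ> \<rho>) n) l < d / 2) sequentially"
    using \<rho>(2) by (rule tendstoD) (use d in simp)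
  ultimately have "eventually (\<lambda>n. 1 / real (Suc n) < d / 2 \<and> dist ((s \<circ> \<rho>) n) l < d / 2) sequentially"
    by (rule eventually_conj)
  then obtain n where n: "1 / real (Suc n) < d / 2" "dist ((s \<circ> \<rho>) n) l < d / 2"
    using eventually_happens'[OF sequentially_bot] by blast
  have "1 / real (Suc (\<rho> n)) \<le> 1 / real (Suc n)"
    using seq_suble[OF \<rho>(1), of n] by (simp add: field_simps)
  then have A: "\<bar>s' (\<rho> n) - s (\<rho> n)\<bar> < d / 2" using n(1) s(3)[of "\<rho> n"] by linarith
  have B: "\<bar>s (\<rho> n) - l\<bar> < d / 2" using n(2) by (simp add: dist_real_def)
  have near: "\<bar>s (\<rho> n) - l\<bar> < d" "\<bar>s' (\<rho> n) - l\<bar> < d"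
    using A B by linarith+
  have pos: "0 < s (\<rho> n)" "0 < s' (\<rho> n)" using s(1)[of "\<rho> n"] s(2)[of "\<rho> n"] a by auto
  have "weak_bound r (e / 2 + e / 2) (\<lambda>y. (f (s' (\<rho> n)) y - f l y) - (f (s (\<rho> n)) y - f l y))"
    by (intro weak_bound_diff d pos near)
  then show False using s(4)[of "\<rho> n"] by simp
qed

lemma conv_diff_right:
  assumes "integrable lborel (\<lambda>y. k (x - y) * f y)" "integrable lborel (\<lambda>y. k (x - y) * f' y)"
  shows "conv k (\<lambda>y. f y - f' y) x = conv k f x - conv k f' x"
  unfolding conv_def using assms by (simp add: right_diff_distrib)

lemma conv_diff_left:
  assumes "integrable lborel (\<lambda>y. k (x - y) * f y)" "integrable lborel (\<lambda>y. k' (x - y) * f y)"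
  shows "conv (\<lambda>z. k z - k' z) f x = conv k f x - conv k' f x"
  unfolding conv_def using assms by (simp add: left_diff_distrib)

section \<open>Self-similar kernels\<close>

text \<open>
  All that the nonlinear theory uses about the heat kernel of \<open>(-\<Delta>)\<^sup>m\<close>. It is bounded in
  \<open>L\<^sup>1\<close> rather than assumed positive, since the kernel changes sign for \<open>m > 1\<close>.
\<close>

locale kernel_family =
  fixes g :: "real \<Rightarrow> 'a::euclidean_space \<Rightarrow> real" and m G1 G2 :: real
  assumes m_pos: "0 < m" and G_pos: "0 < G1" "0 < G2"
    and scale: "\<And>t x. 0 < t \<Longrightarrow>
       g t x = t powr (- (real DIM('a) / (2 * m))) * g 1 (t powr (- (1 / (2 * m))) *\<^sub>R x)"
    and cont: "continuous_on UNIV (g 1)"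
    and bdd: "\<And>x. \<bar>g 1 x\<bar> \<le> G2"
    and L1: "(\<integral>\<^sup>+x. ennreal \<bar>g 1 x\<bar> \<partial>lborel) \<le> ennreal G1"
    and mass: "(\<integral>x. g 1 x \<partial>lborel) = 1"
begin

text \<open>
  The supremum of the kernel at time \<open>t\<close> decays like \<open>t^(-n/2m)\<close>.
\<close>

definition rate :: real where "rate = real DIM('a) / (2 * m)"

lemma rate_pos: "0 < rate"
  using m_pos by (simp add: rate_def)

lemma kernel_continuous:
  assumes t: "0 < t"
  shows "continuous_on UNIV (g t)"
proof -
  have "g t = (\<lambda>x. t powr (- (real DIM('a) / (2 * m))) * g 1 (t powr (- (1 / (2 * m))) *\<^sub>R x))"
    using scale[OF t] by (intro ext)
  then show ?thesis
    by (simp only:) (intro continuous_intros continuous_on_compose2[OF cont], auto)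
qed

lemma kernel_measurable [measurable]: "0 < t \<Longrightarrow> g t \<in> borel_measurable borel"
  by (rule borel_measurable_continuous_onI) (rule kernel_continuous)

lemma kernel_bdd: "0 < t \<Longrightarrow> \<bar>g t x\<bar> \<le> G2 * t powr (- rate)"
  using mult_left_mono[OF bdd, of "t powr (- rate)"]
  by (subst scale) (auto simp: abs_mult rate_def mult.commute)

lemma kernel_L1_eq: "0 < t \<Longrightarrow> (\<integral>\<^sup>+x. ennreal \<bar>g t x\<bar> \<partial>lborel) = (\<integral>\<^sup>+x. ennreal \<bar>g 1 x\<bar> \<partial>lborel)"
proof -
  assume t: "0 < t"
  define c where "c = t powr (- (1 / (2 * m)))"
  have c: "0 < c" using t by (simp add: c_def)
  have cn: "c ^ DIM('a) = t powr (- (real DIM('a) / (2 * m)))"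
    using t by (simp add: c_def powr_powr flip: powr_realpow)
  have "(\<integral>\<^sup>+x. ennreal \<bar>g 1 x\<bar> \<partial>lborel) = ennreal (\<bar>c\<bar> ^ DIM('a)) * (\<integral>\<^sup>+x. ennreal \<bar>g 1 (0 + c *\<^sub>R x)\<bar> \<partial>lborel)"
    by (rule nn_integral_affine) (use c in auto)
  also have "\<dots> = (\<integral>\<^sup>+x. ennreal (\<bar>c\<bar> ^ DIM('a)) * ennreal \<bar>g 1 (0 + c *\<^sub>R x)\<bar> \<partial>lborel)"
    by (rule nn_integral_cmult[symmetric]) measurable
  also have "\<dots> = (\<integral>\<^sup>+x. ennreal \<bar>g t x\<bar> \<partial>lborel)"
    using c by (intro nn_integral_cong) (simp add: scale[OF t] cn[symmetric] c_def[symmetric] abs_mult ennreal_mult)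
  finally show ?thesis by simp
qed

lemma kernel_L1: "0 < t \<Longrightarrow> (\<integral>\<^sup>+x. ennreal \<bar>g t x\<bar> \<partial>lborel) \<le> ennreal G1"
  by (subst kernel_L1_eq) (use L1 in auto)

lemma kernel_integrable: "0 < t \<Longrightarrow> integrable lborel (g t)"
  unfolding integrable_iff_bounded using kernel_L1[of t] by (auto intro: le_less_trans)

text \<open>
  Scheffe's lemma: the kernels converge pointwise, and their \<open>L\<^sup>1\<close> norms do not depend on time.
\<close>

lemma kernel_L1_tendsto:
  assumes s: "\<And>j::nat. 0 < s j" "s \<longlonglongrightarrow> s0" "0 < s0" and x: "x \<longlonglongrightarrow> x0"
  shows "(\<lambda>j. \<integral>\<^sup>+y. ennreal \<bar>g (s j) (x j - y) - g s0 (x0 - y)\<bar> \<partial>lborel) \<longlonglongrightarrow> 0"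
proof -
  note [measurable] = kernel_measurable[OF s(1)] kernel_measurable[OF s(3)]
  have refl: "(\<integral>\<^sup>+y. ennreal (norm (g t (z - y))) \<partial>lborel) = (\<integral>\<^sup>+x. ennreal \<bar>g 1 x\<bar> \<partial>lborel)"
    if t: "0 < t" for t z
  proof -
    note [measurable] = kernel_measurable[OF t]
    show ?thesis using nn_integral_reflect[of "\<lambda>y. ennreal \<bar>g t y\<bar>" z] kernel_L1_eq[OF t] by simp
  qed
  have int: "integrable lborel (\<lambda>y. g t (z - y))" if t: "0 < t" for t z
  proof -
    note [measurable] = kernel_measurable[OF t]
    show ?thesis unfolding integrable_iff_bounded refl[OF t] using L1 by (auto intro: le_less_trans)
  qed
  have "(\<lambda>j. \<integral>\<^sup>+y. norm (g (s j) (x j - y) - g s0 (x0 - y)) \<partial>lborel) \<longlonglongrightarrow> 0"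
  proof (rule Scheffe_lemma1)
    show "AE y in lborel. (\<lambda>j. g (s j) (x j - y)) \<longlonglongrightarrow> g s0 (x0 - y)"
    proof (rule AE_I2)
      fix y
      have arg: "(\<lambda>j. s j powr (- (1 / (2 * m))) *\<^sub>R (x j - y)) \<longlonglongrightarrow> s0 powr (- (1 / (2 * m))) *\<^sub>R (x0 - y)"
        using s by (intro tendsto_intros x) auto
      have "isCont (g 1) z" for z using cont by (simp add: continuous_on_eq_continuous_at)
      then have "(\<lambda>j. g 1 (s j powr (- (1 / (2 * m))) *\<^sub>R (x j - y))) \<longlonglongrightarrow> g 1 (s0 powr (- (1 / (2 * m))) *\<^sub>R (x0 - y))"
        using arg by (rule isCont_tendsto_compose)
      moreover have "(\<lambda>j. s j powr (- (real DIM('a) / (2 * m)))) \<longlonglongrightarrow> s0 powr (- (real DIM('a) / (2 * m)))"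
        using s by (intro tendsto_intros) auto
      ultimately have "(\<lambda>j. s j powr (- (real DIM('a) / (2 * m))) * g 1 (s j powr (- (1 / (2 * m))) *\<^sub>R (x j - y)))
         \<longlonglongrightarrow> s0 powr (- (real DIM('a) / (2 * m))) * g 1 (s0 powr (- (1 / (2 * m))) *\<^sub>R (x0 - y))"
        by (rule tendsto_mult[rotated])
      then show "(\<lambda>j. g (s j) (x j - y)) \<longlonglongrightarrow> g s0 (x0 - y)"
        by (simp only: scale[OF s(1)] scale[OF s(3)])
    qed
    show "limsup (\<lambda>j. \<integral>\<^sup>+y. ennreal (norm (g (s j) (x j - y))) \<partial>lborel) \<le> (\<integral>\<^sup>+y. ennreal (norm (g s0 (x0 - y))) \<partial>lborel)"
      unfolding refl[OF s(1)] refl[OF s(3)] by (simp add: Limsup_const)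
  qed (rule int, fact)+
  then show ?thesis by simp
qed

lemma kernel_conv_integrable:
  assumes "1 < r" "weak_bound r M f" "0 < t"
  shows "integrable lborel (\<lambda>y. g t (x - y) * f y)"
  using assms G_pos by (intro conv_integrable[OF assms(1,2) _ kernel_L1 _ kernel_bdd]) auto

text \<open>
  For \<open>f\<close> of norm \<open>N\<close> in \<open>L^(r,\<infinity>)\<close>, the quantity \<open>r N smoothing r |E| s\<close> bounds the integral of
  \<open>|g\<^sub>s * f|\<close> over \<open>E\<close>.
\<close>

definition smoothing :: "real \<Rightarrow> real \<Rightarrow> real \<Rightarrow> ennreal" where
  "smoothing r a s = ennreal ((G1 * a) powr (1 - 1 / r) * min G1 (G2 * s powr (- rate) * a) powr (1 / r))"

lemma smoothing_measurable [measurable]: "smoothing r a \<in> borel_measurable borel"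
  unfolding smoothing_def by measurable

lemma smoothing_antitone:
  assumes "0 < s" "s \<le> s'" "1 < r" "0 \<le> a"
  shows "smoothing r a s' \<le> smoothing r a s"
proof -
  have "s' powr (- rate) \<le> s powr (- rate)" using assms rate_pos by (intro powr_mono2') auto
  then have "min G1 (G2 * s' powr (- rate) * a) \<le> min G1 (G2 * s powr (- rate) * a)"
    using assms G_pos by (intro min.mono mult_right_mono mult_left_mono) auto
  then show ?thesis
    unfolding smoothing_def using assms G_pos by (intro ennreal_leI mult_left_mono powr_mono2) auto
qed

lemma kernel_conv_local:
  assumes r: "1 < r" and f: "weak_bound r N f" and s: "0 < s"
    and E: "E \<in> sets borel" "emeasure lborel E < \<infinity>"
  shows "(\<integral>\<^sup>+x\<in>E. ennreal \<bar>conv (g s) f x\<bar> \<partial>lborel) \<le> ennreal (r * N) * smoothing r (measure lborel E) s"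
proof -
  have "(\<integral>\<^sup>+x\<in>E. ennreal \<bar>conv (g s) f x\<bar> \<partial>lborel)
    \<le> ennreal (r * N * (G1 * measure lborel E) powr (1 - 1 / r) * min G1 (G2 * s powr (- rate) * measure lborel E) powr (1 / r))"
    using G_pos s by (intro conv_local_bound[OF r f _ kernel_L1 _ kernel_bdd E]) auto
  also have "\<dots> = ennreal (r * N) * smoothing r (measure lborel E) s"
    unfolding smoothing_def using r weak_boundD(1)[OF f] by (subst ennreal_mult[symmetric]) (auto simp: mult.assoc)
  finally show ?thesis .
qed

text \<open>
  The constant of the critical estimate \<open>smoothing_integral\<close>.
\<close>

definition gain :: "real \<Rightarrow> real \<Rightarrow> real" where
  "gain r q = G1 powr (1 - 1 / r) * (G1 powr (1 / r) + G2 powr (1 / r) * (q / rate))"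

lemma gain_pos: "0 < q \<Longrightarrow> 0 < gain r q"
  unfolding gain_def using G_pos rate_pos by (intro mult_pos_pos add_pos_pos) auto

text \<open>
  The critical estimate. When \<open>1/r = 1/q + 2m/n\<close>, the norm of \<open>g\<^sub>s *\<close> from \<open>L^(r,\<infinity>)\<close> to \<open>L^(q,\<infinity>)\<close> is of
  order \<open>1/s\<close>, and its time integral diverges at both ends. For a fixed set \<open>E\<close>, however, the bound
  without gain is better for \<open>s\<close> below \<open>T = |E|^(2m/n)\<close>, and the bound with full gain, of order
  \<open>s^(-n/(2mr))\<close> with exponent below \<open>-1\<close>, is better above it. Both parts are then multiples of
  \<open>|E|^(1 - 1/q)\<close>.
\<close>

lemma smoothing_integral:
  assumes r: "1 < r" and q: "0 < q" and rq: "1 / r = 1 / q + 1 / rate" and a: "0 \<le> a"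
  shows "(\<integral>\<^sup>+s\<in>{0<..}. smoothing r a s \<partial>lborel) \<le> ennreal (gain r q * a powr (1 - 1 / q))"
proof (cases "a = 0")
  case True
  then show ?thesis by (simp add: smoothing_def)
next
  case False
  with a have a: "0 < a" by simp
  \<comment> \<open>The time at which the kernel has spread over a set of measure \<open>a\<close>.\<close>
  define T where "T = a powr (1 / rate)"
  have T: "0 < T" using a by (simp add: T_def)
  define A where "A = (G1 * a) powr (1 - 1 / r)"
  have A: "0 < A" using a G_pos by (simp add: A_def)
  have rr: "rate / r = rate / q + 1" using rate_pos rq by (simp add: field_simps)
  have rr1: "1 < rate / r" using rr rate_pos q by simp
  have "(\<integral>\<^sup>+s\<in>{0<..}. smoothing r a s \<partial>lborel)
     \<le> (\<integral>\<^sup>+s. ennreal (A * G1 powr (1 / r)) * indicator {0<..<T} s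
        + ennreal (A * (G2 * a) powr (1 / r)) * (ennreal (s powr (- (rate / r))) * indicator {T..} s) \<partial>lborel)"
  proof (rule nn_integral_mono)
    fix s :: real
    show "smoothing r a s * indicator {0<..} s \<le> ennreal (A * G1 powr (1 / r)) * indicator {0<..<T} s
        + ennreal (A * (G2 * a) powr (1 / r)) * (ennreal (s powr (- (rate / r))) * indicator {T..} s)"
    proof -
      consider "s \<le> 0" | "0 < s" "s < T" | "T \<le> s" by linarith
      then show ?thesis
      proof cases
        case 2
        have "min G1 (G2 * s powr (- rate) * a) powr (1 / r) \<le> G1 powr (1 / r)"
          using r G_pos a by (intro powr_mono2) auto
        then have "smoothing r a s \<le> ennreal (A * G1 powr (1 / r))"
          unfolding smoothing_def A_def by (intro ennreal_leI mult_left_mono) auto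
        then show ?thesis using 2 by simp
      next
        case 3
        then have s: "0 < s" using T by simp
        have "min G1 (G2 * s powr (- rate) * a) powr (1 / r) \<le> (G2 * s powr (- rate) * a) powr (1 / r)"
          using r G_pos a by (intro powr_mono2) auto
        also have "\<dots> = (G2 * a) powr (1 / r) * s powr (- (rate / r))"
          using G_pos a s by (simp add: powr_mult powr_powr)
        finally have "smoothing r a s \<le> ennreal (A * ((G2 * a) powr (1 / r) * s powr (- (rate / r))))"
          unfolding smoothing_def A_def by (intro ennreal_leI mult_left_mono) auto
        also have "\<dots> = ennreal (A * (G2 * a) powr (1 / r)) * ennreal (s powr (- (rate / r)))"
          using A by (subst ennreal_mult[symmetric]) (auto simp: mult.assoc)
        finally show ?thesis using 3 s by simp
      qed simp
    qed
  qed
  also have "\<dots> = ennreal (A * G1 powr (1 / r)) * ennreal T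
     + ennreal (A * (G2 * a) powr (1 / r)) * (\<integral>\<^sup>+s\<in>{T..}. ennreal (s powr (- (rate / r))) \<partial>lborel)"
    using T by (subst nn_integral_add) (auto simp: nn_integral_cmult)
  also have "(\<integral>\<^sup>+s\<in>{T..}. ennreal (s powr (- (rate / r))) \<partial>lborel) = ennreal (T powr (- (rate / r) + 1) / (rate / r - 1))"
    using rr1 T by (subst nn_integral_powr_to_inf) auto
  also have "ennreal (A * G1 powr (1 / r)) * ennreal T
     + ennreal (A * (G2 * a) powr (1 / r)) * ennreal (T powr (- (rate / r) + 1) / (rate / r - 1))
     = ennreal (A * G1 powr (1 / r) * T + A * (G2 * a) powr (1 / r) * (T powr (- (rate / r) + 1) / (rate / r - 1)))"
    using A T rr1 by (simp flip: ennreal_mult ennreal_plus)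
  also have "A * G1 powr (1 / r) * T + A * (G2 * a) powr (1 / r) * (T powr (- (rate / r) + 1) / (rate / r - 1))
     = gain r q * a powr (1 - 1 / q)"
  proof -
    have 1: "A = G1 powr (1 - 1 / r) * a powr (1 - 1 / r)" unfolding A_def using G_pos a by (simp add: powr_mult)
    have "- (rate / r) + 1 = - (rate / q)" using rr by simp
    then have 2: "T powr (- (rate / r) + 1) = a powr (- (1 / q))"
      unfolding T_def using rate_pos by (simp add: powr_powr)
    have 3: "(G2 * a) powr (1 / r) = G2 powr (1 / r) * a powr (1 / r)" using G_pos a by (simp add: powr_mult)
    have 4: "rate / r - 1 = rate / q" using rr by simp
    have "a powr (1 / r) * a powr (- (1 / q)) = a powr (1 / r + - (1 / q))" by (rule powr_add[symmetric])
    also have "1 / r + - (1 / q) = 1 / rate" using rq by simp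
    finally have 5: "a powr (1 / r) * a powr (- (1 / q)) = T" by (simp add: T_def)
    have "a powr (1 - 1 / r) * T = a powr (1 - 1 / r + 1 / rate)" unfolding T_def by (rule powr_add[symmetric])
    also have "1 - 1 / r + 1 / rate = 1 - 1 / q" using rq by simp
    finally have 6: "a powr (1 - 1 / r) * T = a powr (1 - 1 / q)" .
    have "A * G1 powr (1 / r) * T + A * (G2 * a) powr (1 / r) * (T powr (- (rate / r) + 1) / (rate / r - 1))
      = A * T * (G1 powr (1 / r)) + A * G2 powr (1 / r) * (a powr (1 / r) * a powr (- (1 / q))) * (q / rate)"
      unfolding 2 3 4 by simp
    also have "\<dots> = A * T * (G1 powr (1 / r) + G2 powr (1 / r) * (q / rate))"
      unfolding 5 by (simp add: algebra_simps)
    also have "A * T = G1 powr (1 - 1 / r) * a powr (1 - 1 / q)" unfolding 1 6[symmetric] by simp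
    finally show ?thesis by (simp add: gain_def mult_ac)
  qed
  finally show ?thesis .
qed

text \<open>
  This yields the joint measurability that Tonelli's theorem requires of the integrands over time.
  The reasons are the \<open>L\<^sup>1\<close>-continuity of the kernel, the continuity of the curve, and
  \<open>weak_pairing\<close>, which turns smallness in \<open>L\<^sup>1\<close> together with a uniform bound into smallness of
  the pairing.
\<close>

lemma conv_curve_continuous:
  assumes r: "1 < r" and f: "cont_curve r f"
  shows "continuous_on ({0<..<t} \<times> UNIV) (\<lambda>(s, x). conv (g s) (f (t - s)) x)"
  unfolding continuous_on_sequentially
proof (intro allI ballI impI, elim conjE)
  fix X :: "nat \<Rightarrow> real \<times> 'a" and p :: "real \<times> 'a"
  assume p: "p \<in> {0<..<t} \<times> UNIV" and X: "\<forall>n. X n \<in> {0<..<t} \<times> UNIV" "X \<longlonglongrightarrow> p"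
  define s x s0 x0 where "s n = fst (X n)" and "x n = snd (X n)" and "s0 = fst p" and "x0 = snd p" for n
  have s: "\<And>n. 0 < s n" "\<And>n. s n < t" "s \<longlonglongrightarrow> s0" "0 < s0" "s0 < t"
    using p X tendsto_fst[OF X(2)] by (auto simp: s_def[abs_def] s0_def mem_Times_iff)
  have x: "x \<longlonglongrightarrow> x0" using tendsto_snd[OF X(2)] by (simp add: x_def[abs_def] x0_def)
  note km = kernel_measurable[OF s(1)] kernel_measurable[OF s(4)]
  note [measurable] = km
  define a where "a n = enn2real (\<integral>\<^sup>+y. ennreal \<bar>g (s n) (x n - y) - g s0 (x0 - y)\<bar> \<partial>lborel)" for n
  have fin: "(\<integral>\<^sup>+y. ennreal \<bar>g (s n) (x n - y) - g s0 (x0 - y)\<bar> \<partial>lborel) \<le> ennreal (2 * G1)" for n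
  proof -
    have "(\<integral>\<^sup>+y. ennreal \<bar>g (s n) (x n - y) - g s0 (x0 - y)\<bar> \<partial>lborel)
      \<le> (\<integral>\<^sup>+y. ennreal \<bar>g (s n) (x n - y)\<bar> + ennreal \<bar>g s0 (x0 - y)\<bar> \<partial>lborel)"
      by (rule nn_integral_mono) (auto simp flip: ennreal_plus intro!: ennreal_leI)
    also have "\<dots> = (\<integral>\<^sup>+y. ennreal \<bar>g (s n) (x n - y)\<bar> \<partial>lborel) + (\<integral>\<^sup>+y. ennreal \<bar>g s0 (x0 - y)\<bar> \<partial>lborel)"
      by (rule nn_integral_add) measurable
    also have "\<dots> = (\<integral>\<^sup>+y. ennreal \<bar>g (s n) y\<bar> \<partial>lborel) + (\<integral>\<^sup>+y. ennreal \<bar>g s0 y\<bar> \<partial>lborel)"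
      using nn_integral_reflect[of "\<lambda>y. ennreal \<bar>g (s n) y\<bar>" "x n"] nn_integral_reflect[of "\<lambda>y. ennreal \<bar>g s0 y\<bar>" x0] by simp
    also have "\<dots> \<le> ennreal G1 + ennreal G1" using s by (intro add_mono kernel_L1)
    also have "\<dots> = ennreal (2 * G1)" using G_pos by (simp flip: ennreal_plus)
    finally show ?thesis .
  qed
  then have ea: "(\<integral>\<^sup>+y. ennreal \<bar>g (s n) (x n - y) - g s0 (x0 - y)\<bar> \<partial>lborel) = ennreal (a n)" for n
    unfolding a_def using le_less_trans[OF fin[of n] ennreal_less_top] by simp
  have a0: "0 \<le> a n" for n by (simp add: a_def)
  have "(\<lambda>n. ennreal (a n)) \<longlonglongrightarrow> ennreal 0"
    using kernel_L1_tendsto[OF s(1,3,4) x] unfolding ea by simp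
  then have alim: "a \<longlonglongrightarrow> 0" using a0 by (subst (asm) tendsto_ennreal_iff) auto
  define b where "b n = G2 * s n powr (- rate) + G2 * s0 powr (- rate)" for n
  have blim: "b \<longlonglongrightarrow> G2 * s0 powr (- rate) + G2 * s0 powr (- rate)"
    unfolding b_def using s by (intro tendsto_intros) auto
  obtain M where M: "weak_bound r M (f (t - s0))" using cont_curve_bound[OF f, of "t - s0"] s by auto
  have d1: "\<bar>conv (g (s n)) (f (t - s0)) (x n) - conv (g s0) (f (t - s0)) x0\<bar>
      \<le> r * M * a n powr (1 - 1 / r) * b n powr (1 / r)" for n
  proof -
    have "conv (g (s n)) (f (t - s0)) (x n) - conv (g s0) (f (t - s0)) x0
       = (\<integral>y. (g (s n) (x n - y) - g s0 (x0 - y)) * f (t - s0) y \<partial>lborel)"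
      unfolding conv_def using kernel_conv_integrable[OF r M s(1)] kernel_conv_integrable[OF r M s(4)]
      by (simp add: left_diff_distrib)
    also have "\<bar>\<dots>\<bar> \<le> r * M * a n powr (1 - 1 / r) * b n powr (1 / r)"
    proof (rule weak_pairing_integrable(2)[OF r M])
      show "\<bar>g (s n) (x n - y) - g s0 (x0 - y)\<bar> \<le> b n" for y
        unfolding b_def using kernel_bdd[OF s(1)[of n], of "x n - y"] kernel_bdd[OF s(4), of "x0 - y"] by linarith
    qed (use ea a0 in auto)
    finally show ?thesis .
  qed
  have l1: "(\<lambda>n. r * M * a n powr (1 - 1 / r) * b n powr (1 / r)) \<longlonglongrightarrow> 0"
  proof -
    have "(\<lambda>n. a n powr (1 - 1 / r)) \<longlonglongrightarrow> 0"
      by (rule tendsto_zero_powrI[OF alim tendsto_const]) (use a0 r in auto)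
    moreover have "(\<lambda>n. b n powr (1 / r)) \<longlonglongrightarrow> (G2 * s0 powr (- rate) + G2 * s0 powr (- rate)) powr (1 / r)"
      by (rule tendsto_powr[OF blim tendsto_const]) (use G_pos s in \<open>auto simp: add_nonneg_eq_0_iff\<close>)
    ultimately have "(\<lambda>n. r * M * a n powr (1 - 1 / r) * b n powr (1 / r))
       \<longlonglongrightarrow> r * M * 0 * (G2 * s0 powr (- rate) + G2 * s0 powr (- rate)) powr (1 / r)"
      by (intro tendsto_mult tendsto_const)
    then show ?thesis by simp
  qed
  have l2: "(\<lambda>n. conv (g (s n)) (f (t - s n)) (x n) - conv (g (s n)) (f (t - s0)) (x n)) \<longlonglongrightarrow> 0"
  proof (rule LIMSEQ_I)
    fix e :: real assume e: "0 < e"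
    define B where "B = G2 * s0 powr (- rate) + G2 * s0 powr (- rate) + 1"
    have B: "0 < B" using G_pos s by (simp add: B_def add_nonneg_pos)
    define C where "C = r * G1 powr (1 - 1 / r) * B powr (1 / r)"
    have C: "0 < C" using G_pos B r by (simp add: C_def)
    define e' where "e' = e / (2 * C)"
    have e': "0 < e'" using e C by (simp add: e'_def)
    have "0 < t - s0" using s by simp
    then obtain d where d: "0 < d" "\<And>\<tau>'. 0 < \<tau>' \<Longrightarrow> \<bar>\<tau>' - (t - s0)\<bar> < d \<Longrightarrow> weak_bound r e' (\<lambda>y. f \<tau>' y - f (t - s0) y)"
      using cont_curve_near[OF f _ e'] by blast
    have "eventually (\<lambda>n. dist (s n) s0 < d) sequentially" using s(3) d(1) by (rule tendstoD)
    moreover have "eventually (\<lambda>n. b n < B) sequentially"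
      by (rule order_tendstoD(2)[OF blim]) (simp add: B_def)
    ultimately have "eventually (\<lambda>n. norm (conv (g (s n)) (f (t - s n)) (x n) - conv (g (s n)) (f (t - s0)) (x n) - 0) < e) sequentially"
    proof eventually_elim
      case (elim n)
      have wb: "weak_bound r e' (\<lambda>y. f (t - s n) y - f (t - s0) y)"
        by (rule d(2)) (use elim s(2)[of n] in \<open>auto simp: dist_real_def\<close>)
      obtain N where N: "weak_bound r N (f (t - s n))" using cont_curve_bound[OF f, of "t - s n"] s(2)[of n] by auto
      have "conv (g (s n)) (f (t - s n)) (x n) - conv (g (s n)) (f (t - s0)) (x n)
         = (\<integral>y. g (s n) (x n - y) * (f (t - s n) y - f (t - s0) y) \<partial>lborel)"
        unfolding conv_def using kernel_conv_integrable[OF r M s(1)] kernel_conv_integrable[OF r N s(1)]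
        by (simp add: right_diff_distrib)
      also have "\<bar>\<dots>\<bar> \<le> r * e' * G1 powr (1 - 1 / r) * B powr (1 / r)"
      proof (rule weak_pairing_integrable(2)[OF r wb])
        show "(\<integral>\<^sup>+y. ennreal \<bar>g (s n) (x n - y)\<bar> \<partial>lborel) \<le> ennreal G1"
          using nn_integral_reflect[of "\<lambda>y. ennreal \<bar>g (s n) y\<bar>" "x n"] kernel_L1[OF s(1)] by simp
        show "\<bar>g (s n) (x n - y)\<bar> \<le> B" for y
        proof -
          have "G2 * s n powr (- rate) \<le> b n" unfolding b_def using G_pos by simp
          then show ?thesis using kernel_bdd[OF s(1)[of n], of "x n - y"] elim by linarith
        qed
      qed (use G_pos in auto)
      also have "\<dots> = e' * C" by (simp add: C_def mult_ac)
      also have "\<dots> = e / 2" using C by (simp add: e'_def)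
      finally show ?case using e by simp
    qed
    then show "\<exists>no. \<forall>n\<ge>no. norm (conv (g (s n)) (f (t - s n)) (x n) - conv (g (s n)) (f (t - s0)) (x n) - 0) < e"
      by (simp add: eventually_sequentially)
  qed
  have "(\<lambda>n. conv (g (s n)) (f (t - s0)) (x n) - conv (g s0) (f (t - s0)) x0) \<longlonglongrightarrow> 0"
    by (rule Lim_null_comparison[OF _ l1]) (use d1 in simp)
  from tendsto_add[OF l2 this]
  have "(\<lambda>n. conv (g (s n)) (f (t - s n)) (x n) - conv (g s0) (f (t - s0)) x0) \<longlonglongrightarrow> 0" by simp
  then have "(\<lambda>n. conv (g (s n)) (f (t - s n)) (x n)) \<longlonglongrightarrow> conv (g s0) (f (t - s0)) x0"
    by (rule LIM_zero_cancel)
  then show "((\<lambda>(s, x). conv (g s) (f (t - s)) x) \<circ> X) \<longlonglongrightarrow> (case p of (s, x) \<Rightarrow> conv (g s) (f (t - s)) x)"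
    by (simp add: o_def s_def x_def s0_def x0_def case_prod_beta)
qed

lemma conv_curve_measurable:
  assumes r: "1 < r" and f: "cont_curve r f"
  shows "(\<lambda>(s, x). indicator {0<..<t} s * conv (g s) (f (t - s)) x) \<in> borel_measurable (borel \<Otimes>\<^sub>M borel)"
proof -
  have "(\<lambda>p. indicator ({0<..<t} \<times> UNIV) p *\<^sub>R (case p of (s, x) \<Rightarrow> conv (g s) (f (t - s)) x)) \<in> borel_measurable borel"
    by (rule borel_measurable_continuous_on_indicator[OF _ conv_curve_continuous[OF r f]])
       (intro borel_open open_Times, auto)
  also have "(\<lambda>p. indicator ({0<..<t} \<times> UNIV) p *\<^sub>R (case p of (s, x) \<Rightarrow> conv (g s) (f (t - s)) x))
     = (\<lambda>(s, x). indicator {0<..<t} s * conv (g s) (f (t - s)) x)"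
    by (auto simp: fun_eq_iff indicator_def)
  finally show ?thesis by (simp add: borel_prod)
qed

section \<open>The Duhamel integral\<close>

text \<open>
  Written in the variable \<open>s = t - \<tau>\<close>, the age of the kernel, so that the integrability of the
  kernel in \<open>s\<close> and the time weight of the forcing separate.
\<close>

definition duhamel :: "real \<Rightarrow> (real \<Rightarrow> 'a \<Rightarrow> real) \<Rightarrow> 'a \<Rightarrow> real" where
  "duhamel t f x = (\<integral>s. indicator {0<..<t} s * conv (g s) (f (t - s)) x \<partial>lborel)"

definition duhamel_const :: "real \<Rightarrow> real \<Rightarrow> real \<Rightarrow> real" where
  "duhamel_const r q \<delta> = r * gain r q * (2 * (1 + 1 / (1 - \<delta>)))"

lemma duhamel_const_pos: "1 < r \<Longrightarrow> 0 < q \<Longrightarrow> \<delta> < 1 \<Longrightarrow> 0 < duhamel_const r q \<delta>"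
  unfolding duhamel_const_def using gain_pos by (intro mult_pos_pos add_pos_pos) auto

text \<open>
  For each \<open>E\<close> the inner integral is at most \<open>(t - s)^(-\<delta>)\<close> times the antitone function
  \<open>smoothing r |E|\<close>, which the critical estimate makes integrable in \<open>s\<close>.
\<close>

lemma duhamel_bound:
  assumes r: "1 < r" and f: "cont_curve r f" and q: "0 < q" and rq: "1 / r = 1 / q + 1 / rate"
    and \<delta>: "0 \<le> \<delta>" "\<delta> < 1" and t: "0 < t" and M: "0 \<le> M"
    and bd: "\<And>\<tau>. 0 < \<tau> \<Longrightarrow> \<tau> < t \<Longrightarrow> weak_bound r (M * \<tau> powr (- \<delta>)) (f \<tau>)"
  shows "AE x in lborel. integrable lborel (\<lambda>s. indicator {0<..<t} s * conv (g s) (f (t - s)) x)"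
    and "weak_bound q (duhamel_const r q \<delta> * M * t powr (- \<delta>)) (duhamel t f)"
proof -
  have B: "0 \<le> duhamel_const r q \<delta> * M * t powr (- \<delta>)"
    using duhamel_const_pos[OF r q \<delta>(2)] M by simp
  have "(\<integral>\<^sup>+s. (\<integral>\<^sup>+x\<in>E. ennreal \<bar>indicator {0<..<t} s * conv (g s) (f (t - s)) x\<bar> \<partial>lborel) \<partial>lborel)
     \<le> ennreal (duhamel_const r q \<delta> * M * t powr (- \<delta>) * measure lborel E powr (1 - 1 / q))"
    if E: "E \<in> sets borel" "emeasure lborel E < \<infinity>" for E
  proof -
    define a where "a = measure lborel E"
    have a: "0 \<le> a" by (simp add: a_def)
    have "(\<integral>\<^sup>+s. (\<integral>\<^sup>+x\<in>E. ennreal \<bar>indicator {0<..<t} s * conv (g s) (f (t - s)) x\<bar> \<partial>lborel) \<partial>lborel)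
       \<le> (\<integral>\<^sup>+s. ennreal (r * M) * (ennreal ((t - s) powr (- \<delta>)) * smoothing r a s * indicator {0<..<t} s) \<partial>lborel)"
    proof (rule nn_integral_mono)
      fix s :: real
      show "(\<integral>\<^sup>+x\<in>E. ennreal \<bar>indicator {0<..<t} s * conv (g s) (f (t - s)) x\<bar> \<partial>lborel)
        \<le> ennreal (r * M) * (ennreal ((t - s) powr (- \<delta>)) * smoothing r a s * indicator {0<..<t} s)"
      proof (cases "s \<in> {0<..<t}")
        case True
        then have "(\<integral>\<^sup>+x\<in>E. ennreal \<bar>conv (g s) (f (t - s)) x\<bar> \<partial>lborel)
          \<le> ennreal (r * (M * (t - s) powr (- \<delta>))) * smoothing r a s"
          unfolding a_def by (intro kernel_conv_local[OF r bd _ E]) auto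
        also have "\<dots> = ennreal (r * M) * (ennreal ((t - s) powr (- \<delta>)) * smoothing r a s)"
          using r M by (simp add: ennreal_mult mult.assoc)
        finally show ?thesis using True by simp
      qed simp
    qed
    also have "\<dots> = ennreal (r * M) * (\<integral>\<^sup>+s\<in>{0<..<t}. ennreal ((t - s) powr (- \<delta>)) * smoothing r a s \<partial>lborel)"
      by (rule nn_integral_cmult) measurable
    also have "\<dots> \<le> ennreal (r * M) * ennreal (2 * (1 + 1 / (1 - \<delta>)) * t powr (- \<delta>) * (gain r q * a powr (1 - 1 / q)))"
    proof (intro mult_left_mono weighted_time_integral smoothing_integral[OF r q rq a])
      show "0 < s \<Longrightarrow> s \<le> s' \<Longrightarrow> smoothing r a s' \<le> smoothing r a s" for s s'
        by (rule smoothing_antitone[OF _ _ r a])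
    qed (use gain_pos[OF q, of r] \<delta> t in auto)
    also have "\<dots> = ennreal (duhamel_const r q \<delta> * M * t powr (- \<delta>) * a powr (1 - 1 / q))"
      using r M gain_pos[OF q, of r] \<delta> by (subst ennreal_mult[symmetric]) (auto simp: duhamel_const_def mult_ac)
    finally show ?thesis by (simp add: a_def)
  qed
  note * = weak_bound_time_integral[OF conv_curve_measurable[OF r f] B this]
  show "AE x in lborel. integrable lborel (\<lambda>s. indicator {0<..<t} s * conv (g s) (f (t - s)) x)" by (rule *(1))
  show "weak_bound q (duhamel_const r q \<delta> * M * t powr (- \<delta>)) (duhamel t f)"
    unfolding duhamel_def[abs_def] by (rule *(2))
qed

text \<open>
  In the scale-invariant norm the Duhamel term does not become small as \<open>t \<rightarrow> 0\<close>; in the space of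
  the forcing it is \<open>O(t)\<close>, which is enough for weak-\<open>\<star>\<close> convergence.
\<close>

lemma duhamel_small_time:
  assumes r: "1 < r" and f: "cont_curve r f" and t: "0 < t" and M: "0 \<le> M"
    and bd: "\<And>\<tau>. 0 < \<tau> \<Longrightarrow> \<tau> < t \<Longrightarrow> weak_bound r M (f \<tau>)"
  shows "weak_bound r (r * G1 * M * t) (duhamel t f)"
proof -
  have B: "0 \<le> r * G1 * M * t" using r G_pos M t by simp
  have "(\<integral>\<^sup>+s. (\<integral>\<^sup>+x\<in>E. ennreal \<bar>indicator {0<..<t} s * conv (g s) (f (t - s)) x\<bar> \<partial>lborel) \<partial>lborel)
     \<le> ennreal (r * G1 * M * t * measure lborel E powr (1 - 1 / r))"
    if E: "E \<in> sets borel" "emeasure lborel E < \<infinity>" for E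
  proof -
    define a where "a = measure lborel E"
    have a: "0 \<le> a" by (simp add: a_def)
    have "(\<integral>\<^sup>+s. (\<integral>\<^sup>+x\<in>E. ennreal \<bar>indicator {0<..<t} s * conv (g s) (f (t - s)) x\<bar> \<partial>lborel) \<partial>lborel)
       \<le> (\<integral>\<^sup>+s. ennreal (r * M * (G1 * a powr (1 - 1 / r))) * indicator {0<..<t} s \<partial>lborel)"
    proof (rule nn_integral_mono)
      fix s :: real
      show "(\<integral>\<^sup>+x\<in>E. ennreal \<bar>indicator {0<..<t} s * conv (g s) (f (t - s)) x\<bar> \<partial>lborel)
        \<le> ennreal (r * M * (G1 * a powr (1 - 1 / r))) * indicator {0<..<t} s"
      proof (cases "s \<in> {0<..<t}")
        case True
        then have "(\<integral>\<^sup>+x\<in>E. ennreal \<bar>conv (g s) (f (t - s)) x\<bar> \<partial>lborel) \<le> ennreal (r * M) * smoothing r a s"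
          unfolding a_def by (intro kernel_conv_local[OF r bd _ E]) auto
        also have "smoothing r a s \<le> ennreal (G1 * a powr (1 - 1 / r))"
        proof -
          have "min G1 (G2 * s powr (- rate) * a) powr (1 / r) \<le> G1 powr (1 / r)"
            using r G_pos a by (intro powr_mono2) auto
          then have "(G1 * a) powr (1 - 1 / r) * min G1 (G2 * s powr (- rate) * a) powr (1 / r)
              \<le> (G1 * a) powr (1 - 1 / r) * G1 powr (1 / r)" by (rule mult_left_mono) simp
          also have "\<dots> = (G1 powr (1 - 1 / r) * G1 powr (1 / r)) * a powr (1 - 1 / r)"
            using G_pos a by (simp add: powr_mult)
          also have "G1 powr (1 - 1 / r) * G1 powr (1 / r) = G1" using G_pos by (simp flip: powr_add)
          finally show ?thesis unfolding smoothing_def by (rule ennreal_leI)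
        qed
        finally show ?thesis using True r M G_pos by (simp add: mult_left_mono flip: ennreal_mult)
      qed simp
    qed
    also have "\<dots> = ennreal (r * M * (G1 * a powr (1 - 1 / r)) * t)"
      using t r M G_pos by (simp add: nn_integral_cmult_indicator ennreal_mult)
    finally show ?thesis by (simp add: a_def mult_ac)
  qed
  from weak_bound_time_integral(2)[OF conv_curve_measurable[OF r f] B this]
  show ?thesis unfolding duhamel_def[abs_def] .
qed

lemma duhamel_diff:
  assumes r: "1 < r" and f: "cont_curve r f" "cont_curve r f'"
    and int: "AE x in lborel. integrable lborel (\<lambda>s. indicator {0<..<t} s * conv (g s) (f (t - s)) x)"
      "AE x in lborel. integrable lborel (\<lambda>s. indicator {0<..<t} s * conv (g s) (f' (t - s)) x)"
  shows "AE x in lborel. duhamel t (\<lambda>\<tau> y. f \<tau> y - f' \<tau> y) x = duhamel t f x - duhamel t f' x"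
  using int
proof eventually_elim
  case (elim x)
  have "indicator {0<..<t} s * conv (g s) (\<lambda>y. f (t - s) y - f' (t - s) y) x
     = indicator {0<..<t} s * conv (g s) (f (t - s)) x - indicator {0<..<t} s * conv (g s) (f' (t - s)) x" for s
  proof (cases "s \<in> {0<..<t}")
    case True
    then obtain M M' where "weak_bound r M (f (t - s))" "weak_bound r M' (f' (t - s))"
      using cont_curve_bound[OF f(1), of "t - s"] cont_curve_bound[OF f(2), of "t - s"] by auto
    then show ?thesis using True conv_diff_right[OF kernel_conv_integrable[OF r] kernel_conv_integrable[OF r]] by auto
  qed simp
  then show ?case unfolding duhamel_def using elim by simp
qed

text \<open>
  The increment is itself a time integral, estimated on each \<open>E\<close> in two regions. For
  \<open>s \<le> t\<^sub>1 - \<kappa>\<close> the forcing is evaluated at times at least \<open>\<kappa>\<close>, where it is uniformly continuous, and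
  the critical estimate applies to the difference. For later \<open>s\<close> the kernel has age at least
  \<open>a / 2\<close>, so that \<open>smoothing\<close> is bounded, and the integrable weight \<open>\<tau>^(-\<delta>)\<close> over an interval of
  length at most \<open>2 \<kappa>\<close> contributes \<open>O(\<kappa>^(1-\<delta>))\<close>.
\<close>

lemma duhamel_increment:
  assumes r: "1 < r" and f: "cont_curve r f" and q: "0 < q" and rq: "1 / r = 1 / q + 1 / rate"
    and \<delta>: "0 \<le> \<delta>" "\<delta> < 1" and M: "0 \<le> M"
    and bd: "\<And>\<tau>. 0 < \<tau> \<Longrightarrow> weak_bound r (M * \<tau> powr (- \<delta>)) (f \<tau>)"
    and a: "0 < a" and e: "0 < e"
  shows "\<exists>d>0. \<forall>t1 t2. a \<le> t1 \<longrightarrow> t1 \<le> t2 \<longrightarrow> t2 \<le> b \<longrightarrow> t2 - t1 < d \<longrightarrow>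
      weak_bound q e (\<lambda>x. duhamel t2 f x - duhamel t1 f x)"
proof -
  define Q where "Q = r * gain r q"
  have Q: "0 < Q" using r gain_pos[OF q] by (simp add: Q_def)
  define D where "D = 2 / a * M / (1 - \<delta>)"
  have D: "0 \<le> D" using a M \<delta> by (simp add: D_def)
  define e1 where "e1 = e / (2 * Q)"
  have e1: "0 < e1" using e Q by (simp add: e1_def)
  \<comment> \<open>The width of the time interval near \<open>\<tau> = 0\<close>; the factor 3 is \<open>2 + 1\<close>, from the terms
    for \<open>t2\<close> and \<open>t1\<close>, whose weights are integrated over lengths \<open>2 \<kappa>\<close> and \<open>\<kappa>\<close>.\<close>
  have "\<exists>\<kappa>>0. \<kappa> \<le> a / 2 \<and> 3 * D * \<kappa> powr (1 - \<delta>) \<le> e1"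
  proof -
    define \<kappa> where "\<kappa> = min (a / 2) ((e1 / (3 * D + 1)) powr (1 / (1 - \<delta>)))"
    have "\<kappa> powr (1 - \<delta>) \<le> ((e1 / (3 * D + 1)) powr (1 / (1 - \<delta>))) powr (1 - \<delta>)"
      using \<delta> a e1 D by (intro powr_mono2) (auto simp: \<kappa>_def)
    also have "\<dots> = e1 / (3 * D + 1)" using \<delta> e1 D by (simp add: powr_powr)
    finally have "3 * D * \<kappa> powr (1 - \<delta>) \<le> 3 * D * (e1 / (3 * D + 1))"
      using D by (intro mult_left_mono) auto
    also have "\<dots> \<le> e1" using D e1 by (simp add: field_simps)
    finally show ?thesis using a e1 D by (intro exI[of _ \<kappa>]) (auto simp: \<kappa>_def)
  qed
  then obtain \<kappa> where \<kappa>: "0 < \<kappa>" "\<kappa> \<le> a / 2" "3 * D * \<kappa> powr (1 - \<delta>) \<le> e1" by blast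
  obtain d0 where d0: "0 < d0" "\<And>\<tau> \<tau>'. \<tau> \<in> {\<kappa>..b} \<Longrightarrow> \<tau>' \<in> {\<kappa>..b} \<Longrightarrow> \<bar>\<tau>' - \<tau>\<bar> < d0 \<Longrightarrow> weak_bound r e1 (\<lambda>y. f \<tau>' y - f \<tau> y)"
    using cont_curve_uniform[OF f \<kappa>(1) e1] by blast
  show ?thesis
  proof (intro exI[of _ "min d0 \<kappa>"] conjI allI impI)
    show "0 < min d0 \<kappa>" using d0 \<kappa> by simp
    fix t1 t2 assume t: "a \<le> t1" "t1 \<le> t2" "t2 \<le> b" "t2 - t1 < min d0 \<kappa>"
    have tp: "0 < t1" "0 < t2" using t a by auto
    define k where "k s x = indicator {0<..<t2} s * conv (g s) (f (t2 - s)) x - indicator {0<..<t1} s * conv (g s) (f (t1 - s)) x" for s x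
    have km: "(\<lambda>(s, x). k s x) \<in> borel_measurable (borel \<Otimes>\<^sub>M borel)"
      using borel_measurable_diff[OF conv_curve_measurable[OF r f, of t2] conv_curve_measurable[OF r f, of t1]]
      unfolding k_def by (simp add: case_prod_beta')
    have est: "(\<integral>\<^sup>+s. (\<integral>\<^sup>+x\<in>E. ennreal \<bar>k s x\<bar> \<partial>lborel) \<partial>lborel) \<le> ennreal (e * measure lborel E powr (1 - 1 / q))"
      if E: "E \<in> sets borel" "emeasure lborel E < \<infinity>" for E
    proof -
      define A where "A = measure lborel E"
      have A: "0 \<le> A" by (simp add: A_def)
      define J where "J = gain r q * A powr (1 - 1 / q)"
      have J: "0 \<le> J" using gain_pos[OF q, of r] by (simp add: J_def)
      have anti: "0 < s \<Longrightarrow> s \<le> s' \<Longrightarrow> smoothing r A s' \<le> smoothing r A s" for s s'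
        by (rule smoothing_antitone[OF _ _ r A])
      have Jint: "(\<integral>\<^sup>+s\<in>{0<..}. smoothing r A s \<partial>lborel) \<le> ennreal J"
        unfolding J_def by (rule smoothing_integral[OF r q rq A])
      have half: "smoothing r A (a / 2) \<le> ennreal (2 / a * J)"
      proof -
        have "smoothing r A (a / 2) = ennreal (2 / a) * (ennreal (a / 2) * smoothing r A (a / 2))"
          using a by (simp add: mult.assoc[symmetric] ennreal_mult[symmetric])
        also have "\<dots> \<le> ennreal (2 / a) * ennreal J"
          using antitone_integral_bound[OF anti _ Jint, of "a / 2"] a by (intro mult_left_mono) auto
        also have "\<dots> = ennreal (2 / a * J)" using a J by (intro ennreal_mult[symmetric]) auto
        finally show ?thesis .
      qed
      have piece: "(\<integral>\<^sup>+x\<in>E. ennreal \<bar>conv (g s) (f (u - s)) x\<bar> \<partial>lborel)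
         \<le> ennreal (r * M * (u - s) powr (- \<delta>) * (2 / a * J))" if "a / 2 \<le> s" "s < u" for s u
      proof -
        have "(\<integral>\<^sup>+x\<in>E. ennreal \<bar>conv (g s) (f (u - s)) x\<bar> \<partial>lborel)
          \<le> ennreal (r * (M * (u - s) powr (- \<delta>))) * smoothing r A s"
          unfolding A_def using that a by (intro kernel_conv_local[OF r bd _ E]) auto
        also have "\<dots> \<le> ennreal (r * (M * (u - s) powr (- \<delta>))) * ennreal (2 / a * J)"
          using anti[of "a / 2" s] that a half by (intro mult_left_mono) (auto elim: order_trans)
        also have "\<dots> = ennreal (r * M * (u - s) powr (- \<delta>) * (2 / a * J))"
          using r M a J by (simp add: mult.assoc flip: ennreal_mult)
        finally show ?thesis .
      qed
      have "(\<integral>\<^sup>+s. (\<integral>\<^sup>+x\<in>E. ennreal \<bar>k s x\<bar> \<partial>lborel) \<partial>lborel)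
        \<le> (\<integral>\<^sup>+s. ennreal (r * e1) * (smoothing r A s * indicator {0<..} s)
            + (ennreal (r * M * (2 / a * J)) * (ennreal ((t2 - s) powr (- \<delta>)) * indicator {0<..<2 * \<kappa>} (t2 - s))
            + ennreal (r * M * (2 / a * J)) * (ennreal ((t1 - s) powr (- \<delta>)) * indicator {0<..<\<kappa>} (t1 - s))) \<partial>lborel)"
        (is "_ \<le> (\<integral>\<^sup>+s. ?R s \<partial>lborel)")
      proof (rule nn_integral_mono)
        fix s :: real
        consider "s \<le> 0 \<or> t2 \<le> s" | "0 < s" "s \<le> t1 - \<kappa>" | "t1 - \<kappa> < s" "s < t1" | "t1 \<le> s" "s < t2" by linarith
        then show "(\<integral>\<^sup>+x\<in>E. ennreal \<bar>k s x\<bar> \<partial>lborel) \<le> ?R s"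
        proof cases
          case 1
          then have "k s x = 0" for x using t unfolding k_def by (auto simp: indicator_def)
          then show ?thesis by simp
        next
          case 2
          have s2: "s \<in> {0<..<t2}" "s \<in> {0<..<t1}" using 2 \<kappa> t by auto
          have wb: "weak_bound r e1 (\<lambda>y. f (t2 - s) y - f (t1 - s) y)"
            by (rule d0(2)) (use 2 \<kappa> t in auto)
          have "k s x = conv (g s) (\<lambda>y. f (t2 - s) y - f (t1 - s) y) x" for x
            unfolding k_def using s2
            by (subst conv_diff_right[OF kernel_conv_integrable[OF r bd] kernel_conv_integrable[OF r bd]]) auto
          then have "(\<integral>\<^sup>+x\<in>E. ennreal \<bar>k s x\<bar> \<partial>lborel) \<le> ennreal (r * e1) * smoothing r A s"
            unfolding A_def using kernel_conv_local[OF r wb 2(1) E] by simp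
          also have "\<dots> \<le> ?R s" using 2 by (intro add_increasing2) auto
          finally show ?thesis .
        next
          case 3
          have s2: "s \<in> {0<..<t2}" "s \<in> {0<..<t1}" "a / 2 \<le> s" "s < t1" "s < t2" using 3 \<kappa> t a by auto
          have "(\<integral>\<^sup>+x\<in>E. ennreal \<bar>k s x\<bar> \<partial>lborel)
            \<le> (\<integral>\<^sup>+x. ennreal \<bar>conv (g s) (f (t2 - s)) x\<bar> * indicator E x + ennreal \<bar>conv (g s) (f (t1 - s)) x\<bar> * indicator E x \<partial>lborel)"
            unfolding k_def using s2
            by (intro nn_integral_mono) (auto simp: indicator_def simp flip: ennreal_plus intro!: ennreal_leI)
          also have "\<dots> = (\<integral>\<^sup>+x\<in>E. ennreal \<bar>conv (g s) (f (t2 - s)) x\<bar> \<partial>lborel) + (\<integral>\<^sup>+x\<in>E. ennreal \<bar>conv (g s) (f (t1 - s)) x\<bar> \<partial>lborel)"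
          proof (rule nn_integral_add)
            have "f (t2 - s) \<in> borel_measurable borel" "f (t1 - s) \<in> borel_measurable borel" "g s \<in> borel_measurable borel"
              using weak_boundD(2)[OF bd] kernel_measurable s2 by auto
            note [measurable] = this E(1)
            show "(\<lambda>x. ennreal \<bar>conv (g s) (f (t2 - s)) x\<bar> * indicator E x) \<in> borel_measurable lborel"
              "(\<lambda>x. ennreal \<bar>conv (g s) (f (t1 - s)) x\<bar> * indicator E x) \<in> borel_measurable lborel" by measurable
          qed
          also have "\<dots> \<le> ennreal (r * M * (t2 - s) powr (- \<delta>) * (2 / a * J)) + ennreal (r * M * (t1 - s) powr (- \<delta>) * (2 / a * J))"
            using s2 by (intro add_mono piece)
          also have "\<dots> = ennreal (r * M * (2 / a * J)) * ennreal ((t2 - s) powr (- \<delta>)) + ennreal (r * M * (2 / a * J)) * ennreal ((t1 - s) powr (- \<delta>))"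
            using r M a J by (simp add: mult_ac flip: ennreal_mult)
          also have "\<dots> \<le> ?R s"
          proof -
            have i: "indicator {0<..<2 * \<kappa>} (t2 - s) = (1::ennreal)" "indicator {0<..<\<kappa>} (t1 - s) = (1::ennreal)"
              using 3 t by auto
            show ?thesis unfolding i mult_1_right by (intro add_increasing order_refl) simp
          qed
          finally show ?thesis .
        next
          case 4
          have s2: "s \<in> {0<..<t2}" "s \<notin> {0<..<t1}" "a / 2 \<le> s" "s < t2" using 4 \<kappa> t a by auto
          have "(\<integral>\<^sup>+x\<in>E. ennreal \<bar>k s x\<bar> \<partial>lborel) = (\<integral>\<^sup>+x\<in>E. ennreal \<bar>conv (g s) (f (t2 - s)) x\<bar> \<partial>lborel)"
            unfolding k_def using s2 by simp
          also have "\<dots> \<le> ennreal (r * M * (t2 - s) powr (- \<delta>) * (2 / a * J))" using s2 by (intro piece)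
          also have "\<dots> = ennreal (r * M * (2 / a * J)) * ennreal ((t2 - s) powr (- \<delta>))"
            using r M a J by (simp add: mult_ac flip: ennreal_mult)
          also have "\<dots> \<le> ?R s" using 4 t \<kappa> by (intro add_increasing add_increasing2) auto
          finally show ?thesis .
        qed
      qed
      also have "\<dots> = ennreal (r * e1) * (\<integral>\<^sup>+s\<in>{0<..}. smoothing r A s \<partial>lborel)
        + (ennreal (r * M * (2 / a * J)) * (\<integral>\<^sup>+s. ennreal ((t2 - s) powr (- \<delta>)) * indicator {0<..<2 * \<kappa>} (t2 - s) \<partial>lborel)
         + ennreal (r * M * (2 / a * J)) * (\<integral>\<^sup>+s. ennreal ((t1 - s) powr (- \<delta>)) * indicator {0<..<\<kappa>} (t1 - s) \<partial>lborel))"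
        by (simp add: nn_integral_add nn_integral_cmult)
      also have "(\<integral>\<^sup>+s. ennreal ((t2 - s) powr (- \<delta>)) * indicator {0<..<2 * \<kappa>} (t2 - s) \<partial>lborel) = ennreal ((2 * \<kappa>) powr (1 - \<delta>) / (1 - \<delta>))"
        using nn_integral_reflect[of "\<lambda>s. ennreal (s powr (- \<delta>)) * indicator {0<..<2 * \<kappa>} s" t2]
          nn_integral_powr_from_0[of "- \<delta>" "2 * \<kappa>"] \<delta> \<kappa> by simp
      also have "(\<integral>\<^sup>+s. ennreal ((t1 - s) powr (- \<delta>)) * indicator {0<..<\<kappa>} (t1 - s) \<partial>lborel) = ennreal (\<kappa> powr (1 - \<delta>) / (1 - \<delta>))"
        using nn_integral_reflect[of "\<lambda>s. ennreal (s powr (- \<delta>)) * indicator {0<..<\<kappa>} s" t1]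
          nn_integral_powr_from_0[of "- \<delta>" "\<kappa>"] \<delta> \<kappa> by simp
      also have "ennreal (r * e1) * (\<integral>\<^sup>+s\<in>{0<..}. smoothing r A s \<partial>lborel)
        + (ennreal (r * M * (2 / a * J)) * ennreal ((2 * \<kappa>) powr (1 - \<delta>) / (1 - \<delta>))
         + ennreal (r * M * (2 / a * J)) * ennreal (\<kappa> powr (1 - \<delta>) / (1 - \<delta>)))
        \<le> ennreal (r * e1) * ennreal J
        + (ennreal (r * M * (2 / a * J)) * ennreal ((2 * \<kappa>) powr (1 - \<delta>) / (1 - \<delta>))
         + ennreal (r * M * (2 / a * J)) * ennreal (\<kappa> powr (1 - \<delta>) / (1 - \<delta>)))"
        by (intro add_right_mono mult_left_mono Jint) auto
      also have "\<dots> = ennreal (r * e1 * J + (r * M * (2 / a * J) * ((2 * \<kappa>) powr (1 - \<delta>) / (1 - \<delta>)) + r * M * (2 / a * J) * (\<kappa> powr (1 - \<delta>) / (1 - \<delta>))))"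
        using r e1 J M a \<delta> by (simp flip: ennreal_mult ennreal_plus)
      also have "\<dots> \<le> ennreal (e * A powr (1 - 1 / q))"
      proof (rule ennreal_leI)
        have "(2 * \<kappa>) powr (1 - \<delta>) \<le> 2 * \<kappa> powr (1 - \<delta>)"
          using \<kappa> \<delta> powr_mono[of "1 - \<delta>" 1 2] by (subst powr_mult) auto
        then have "r * M * (2 / a * J) * ((2 * \<kappa>) powr (1 - \<delta>) / (1 - \<delta>)) \<le> r * M * (2 / a * J) * (2 * \<kappa> powr (1 - \<delta>) / (1 - \<delta>))"
          using r M a J \<delta> by (intro mult_left_mono divide_right_mono) auto
        also have "\<dots> = 2 * (r * J * (D * \<kappa> powr (1 - \<delta>)))" by (simp add: D_def mult_ac)
        finally have P: "r * M * (2 / a * J) * ((2 * \<kappa>) powr (1 - \<delta>) / (1 - \<delta>)) \<le> 2 * (r * J * (D * \<kappa> powr (1 - \<delta>)))" .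
        have Q': "r * M * (2 / a * J) * (\<kappa> powr (1 - \<delta>) / (1 - \<delta>)) = r * J * (D * \<kappa> powr (1 - \<delta>))"
          by (simp add: D_def mult_ac)
        have "r * J * (3 * D * \<kappa> powr (1 - \<delta>)) = 3 * (r * J * (D * \<kappa> powr (1 - \<delta>)))" "r * e1 * J = r * J * e1" by simp_all
        then have "r * e1 * J + (r * M * (2 / a * J) * ((2 * \<kappa>) powr (1 - \<delta>) / (1 - \<delta>)) + r * M * (2 / a * J) * (\<kappa> powr (1 - \<delta>) / (1 - \<delta>)))
          \<le> r * J * e1 + r * J * (3 * D * \<kappa> powr (1 - \<delta>))"
          unfolding Q' using P by linarith
        also have "\<dots> \<le> r * J * e1 + r * J * e1"
          using \<kappa>(3) r J by (intro add_left_mono mult_left_mono) auto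
        also have "\<dots> = 2 * Q * e1 * A powr (1 - 1 / q)" by (simp add: J_def Q_def mult_ac)
        also have "2 * Q * e1 = e" using Q by (simp add: e1_def)
        finally show "r * e1 * J + (r * M * (2 / a * J) * ((2 * \<kappa>) powr (1 - \<delta>) / (1 - \<delta>)) + r * M * (2 / a * J) * (\<kappa> powr (1 - \<delta>) / (1 - \<delta>)))
          \<le> e * A powr (1 - 1 / q)" .
      qed
      finally show ?thesis by (simp add: A_def)
    qed
    have int: "AE x in lborel. integrable lborel (\<lambda>s. indicator {0<..<u} s * conv (g s) (f (u - s)) x)" if "0 < u" for u
      by (rule duhamel_bound(1)[OF r f q rq \<delta> that M]) (rule bd)
    have wb: "weak_bound q (duhamel_const r q \<delta> * M * u powr (- \<delta>)) (duhamel u f)" if "0 < u" for u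
      by (rule duhamel_bound(2)[OF r f q rq \<delta> that M]) (rule bd)
    have wbk: "weak_bound q e (\<lambda>x. \<integral>s. k s x \<partial>lborel)"
      by (rule weak_bound_time_integral(2)[OF km _ est]) (use e in simp)
    have ae: "AE x in lborel. (\<integral>s. k s x \<partial>lborel) = duhamel t2 f x - duhamel t1 f x"
      using int[OF tp(1)] int[OF tp(2)]
      by eventually_elim (simp add: k_def duhamel_def)
    have "duhamel t2 f \<in> borel_measurable borel" "duhamel t1 f \<in> borel_measurable borel"
      using weak_boundD(2)[OF wb[OF tp(1)]] weak_boundD(2)[OF wb[OF tp(2)]] by auto
    then show "weak_bound q e (\<lambda>x. duhamel t2 f x - duhamel t1 f x)"
      by (intro weak_bound_AE_cong[OF wbk _ ae]) measurable
  qed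
qed

lemma weak_bound_minus_commute:
  assumes "weak_bound q e (\<lambda>x. f x - h x)"
  shows "weak_bound q e (\<lambda>x. h x - f x)"
  using weak_bound_cmult[OF assms, of "-1"] by simp

lemma duhamel_cont_curve:
  assumes r: "1 < r" and f: "cont_curve r f" and q: "0 < q" and rq: "1 / r = 1 / q + 1 / rate"
    and \<delta>: "0 \<le> \<delta>" "\<delta> < 1" and M: "0 \<le> M"
    and bd: "\<And>\<tau>. 0 < \<tau> \<Longrightarrow> weak_bound r (M * \<tau> powr (- \<delta>)) (f \<tau>)"
  shows "cont_curve q (\<lambda>t. duhamel t f)"
  unfolding cont_curve_def
proof (intro conjI allI impI)
  fix t :: real assume t: "0 < t"
  show "\<exists>M. weak_bound q M (duhamel t f)"
    by (rule exI, rule duhamel_bound(2)[OF r f q rq \<delta> t M]) (rule bd)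
  fix e :: real assume e: "0 < e"
  have "0 < t / 2" using t by simp
  from duhamel_increment[OF r f q rq \<delta> M bd this e, of "2 * t"] obtain d where d: "0 < d"
    "\<And>t1 t2. t / 2 \<le> t1 \<Longrightarrow> t1 \<le> t2 \<Longrightarrow> t2 \<le> 2 * t \<Longrightarrow> t2 - t1 < d \<Longrightarrow> weak_bound q e (\<lambda>x. duhamel t2 f x - duhamel t1 f x)"
    by blast
  show "\<exists>d>0. \<forall>t'>0. \<bar>t' - t\<bar> < d \<longrightarrow> weak_bound q e (\<lambda>x. duhamel t' f x - duhamel t f x)"
  proof (intro exI[of _ "min d (t / 2)"] conjI allI impI)
    fix t' :: real assume t': "0 < t'" "\<bar>t' - t\<bar> < min d (t / 2)"
    show "weak_bound q e (\<lambda>x. duhamel t' f x - duhamel t f x)"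
    proof (cases "t \<le> t'")
      case True
      then show ?thesis by (intro d(2)) (use t' in auto)
    next
      case False
      then have "weak_bound q e (\<lambda>x. duhamel t f x - duhamel t' f x)"
        by (intro d(2)) (use t' t in auto)
      then show ?thesis by (rule weak_bound_minus_commute)
    qed
  qed (use d t in auto)
qed

lemma heat_bound:
  assumes r: "1 < r" and f: "weak_bound r M f" and t: "0 < t"
    and \<theta>: "0 \<le> \<theta>" "\<theta> \<le> 1 / r" and q: "1 / q = 1 / r - \<theta>"
  shows "weak_bound q (r * M * (G1 powr (1 - \<theta>) * (G2 * t powr (- rate)) powr \<theta>)) (conv (g t) f)"
  using t G_pos by (intro weak_bound_conv[OF r f _ kernel_L1 _ kernel_bdd \<theta> q]) auto

text \<open>
  Apply Young's inequality to the difference of two kernels, which is small in \<open>L\<^sup>1\<close> and bounded;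
  \<open>\<theta> < 1\<close> leaves a positive power of the \<open>L\<^sup>1\<close> norm.
\<close>

lemma heat_cont_curve:
  assumes r: "1 < r" and f: "weak_bound r M f"
    and \<theta>: "0 \<le> \<theta>" "\<theta> < 1" "\<theta> \<le> 1 / r" and q: "1 / q = 1 / r - \<theta>"
  shows "cont_curve q (\<lambda>t. conv (g t) f)"
  unfolding cont_curve_def
proof (intro conjI allI impI)
  fix t :: real assume t: "0 < t"
  show "\<exists>M. weak_bound q M (conv (g t) f)" using heat_bound[OF r f t \<theta>(1,3) q] by blast
  fix e :: real assume e: "0 < e"
  have M: "0 \<le> M" using weak_boundD(1)[OF f] .
  show "\<exists>d>0. \<forall>t'>0. \<bar>t' - t\<bar> < d \<longrightarrow> weak_bound q e (\<lambda>x. conv (g t') f x - conv (g t) f x)"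
  proof (rule ccontr)
    assume neg: "\<not> ?thesis"
    have "\<exists>t'. 0 < t' \<and> \<bar>t' - t\<bar> < 1 / real (Suc n) \<and> \<not> weak_bound q e (\<lambda>x. conv (g t') f x - conv (g t) f x)" for n
    proof -
      have "0 < 1 / real (Suc n)" by simp
      then show ?thesis using neg by blast
    qed
    then obtain s where s: "\<And>n. 0 < s n" "\<And>n. \<bar>s n - t\<bar> < 1 / real (Suc n)"
      "\<And>n. \<not> weak_bound q e (\<lambda>x. conv (g (s n)) f x - conv (g t) f x)" by metis
    have "(\<lambda>n. s n - t) \<longlonglongrightarrow> 0"
    proof (rule Lim_null_comparison)
      show "(\<lambda>n. 1 / real (Suc n)) \<longlonglongrightarrow> 0" using LIMSEQ_Suc[OF lim_1_over_n] by simp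
    qed (use s(2) in \<open>auto intro!: always_eventually less_imp_le\<close>)
    then have slim: "s \<longlonglongrightarrow> t" by (rule LIM_zero_cancel)
    note [measurable] = kernel_measurable[OF s(1)] kernel_measurable[OF t]
    define a where "a n = enn2real (\<integral>\<^sup>+y. ennreal \<bar>g (s n) y - g t y\<bar> \<partial>lborel)" for n
    have ea: "(\<integral>\<^sup>+y. ennreal \<bar>g (s n) y - g t y\<bar> \<partial>lborel) = ennreal (a n)" for n
    proof -
      have "integrable lborel (\<lambda>y. g (s n) y - g t y)"
        using kernel_integrable[OF s(1)] kernel_integrable[OF t] by simp
      then have "(\<integral>\<^sup>+y. ennreal (norm (g (s n) y - g t y)) \<partial>lborel) < \<infinity>" unfolding integrable_iff_bounded by blast
      then show ?thesis unfolding a_def by simp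
    qed
    have a0: "0 \<le> a n" for n by (simp add: a_def)
    have "(\<lambda>j. \<integral>\<^sup>+y. ennreal \<bar>g (s j) (0 - y) - g t (0 - y)\<bar> \<partial>lborel) \<longlonglongrightarrow> 0"
      by (rule kernel_L1_tendsto[OF s(1) slim t tendsto_const])
    moreover have "(\<integral>\<^sup>+y. ennreal \<bar>g (s j) (0 - y) - g t (0 - y)\<bar> \<partial>lborel) = ennreal (a j)" for j
      unfolding ea[symmetric] by (rule nn_integral_reflect) measurable
    ultimately have "(\<lambda>n. ennreal (a n)) \<longlonglongrightarrow> ennreal 0" by simp
    then have alim: "a \<longlonglongrightarrow> 0" using a0 by (subst (asm) tendsto_ennreal_iff) auto
    define b where "b n = G2 * s n powr (- rate) + G2 * t powr (- rate)" for n
    have blim: "b \<longlonglongrightarrow> G2 * t powr (- rate) + G2 * t powr (- rate)"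
      unfolding b_def using slim t by (intro tendsto_intros) auto
    have wb: "weak_bound q (r * M * (a n powr (1 - \<theta>) * b n powr \<theta>)) (\<lambda>x. conv (g (s n)) f x - conv (g t) f x)" for n
    proof -
      have "weak_bound q (r * M * (a n powr (1 - \<theta>) * b n powr \<theta>)) (conv (\<lambda>z. g (s n) z - g t z) f)"
      proof (rule weak_bound_conv[OF r f _ _ a0 _ \<theta>(1,3) q])
        show "\<bar>g (s n) x - g t x\<bar> \<le> b n" for x
          unfolding b_def using kernel_bdd[OF s(1)[of n], of x] kernel_bdd[OF t, of x] by linarith
      qed (use ea in auto)
      moreover have "conv (\<lambda>z. g (s n) z - g t z) f = (\<lambda>x. conv (g (s n)) f x - conv (g t) f x)"
        using conv_diff_left[OF kernel_conv_integrable[OF r f s(1)] kernel_conv_integrable[OF r f t]] by (intro ext)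
      ultimately show ?thesis by simp
    qed
    have "(\<lambda>n. a n powr (1 - \<theta>)) \<longlonglongrightarrow> 0"
      by (rule tendsto_zero_powrI[OF alim tendsto_const]) (use a0 \<theta> in auto)
    moreover have "(\<lambda>n. b n powr \<theta>) \<longlonglongrightarrow> (G2 * t powr (- rate) + G2 * t powr (- rate)) powr \<theta>"
      by (rule tendsto_powr[OF blim tendsto_const]) (use G_pos t in \<open>auto simp: add_nonneg_eq_0_iff\<close>)
    ultimately have "(\<lambda>n. r * M * (a n powr (1 - \<theta>) * b n powr \<theta>))
        \<longlonglongrightarrow> r * M * (0 * (G2 * t powr (- rate) + G2 * t powr (- rate)) powr \<theta>)"
      by (intro tendsto_mult tendsto_const)
    then have "(\<lambda>n. r * M * (a n powr (1 - \<theta>) * b n powr \<theta>)) \<longlonglongrightarrow> 0" by simp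
    then have "eventually (\<lambda>n. r * M * (a n powr (1 - \<theta>) * b n powr \<theta>) < e) sequentially"
      by (rule order_tendstoD(2)) (use e in simp)
    then obtain n where "r * M * (a n powr (1 - \<theta>) * b n powr \<theta>) < e"
      by (auto simp: eventually_sequentially)
    then show False using weak_bound_mono[OF wb] s(3)[of n] by (meson less_imp_le)
  qed
qed

end

section \<open>Attainment of the initial value\<close>

lemma weak_bound_integrable_ball:
  assumes f: "weak_bound q M f"
  shows "integrable lborel (\<lambda>x. f x * indicator (ball 0 R) x)"
proof -
  note [measurable] = weak_boundD(2)[OF f]
  have b: "ball (0::'a) R \<in> sets borel" by simp
  note [measurable] = b
  have "(\<integral>\<^sup>+x. ennreal (norm (f x * indicator (ball 0 R) x)) \<partial>lborel) = (\<integral>\<^sup>+x\<in>ball 0 R. ennreal \<bar>f x\<bar> \<partial>lborel)"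
    by (rule nn_integral_cong) (auto simp: indicator_def)
  also have "\<dots> \<le> ennreal (M * measure lborel (ball (0::'a) R) powr (1 - 1 / q))"
    by (rule weak_boundD(3)[OF f b]) simp
  also have "\<dots> < \<infinity>" by simp
  finally show ?thesis by (simp add: integrable_iff_bounded)
qed

lemma weak_bound_translation_local:
  assumes q: "1 < q" and f: "weak_bound q M f" and E: "E \<in> sets borel" "emeasure lborel E < \<infinity>"
  shows "(\<integral>\<^sup>+x\<in>E. ennreal \<bar>f (x - y) - f x\<bar> \<partial>lborel) \<le> ennreal (2 * M * measure lborel E powr (1 - 1 / q))"
proof -
  note [measurable] = weak_boundD(2)[OF f] E(1)
  have M: "0 \<le> M" by (rule weak_boundD(1)[OF f])
  define E' where "E' = {x. x + y \<in> E}"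
  have [measurable]: "E' \<in> sets borel" unfolding E'_def by measurable
  have "emeasure lborel E' = (\<integral>\<^sup>+x. indicator E' x \<partial>lborel)" by simp
  also have "\<dots> = (\<integral>\<^sup>+x. indicator E (x - (- y)) \<partial>lborel)"
    by (rule nn_integral_cong) (auto simp: E'_def indicator_def)
  also have "\<dots> = (\<integral>\<^sup>+x. indicator E x \<partial>lborel)" by (rule nn_integral_shift) measurable
  finally have eE: "emeasure lborel E' = emeasure lborel E" by simp
  then have mE: "measure lborel E' = measure lborel E" by (simp add: measure_def)
  have "(\<integral>\<^sup>+x\<in>E. ennreal \<bar>f (x - y) - f x\<bar> \<partial>lborel)
     \<le> (\<integral>\<^sup>+x. ennreal \<bar>f (x - y)\<bar> * indicator E' (x - y) + ennreal \<bar>f x\<bar> * indicator E x \<partial>lborel)"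
    by (rule nn_integral_mono) (auto simp: E'_def indicator_def simp flip: ennreal_plus intro!: ennreal_leI)
  also have "\<dots> = (\<integral>\<^sup>+x. ennreal \<bar>f (x - y)\<bar> * indicator E' (x - y) \<partial>lborel) + (\<integral>\<^sup>+x\<in>E. ennreal \<bar>f x\<bar> \<partial>lborel)"
    by (rule nn_integral_add) measurable
  also have "(\<integral>\<^sup>+x. ennreal \<bar>f (x - y)\<bar> * indicator E' (x - y) \<partial>lborel) = (\<integral>\<^sup>+x\<in>E'. ennreal \<bar>f x\<bar> \<partial>lborel)"
    by (rule nn_integral_shift[of "\<lambda>x. ennreal \<bar>f x\<bar> * indicator E' x"]) measurable
  also have "(\<integral>\<^sup>+x\<in>E'. ennreal \<bar>f x\<bar> \<partial>lborel) + (\<integral>\<^sup>+x\<in>E. ennreal \<bar>f x\<bar> \<partial>lborel)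
     \<le> ennreal (M * measure lborel E' powr (1 - 1 / q)) + ennreal (M * measure lborel E powr (1 - 1 / q))"
    using E eE by (intro add_mono weak_boundD(3)[OF f]) auto
  also have "\<dots> = ennreal (2 * M * measure lborel E powr (1 - 1 / q))"
    using M by (simp add: mE flip: ennreal_plus)
  finally show ?thesis .
qed

text \<open>
  On a ball \<open>f\<close> is integrable and \<open>translation_continuous_L1\<close> applies. The part of \<open>E\<close> outside a
  large ball has small measure, and the weak bound controls \<open>f\<close> and its translates there.
\<close>

lemma translation_continuous_local:
  fixes f :: "'a::euclidean_space \<Rightarrow> real"
  assumes q: "1 < q" and f: "weak_bound q M f" and E: "E \<in> sets borel" "emeasure lborel E < \<infinity>"
    and y: "y \<longlonglongrightarrow> (0::'a)"
  shows "(\<lambda>j. \<integral>\<^sup>+x\<in>E. ennreal \<bar>f (x - y j) - f x\<bar> \<partial>lborel) \<longlonglongrightarrow> 0"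
proof (rule tendsto_0_if_Limsup_eq_0_ennreal)
  note fm[measurable] = weak_boundD(2)[OF f]
  note [measurable] = E(1)
  have M: "0 \<le> M" by (rule weak_boundD(1)[OF f])
  have "limsup (\<lambda>j. \<integral>\<^sup>+x\<in>E. ennreal \<bar>f (x - y j) - f x\<bar> \<partial>lborel) \<le> 0"
  proof (rule ennreal_le_epsilon)
    fix e :: real assume e: "0 < e"
    \<comment> \<open>The part of \<open>E\<close> near infinity, where local integrability of \<open>f\<close> gives no uniform control.\<close>
    define D where "D n = E - ball 0 (real n)" for n :: nat
    have Dm[measurable]: "D n \<in> sets borel" for n using E by (simp add: D_def)
    have Dfin: "emeasure lborel (D n) < \<infinity>" for n
      by (rule le_less_trans[OF emeasure_mono E(2)]) (use E in \<open>auto simp: D_def\<close>)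
    have "(\<lambda>n. emeasure lborel (D n)) \<longlonglongrightarrow> emeasure lborel (\<Inter>n. D n)"
    proof (rule Lim_emeasure_decseq)
      show "emeasure lborel (D n) \<noteq> \<infinity>" for n using Dfin[of n] by simp
    qed (auto simp: decseq_def D_def intro: E(1))
    moreover have "(\<Inter>n. D n) = {}"
      unfolding D_def using reals_Archimedean2 by (auto simp: dist_norm)
    ultimately have "(\<lambda>n. emeasure lborel (D n)) \<longlonglongrightarrow> ennreal 0" by simp
    moreover have eD: "emeasure lborel (D n) = ennreal (measure lborel (D n))" for n
      using Dfin[of n] by (simp add: emeasure_eq_ennreal_measure)
    ultimately have "(\<lambda>n. measure lborel (D n)) \<longlonglongrightarrow> 0"
      by (simp only: eD) (subst (asm) tendsto_ennreal_iff, auto)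
    then have "(\<lambda>n. measure lborel (D n) powr (1 - 1 / q)) \<longlonglongrightarrow> 0"
      by (rule tendsto_zero_powrI[OF _ tendsto_const]) (use q in auto)
    then have "(\<lambda>n. 2 * M * measure lborel (D n) powr (1 - 1 / q)) \<longlonglongrightarrow> 2 * M * 0"
      by (intro tendsto_mult tendsto_const)
    then have "eventually (\<lambda>n. 2 * M * measure lborel (D n) powr (1 - 1 / q) < e) sequentially"
      by (rule order_tendstoD(2)) (use e in simp)
    then obtain N where N: "2 * M * measure lborel (D N) powr (1 - 1 / q) < e"
      by (auto simp: eventually_sequentially)
    define w where "w x = f x * indicator (ball 0 (real N + 1)) x" for x
    have b: "ball (0::'a) (real N + 1) \<in> sets borel" "ball (0::'a) (real N) \<in> sets borel" by auto
    note [measurable] = b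
    have wm[measurable]: "w \<in> borel_measurable borel" unfolding w_def by measurable
    have wi: "integrable lborel w" unfolding w_def by (rule weak_bound_integrable_ball[OF f])
    have "eventually (\<lambda>j. dist (y j) 0 < 1) sequentially" using y by (rule tendstoD) simp
    then have ev: "eventually (\<lambda>j. (\<integral>\<^sup>+x\<in>E. ennreal \<bar>f (x - y j) - f x\<bar> \<partial>lborel)
        \<le> (\<integral>\<^sup>+x. ennreal \<bar>w (x - y j) - w x\<bar> \<partial>lborel) + ennreal e) sequentially"
    proof eventually_elim
      case (elim j)
      have "(\<integral>\<^sup>+x\<in>E. ennreal \<bar>f (x - y j) - f x\<bar> \<partial>lborel)
        \<le> (\<integral>\<^sup>+x. ennreal \<bar>w (x - y j) - w x\<bar> + ennreal \<bar>f (x - y j) - f x\<bar> * indicator (D N) x \<partial>lborel)"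
      proof (rule nn_integral_mono)
        fix x :: 'a
        show "ennreal \<bar>f (x - y j) - f x\<bar> * indicator E x
          \<le> ennreal \<bar>w (x - y j) - w x\<bar> + ennreal \<bar>f (x - y j) - f x\<bar> * indicator (D N) x"
        proof (cases "x \<in> ball 0 (real N)")
          case True
          have "norm (x - y j) \<le> norm x + norm (y j)" by (rule norm_triangle_ineq4)
          then have "x - y j \<in> ball 0 (real N + 1)" "x \<in> ball 0 (real N + 1)"
            using True elim by (auto simp: dist_norm norm_minus_commute)
          then show ?thesis by (auto simp: w_def indicator_def)
        next
          case False
          then show ?thesis by (auto simp: D_def indicator_def)
        qed
      qed
      also have "\<dots> = (\<integral>\<^sup>+x. ennreal \<bar>w (x - y j) - w x\<bar> \<partial>lborel) + (\<integral>\<^sup>+x\<in>D N. ennreal \<bar>f (x - y j) - f x\<bar> \<partial>lborel)"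
        by (rule nn_integral_add) measurable
      also have "(\<integral>\<^sup>+x\<in>D N. ennreal \<bar>f (x - y j) - f x\<bar> \<partial>lborel) \<le> ennreal (2 * M * measure lborel (D N) powr (1 - 1 / q))"
        by (rule weak_bound_translation_local[OF q f Dm Dfin])
      also have "\<dots> \<le> ennreal e" using N by (intro ennreal_leI) simp
      finally show ?case by (simp add: add_left_mono)
    qed
    have "(\<lambda>j. (\<integral>\<^sup>+x. ennreal \<bar>w (x - y j) - w x\<bar> \<partial>lborel) + ennreal e) \<longlonglongrightarrow> 0 + ennreal e"
      by (intro tendsto_add tendsto_const translation_continuous_L1[OF wi y])
    then have "limsup (\<lambda>j. (\<integral>\<^sup>+x. ennreal \<bar>w (x - y j) - w x\<bar> \<partial>lborel) + ennreal e) = 0 + ennreal e"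
      by (rule lim_imp_Limsup[OF sequentially_bot])
    then show "limsup (\<lambda>j. \<integral>\<^sup>+x\<in>E. ennreal \<bar>f (x - y j) - f x\<bar> \<partial>lborel) \<le> 0 + ennreal e"
      using Limsup_mono[OF ev] by simp
  qed
  then show "limsup (\<lambda>j. \<integral>\<^sup>+x\<in>E. ennreal \<bar>f (x - y j) - f x\<bar> \<partial>lborel) = 0" by simp
qed

lemma conv_cmult: "conv k (\<lambda>y. c * f y) x = c * conv k f x"
  unfolding conv_def by (simp add: mult.left_commute)

lemma conv_AE_cong:
  assumes [measurable]: "k \<in> borel_measurable borel" "f \<in> borel_measurable borel" "f' \<in> borel_measurable borel"
    and eq: "AE y in lborel. f y = f' y"
  shows "conv k f x = conv k f' x"
  unfolding conv_def by (rule integral_cong_AE) (measurable, use eq in auto)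

context kernel_family
begin

lemma kernel_rescale:
  assumes \<sigma>: "0 < \<sigma>" and s: "0 < s"
  shows "\<sigma> ^ DIM('a) * g (\<sigma> powr (2 * m) * s) (\<sigma> *\<^sub>R w) = g s w"
proof -
  have m: "m \<noteq> 0" using m_pos by simp
  have 1: "(\<sigma> powr (2 * m) * s) powr (- (real DIM('a) / (2 * m))) = \<sigma> powr (- real DIM('a)) * s powr (- (real DIM('a) / (2 * m)))"
    using \<sigma> s m by (simp add: powr_mult powr_powr)
  have 2: "(\<sigma> powr (2 * m) * s) powr (- (1 / (2 * m))) = s powr (- (1 / (2 * m))) / \<sigma>"
    using \<sigma> s m by (simp add: powr_mult powr_powr powr_minus_divide)
  have 3: "\<sigma> ^ DIM('a) * \<sigma> powr (- real DIM('a)) = 1"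
    using \<sigma> by (simp add: powr_minus powr_realpow)
  have pos: "0 < \<sigma> powr (2 * m) * s" using \<sigma> s by simp
  show ?thesis unfolding scale[OF pos] scale[OF s] 1 2 using \<sigma> 3
    by (simp add: mult.assoc[symmetric])
qed

lemma conv_rescale:
  assumes \<sigma>: "0 < \<sigma>" and s: "0 < s" and f[measurable]: "f \<in> borel_measurable borel"
  shows "conv (g (\<sigma> powr (2 * m) * s)) f (\<sigma> *\<^sub>R x) = conv (g s) (\<lambda>y. f (\<sigma> *\<^sub>R y)) x"
proof -
  have pos: "0 < \<sigma> powr (2 * m) * s" using \<sigma> s by simp
  note [measurable] = kernel_measurable[OF pos] kernel_measurable[OF s]
  have "conv (g (\<sigma> powr (2 * m) * s)) f (\<sigma> *\<^sub>R x)
     = \<bar>\<sigma>\<bar> ^ DIM('a) *\<^sub>R (\<integral>y. g (\<sigma> powr (2 * m) * s) (\<sigma> *\<^sub>R x - (0 + \<sigma> *\<^sub>R y)) * f (0 + \<sigma> *\<^sub>R y) \<partial>lborel)"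
    unfolding conv_def by (rule lborel_integral_affine) (use \<sigma> in auto)
  also have "\<dots> = (\<integral>y. \<sigma> ^ DIM('a) * g (\<sigma> powr (2 * m) * s) (\<sigma> *\<^sub>R (x - y)) * f (\<sigma> *\<^sub>R y) \<partial>lborel)"
    using \<sigma> by (simp add: scaleR_diff_right mult.assoc)
  also have "\<dots> = conv (g s) (\<lambda>y. f (\<sigma> *\<^sub>R y)) x"
    unfolding conv_def kernel_rescale[OF \<sigma> s] ..
  finally show ?thesis .
qed

text \<open>
  Substituting \<open>y = x - a z\<close> with \<open>a = t^(1/2m)\<close> moves the time dependence from the kernel to the
  argument of \<open>f\<close>.
\<close>

lemma conv_profile:
  assumes q: "1 < q" and f: "weak_bound q M f" and a: "0 < a"
  shows "integrable lborel (\<lambda>z. g 1 z * f (x - a *\<^sub>R z))"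
    and "conv (g (a powr (2 * m))) f x = (\<integral>z. g 1 z * f (x - a *\<^sub>R z) \<partial>lborel)"
proof -
  note [measurable] = weak_boundD(2)[OF f]
  have pos: "0 < a powr (2 * m)" using a by simp
  note [measurable] = kernel_measurable[OF pos]
  have k: "a ^ DIM('a) * g (a powr (2 * m)) (a *\<^sub>R z) = g 1 z" for z
    using kernel_rescale[OF a, of 1 z] by simp
  have "conv (g (a powr (2 * m))) f x
     = \<bar>- a\<bar> ^ DIM('a) *\<^sub>R (\<integral>y. g (a powr (2 * m)) (x - (x + (- a) *\<^sub>R y)) * f (x + (- a) *\<^sub>R y) \<partial>lborel)"
    unfolding conv_def by (rule lborel_integral_affine) (use a in auto)
  also have "\<dots> = (\<integral>y. (a ^ DIM('a) * g (a powr (2 * m)) (a *\<^sub>R y)) * f (x - a *\<^sub>R y) \<partial>lborel)"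
    using a by (simp add: mult.assoc)
  finally show "conv (g (a powr (2 * m))) f x = (\<integral>z. g 1 z * f (x - a *\<^sub>R z) \<partial>lborel)" unfolding k .
  have "integrable lborel (\<lambda>y. g (a powr (2 * m)) (x - y) * f y)"
    by (rule kernel_conv_integrable[OF q f pos])
  then have "integrable lborel (\<lambda>y. g (a powr (2 * m)) (x - (x + (- a) *\<^sub>R y)) * f (x + (- a) *\<^sub>R y))"
    using a by (subst lborel_integrable_affine_iff[of "\<lambda>y. g (a powr (2 * m)) (x - y) * f y"]) auto
  then have "integrable lborel (\<lambda>y. a ^ DIM('a) * (g (a powr (2 * m)) (a *\<^sub>R y) * f (x - a *\<^sub>R y)))"
    by (intro integrable_mult_right) simp
  then show "integrable lborel (\<lambda>z. g 1 z * f (x - a *\<^sub>R z))" unfolding mult.assoc[symmetric] k .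
qed

text \<open>
  Since \<open>g\<^sub>1\<close> has mass one, \<open>g\<^sub>t * f - f\<close> is the average of \<open>f (x - a z) - f x\<close> against \<open>g\<^sub>1 z\<close>, and
  dominated convergence in \<open>z\<close> reduces the claim to continuity of translations.
\<close>

lemma heat_initial_local:
  assumes q: "1 < q" and f: "weak_bound q M f" and E: "E \<in> sets borel" "emeasure lborel E < \<infinity>"
    and s: "\<And>j::nat. 0 < s j" "s \<longlonglongrightarrow> 0"
  shows "(\<lambda>j. \<integral>\<^sup>+x\<in>E. ennreal \<bar>conv (g (s j)) f x - f x\<bar> \<partial>lborel) \<longlonglongrightarrow> 0"
proof -
  note fm[measurable] = weak_boundD(2)[OF f]
  note [measurable] = E(1) kernel_measurable[OF zero_less_one]
  have M: "0 \<le> M" by (rule weak_boundD(1)[OF f])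
  define a where "a j = s j powr (1 / (2 * m))" for j
  have a: "0 < a j" "a j powr (2 * m) = s j" for j using s(1)[of j] m_pos by (auto simp: a_def powr_powr)
  have alim: "a \<longlonglongrightarrow> 0"
    unfolding a_def by (rule tendsto_zero_powrI[OF s(2) tendsto_const]) (use s(1) less_imp_le m_pos in \<open>auto intro!: always_eventually\<close>)
  define \<omega> where "\<omega> y = (\<integral>\<^sup>+x\<in>E. ennreal \<bar>f (x - y) - f x\<bar> \<partial>lborel)" for y
  have \<omega>m[measurable]: "\<omega> \<in> borel_measurable borel" unfolding \<omega>_def by measurable
  define B where "B = 2 * M * measure lborel E powr (1 - 1 / q)"
  have \<omega>B: "\<omega> y \<le> ennreal B" for y unfolding \<omega>_def B_def by (rule weak_bound_translation_local[OF q f E])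
  have le: "(\<integral>\<^sup>+x\<in>E. ennreal \<bar>conv (g (s j)) f x - f x\<bar> \<partial>lborel) \<le> (\<integral>\<^sup>+z. ennreal \<bar>g 1 z\<bar> * \<omega> (a j *\<^sub>R z) \<partial>lborel)" for j
  proof -
    have pt: "ennreal \<bar>conv (g (s j)) f x - f x\<bar> \<le> (\<integral>\<^sup>+z. ennreal \<bar>g 1 z\<bar> * ennreal \<bar>f (x - a j *\<^sub>R z) - f x\<bar> \<partial>lborel)" for x
    proof -
      note cp = conv_profile[OF q f a(1)[of j], of x]
      have gi: "integrable lborel (\<lambda>z. g 1 z * f x)" using kernel_integrable[of 1] by simp
      have "conv (g (s j)) f x - f x = (\<integral>z. g 1 z * f (x - a j *\<^sub>R z) \<partial>lborel) - (\<integral>z. g 1 z * f x \<partial>lborel)"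
        using cp(2) mass by (simp add: a(2))
      also have "\<dots> = (\<integral>z. g 1 z * (f (x - a j *\<^sub>R z) - f x) \<partial>lborel)"
        using cp(1) gi by (simp add: right_diff_distrib)
      finally have eq: "conv (g (s j)) f x - f x = (\<integral>z. g 1 z * (f (x - a j *\<^sub>R z) - f x) \<partial>lborel)" .
      have "integrable lborel (\<lambda>z. g 1 z * (f (x - a j *\<^sub>R z) - f x))"
        using cp(1) gi by (simp add: right_diff_distrib)
      from integral_norm_bound_ennreal[OF this] show ?thesis
        unfolding eq by (simp add: abs_mult ennreal_mult)
    qed
    have "(\<integral>\<^sup>+x\<in>E. ennreal \<bar>conv (g (s j)) f x - f x\<bar> \<partial>lborel)
      \<le> (\<integral>\<^sup>+x. (\<integral>\<^sup>+z. ennreal \<bar>g 1 z\<bar> * (ennreal \<bar>f (x - a j *\<^sub>R z) - f x\<bar> * indicator E x) \<partial>lborel) \<partial>lborel)"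
    proof (rule nn_integral_mono)
      fix x
      show "ennreal \<bar>conv (g (s j)) f x - f x\<bar> * indicator E x
        \<le> (\<integral>\<^sup>+z. ennreal \<bar>g 1 z\<bar> * (ennreal \<bar>f (x - a j *\<^sub>R z) - f x\<bar> * indicator E x) \<partial>lborel)"
        using pt[of x] by (cases "x \<in> E") auto
    qed
    also have "\<dots> = (\<integral>\<^sup>+z. (\<integral>\<^sup>+x. ennreal \<bar>g 1 z\<bar> * (ennreal \<bar>f (x - a j *\<^sub>R z) - f x\<bar> * indicator E x) \<partial>lborel) \<partial>lborel)"
      by (rule lborel_pair.Fubini') measurable
    also have "\<dots> = (\<integral>\<^sup>+z. ennreal \<bar>g 1 z\<bar> * \<omega> (a j *\<^sub>R z) \<partial>lborel)"
      unfolding \<omega>_def by (intro nn_integral_cong nn_integral_cmult) measurable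
    finally show ?thesis .
  qed
  have "(\<lambda>j. \<integral>\<^sup>+z. ennreal \<bar>g 1 z\<bar> * \<omega> (a j *\<^sub>R z) \<partial>lborel) \<longlonglongrightarrow> (\<integral>\<^sup>+z. 0 \<partial>(lborel :: 'a measure))"
  proof (rule nn_integral_dominated_convergence[where w = "\<lambda>z. ennreal \<bar>g 1 z\<bar> * ennreal B"])
    show "AE z in lborel. ennreal \<bar>g 1 z\<bar> * \<omega> (a j *\<^sub>R z) \<le> ennreal \<bar>g 1 z\<bar> * ennreal B" for j
      using \<omega>B by (intro AE_I2 mult_left_mono) auto
    show "(\<integral>\<^sup>+z. ennreal \<bar>g 1 z\<bar> * ennreal B \<partial>lborel) < \<infinity>"
      using le_less_trans[OF L1 ennreal_less_top] by (simp add: nn_integral_multc ennreal_mult_less_top)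
    show "AE z in lborel. (\<lambda>j. ennreal \<bar>g 1 z\<bar> * \<omega> (a j *\<^sub>R z)) \<longlonglongrightarrow> 0"
    proof (rule AE_I2)
      fix z :: 'a
      have "(\<lambda>j. a j *\<^sub>R z) \<longlonglongrightarrow> 0 *\<^sub>R z" by (intro tendsto_intros alim)
      then have "(\<lambda>j. \<omega> (a j *\<^sub>R z)) \<longlonglongrightarrow> 0"
        unfolding \<omega>_def by (intro translation_continuous_local[OF q f E]) simp
      then have "(\<lambda>j. ennreal \<bar>g 1 z\<bar> * \<omega> (a j *\<^sub>R z)) \<longlonglongrightarrow> ennreal \<bar>g 1 z\<bar> * 0"
        by (intro ennreal_tendsto_cmult) auto
      then show "(\<lambda>j. ennreal \<bar>g 1 z\<bar> * \<omega> (a j *\<^sub>R z)) \<longlonglongrightarrow> 0" by simp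
    qed
  qed measurable
  then have z: "(\<lambda>j. \<integral>\<^sup>+z. ennreal \<bar>g 1 z\<bar> * \<omega> (a j *\<^sub>R z) \<partial>lborel) \<longlonglongrightarrow> 0" by simp
  show ?thesis
    by (rule tendsto_sandwich[OF _ _ tendsto_const z]) (simp_all add: le)
qed

end

section \<open>Integrability from level sets\<close>

text \<open>
  The level set at height \<open>l\<close> lies in a ball of volume of order \<open>l^(-bn)\<close>, which is integrable at
  \<open>l = 0\<close>. This replaces polar coordinates.
\<close>

lemma level_sets_integrable:
  fixes f :: "'a::euclidean_space \<Rightarrow> real"
  assumes [measurable]: "f \<in> borel_measurable borel" and f1: "\<And>x. \<bar>f x\<bar> \<le> 1"
    and c: "0 \<le> c" and b: "b * real DIM('a) < 1"
    and lev: "\<And>l x. 0 < l \<Longrightarrow> l < 1 \<Longrightarrow> l < \<bar>f x\<bar> \<Longrightarrow> norm x < c * l powr (- b)"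
  shows "integrable lborel f"
proof -
  define v where "v = unit_ball_vol (real DIM('a)) * c ^ DIM('a)"
  have v: "0 \<le> v" using c by (simp add: v_def)
  have "(\<integral>\<^sup>+x. ennreal \<bar>f x\<bar> * 1 \<partial>lborel)
     = (\<integral>\<^sup>+l\<in>{0<..}. (\<integral>\<^sup>+x\<in>{x. l < \<bar>f x\<bar>}. 1 \<partial>lborel) \<partial>lborel)"
    by (rule layer_cake) auto
  also have "\<dots> \<le> (\<integral>\<^sup>+l. ennreal v * (ennreal (l powr (- (b * real DIM('a)))) * indicator {0<..<1} l) \<partial>lborel)"
  proof (rule nn_integral_mono)
    fix l :: real
    show "(\<integral>\<^sup>+x\<in>{x. l < \<bar>f x\<bar>}. 1 \<partial>lborel) * indicator {0<..} l
      \<le> ennreal v * (ennreal (l powr (- (b * real DIM('a)))) * indicator {0<..<1} l)"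
    proof (cases "0 < l \<and> l < 1")
      case True
      have "(\<integral>\<^sup>+x\<in>{x. l < \<bar>f x\<bar>}. 1 \<partial>lborel) = emeasure lborel {x. l < \<bar>f x\<bar>}" by simp
      also have "\<dots> \<le> emeasure lborel (ball (0::'a) (c * l powr (- b)))"
        using lev True by (intro emeasure_mono) auto
      also have "\<dots> = ennreal (unit_ball_vol (real DIM('a)) * (c * l powr (- b)) ^ DIM('a))"
        using c by (intro emeasure_ball) simp
      also have "unit_ball_vol (real DIM('a)) * (c * l powr (- b)) ^ DIM('a) = v * l powr (- (b * real DIM('a)))"
        using True by (simp add: v_def power_mult_distrib powr_powr flip: powr_realpow)
      finally show ?thesis using True v by (simp add: ennreal_mult)
    next
      case False
      then consider "l \<le> 0" | "1 \<le> l" by linarith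
      then show ?thesis
      proof cases
        case 2
        then have "{x. l < \<bar>f x\<bar>} = {}" using f1 by (auto simp: not_less intro: order_trans[OF f1])
        then show ?thesis by simp
      qed simp
    qed
  qed
  also have "\<dots> = ennreal v * (\<integral>\<^sup>+l\<in>{0<..<1}. ennreal (l powr (- (b * real DIM('a)))) \<partial>lborel)"
    by (rule nn_integral_cmult) auto
  also have "\<dots> < \<infinity>" using b by (subst nn_integral_powr_from_0) (auto simp: ennreal_mult_less_top)
  finally show ?thesis by (simp add: integrable_iff_bounded)
qed

lemma integrable_decay:
  assumes s: "real DIM('a) < s"
  shows "integrable lborel (\<lambda>x::'a::euclidean_space. (1 + norm x) powr (- s))"
proof (rule level_sets_integrable[where c = 1 and b = "1 / s"])
  have s0: "0 < s" using s by (smt (verit) of_nat_0_le_iff)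
  show "1 / s * real DIM('a) < 1" using s s0 by simp
  show "\<bar>(1 + norm x) powr (- s)\<bar> \<le> 1" for x :: 'a
    using s0 powr_mono[of "- s" 0 "1 + norm x"] norm_ge_zero[of x] by (auto split: if_splits)
  fix l and x :: 'a assume l: "0 < l" "l < 1" "l < \<bar>(1 + norm x) powr (- s)\<bar>"
  have "l powr (1 / s) < ((1 + norm x) powr (- s)) powr (1 / s)"
    using l s0 by (intro powr_less_mono2) auto
  also have "\<dots> = (1 + norm x) powr (- 1)" using s0 by (simp add: powr_powr)
  also have "\<dots> = 1 / (1 + norm x)" using powr_minus_divide[of "1 + norm x" 1] by simp
  finally have "1 + norm x < l powr (- (1 / s))"
    using l by (simp add: powr_minus field_simps add_pos_nonneg)
  then show "norm x < 1 * l powr (- (1 / s))" by simp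
qed auto

lemma integrable_exp_norm_powr:
  assumes m: "0 < m" and t: "0 < t"
  shows "integrable lborel (\<lambda>x::'a::euclidean_space. exp (- t * norm x powr (2 * m)))"
proof -
  define n where "n = real DIM('a)"
  have n: "0 < n" by (simp add: n_def)
  show ?thesis
  proof (rule level_sets_integrable[where c = "(n / (m * t)) powr (1 / (2 * m))" and b = "1 / (2 * n)"])
    show "1 / (2 * n) * real DIM('a) < 1" using n by (simp add: n_def)
    show "\<bar>exp (- t * norm x powr (2 * m))\<bar> \<le> 1" for x :: 'a using t by simp
    fix l and x :: 'a assume l: "0 < l" "l < 1" "l < \<bar>exp (- t * norm x powr (2 * m))\<bar>"
    then have "ln l < ln (exp (- t * norm x powr (2 * m)))" by (subst ln_less_cancel_iff) auto
    then have "ln l < - t * norm x powr (2 * m)" by simp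
    then have "t * norm x powr (2 * m) < ln (1 / l)" using l by (simp add: ln_div)
    also have "ln (1 / l) \<le> (1 / l) powr (m / n) / (m / n)"
      using l m n by (intro ln_powr_bound) auto
    also have "\<dots> = n / m * l powr (- (m / n))" using l by (simp add: powr_divide powr_minus field_simps)
    finally have "norm x powr (2 * m) < n / (m * t) * l powr (- (m / n))" using t m by (simp add: field_simps)
    then have "(norm x powr (2 * m)) powr (1 / (2 * m)) < (n / (m * t) * l powr (- (m / n))) powr (1 / (2 * m))"
      using m by (intro powr_less_mono2) auto
    also have "\<dots> = (n / (m * t)) powr (1 / (2 * m)) * l powr (- (1 / (2 * n)))"
      using m n t l by (subst powr_mult) (auto simp: powr_powr mult.commute)
    finally show "norm x < (n / (m * t)) powr (1 / (2 * m)) * l powr (- (1 / (2 * n)))"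
      using m by (simp add: powr_powr)
  qed auto
qed

section \<open>Iterated differences of the heat symbol\<close>

definition cdiff :: "(complex \<Rightarrow> complex) \<Rightarrow> complex \<Rightarrow> complex" where
  "cdiff \<phi> z = \<phi> z - \<phi> (z + 1)"

text \<open>
  Each difference is an integral of a derivative over a unit segment, which Cauchy's estimate on
  discs of radius \<open>r / 2\<close> bounds by \<open>4 / r\<close> times the previous bound. One step uses up
  \<open>1 + r / 2 \<le> r\<close> of the radius, hence the initial radius \<open>N r + 1\<close>.
\<close>

lemma cdiff_bound:
  assumes r: "2 \<le> r" and B: "0 < B"
  shows "\<phi> holomorphic_on ball 0 (real N * r + 1) \<Longrightarrow> (\<And>z. z \<in> ball 0 (real N * r + 1) \<Longrightarrow> norm (\<phi> z) \<le> B)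
    \<Longrightarrow> norm ((cdiff ^^ N) \<phi> 0) \<le> B * (4 / r) ^ N"
  using B
proof (induction N arbitrary: \<phi> B)
  case (Suc N)
  let ?R = "real (Suc N) * r + 1"
  have R: "real N * r + 2 + r / 2 \<le> ?R" using r by (simp add: algebra_simps)
  have deriv_le: "norm (deriv \<phi> w) \<le> 4 * B / r" if w: "norm w < real N * r + 2" for w
  proof -
    have sub: "cball w (r / 2) \<subseteq> ball 0 ?R"
    proof
      fix z assume "z \<in> cball w (r / 2)"
      then have "norm (z - w) \<le> r / 2" by (simp add: dist_norm norm_minus_commute)
      moreover have "norm z \<le> norm (z - w) + norm w" using norm_triangle_ineq[of "z - w" w] by simp
      ultimately have "norm z < ?R" using w R by linarith
      then show "z \<in> ball 0 ?R" by simp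
    qed
    have "norm ((deriv ^^ 1) \<phi> w) \<le> fact 1 * (2 * B) / (r / 2) ^ 1"
    proof (rule Cauchy_higher_deriv_bound[where y = 0])
      show "\<phi> holomorphic_on ball w (r / 2)"
        by (rule holomorphic_on_subset[OF Suc.prems(1)]) (use sub ball_subset_cball in blast)
      show "continuous_on (cball w (r / 2)) \<phi>"
        by (rule holomorphic_on_imp_continuous_on[OF holomorphic_on_subset[OF Suc.prems(1) sub]])
      fix z assume "z \<in> ball w (r / 2)"
      then have "z \<in> ball 0 ?R" using sub ball_subset_cball by blast
      then have "norm (\<phi> z) < 2 * B" using Suc.prems(2)[of z] Suc.prems(3) by linarith
      then show "\<phi> z \<in> ball 0 (2 * B)" by simp
    qed (use r in auto)
    then show ?thesis by simp
  qed
  have hd: "(\<phi> has_field_derivative deriv \<phi> z) (at z within ball 0 (real N * r + 2))"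
    if z: "z \<in> ball 0 (real N * r + 2)" for z
  proof -
    have "norm z < ?R" using z R r by simp
    then have "(\<phi> has_field_derivative deriv \<phi> z) (at z)"
      by (intro holomorphic_derivI[OF Suc.prems(1)]) auto
    then show ?thesis by (rule has_field_derivative_at_within)
  qed
  have diff: "norm (cdiff \<phi> z) \<le> 4 * B / r" if z: "norm z < real N * r + 1" for z
  proof -
    have z1: "norm (z + 1) < real N * r + 2" using z norm_triangle_ineq[of z 1] by simp
    have "norm (\<phi> z - \<phi> (z + 1)) \<le> (4 * B / r) * norm (z - (z + 1))"
      by (rule field_differentiable_bound[OF convex_ball hd])
         (use deriv_le z z1 in auto)
    then show ?thesis by (simp add: cdiff_def)
  qed
  have "norm ((cdiff ^^ N) (cdiff \<phi>) 0) \<le> (4 * B / r) * (4 / r) ^ N"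
  proof (rule Suc.IH)
    have "(\<phi> \<circ> (\<lambda>z. z + 1)) holomorphic_on ball 0 (real N * r + 1)"
    proof (rule holomorphic_on_compose_gen)
      show "(\<lambda>z. z + 1) ` ball (0::complex) (real N * r + 1) \<subseteq> ball 0 ?R"
      proof (intro image_subsetI)
        fix z :: complex assume "z \<in> ball 0 (real N * r + 1)"
        then have "norm (z + 1) < real N * r + 2" using norm_triangle_ineq[of z 1] by simp
        then show "z + 1 \<in> ball 0 ?R" using R r by simp
      qed
    qed (use Suc.prems(1) in \<open>auto intro!: holomorphic_intros\<close>)
    moreover have "\<phi> holomorphic_on ball 0 (real N * r + 1)"
      by (rule holomorphic_on_subset[OF Suc.prems(1)]) (use r in \<open>auto simp: algebra_simps\<close>)
    ultimately have "(\<lambda>z. \<phi> z - (\<phi> \<circ> (\<lambda>z. z + 1)) z) holomorphic_on ball 0 (real N * r + 1)"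
      by (intro holomorphic_on_diff)
    then show "cdiff \<phi> holomorphic_on ball 0 (real N * r + 1)"
      unfolding cdiff_def[abs_def] by (simp add: o_def)
    show "norm (cdiff \<phi> z) \<le> 4 * B / r" if "z \<in> ball 0 (real N * r + 1)" for z
      using diff that by simp
    show "0 < 4 * B / r" using Suc.prems(3) r by simp
  qed
  then show ?case by (simp only: funpow_Suc_right o_def power_Suc) (simp add: mult_ac)
qed simp

definition rdiff :: "'a::real_vector \<Rightarrow> ('a \<Rightarrow> complex) \<Rightarrow> 'a \<Rightarrow> complex" where
  "rdiff h f \<xi> = f \<xi> - f (\<xi> + h)"

lemma rdiff_minus_const:
  "0 < N \<Longrightarrow> (rdiff h ^^ N) (\<lambda>\<xi>. f \<xi> - c) = (rdiff h ^^ N) f"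
proof (induction N)
  case (Suc N)
  have 1: "rdiff h (\<lambda>\<xi>. f \<xi> - c) = rdiff h f" by (auto simp: rdiff_def fun_eq_iff)
  then show ?case by (simp only: funpow_Suc_right o_def)
qed simp

lemma rdiff_local_bound:
  fixes f :: "'a::real_normed_vector \<Rightarrow> complex"
  assumes "\<And>\<eta>. norm \<eta> \<le> R \<Longrightarrow> norm (f \<eta>) \<le> B"
  shows "norm \<xi> + real N * norm h \<le> R \<Longrightarrow> norm ((rdiff h ^^ N) f \<xi>) \<le> 2 ^ N * B"
proof (induction N arbitrary: \<xi>)
  case 0
  then show ?case using assms[of \<xi>] by simp
next
  case (Suc N)
  have "norm \<xi> + real N * norm h \<le> norm \<xi> + real (Suc N) * norm h" by (simp add: algebra_simps)
  then have 1: "norm ((rdiff h ^^ N) f \<xi>) \<le> 2 ^ N * B" using Suc.prems by (intro Suc.IH) linarith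
  have "norm (\<xi> + h) + real N * norm h \<le> norm \<xi> + real (Suc N) * norm h"
    using norm_triangle_ineq[of \<xi> h] by (simp add: algebra_simps)
  then have 2: "norm ((rdiff h ^^ N) f (\<xi> + h)) \<le> 2 ^ N * B" using Suc.prems by (intro Suc.IH) linarith
  have "(rdiff h ^^ Suc N) f \<xi> = (rdiff h ^^ N) f \<xi> - (rdiff h ^^ N) f (\<xi> + h)" by (simp add: rdiff_def)
  then show ?case using 1 2 norm_triangle_ineq4[of "(rdiff h ^^ N) f \<xi>" "(rdiff h ^^ N) f (\<xi> + h)"] by simp
qed

text \<open>
  Differences along \<open>h\<close> only sample the line through \<open>\<xi>\<close> at integer multiples of \<open>h\<close>, so any function
  of a complex variable that interpolates these values may replace \<open>f\<close>.
\<close>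

lemma cdiff_eq_rdiff:
  assumes "\<And>j. j \<le> K \<Longrightarrow> \<phi> (of_nat j) = f (\<xi> + of_nat j *\<^sub>R h)"
  shows "j + N \<le> K \<Longrightarrow> (cdiff ^^ N) \<phi> (of_nat j) = (rdiff h ^^ N) f (\<xi> + of_nat j *\<^sub>R h)"
proof (induction N arbitrary: j)
  case 0
  then show ?case using assms by simp
next
  case (Suc N)
  have a: "(cdiff ^^ N) \<phi> (of_nat j) = (rdiff h ^^ N) f (\<xi> + of_nat j *\<^sub>R h)" by (rule Suc.IH) (use Suc.prems in simp)
  have b: "(cdiff ^^ N) \<phi> (of_nat (Suc j)) = (rdiff h ^^ N) f (\<xi> + of_nat (Suc j) *\<^sub>R h)" by (rule Suc.IH) (use Suc.prems in simp)
  have c: "of_nat (Suc j) = (of_nat j + 1 :: complex)" "\<xi> + of_nat (Suc j) *\<^sub>R h = \<xi> + of_nat j *\<^sub>R h + h"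
    by (simp_all add: algebra_simps)
  have "(cdiff ^^ Suc N) \<phi> (of_nat j) = (cdiff ^^ N) \<phi> (of_nat j) - (cdiff ^^ N) \<phi> (of_nat j + 1)"
    by (simp add: cdiff_def)
  also have "\<dots> = (rdiff h ^^ N) f (\<xi> + of_nat j *\<^sub>R h) - (rdiff h ^^ N) f (\<xi> + of_nat j *\<^sub>R h + h)"
    using a b unfolding c by simp
  also have "\<dots> = (rdiff h ^^ Suc N) f (\<xi> + of_nat j *\<^sub>R h)" by (simp add: rdiff_def)
  finally show ?case .
qed

lemma norm_exp_minus_1_le:
  fixes w :: complex
  assumes "0 \<le> Re w"
  shows "norm (exp (- w) - 1) \<le> norm w"
proof -
  have "norm (exp (- w) - exp 0) \<le> 1 * norm (- w - 0)"
  proof (rule field_differentiable_bound)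
    show "convex {z. Re z \<le> 0}" by (rule convex_halfspace_Re_le)
    show "(exp has_field_derivative exp z) (at z within {z. Re z \<le> 0})" for z
      by (rule DERIV_subset[OF DERIV_exp]) auto
  qed (use assms in auto)
  then show ?thesis by simp
qed

definition heat_symbol :: "real \<Rightarrow> 'a::euclidean_space \<Rightarrow> complex" where
  "heat_symbol m \<xi> = complex_of_real (exp (- (norm \<xi> powr (2 * m))))"

lemma heat_symbol_small: "norm (heat_symbol m \<xi> - 1) \<le> norm \<xi> powr (2 * m)"
proof -
  have "norm (exp (- complex_of_real (norm \<xi> powr (2 * m))) - 1) \<le> norm (complex_of_real (norm \<xi> powr (2 * m)))"
    by (rule norm_exp_minus_1_le) simp
  then show ?thesis by (simp add: heat_symbol_def exp_of_real[symmetric])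
qed

text \<open>
  Since \<open>|\<xi> + s h|\<^sup>2 = |\<xi>|\<^sup>2 (1 + w s)\<close> with a quadratic polynomial \<open>w\<close> that vanishes at 0, the symbol
  along this line is \<open>exp (- |\<xi>|^(2m) (1 + w s)\<^sup>m)\<close>, which is holomorphic on the disc
  \<open>|s| < \<kappa> |\<xi>| / |h|\<close>. There \<open>|w| \<le> 3 \<kappa>\<close>, so for small \<open>\<kappa>\<close> the power \<open>(1 + w s)\<^sup>m\<close> has positive real part
  and the symbol differs from 1 by \<open>O(|\<xi>|^(2m))\<close>. \<open>cdiff_bound\<close> now gains a factor \<open>|h| / |\<xi>|\<close> from
  each of the \<open>N\<close> differences.
\<close>

lemma heat_symbol_far:
  fixes \<xi> h :: "'a::euclidean_space"
  assumes m: "0 < m" and \<kappa>: "0 < \<kappa>" "12 * \<kappa> \<le> 1" "12 * m * \<kappa> \<le> 1" and N: "0 < N"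
    and h: "0 < norm h" and far: "3 * real N * norm h \<le> \<kappa> * norm \<xi>"
  shows "norm ((rdiff h ^^ N) (heat_symbol m) \<xi>)
     \<le> 3 * norm \<xi> powr (2 * m) * (12 * real N * norm h / (\<kappa> * norm \<xi>)) ^ N"
proof -
  have xi: "0 < norm \<xi>"
  proof (rule ccontr)
    assume "\<not> 0 < norm \<xi>"
    then have "3 * real N * norm h \<le> 0" using far by simp
    moreover have "0 < 3 * real N * norm h" using N h by simp
    ultimately show False by linarith
  qed
  define \<rho> where "\<rho> = norm h / norm \<xi>"
  have \<rho>: "0 < \<rho>" using h xi by (simp add: \<rho>_def)
  \<comment> \<open>Chosen so that the disc of radius \<open>N r + 1\<close> is the one on which the symbol extends.\<close>
  define r where "r = \<kappa> / (real N * \<rho>) - 1 / real N"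
  have Nr: "real N * r + 1 = \<kappa> / \<rho>" using N by (simp add: r_def field_simps)
  have far': "3 * real N \<le> \<kappa> / \<rho>" using far h xi by (simp add: \<rho>_def field_simps)
  have N1: "1 \<le> real N" using N by simp
  have r: "2 \<le> r"
  proof -
    have "2 * real N \<le> real N * r" using Nr far' N1 by linarith
    then show ?thesis using N by (simp add: mult.commute)
  qed
  have r3: "\<kappa> / (3 * real N * \<rho>) \<le> r"
  proof -
    have "X / 3 \<le> X - 1" if "3 \<le> X" for X :: real using that by linarith
    moreover have "3 \<le> \<kappa> / \<rho>" using far' N1 by linarith
    ultimately have "\<kappa> / \<rho> / 3 \<le> \<kappa> / \<rho> - 1" by blast
    also have "\<dots> = r * real N" using Nr by (simp add: mult.commute)
    finally have "\<kappa> / \<rho> / 3 / real N \<le> r" using N by (subst pos_divide_le_eq) auto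
    then show ?thesis by (simp add: mult_ac)
  qed
  define a where "a = 2 * (\<xi> \<bullet> h) / (norm \<xi>)\<^sup>2"
  define b where "b = (norm h)\<^sup>2 / (norm \<xi>)\<^sup>2"
  have ab: "\<bar>a\<bar> \<le> 2 * \<rho>" "b = \<rho>\<^sup>2"
  proof -
    have "\<bar>\<xi> \<bullet> h\<bar> \<le> norm \<xi> * norm h" by (rule Cauchy_Schwarz_ineq2)
    then show "\<bar>a\<bar> \<le> 2 * \<rho>" using xi by (simp add: a_def \<rho>_def abs_mult power2_eq_square field_simps)
    show "b = \<rho>\<^sup>2" by (simp add: b_def \<rho>_def power_divide)
  qed
  define w where "w s = s * complex_of_real a + s\<^sup>2 * complex_of_real b" for s
  \<comment> \<open>The symbol minus 1 at \<open>\<xi> + s h\<close>, continued to complex \<open>s\<close> with the principal power.\<close>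
  define \<phi> where "\<phi> s = exp (- (complex_of_real (norm \<xi> powr (2 * m)) * exp (complex_of_real m * Ln (1 + w s)))) - 1" for s
  have w: "norm (w s) \<le> 3 * \<kappa>" if s: "norm s < \<kappa> / \<rho>" for s
  proof -
    have sr: "norm s * \<rho> \<le> \<kappa>" using s \<rho> by (simp add: field_simps)
    have "norm (w s) \<le> norm s * \<bar>a\<bar> + (norm s)\<^sup>2 * \<bar>b\<bar>"
      unfolding w_def by (rule order_trans[OF norm_triangle_ineq]) (simp add: norm_mult norm_power)
    also have "\<dots> \<le> norm s * (2 * \<rho>) + (norm s)\<^sup>2 * \<rho>\<^sup>2"
      using ab by (intro add_mono mult_left_mono) auto
    also have "\<dots> = 2 * (norm s * \<rho>) + (norm s * \<rho>)\<^sup>2" by (simp add: power_mult_distrib)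
    also have "\<dots> \<le> 2 * \<kappa> + \<kappa> * 1"
      unfolding power2_eq_square using sr \<rho> \<kappa> by (intro add_mono mult_mono mult_left_mono) auto
    finally show ?thesis by simp
  qed
  have bounds: "1 + w s \<notin> \<real>\<^sub>\<le>\<^sub>0" "norm (complex_of_real m * Ln (1 + w s)) \<le> 1 / 2" if s: "norm s < \<kappa> / \<rho>" for s
  proof -
    have ws: "norm (w s) \<le> 1 / 4" using w[OF s] \<kappa> by linarith
    then have "\<bar>Re (w s)\<bar> \<le> 1 / 4" using abs_Re_le_cmod[of "w s"] by linarith
    then have "0 < Re (1 + w s)" by simp
    then show "1 + w s \<notin> \<real>\<^sub>\<le>\<^sub>0" by (auto simp: complex_nonpos_Reals_iff)
    have "norm (Ln (1 + w s)) \<le> 2 * norm (w s)" by (rule norm_Ln_le) (use ws in linarith)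
    also have "\<dots> \<le> 6 * \<kappa>" using w[OF s] by simp
    finally have "m * norm (Ln (1 + w s)) \<le> m * (6 * \<kappa>)" using m by (intro mult_left_mono) auto
    moreover have "m * (6 * \<kappa>) \<le> 1 / 2" using \<kappa>(3) by (simp add: mult_ac)
    moreover have "norm (complex_of_real m * Ln (1 + w s)) = m * norm (Ln (1 + w s))"
      using m by (simp add: norm_mult)
    ultimately show "norm (complex_of_real m * Ln (1 + w s)) \<le> 1 / 2" by linarith
  qed
  have hol: "\<phi> holomorphic_on ball 0 (real N * r + 1)"
    unfolding \<phi>_def w_def Nr using bounds(1) unfolding w_def
    by (intro holomorphic_intros) auto
  have bd: "norm (\<phi> s) \<le> 3 * norm \<xi> powr (2 * m)" if s: "s \<in> ball 0 (real N * r + 1)" for s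
  proof -
    have s': "norm s < \<kappa> / \<rho>" using s unfolding Nr by simp
    define v where "v = complex_of_real m * Ln (1 + w s)"
    have v: "norm v \<le> 1 / 2" unfolding v_def by (rule bounds(2)[OF s'])
    have "\<bar>Im v\<bar> \<le> 1 / 2" using v abs_Im_le_cmod[of v] by linarith
    then have "0 \<le> cos (Im v)" using pi_gt3 by (intro cos_ge_zero) linarith+
    then have Re0: "0 \<le> Re (complex_of_real (norm \<xi> powr (2 * m)) * exp v)" by (simp add: Re_exp)
    have "norm (exp v) \<le> exp (norm v)" by (rule norm_exp)
    also have "\<dots> \<le> exp 1" using v by simp
    also have "\<dots> \<le> 3" by (rule exp_le)
    finally have e3: "norm (exp v) \<le> 3" .
    have "norm (\<phi> s) \<le> norm (complex_of_real (norm \<xi> powr (2 * m)) * exp v)"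
      unfolding \<phi>_def v_def[symmetric] by (rule norm_exp_minus_1_le[OF Re0])
    also have "\<dots> = norm \<xi> powr (2 * m) * norm (exp v)" by (simp add: norm_mult)
    also have "\<dots> \<le> norm \<xi> powr (2 * m) * 3" using e3 by (intro mult_left_mono) auto
    finally show ?thesis by simp
  qed
  have val: "\<phi> (of_nat j) = heat_symbol m (\<xi> + of_nat j *\<^sub>R h) - 1" if j: "j \<le> N" for j
  proof -
    have "norm (of_nat j :: complex) < \<kappa> / \<rho>"
      using j far' N1 by simp
    from w[OF this] have ws: "norm (w (of_nat j)) \<le> 1 / 4" using \<kappa> by linarith
    define z where "z = 1 + real j * a + (real j)\<^sup>2 * b"
    have wz: "1 + w (of_nat j) = complex_of_real z" by (simp add: w_def z_def)
    have "\<bar>real j * a + (real j)\<^sup>2 * b\<bar> \<le> 1 / 4"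
    proof -
      have "w (of_nat j) = complex_of_real (real j * a + (real j)\<^sup>2 * b)" by (simp add: w_def)
      then show ?thesis using ws by (simp only: norm_of_real)
    qed
    then have z: "0 < z" unfolding z_def by linarith
    have "exp (complex_of_real m * Ln (1 + w (of_nat j))) = complex_of_real (z powr m)"
      unfolding wz using z by (simp add: Ln_of_real powr_def exp_of_real[symmetric])
    moreover have "norm (\<xi> + of_nat j *\<^sub>R h) powr (2 * m) = norm \<xi> powr (2 * m) * z powr m"
    proof -
      have "(norm (\<xi> + of_nat j *\<^sub>R h))\<^sup>2 = (norm \<xi>)\<^sup>2 * z"
        using xi unfolding z_def a_def b_def power2_norm_eq_inner
        by (simp add: inner_add_left inner_add_right inner_commute power2_eq_square field_simps)
      then have "((norm (\<xi> + of_nat j *\<^sub>R h))\<^sup>2) powr m = ((norm \<xi>)\<^sup>2 * z) powr m" by simp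
      then show ?thesis using z by (simp add: powr_mult powr_powr flip: powr_numeral)
    qed
    ultimately show ?thesis
      by (simp add: \<phi>_def heat_symbol_def exp_of_real[symmetric])
  qed
  have pos: "0 < 3 * norm \<xi> powr (2 * m)" using xi by simp
  have "norm ((cdiff ^^ N) \<phi> 0) \<le> 3 * norm \<xi> powr (2 * m) * (4 / r) ^ N"
    by (rule cdiff_bound[OF r pos hol bd])
  also have "(cdiff ^^ N) \<phi> 0 = (rdiff h ^^ N) (\<lambda>\<xi>. heat_symbol m \<xi> - 1) \<xi>"
    using cdiff_eq_rdiff[where K = N and \<phi> = \<phi> and f = "\<lambda>\<xi>. heat_symbol m \<xi> - 1" and \<xi> = \<xi> and h = h and j = 0 and N = N] val by simp
  also have "\<dots> = (rdiff h ^^ N) (heat_symbol m) \<xi>" using rdiff_minus_const[OF N, of h "heat_symbol m" 1] by simp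
  also have "3 * norm \<xi> powr (2 * m) * (4 / r) ^ N \<le> 3 * norm \<xi> powr (2 * m) * (12 * real N * norm h / (\<kappa> * norm \<xi>)) ^ N"
  proof (intro mult_left_mono power_mono)
    have "4 / r \<le> 4 / (\<kappa> / (3 * real N * \<rho>))" using r3 r \<kappa> N \<rho> by (intro divide_left_mono) auto
    also have "\<dots> = 12 * real N * norm h / (\<kappa> * norm \<xi>)" by (simp add: \<rho>_def)
    finally show "4 / r \<le> 12 * real N * norm h / (\<kappa> * norm \<xi>)" .
  qed (use r in auto)
  finally show ?thesis .
qed

text \<open>
  Far from the origin, relative to \<open>|h|\<close>, this is \<open>heat_symbol_far\<close>. Near the origin, where the
  symbol need not be smooth, differences of the symbol and of the symbol minus 1 coincide, and the
  latter is \<open>O(|h|^(2m))\<close>.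
\<close>

lemma rdiff_heat_symbol_bound:
  assumes m: "0 < m" and N: "2 * m < real N"
  shows "\<exists>C\<ge>0. \<forall>(\<xi>::'a::euclidean_space) h. h \<noteq> 0 \<longrightarrow>
    norm ((rdiff h ^^ N) (heat_symbol m) \<xi>) \<le> C * norm h powr (2 * m) * (1 + norm \<xi> / norm h) powr (- (real N - 2 * m))"
proof -
  have N0: "0 < N" using m N by (cases N) auto
  have N1: "1 \<le> real N" using N0 by simp
  define \<kappa> where "\<kappa> = min (1 / 12) (1 / (12 * m))"
  have \<kappa>: "0 < \<kappa>" "12 * \<kappa> \<le> 1" "12 * m * \<kappa> \<le> 1"
  proof -
    show "0 < \<kappa>" using m by (simp add: \<kappa>_def)
    show "12 * \<kappa> \<le> 1" by (simp add: \<kappa>_def)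
    have "12 * m * \<kappa> \<le> 12 * m * (1 / (12 * m))" using m by (intro mult_left_mono) (auto simp: \<kappa>_def)
    then show "12 * m * \<kappa> \<le> 1" using m by simp
  qed
  \<comment> \<open>The ratio \<open>|\<xi>| / |h|\<close> from which on the holomorphic extension covers all \<open>N\<close> steps.\<close>
  define L where "L = 3 * real N / \<kappa>"
  have L: "1 \<le> L"
  proof -
    have "\<kappa> \<le> 3 * real N" using \<kappa>(2) N1 by linarith
    then show ?thesis using \<kappa>(1) by (simp add: L_def)
  qed
  define s where "s = real N - 2 * m"
  have s: "0 < s" using N by (simp add: s_def)
  define C1 where "C1 = 3 * (12 * real N / \<kappa>) ^ N * 2 powr s"
  define C2 where "C2 = 2 ^ N * (L + real N) powr (2 * m) * (1 + L) powr s"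
  have C: "0 \<le> C1" "0 \<le> C2" using \<kappa> by (auto simp: C1_def C2_def)
  show ?thesis
  proof (intro exI[of _ "C1 + C2"] conjI allI impI)
    show "0 \<le> C1 + C2" using C by simp
    fix \<xi> h :: 'a assume "h \<noteq> 0"
    then have h: "0 < norm h" by simp
    define u where "u = norm \<xi> / norm h"
    have u: "0 \<le> u" by (simp add: u_def)
    have xi: "norm \<xi> = u * norm h" using h by (simp add: u_def)
    have "norm ((rdiff h ^^ N) (heat_symbol m) \<xi>) \<le> (if L \<le> u then C1 else C2) * norm h powr (2 * m) * (1 + u) powr (- s)"
    proof (cases "L \<le> u")
      case True
      have u1: "1 \<le> u" using True L by linarith
      have far: "3 * real N * norm h \<le> \<kappa> * norm \<xi>"
      proof -
        have "3 * real N \<le> \<kappa> * u" using True \<kappa>(1) unfolding L_def by (simp add: field_simps)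
        then have "3 * real N * norm h \<le> (\<kappa> * u) * norm h" using h by (intro mult_right_mono) auto
        then show ?thesis by (simp add: xi mult_ac)
      qed
      have "norm ((rdiff h ^^ N) (heat_symbol m) \<xi>)
         \<le> 3 * norm \<xi> powr (2 * m) * (12 * real N * norm h / (\<kappa> * norm \<xi>)) ^ N"
        by (rule heat_symbol_far[OF m \<kappa> N0 h far])
      also have "\<dots> = 3 * (u powr (2 * m) * norm h powr (2 * m)) * ((12 * real N / \<kappa>) ^ N * u powr (- real N))"
      proof -
        have "12 * real N * norm h / (\<kappa> * norm \<xi>) = (12 * real N / \<kappa>) * (1 / u)"
          using h by (simp add: xi)
        moreover have "(1 / u) ^ N = u powr (- real N)"
          using u1 by (simp add: powr_minus powr_realpow power_one_over inverse_eq_divide)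
        moreover have "norm \<xi> powr (2 * m) = u powr (2 * m) * norm h powr (2 * m)"
          unfolding xi using u h by (simp add: powr_mult)
        ultimately show ?thesis by (simp only: power_mult_distrib)
      qed
      also have "\<dots> = 3 * (12 * real N / \<kappa>) ^ N * norm h powr (2 * m) * (u powr (2 * m) * u powr (- real N))"
        by (simp only: mult_ac)
      also have "u powr (2 * m) * u powr (- real N) = u powr (- s)" by (simp add: s_def flip: powr_add)
      also have "3 * (12 * real N / \<kappa>) ^ N * norm h powr (2 * m) * u powr (- s)
        \<le> 3 * (12 * real N / \<kappa>) ^ N * norm h powr (2 * m) * (2 powr s * (1 + u) powr (- s))"
      proof (rule mult_left_mono)
        have "u powr (- s) \<le> ((1 + u) / 2) powr (- s)" using u1 s by (intro powr_mono2') auto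
        also have "\<dots> = 2 powr s * (1 + u) powr (- s)" using u by (simp add: powr_divide powr_minus field_simps)
        finally show "u powr (- s) \<le> 2 powr s * (1 + u) powr (- s)" .
      qed (use \<kappa> in auto)
      finally show ?thesis using True by (simp add: C1_def mult_ac)
    next
      case False
      define R where "R = (L + real N) * norm h"
      have "norm ((rdiff h ^^ N) (\<lambda>\<xi>. heat_symbol m \<xi> - 1) \<xi>) \<le> 2 ^ N * R powr (2 * m)"
      proof (rule rdiff_local_bound[where R = R])
        fix \<eta> :: 'a assume "norm \<eta> \<le> R"
        then have "norm \<eta> powr (2 * m) \<le> R powr (2 * m)" using m by (intro powr_mono2) auto
        then show "norm (heat_symbol m \<eta> - 1) \<le> R powr (2 * m)" using heat_symbol_small[of m \<eta>] by linarith
      next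
        show "norm \<xi> + real N * norm h \<le> R" using False h by (simp add: R_def xi algebra_simps)
      qed
      also have "(rdiff h ^^ N) (\<lambda>\<xi>. heat_symbol m \<xi> - 1) = (rdiff h ^^ N) (heat_symbol m)"
        by (rule rdiff_minus_const[OF N0])
      also have "2 ^ N * R powr (2 * m) = 2 ^ N * (L + real N) powr (2 * m) * norm h powr (2 * m) * 1"
        unfolding R_def using L by (simp add: powr_mult)
      also have "\<dots> \<le> 2 ^ N * (L + real N) powr (2 * m) * norm h powr (2 * m) * ((1 + L) powr s * (1 + u) powr (- s))"
      proof (rule mult_left_mono)
        have "(1 + L) powr (- s) \<le> (1 + u) powr (- s)" using False u s L by (intro powr_mono2') auto
        then have "(1 + L) powr s * (1 + L) powr (- s) \<le> (1 + L) powr s * (1 + u) powr (- s)" by (rule mult_left_mono) simp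
        moreover have "(1 + L) powr s * (1 + L) powr (- s) = 1" using L by (simp flip: powr_add)
        ultimately show "1 \<le> (1 + L) powr s * (1 + u) powr (- s)" by simp
      qed simp
      finally show ?thesis using False by (simp add: C2_def mult_ac)
    qed
    also have "\<dots> \<le> (C1 + C2) * norm h powr (2 * m) * (1 + u) powr (- s)"
      using C by (intro mult_right_mono) auto
    finally show "norm ((rdiff h ^^ N) (heat_symbol m) \<xi>) \<le> (C1 + C2) * norm h powr (2 * m) * (1 + norm \<xi> / norm h) powr (- (real N - 2 * m))"
      by (simp add: u_def s_def)
  qed
qed

section \<open>Decay and mass of the heat kernel\<close>

text \<open>
  The inverse transform without its factor \<open>(2\<pi>)^(-n)\<close>.
\<close>

definition fourier :: "('a::euclidean_space \<Rightarrow> complex) \<Rightarrow> 'a \<Rightarrow> complex" where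
  "fourier f x = (\<integral>\<xi>. exp (\<i> * complex_of_real (x \<bullet> \<xi>)) * f \<xi> \<partial>lborel)"

lemma fourier_integrand:
  assumes f: "integrable lborel f"
  shows "integrable lborel (\<lambda>\<xi>. exp (\<i> * complex_of_real (x \<bullet> \<xi>)) * f \<xi>)"
proof (rule Bochner_Integration.integrable_bound[OF f])
  note [measurable] = borel_measurable_integrable[OF f]
  show "(\<lambda>\<xi>. exp (\<i> * complex_of_real (x \<bullet> \<xi>)) * f \<xi>) \<in> borel_measurable lborel" by measurable
qed (simp add: norm_mult)

lemma fourier_norm_le:
  assumes f: "integrable lborel f"
  shows "norm (fourier f x) \<le> (\<integral>\<xi>. norm (f \<xi>) \<partial>lborel)"
proof -
  have "norm (fourier f x) \<le> (\<integral>\<xi>. norm (exp (\<i> * complex_of_real (x \<bullet> \<xi>)) * f \<xi>) \<partial>lborel)"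
    unfolding fourier_def by (rule integral_norm_bound)
  then show ?thesis by (simp add: norm_mult)
qed

lemma fourier_continuous:
  assumes f: "integrable lborel f"
  shows "continuous_on UNIV (fourier f)"
  unfolding continuous_on_sequentially
proof (intro allI ballI impI, elim conjE)
  fix X :: "nat \<Rightarrow> 'a" and x assume X: "X \<longlonglongrightarrow> x"
  note [measurable] = borel_measurable_integrable[OF f]
  show "(fourier f \<circ> X) \<longlonglongrightarrow> fourier f x"
    unfolding fourier_def o_def
  proof (rule integral_dominated_convergence[where w = "\<lambda>\<xi>. norm (f \<xi>)"])
    show "AE \<xi> in lborel. (\<lambda>i. exp (\<i> * complex_of_real (X i \<bullet> \<xi>)) * f \<xi>) \<longlonglongrightarrow> exp (\<i> * complex_of_real (x \<bullet> \<xi>)) * f \<xi>"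
      by (intro AE_I2 tendsto_intros X)
  qed (use f in \<open>auto simp: norm_mult\<close>)
qed

lemma fourier_measurable [measurable]:
  assumes [measurable]: "f \<in> borel_measurable borel"
  shows "fourier f \<in> borel_measurable borel"
  unfolding fourier_def by measurable

lemma rdiff_integrable:
  assumes f: "integrable lborel f"
  shows "integrable lborel (rdiff h f)"
proof -
  have fm: "f \<in> borel_measurable borel" using borel_measurable_integrable[OF f] by simp
  have "integrable lborel (\<lambda>\<xi>. f (h + 1 *\<^sub>R \<xi>))"
    using f lborel_integrable_affine_iff[OF fm, of 1 h] by simp
  then show ?thesis unfolding rdiff_def[abs_def] using f by (simp add: add.commute)
qed

text \<open>
  Translation by \<open>h\<close> multiplies the transform by a phase, which equals \<open>-1\<close> when \<open>x \<bullet> h = \<pi>\<close>.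
\<close>

lemma fourier_rdiff:
  assumes f: "integrable lborel f" and h: "x \<bullet> h = pi"
  shows "fourier (rdiff h f) x = 2 * fourier f x"
proof -
  have fm[measurable]: "f \<in> borel_measurable borel" using borel_measurable_integrable[OF f] by simp
  define F where "F \<xi> = exp (\<i> * complex_of_real (x \<bullet> (\<xi> - h))) * f \<xi>" for \<xi>
  have Fm[measurable]: "F \<in> borel_measurable borel" unfolding F_def by measurable
  have F: "F \<xi> = - (exp (\<i> * complex_of_real (x \<bullet> \<xi>)) * f \<xi>)" for \<xi>
  proof -
    have "\<i> * complex_of_real (x \<bullet> (\<xi> - h)) = \<i> * complex_of_real (x \<bullet> \<xi>) - \<i> * complex_of_real pi"
      by (simp add: inner_diff_right h algebra_simps)
    then show ?thesis unfolding F_def by (simp add: exp_diff mult.commute)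
  qed
  have sh: "F (h + 1 *\<^sub>R \<xi>) = exp (\<i> * complex_of_real (x \<bullet> \<xi>)) * f (\<xi> + h)" for \<xi>
    unfolding F_def by (simp add: add.commute)
  have Fi: "integrable lborel F" using fourier_integrand[OF f, of x] unfolding F by simp
  have i2: "integrable lborel (\<lambda>\<xi>. exp (\<i> * complex_of_real (x \<bullet> \<xi>)) * f (\<xi> + h))"
    using Fi lborel_integrable_affine_iff[OF Fm, of 1 h] unfolding sh by simp
  have "(\<integral>\<xi>. exp (\<i> * complex_of_real (x \<bullet> \<xi>)) * f (\<xi> + h) \<partial>lborel) = (\<integral>\<xi>. F \<xi> \<partial>lborel)"
    using lborel_integral_affine[OF Fm, of 1 h] unfolding sh by simp
  also have "\<dots> = - fourier f x" unfolding F fourier_def by simp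
  finally have "fourier (rdiff h f) x = fourier f x - (- fourier f x)"
    unfolding fourier_def rdiff_def using i2 fourier_integrand[OF f, of x] by (simp add: right_diff_distrib)
  then show ?thesis by simp
qed

lemma fourier_rdiff_power:
  assumes f: "integrable lborel f" and h: "x \<bullet> h = pi"
  shows "integrable lborel ((rdiff h ^^ N) f) \<and> fourier ((rdiff h ^^ N) f) x = 2 ^ N * fourier f x"
proof (induction N)
  case (Suc N)
  then show ?case using rdiff_integrable[of "(rdiff h ^^ N) f" h] fourier_rdiff[of "(rdiff h ^^ N) f" x h] h by simp
qed (use f in simp)

lemma heat_symbol_integrable:
  assumes m: "0 < m"
  shows "integrable lborel (heat_symbol m :: 'a::euclidean_space \<Rightarrow> complex)"
  using integrable_exp_norm_powr[OF m zero_less_one, where 'a = 'a]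
  unfolding heat_symbol_def[abs_def] by (simp add: complex_of_real_integrable_eq)

text \<open>
  Take \<open>h\<close> parallel to \<open>x\<close> with \<open>x \<bullet> h = \<pi>\<close>. Then \<open>2\<^sup>N\<close> times the transform is the transform of
  the \<open>N\<close>-th difference, hence at most its \<open>L\<^sup>1\<close> norm; by \<open>rdiff_heat_symbol_bound\<close> and scaling this
  is of order \<open>|h|^(n+2m)\<close>, and \<open>|h| = \<pi> / |x|\<close>. Finite differences take the place of integration by
  parts, because for \<open>m \<notin> \<nat>\<close> the symbol is not smooth at 0 and the exponent is fractional.
\<close>

lemma fourier_heat_decay:
  assumes m: "0 < m"
  shows "\<exists>C\<ge>0. \<forall>x::'a::euclidean_space. x \<noteq> 0 \<longrightarrow>
     norm (fourier (heat_symbol m) x) \<le> C * norm x powr (- (real DIM('a) + 2 * m))"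
proof -
  define n where "n = real DIM('a)"
  \<comment> \<open>This many differences make the weight \<open>(1 + |\<xi>| / |h|)^(2m - N)\<close> integrable.\<close>
  obtain N :: nat where N: "n + 2 * m < real N" using reals_Archimedean2 by blast
  have n0: "0 < n" by (simp add: n_def)
  have N2: "2 * m < real N" using N n0 by linarith
  obtain C where C: "0 \<le> C" "\<And>(\<xi>::'a) h. h \<noteq> 0 \<Longrightarrow>
    norm ((rdiff h ^^ N) (heat_symbol m) \<xi>) \<le> C * norm h powr (2 * m) * (1 + norm \<xi> / norm h) powr (- (real N - 2 * m))"
    using rdiff_heat_symbol_bound[OF m N2] by blast
  define w where "w = (\<lambda>\<xi>::'a. (1 + norm \<xi>) powr (- (real N - 2 * m)))"
  have wm[measurable]: "w \<in> borel_measurable borel" unfolding w_def by measurable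
  have wi: "integrable lborel w" unfolding w_def by (rule integrable_decay) (use N in \<open>simp add: n_def\<close>)
  define J where "J = (\<integral>\<xi>. w \<xi> \<partial>lborel)"
  have J: "0 \<le> J" unfolding J_def by (rule Bochner_Integration.integral_nonneg) (simp add: w_def)
  have main: "norm (fourier (heat_symbol m) x) \<le> C * J * pi powr (n + 2 * m) * norm x powr (- (n + 2 * m))" if x: "x \<noteq> 0" for x :: 'a
  proof -
    define h where "h = (pi / (norm x)\<^sup>2) *\<^sub>R x"
    have xh: "x \<bullet> h = pi" using x by (simp add: h_def power2_norm_eq_inner)
    have nh: "norm h = pi / norm x" using x by (simp add: h_def power2_eq_square)
    have hp: "0 < norm h" "h \<noteq> 0" using x by (auto simp: nh) (use x in \<open>simp add: h_def\<close>)
    note fr = fourier_rdiff_power[OF heat_symbol_integrable[OF m] xh, of N]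
    have wh: "integrable lborel (\<lambda>\<xi>. w ((1 / norm h) *\<^sub>R \<xi>))"
      using lborel_integrable_affine_iff[OF wm, of "1 / norm h" 0] wi hp by simp
    have "2 ^ N * norm (fourier (heat_symbol m) x) = norm (fourier ((rdiff h ^^ N) (heat_symbol m)) x)"
      using fr by (simp add: norm_mult norm_power)
    also have "\<dots> \<le> (\<integral>\<xi>. norm ((rdiff h ^^ N) (heat_symbol m) \<xi>) \<partial>lborel)"
      using fr by (intro fourier_norm_le) simp
    also have "\<dots> \<le> (\<integral>\<xi>. C * norm h powr (2 * m) * w ((1 / norm h) *\<^sub>R \<xi>) \<partial>lborel)"
    proof (rule integral_mono)
      show "integrable lborel (\<lambda>\<xi>. norm ((rdiff h ^^ N) (heat_symbol m) \<xi>))" using fr by simp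
      show "integrable lborel (\<lambda>\<xi>. C * norm h powr (2 * m) * w ((1 / norm h) *\<^sub>R \<xi>))" using wh by simp
      show "norm ((rdiff h ^^ N) (heat_symbol m) \<xi>) \<le> C * norm h powr (2 * m) * w ((1 / norm h) *\<^sub>R \<xi>)" for \<xi>
        using C(2)[OF hp(2), of \<xi>] by (simp add: w_def)
    qed
    also have "\<dots> = C * norm h powr (2 * m) * (\<integral>\<xi>. w ((1 / norm h) *\<^sub>R \<xi>) \<partial>lborel)" by simp
    also have "(\<integral>\<xi>. w ((1 / norm h) *\<^sub>R \<xi>) \<partial>lborel) = norm h ^ DIM('a) * J"
    proof -
      have "J = \<bar>1 / norm h\<bar> ^ DIM('a) *\<^sub>R (\<integral>\<xi>. w (0 + (1 / norm h) *\<^sub>R \<xi>) \<partial>lborel)"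
        unfolding J_def by (rule lborel_integral_affine[OF wm]) (use hp in simp)
      then show ?thesis using hp by (simp add: power_divide)
    qed
    also have "C * norm h powr (2 * m) * (norm h ^ DIM('a) * J) = C * J * (norm h powr (2 * m) * norm h powr n)"
      using hp by (simp add: n_def powr_realpow)
    also have "norm h powr (2 * m) * norm h powr n = norm h powr (n + 2 * m)" by (simp add: add.commute flip: powr_add)
    also have "\<dots> = pi powr (n + 2 * m) * norm x powr (- (n + 2 * m))"
    proof -
      have "(pi / z) powr e = pi powr e * z powr (- e)" if "0 < z" for z e :: real
        using that by (simp add: powr_divide powr_minus_divide)
      then show ?thesis unfolding nh using x by simp
    qed
    finally have le: "2 ^ N * norm (fourier (heat_symbol m) x) \<le> C * J * (pi powr (n + 2 * m) * norm x powr (- (n + 2 * m)))" .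
    have "1 * norm (fourier (heat_symbol m) x) \<le> 2 ^ N * norm (fourier (heat_symbol m) x)"
      by (intro mult_right_mono) auto
    then show ?thesis using le by (simp add: mult_ac)
  qed
  show ?thesis
    by (rule exI[of _ "C * J * pi powr (n + 2 * m)"]) (use C(1) J main in \<open>auto simp: n_def\<close>)
qed

lemma fourier_heat_integrable:
  assumes m: "0 < m"
  shows "integrable lborel (fourier (heat_symbol m) :: 'a::euclidean_space \<Rightarrow> complex)"
proof -
  define s where "s = real DIM('a) + 2 * m"
  have s: "0 < s" using m by (simp add: s_def add_nonneg_pos)
  obtain C where C: "0 \<le> C" "\<And>x::'a. x \<noteq> 0 \<Longrightarrow> norm (fourier (heat_symbol m) x) \<le> C * norm x powr (- s)"
    using fourier_heat_decay[OF m, where 'a = 'a] unfolding s_def by blast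
  define A where "A = (\<integral>\<xi>. norm (heat_symbol m (\<xi>::'a)) \<partial>lborel)"
  have A: "0 \<le> A" "norm (fourier (heat_symbol m) x) \<le> A" for x :: 'a
    unfolding A_def using fourier_norm_le[OF heat_symbol_integrable[OF m], of x] by (auto intro: Bochner_Integration.integral_nonneg)
  have [measurable]: "(heat_symbol m :: 'a \<Rightarrow> complex) \<in> borel_measurable borel"
    using borel_measurable_integrable[OF heat_symbol_integrable[OF m, where 'a = 'a]] by simp
  show ?thesis
  proof (rule Bochner_Integration.integrable_bound)
    show "integrable lborel (\<lambda>x::'a. ((A + C) * 2 powr s) * (1 + norm x) powr (- s))"
      by (rule integrable_mult_right) (rule integrable_decay, use m in \<open>simp add: s_def\<close>)
    show "AE x::'a in lborel. norm (fourier (heat_symbol m) x) \<le> norm (((A + C) * 2 powr s) * (1 + norm x) powr (- s))"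
    proof (rule AE_I2)
      fix x :: 'a
      have "norm (fourier (heat_symbol m) x) \<le> (A + C) * (2 powr s * (1 + norm x) powr (- s))"
      proof (cases "1 \<le> norm x")
        case True
        have "norm x powr (- s) \<le> ((1 + norm x) / 2) powr (- s)" using True s by (intro powr_mono2') auto
        also have "\<dots> = 2 powr s * (1 + norm x) powr (- s)"
          by (subst powr_divide) (auto simp: powr_minus field_simps)
        finally have "C * norm x powr (- s) \<le> (A + C) * (2 powr s * (1 + norm x) powr (- s))"
          using A(1) C(1) by (intro mult_mono) auto
        moreover have "x \<noteq> 0" using True by auto
        ultimately show ?thesis using C(2)[of x] by linarith
      next
        case False
        have "2 powr (- s) \<le> (1 + norm x) powr (- s)" using False s by (intro powr_mono2') (auto simp: add_pos_nonneg)
        then have "2 powr s * 2 powr (- s) \<le> 2 powr s * (1 + norm x) powr (- s)" by (rule mult_left_mono) simp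
        moreover have "2 powr s * 2 powr (- s) = (1::real)" by (simp flip: powr_add)
        ultimately have "(A + C) * 1 \<le> (A + C) * (2 powr s * (1 + norm x) powr (- s))"
          using A(1) C(1) by (intro mult_left_mono) auto
        moreover have "norm (fourier (heat_symbol m) x) \<le> (A + C) * 1" using A(2)[of x] C(1) by simp
        ultimately show ?thesis by (rule order_trans[rotated])
      qed
      then show "norm (fourier (heat_symbol m) x) \<le> norm (((A + C) * 2 powr s) * (1 + norm x) powr (- s))"
        using A(1) C(1) by (simp add: abs_mult mult.assoc)
    qed
  qed measurable
qed

lemma gaussian_integrable_real: "integrable lborel (\<lambda>s::real. exp (- s\<^sup>2 / 2))"
proof -
  have "integrable lborel (\<lambda>s. sqrt (2 * pi) * std_normal_density s)"
    using integrable_normal_density[of 1 0] by (intro integrable_mult_right) auto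
  then show ?thesis by (simp add: std_normal_density_def)
qed

lemma gaussian_fourier_real:
  "(\<integral>s. exp (\<i> * complex_of_real (t * s)) * complex_of_real (exp (- s\<^sup>2 / 2)) \<partial>lborel)
     = complex_of_real (sqrt (2 * pi) * exp (- t\<^sup>2 / 2))"
proof -
  have "complex_of_real (exp (- t\<^sup>2 / 2)) = char std_normal_distribution t"
    by (simp add: char_std_normal_distribution)
  also have "\<dots> = (\<integral>s. std_normal_density s *\<^sub>R exp (\<i> * complex_of_real (t * s)) \<partial>lborel)"
    unfolding char_def by (subst integral_density) auto
  also have "\<dots> = (\<integral>s. complex_of_real (1 / sqrt (2 * pi)) * (exp (\<i> * complex_of_real (t * s)) * complex_of_real (exp (- s\<^sup>2 / 2))) \<partial>lborel)"
    by (rule Bochner_Integration.integral_cong) (auto simp: std_normal_density_def scaleR_conv_of_real)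
  also have "\<dots> = complex_of_real (1 / sqrt (2 * pi)) * (\<integral>s. exp (\<i> * complex_of_real (t * s)) * complex_of_real (exp (- s\<^sup>2 / 2)) \<partial>lborel)"
    by simp
  finally show ?thesis by (simp add: field_simps)
qed

text \<open>
  The integrand is a product over the coordinates, and in one dimension this is the characteristic
  function of the standard normal distribution.
\<close>

lemma gaussian_fourier:
  fixes \<eta> :: "'a::euclidean_space"
  shows "(\<integral>y. exp (\<i> * complex_of_real (\<eta> \<bullet> y)) * complex_of_real (exp (- (norm y)\<^sup>2 / 2)) \<partial>lborel)
     = complex_of_real (sqrt (2 * pi) ^ DIM('a) * exp (- (norm \<eta>)\<^sup>2 / 2))"
    and gaussian_integrable: "integrable lborel (\<lambda>y::'a. exp (- (norm y)\<^sup>2 / 2))"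
proof -
  interpret product_sigma_finite "\<lambda>_::'a. lborel :: real measure" by unfold_locales
  define E where "E = (\<lambda>f::'a \<Rightarrow> real. \<Sum>b\<in>Basis. f b *\<^sub>R b)"
  have Em: "E \<in> measurable (\<Pi>\<^sub>M b\<in>Basis. lborel) borel" unfolding E_def by measurable
  have lb: "(lborel :: 'a measure) = distr (\<Pi>\<^sub>M b\<in>Basis. lborel) borel E" unfolding E_def by (rule lborel_eq)
  have ip: "v \<bullet> E f = (\<Sum>b\<in>Basis. (v \<bullet> b) * f b)" for v f
    unfolding E_def by (simp add: inner_sum_right mult.commute)
  have Eb: "E f \<bullet> b = f b" if "b \<in> Basis" for f b
    using that unfolding E_def by (simp add: inner_sum_left inner_Basis if_distrib cong: if_cong)
  have nm: "(norm v)\<^sup>2 = (\<Sum>b\<in>Basis. (v \<bullet> b)\<^sup>2)" for v :: 'a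
    unfolding power2_norm_eq_inner by (subst euclidean_inner) (simp add: power2_eq_square)
  define \<gamma> where "\<gamma> t s = exp (\<i> * complex_of_real (t * s)) * complex_of_real (exp (- s\<^sup>2 / 2))" for t s :: real
  have \<gamma>i: "integrable lborel (\<gamma> t)" for t
  proof (rule Bochner_Integration.integrable_bound[OF gaussian_integrable_real])
    show "\<gamma> t \<in> borel_measurable lborel" unfolding \<gamma>_def by measurable
  qed (simp add: \<gamma>_def norm_mult)
  have prod: "exp (\<i> * complex_of_real (\<eta> \<bullet> E f)) * complex_of_real (exp (- (norm (E f))\<^sup>2 / 2)) = (\<Prod>b\<in>Basis. \<gamma> (\<eta> \<bullet> b) (f b))" for f \<eta>
  proof -
    have "(\<Prod>b\<in>Basis. \<gamma> (\<eta> \<bullet> b) (f b)) = (\<Prod>b\<in>Basis. exp (\<i> * complex_of_real ((\<eta> \<bullet> b) * f b))) * complex_of_real (\<Prod>b\<in>Basis. exp (- (f b)\<^sup>2 / 2))"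
      unfolding \<gamma>_def by (simp add: prod.distrib)
    also have "(\<Prod>b\<in>Basis. exp (\<i> * complex_of_real ((\<eta> \<bullet> b) * f b))) = exp (\<i> * complex_of_real (\<eta> \<bullet> E f))"
      unfolding ip by (subst exp_sum[symmetric]) (auto simp: sum_distrib_left)
    also have "(\<Prod>b\<in>Basis. exp (- (f b)\<^sup>2 / 2)) = exp (- (norm (E f))\<^sup>2 / 2)"
      unfolding nm by (subst exp_sum[symmetric]) (auto simp: Eb sum_negf sum_divide_distrib)
    finally show ?thesis by simp
  qed
  have meas: "(\<lambda>y::'a. exp (\<i> * complex_of_real (\<eta> \<bullet> y)) * complex_of_real (exp (- (norm y)\<^sup>2 / 2))) \<in> borel_measurable borel" for \<eta>
    by measurable
  have "(\<integral>y. exp (\<i> * complex_of_real (\<eta> \<bullet> y)) * complex_of_real (exp (- (norm y)\<^sup>2 / 2)) \<partial>lborel)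
     = (\<integral>f. (\<Prod>b\<in>Basis. \<gamma> (\<eta> \<bullet> b) (f b)) \<partial>(\<Pi>\<^sub>M b\<in>Basis. lborel))"
    by (subst lb, subst integral_distr[OF Em meas]) (simp only: prod)
  also have "\<dots> = (\<Prod>b\<in>Basis. \<integral>s. \<gamma> (\<eta> \<bullet> b) s \<partial>lborel)"
    by (rule product_integral_prod) (auto intro: \<gamma>i)
  also have "\<dots> = (\<Prod>b\<in>(Basis::'a set). complex_of_real (sqrt (2 * pi) * exp (- (\<eta> \<bullet> b)\<^sup>2 / 2)))"
    unfolding \<gamma>_def gaussian_fourier_real ..
  also have "\<dots> = complex_of_real (sqrt (2 * pi) ^ DIM('a) * (\<Prod>b\<in>Basis. exp (- (\<eta> \<bullet> b)\<^sup>2 / 2)))"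
    by (simp add: prod.distrib)
  also have "(\<Prod>b\<in>Basis. exp (- (\<eta> \<bullet> b)\<^sup>2 / 2)) = exp (- (norm \<eta>)\<^sup>2 / 2)"
    unfolding nm by (subst exp_sum[symmetric]) (auto simp: sum_negf sum_divide_distrib)
  finally show "(\<integral>y. exp (\<i> * complex_of_real (\<eta> \<bullet> y)) * complex_of_real (exp (- (norm y)\<^sup>2 / 2)) \<partial>lborel)
     = complex_of_real (sqrt (2 * pi) ^ DIM('a) * exp (- (norm \<eta>)\<^sup>2 / 2))" .
  have "integrable (\<Pi>\<^sub>M b\<in>Basis. lborel) (\<lambda>f. \<Prod>b\<in>(Basis::'a set). \<gamma> (0 \<bullet> b) (f b))"
    by (rule product_integrable_prod) (auto intro: \<gamma>i)
  then have "integrable lborel (\<lambda>y::'a. exp (\<i> * complex_of_real (0 \<bullet> y)) * complex_of_real (exp (- (norm y)\<^sup>2 / 2)))"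
    by (subst lb, subst integrable_distr_eq[OF Em meas]) (simp only: prod)
  then show "integrable lborel (\<lambda>y::'a. exp (- (norm y)\<^sup>2 / 2))"
    by (simp add: complex_of_real_integrable_eq)
qed

text \<open>
  Fourier inversion at the origin. With a Gaussian factor \<open>\<gamma> (e x)\<close> inserted, Fubini turns the
  integral into an average of the symbol near 0, and the symbol is continuous with value 1 there;
  then let \<open>e \<rightarrow> 0\<close> on both sides.
\<close>

lemma fourier_heat_mass:
  assumes m: "0 < m"
  shows "(\<integral>x. fourier (heat_symbol m) (x::'a::euclidean_space) \<partial>lborel) = complex_of_real ((2 * pi) ^ DIM('a))"
proof -
  let ?G = "sqrt (2 * pi) ^ DIM('a)"
  define \<Phi> where "\<Phi> = (fourier (heat_symbol m) :: 'a \<Rightarrow> complex)"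
  have \<Phi>i: "integrable lborel \<Phi>" unfolding \<Phi>_def by (rule fourier_heat_integrable[OF m])
  have symi: "integrable lborel (heat_symbol m :: 'a \<Rightarrow> complex)" by (rule heat_symbol_integrable[OF m])
  have sm[measurable]: "(heat_symbol m :: 'a \<Rightarrow> complex) \<in> borel_measurable borel"
    using borel_measurable_integrable[OF symi] by simp
  have \<Phi>m[measurable]: "\<Phi> \<in> borel_measurable borel" unfolding \<Phi>_def by measurable
  define \<gamma> where "\<gamma> (x::'a) = exp (- (norm x)\<^sup>2 / 2)" for x
  have \<gamma>m[measurable]: "\<gamma> \<in> borel_measurable borel" unfolding \<gamma>_def by measurable
  have \<gamma>i: "integrable lborel \<gamma>" unfolding \<gamma>_def by (rule gaussian_integrable)
  have key: "(\<integral>x. \<Phi> x * complex_of_real (\<gamma> (e *\<^sub>R x)) \<partial>lborel) = ?G * (\<integral>\<eta>. heat_symbol m (e *\<^sub>R \<eta>) * complex_of_real (\<gamma> \<eta>) \<partial>lborel)"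
    if e: "0 < e" for e :: real
  proof -
    have \<gamma>e: "integrable lborel (\<lambda>x. \<gamma> (e *\<^sub>R x))"
      using lborel_integrable_affine_iff[OF \<gamma>m, of e 0] \<gamma>i e by simp
    define K where "K = (\<lambda>(x::'a, \<xi>::'a). exp (\<i> * complex_of_real (x \<bullet> \<xi>)) * heat_symbol m \<xi> * complex_of_real (\<gamma> (e *\<^sub>R x)))"
    have Km[measurable]: "K \<in> borel_measurable (lborel \<Otimes>\<^sub>M lborel)" unfolding K_def by measurable
    have Ki: "integrable (lborel \<Otimes>\<^sub>M lborel) K"
    proof (rule lborel_pair.Fubini_integrable[OF Km])
      have "(\<lambda>x. \<integral>y. norm (K (x, y)) \<partial>lborel) = (\<lambda>x. (\<integral>\<xi>. norm (heat_symbol m (\<xi>::'a)) \<partial>lborel) * \<gamma> (e *\<^sub>R x))"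
        by (rule ext) (simp add: K_def norm_mult \<gamma>_def)
      then show "integrable lborel (\<lambda>x. \<integral>y. norm (K (x, y)) \<partial>lborel)" using \<gamma>e by simp
      show "AE x in lborel. integrable lborel (\<lambda>y. K (x, y))"
        unfolding K_def using fourier_integrand[OF symi] by (intro AE_I2) simp
    qed
    have "(\<integral>x. \<Phi> x * complex_of_real (\<gamma> (e *\<^sub>R x)) \<partial>lborel) = (\<integral>x. (\<integral>\<xi>. K (x, \<xi>) \<partial>lborel) \<partial>lborel)"
      unfolding \<Phi>_def fourier_def K_def by simp
    also have "\<dots> = (\<integral>\<xi>. (\<integral>x. K (x, \<xi>) \<partial>lborel) \<partial>lborel)"
      by (rule lborel_pair.Fubini_integral[symmetric]) (use Ki in simp)
    also have "\<dots> = (\<integral>\<xi>. heat_symbol m \<xi> * complex_of_real (?G * (1 / e) ^ DIM('a) * \<gamma> ((1 / e) *\<^sub>R \<xi>)) \<partial>lborel)"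
    proof (rule Bochner_Integration.integral_cong[OF refl])
      fix \<xi> :: 'a
      have "(\<integral>x. K (x, \<xi>) \<partial>lborel) = heat_symbol m \<xi> * (\<integral>x. exp (\<i> * complex_of_real (x \<bullet> \<xi>)) * complex_of_real (\<gamma> (e *\<^sub>R x)) \<partial>lborel)"
        unfolding K_def by (simp add: mult_ac)
      also have "(\<integral>x. exp (\<i> * complex_of_real (x \<bullet> \<xi>)) * complex_of_real (\<gamma> (e *\<^sub>R x)) \<partial>lborel)
         = \<bar>1 / e\<bar> ^ DIM('a) *\<^sub>R (\<integral>x. exp (\<i> * complex_of_real ((0 + (1 / e) *\<^sub>R x) \<bullet> \<xi>)) * complex_of_real (\<gamma> (e *\<^sub>R (0 + (1 / e) *\<^sub>R x))) \<partial>lborel)"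
        by (rule lborel_integral_affine) (use e in auto)
      also have "(\<integral>x. exp (\<i> * complex_of_real ((0 + (1 / e) *\<^sub>R x) \<bullet> \<xi>)) * complex_of_real (\<gamma> (e *\<^sub>R (0 + (1 / e) *\<^sub>R x))) \<partial>lborel)
         = (\<integral>x. exp (\<i> * complex_of_real (((1 / e) *\<^sub>R \<xi>) \<bullet> x)) * complex_of_real (exp (- (norm x)\<^sup>2 / 2)) \<partial>lborel)"
        using e by (simp add: \<gamma>_def inner_commute)
      also have "\<dots> = complex_of_real (?G * \<gamma> ((1 / e) *\<^sub>R \<xi>))"
        unfolding gaussian_fourier(1) by (simp add: \<gamma>_def)
      finally show "(\<integral>x. K (x, \<xi>) \<partial>lborel) = heat_symbol m \<xi> * complex_of_real (?G * (1 / e) ^ DIM('a) * \<gamma> ((1 / e) *\<^sub>R \<xi>))"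
        using e by (simp add: scaleR_conv_of_real mult_ac)
    qed
    also have "\<dots> = \<bar>e\<bar> ^ DIM('a) *\<^sub>R (\<integral>\<eta>. heat_symbol m (0 + e *\<^sub>R \<eta>) * complex_of_real (?G * (1 / e) ^ DIM('a) * \<gamma> ((1 / e) *\<^sub>R (0 + e *\<^sub>R \<eta>))) \<partial>lborel)"
      by (rule lborel_integral_affine) (use e in auto)
    also have "\<dots> = \<bar>e\<bar> ^ DIM('a) *\<^sub>R (\<integral>\<eta>. complex_of_real (?G * (1 / e) ^ DIM('a)) * (heat_symbol m (e *\<^sub>R \<eta>) * complex_of_real (\<gamma> \<eta>)) \<partial>lborel)"
      using e by (simp add: mult_ac)
    also have "\<dots> = \<bar>e\<bar> ^ DIM('a) *\<^sub>R (complex_of_real (?G * (1 / e) ^ DIM('a)) * (\<integral>\<eta>. heat_symbol m (e *\<^sub>R \<eta>) * complex_of_real (\<gamma> \<eta>) \<partial>lborel))"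
      by (simp only: integral_mult_right_zero)
    also have "\<dots> = (complex_of_real (e ^ DIM('a) * (1 / e) ^ DIM('a)) * ?G) * (\<integral>\<eta>. heat_symbol m (e *\<^sub>R \<eta>) * complex_of_real (\<gamma> \<eta>) \<partial>lborel)"
      using e by (simp add: scaleR_conv_of_real mult_ac)
    also have "e ^ DIM('a) * (1 / e) ^ DIM('a) = 1" using e by (simp flip: power_mult_distrib)
    finally show ?thesis by simp
  qed
  define e where "e k = 1 / real (Suc k)" for k
  have e: "0 < e k" for k by (simp add: e_def)
  have elim: "e \<longlonglongrightarrow> 0" unfolding e_def using LIMSEQ_Suc[OF lim_1_over_n] by simp
  have "isCont \<gamma> 0" unfolding \<gamma>_def by (intro continuous_intros) auto
  have l1: "(\<lambda>k. \<integral>x. \<Phi> x * complex_of_real (\<gamma> (e k *\<^sub>R x)) \<partial>lborel) \<longlonglongrightarrow> (\<integral>x. \<Phi> x \<partial>lborel)"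
  proof (rule integral_dominated_convergence[where w = "\<lambda>x. norm (\<Phi> x)"])
    show "AE x in lborel. (\<lambda>k. \<Phi> x * complex_of_real (\<gamma> (e k *\<^sub>R x))) \<longlonglongrightarrow> \<Phi> x"
    proof (rule AE_I2)
      fix x
      have "(\<lambda>k. \<Phi> x * complex_of_real (exp (- (norm (e k *\<^sub>R x))\<^sup>2 / 2))) \<longlonglongrightarrow> \<Phi> x * complex_of_real (exp (- (norm (0 *\<^sub>R x))\<^sup>2 / 2))"
        by (intro tendsto_intros elim) auto
      then show "(\<lambda>k. \<Phi> x * complex_of_real (\<gamma> (e k *\<^sub>R x))) \<longlonglongrightarrow> \<Phi> x" by (simp add: \<gamma>_def)
    qed
    show "AE x in lborel. norm (\<Phi> x * complex_of_real (\<gamma> (e k *\<^sub>R x))) \<le> norm (\<Phi> x)" for k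
      by (rule AE_I2) (simp add: norm_mult \<gamma>_def mult_left_le)
  qed (use \<Phi>i in auto)
  have l2: "(\<lambda>k. \<integral>\<eta>. heat_symbol m (e k *\<^sub>R \<eta>) * complex_of_real (\<gamma> \<eta>) \<partial>lborel) \<longlonglongrightarrow> (\<integral>\<eta>. complex_of_real (\<gamma> \<eta>) \<partial>lborel)"
  proof (rule integral_dominated_convergence[where w = "\<gamma>"])
    show "AE \<eta> in lborel. (\<lambda>k. heat_symbol m (e k *\<^sub>R \<eta>) * complex_of_real (\<gamma> \<eta>)) \<longlonglongrightarrow> complex_of_real (\<gamma> \<eta>)"
    proof (rule AE_I2)
      fix \<eta> :: 'a
      have "(\<lambda>k. norm (e k *\<^sub>R \<eta>)) \<longlonglongrightarrow> norm (0 *\<^sub>R \<eta>)" by (intro tendsto_intros elim)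
      then have "(\<lambda>k. norm (e k *\<^sub>R \<eta>) powr (2 * m)) \<longlonglongrightarrow> 0"
        by (intro tendsto_zero_powrI[OF _ tendsto_const]) (use m in auto)
      then have "(\<lambda>k. complex_of_real (exp (- (norm (e k *\<^sub>R \<eta>) powr (2 * m)))) * complex_of_real (\<gamma> \<eta>)) \<longlonglongrightarrow> complex_of_real (exp (- 0)) * complex_of_real (\<gamma> \<eta>)"
        by (intro tendsto_intros)
      then show "(\<lambda>k. heat_symbol m (e k *\<^sub>R \<eta>) * complex_of_real (\<gamma> \<eta>)) \<longlonglongrightarrow> complex_of_real (\<gamma> \<eta>)"
        by (simp add: heat_symbol_def)
    qed
    show "AE \<eta> in lborel. norm (heat_symbol m (e k *\<^sub>R \<eta>) * complex_of_real (\<gamma> \<eta>)) \<le> \<gamma> \<eta>" for k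
      by (rule AE_I2) (simp add: norm_mult heat_symbol_def \<gamma>_def mult_left_le_one_le)
  qed (use \<gamma>i in auto)
  have "(\<integral>\<eta>. complex_of_real (\<gamma> \<eta>) \<partial>lborel) = ?G"
    using gaussian_fourier(1)[of "0::'a"] by (simp add: \<gamma>_def)
  with l2 have "(\<lambda>k. ?G * (\<integral>\<eta>. heat_symbol m (e k *\<^sub>R \<eta>) * complex_of_real (\<gamma> \<eta>) \<partial>lborel)) \<longlonglongrightarrow> complex_of_real ?G * complex_of_real ?G"
    by (intro tendsto_mult tendsto_const) simp
  with l1 have "(\<integral>x. \<Phi> x \<partial>lborel) = complex_of_real ?G * complex_of_real ?G"
    unfolding key[OF e] by (rule LIMSEQ_unique)
  also have "\<dots> = complex_of_real ((sqrt (2 * pi) * sqrt (2 * pi)) ^ DIM('a))"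
    by (simp only: of_real_mult power_mult_distrib of_real_power)
  also have "sqrt (2 * pi) * sqrt (2 * pi) = 2 * pi" by simp
  finally show ?thesis by (simp add: \<Phi>_def)
qed

text \<open>
  The substitution \<open>\<xi> = t^(-1/2m) \<eta>\<close> removes \<open>t\<close> from the symbol.
\<close>

lemma heat_kernel_eq_fourier:
  fixes x :: "real^'n"
  assumes m: "0 < m" and t: "0 < t"
  shows "heat_kernel m t x = t powr (- (real CARD('n) / (2 * m)))
     * (Re (fourier (heat_symbol m) (t powr (- (1 / (2 * m))) *\<^sub>R x)) / (2 * pi) ^ CARD('n))"
proof -
  define c where "c = t powr (- (1 / (2 * m)))"
  have c: "0 < c" using t by (simp add: c_def)
  have cn: "c ^ CARD('n) = t powr (- (real CARD('n) / (2 * m)))"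
    using t by (simp add: c_def powr_powr flip: powr_realpow)
  have "c powr (2 * m) = t powr (- 1)" using m by (simp add: c_def powr_powr)
  then have cm: "t * c powr (2 * m) = 1" using t powr_minus_divide[of t 1] by simp
  define F where "F (\<xi>::real^'n) = exp (\<i> * complex_of_real (x \<bullet> \<xi>)) * complex_of_real (exp (- t * norm \<xi> powr (2 * m)))" for \<xi>
  have Fm: "F \<in> borel_measurable borel" unfolding F_def by measurable
  have "(\<integral>\<xi>. F \<xi> \<partial>lebesgue) = (\<integral>\<xi>. F \<xi> \<partial>lborel)"
    by (rule integral_completion) (use Fm in simp)
  also have "\<dots> = \<bar>c\<bar> ^ DIM(real^'n) *\<^sub>R (\<integral>\<xi>. F (0 + c *\<^sub>R \<xi>) \<partial>lborel)"
    by (rule lborel_integral_affine[OF Fm]) (use c in simp)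
  also have "(\<lambda>\<xi>. F (0 + c *\<^sub>R \<xi>)) = (\<lambda>\<xi>. exp (\<i> * complex_of_real ((c *\<^sub>R x) \<bullet> \<xi>)) * heat_symbol m \<xi>)"
  proof
    fix \<xi> :: "real^'n"
    have "- t * norm (c *\<^sub>R \<xi>) powr (2 * m) = - (t * c powr (2 * m) * norm \<xi> powr (2 * m))"
      using c by (simp add: powr_mult mult.assoc)
    also have "\<dots> = - (norm \<xi> powr (2 * m))" by (simp add: cm)
    finally show "F (0 + c *\<^sub>R \<xi>) = exp (\<i> * complex_of_real ((c *\<^sub>R x) \<bullet> \<xi>)) * heat_symbol m \<xi>"
      by (simp add: F_def heat_symbol_def)
  qed
  also have "\<bar>c\<bar> ^ DIM(real^'n) *\<^sub>R (\<integral>\<xi>. exp (\<i> * complex_of_real ((c *\<^sub>R x) \<bullet> \<xi>)) * heat_symbol m \<xi> \<partial>lborel)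
     = complex_of_real (c ^ CARD('n)) * fourier (heat_symbol m) (c *\<^sub>R x)"
    using c by (simp add: fourier_def scaleR_conv_of_real)
  finally have eq: "(\<integral>\<xi>. F \<xi> \<partial>lebesgue) = complex_of_real (c ^ CARD('n)) * fourier (heat_symbol m) (c *\<^sub>R x)" .
  have "heat_kernel m t x = Re ((\<integral>\<xi>. F \<xi> \<partial>lebesgue) / complex_of_real ((2 * pi) ^ CARD('n)))"
    by (simp add: heat_kernel_def inverse_Fourier_def F_def)
  also have "\<dots> = c ^ CARD('n) * (Re (fourier (heat_symbol m) (c *\<^sub>R x)) / (2 * pi) ^ CARD('n))"
    unfolding eq by (simp only: Re_divide_of_real Re_complex_of_real mult.assoc flip: of_real_mult) (simp add: Re_divide_of_real)
  finally show ?thesis unfolding cn by (simp add: c_def)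
qed

theorem heat_kernel_family:
  assumes m: "0 < m"
  shows "\<exists>G1 G2. kernel_family (heat_kernel m :: real \<Rightarrow> real^'n \<Rightarrow> real) m G1 G2"
proof -
  define \<Phi> where "\<Phi> = (fourier (heat_symbol m) :: real^'n \<Rightarrow> complex)"
  define K where "K = (2 * pi) ^ CARD('n)"
  have K: "0 < K" by (simp add: K_def)
  have \<Phi>i: "integrable lborel \<Phi>" unfolding \<Phi>_def by (rule fourier_heat_integrable[OF m])
  have symi: "integrable lborel (heat_symbol m :: real^'n \<Rightarrow> complex)" by (rule heat_symbol_integrable[OF m])
  have one: "heat_kernel m 1 x = Re (\<Phi> x) / K" for x :: "real^'n"
    using heat_kernel_eq_fourier[OF m zero_less_one, of x] by (simp add: \<Phi>_def K_def)
  have onef: "(heat_kernel m 1 :: real^'n \<Rightarrow> real) = (\<lambda>x. Re (\<Phi> x) / K)" using one by (intro ext)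
  define A where "A = (\<integral>\<xi>. norm (heat_symbol m (\<xi>::real^'n)) \<partial>lborel)"
  have A: "norm (\<Phi> x) \<le> A" for x unfolding A_def \<Phi>_def by (rule fourier_norm_le[OF symi])
  define B where "B = (\<integral>x. norm (\<Phi> x) \<partial>lborel)"
  have A0: "0 \<le> A" using A[of 0] norm_ge_zero order_trans by blast
  have B0: "0 \<le> B" unfolding B_def by (rule Bochner_Integration.integral_nonneg) simp
  have "kernel_family (heat_kernel m :: real \<Rightarrow> real^'n \<Rightarrow> real) m (B / K + 1) (A / K + 1)"
  proof
    show "0 < B / K + 1" "0 < A / K + 1" using A0 B0 K by (simp_all add: add_nonneg_pos)
    show "heat_kernel m t x = t powr (- (real DIM(real^'n) / (2 * m))) * heat_kernel m 1 (t powr (- (1 / (2 * m))) *\<^sub>R x)"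
      if "0 < t" for t and x :: "real^'n"
      unfolding one heat_kernel_eq_fourier[OF m that] by (simp add: \<Phi>_def K_def)
    show "continuous_on UNIV (heat_kernel m 1 :: real^'n \<Rightarrow> real)"
      unfolding onef \<Phi>_def using K by (intro continuous_intros fourier_continuous[OF symi]) auto
    show "\<bar>heat_kernel m 1 x\<bar> \<le> A / K + 1" for x :: "real^'n"
    proof -
      have "\<bar>Re (\<Phi> x)\<bar> / K \<le> A / K"
        using A[of x] abs_Re_le_cmod[of "\<Phi> x"] K by (intro divide_right_mono) auto
      then show ?thesis unfolding one using K by simp
    qed
    show "(\<integral>\<^sup>+x. ennreal \<bar>heat_kernel m 1 (x::real^'n)\<bar> \<partial>lborel) \<le> ennreal (B / K + 1)"
    proof -
      have "(\<integral>\<^sup>+x. ennreal \<bar>heat_kernel m 1 (x::real^'n)\<bar> \<partial>lborel) \<le> (\<integral>\<^sup>+x. ennreal (norm (\<Phi> x) / K) \<partial>lborel)"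
        unfolding one using K abs_Re_le_cmod by (intro nn_integral_mono ennreal_leI) (simp add: divide_right_mono)
      also have "\<dots> = ennreal (\<integral>x. norm (\<Phi> x) / K \<partial>lborel)"
        using \<Phi>i K by (intro nn_integral_eq_integral) auto
      also have "(\<integral>x. norm (\<Phi> x) / K \<partial>lborel) = B / K" by (simp add: B_def)
      finally show ?thesis by (rule order_trans) (rule ennreal_leI, simp)
    qed
    show "(\<integral>x. heat_kernel m 1 (x::real^'n) \<partial>lborel) = 1"
    proof -
      have "(\<integral>x. heat_kernel m 1 (x::real^'n) \<partial>lborel) = (\<integral>x. Re (\<Phi> x) \<partial>lborel) / K"
        unfolding onef by simp
      also have "(\<integral>x. Re (\<Phi> x) \<partial>lborel) = Re (\<integral>x. \<Phi> x \<partial>lborel)"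
        using \<Phi>i by simp
      also have "\<dots> = K" unfolding \<Phi>_def fourier_heat_mass[OF m] by (simp add: K_def)
      finally show ?thesis using K by simp
    qed
  qed (rule m)
  then show ?thesis by blast
qed

section \<open>Limits and dilations\<close>

lemma cont_curve_add:
  assumes f: "cont_curve r f" and f': "cont_curve r f'"
  shows "cont_curve r (\<lambda>\<tau> y. f \<tau> y + f' \<tau> y)"
proof -
  have "cont_curve r (\<lambda>\<tau> y. - f' \<tau> y)"
    unfolding cont_curve_def
  proof (intro conjI allI impI)
    fix \<tau> :: real assume t: "0 < \<tau>"
    obtain M where "weak_bound r M (f' \<tau>)" using cont_curve_bound[OF f' t] by blast
    from weak_bound_cmult[OF this, of "-1"] show "\<exists>M. weak_bound r M (\<lambda>y. - f' \<tau> y)" by auto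
    fix e :: real assume e: "0 < e"
    obtain d where d: "0 < d" "\<And>\<tau>'. 0 < \<tau>' \<Longrightarrow> \<bar>\<tau>' - \<tau>\<bar> < d \<Longrightarrow> weak_bound r e (\<lambda>y. f' \<tau>' y - f' \<tau> y)"
      using cont_curve_near[OF f' t e] by blast
    show "\<exists>d>0. \<forall>\<tau>'>0. \<bar>\<tau>' - \<tau>\<bar> < d \<longrightarrow> weak_bound r e (\<lambda>y. - f' \<tau>' y - - f' \<tau> y)"
    proof (intro exI[of _ d] conjI allI impI d(1))
      fix \<tau>' assume "0 < \<tau>'" "\<bar>\<tau>' - \<tau>\<bar> < d"
      from weak_bound_cmult[OF d(2)[OF this], of "-1"] show "weak_bound r e (\<lambda>y. - f' \<tau>' y - - f' \<tau> y)" by simp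
    qed
  qed
  from cont_curve_diff[OF f this] show ?thesis by simp
qed

lemma cont_curve_cong:
  assumes f: "cont_curve r f" and eq: "\<And>t. 0 < t \<Longrightarrow> f' t = f t"
  shows "cont_curve r f'"
  unfolding cont_curve_def
proof (intro conjI allI impI)
  fix \<tau> :: real assume t: "0 < \<tau>"
  show "\<exists>M. weak_bound r M (f' \<tau>)" unfolding eq[OF t] by (rule cont_curve_bound[OF f t])
  fix e :: real assume e: "0 < e"
  from cont_curve_near[OF f t e] obtain d where "0 < d"
    "\<And>\<tau>'. 0 < \<tau>' \<Longrightarrow> \<bar>\<tau>' - \<tau>\<bar> < d \<Longrightarrow> weak_bound r e (\<lambda>y. f \<tau>' y - f \<tau> y)" by blast
  then show "\<exists>d>0. \<forall>\<tau>'>0. \<bar>\<tau>' - \<tau>\<bar> < d \<longrightarrow> weak_bound r e (\<lambda>y. f' \<tau>' y - f' \<tau> y)"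
    using eq t by (intro exI[of _ d]) simp
qed

text \<open>
  A locally uniform limit; the factor \<open>t^(-\<delta>)\<close> is bounded on times away from 0.
\<close>

lemma cont_curve_limit:
  assumes v: "\<And>k::nat. cont_curve q (v k)" and \<delta>: "0 \<le> \<delta>"
    and near: "\<And>k t. 0 < t \<Longrightarrow> weak_bound q (e k * t powr (- \<delta>)) (\<lambda>x. u t x - v k t x)"
    and e: "e \<longlonglongrightarrow> 0"
    and um: "\<And>t. 0 < t \<Longrightarrow> u t \<in> borel_measurable borel"
  shows "cont_curve q u"
  unfolding cont_curve_def
proof (intro conjI allI impI)
  fix t :: real assume t: "0 < t"
  obtain M where "weak_bound q M (v 0 t)" using cont_curve_bound[OF v t] by blast
  from weak_bound_add[OF near[OF t, of 0] this] show "\<exists>M. weak_bound q M (u t)" by auto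
  fix \<epsilon> :: real assume \<epsilon>: "0 < \<epsilon>"
  define w where "w = (t / 2) powr (- \<delta>)"
  have w: "0 < w" using t by (simp add: w_def)
  have "(\<lambda>k. e k * w) \<longlonglongrightarrow> 0 * w" by (intro tendsto_mult e tendsto_const)
  then have "eventually (\<lambda>k. e k * w < \<epsilon> / 3) sequentially"
    by (intro order_tendstoD(2)) (use \<epsilon> in auto)
  then obtain k where k: "e k * w < \<epsilon> / 3" by (auto simp: eventually_sequentially)
  have e0: "0 \<le> e k" using weak_boundD(1)[OF near[OF zero_less_one, of k]] by simp
  have close: "weak_bound q (\<epsilon> / 3) (\<lambda>x. u t' x - v k t' x)" if "t / 2 \<le> t'" for t'
  proof (rule weak_bound_mono[OF near])
    show "0 < t'" using that t by simp
    have "t' powr (- \<delta>) \<le> w" unfolding w_def using that t \<delta> by (intro powr_mono2') auto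
    then have "e k * t' powr (- \<delta>) \<le> e k * w" using e0 by (rule mult_left_mono)
    then show "e k * t' powr (- \<delta>) \<le> \<epsilon> / 3" using k by linarith
  qed
  have "0 < \<epsilon> / 3" using \<epsilon> by simp
  then obtain d where d: "0 < d" "\<And>t'. 0 < t' \<Longrightarrow> \<bar>t' - t\<bar> < d \<Longrightarrow> weak_bound q (\<epsilon> / 3) (\<lambda>x. v k t' x - v k t x)"
    using cont_curve_near[OF v t] by blast
  show "\<exists>d>0. \<forall>t'>0. \<bar>t' - t\<bar> < d \<longrightarrow> weak_bound q \<epsilon> (\<lambda>x. u t' x - u t x)"
  proof (intro exI[of _ "min d (t / 2)"] conjI allI impI)
    fix t' assume t': "0 < t'" "\<bar>t' - t\<bar> < min d (t / 2)"
    then have "t / 2 \<le> t'" using abs_ge_self[of "t - t'"] by linarith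
    then have "weak_bound q (\<epsilon> / 3 + \<epsilon> / 3 + \<epsilon> / 3) (\<lambda>x. ((u t' x - v k t' x) + (v k t' x - v k t x)) - (u t x - v k t x))"
      using t t' by (intro weak_bound_diff weak_bound_add close d(2)) auto
    then show "weak_bound q \<epsilon> (\<lambda>x. u t' x - u t x)" by simp
  qed (use d t in auto)
qed

lemma weak_bound_dilate:
  fixes U :: "'a::euclidean_space \<Rightarrow> real"
  assumes U: "weak_bound q M U" and c: "0 < c"
  shows "weak_bound q (M * c powr (- (real DIM('a) / q))) (\<lambda>x. U (c *\<^sub>R x))"
  unfolding weak_bound_def
proof (intro conjI ballI impI)
  note [measurable] = weak_boundD(2)[OF U]
  have M: "0 \<le> M" by (rule weak_boundD(1)[OF U])
  show "0 \<le> M * c powr (- (real DIM('a) / q))" using M by simp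
  show "(\<lambda>x. U (c *\<^sub>R x)) \<in> borel_measurable borel" by measurable
  fix E :: "'a set" assume E: "E \<in> sets borel" "emeasure lborel E < \<infinity>"
  note [measurable] = E(1)
  define a where "a = measure lborel E"
  have a: "0 \<le> a" "emeasure lborel E = ennreal a" using E by (auto simp: a_def emeasure_eq_ennreal_measure)
  define E' where "E' = {x. (1 / c) *\<^sub>R x \<in> E}"
  have E'm[measurable]: "E' \<in> sets borel" unfolding E'_def by measurable
  have cE: "indicator E' (0 + c *\<^sub>R x) = (indicator E x :: ennreal)" for x
    using c by (simp add: E'_def indicator_def)
  define N where "N = c ^ DIM('a)"
  have N: "0 < N" using c by (simp add: N_def)
  have "emeasure lborel E' = (\<integral>\<^sup>+x. indicator E' x \<partial>lborel)" by simp
  also have "\<dots> = ennreal (\<bar>c\<bar> ^ DIM('a)) * (\<integral>\<^sup>+x. indicator E' (0 + c *\<^sub>R x) \<partial>lborel)"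
    by (rule nn_integral_affine) (use c in auto)
  also have "\<dots> = ennreal (N * a)" unfolding cE using c a N by (simp add: N_def ennreal_mult)
  finally have eE': "emeasure lborel E' = ennreal (N * a)" .
  then have mE': "measure lborel E' = N * a" using N a by (simp add: measure_def)
  have "(\<integral>\<^sup>+x\<in>E'. ennreal \<bar>U x\<bar> \<partial>lborel)
     = ennreal (\<bar>c\<bar> ^ DIM('a)) * (\<integral>\<^sup>+x. ennreal \<bar>U (0 + c *\<^sub>R x)\<bar> * indicator E' (0 + c *\<^sub>R x) \<partial>lborel)"
    by (rule nn_integral_affine) (use c in auto)
  then have eq: "ennreal N * (\<integral>\<^sup>+x\<in>E. ennreal \<bar>U (c *\<^sub>R x)\<bar> \<partial>lborel) = (\<integral>\<^sup>+x\<in>E'. ennreal \<bar>U x\<bar> \<partial>lborel)"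
    unfolding cE using c by (simp add: N_def)
  have "(\<integral>\<^sup>+x\<in>E. ennreal \<bar>U (c *\<^sub>R x)\<bar> \<partial>lborel) = ennreal (1 / N) * (ennreal N * (\<integral>\<^sup>+x\<in>E. ennreal \<bar>U (c *\<^sub>R x)\<bar> \<partial>lborel))"
    using N by (simp add: mult.assoc[symmetric] ennreal_mult[symmetric])
  also have "\<dots> \<le> ennreal (1 / N) * ennreal (M * (N * a) powr (1 - 1 / q))"
    unfolding eq mE'[symmetric] by (intro mult_left_mono weak_boundD(3)[OF U]) (auto simp: eE')
  also have "\<dots> = ennreal (M * c powr (- (real DIM('a) / q)) * a powr (1 - 1 / q))"
  proof -
    have Np: "N powr (- 1 / q) = c powr (- (real DIM('a) / q))"
      unfolding N_def using c by (simp add: powr_powr flip: powr_realpow)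
    have "N powr (1 - 1 / q) = N * N powr (- 1 / q)"
      using N powr_add[of N 1 "- 1 / q"] by simp
    then have "1 / N * (M * (N * a) powr (1 - 1 / q)) = M * N powr (- 1 / q) * a powr (1 - 1 / q)"
      using N a by (simp add: powr_mult)
    then show ?thesis unfolding Np using N M by (simp add: ennreal_mult[symmetric])
  qed
  finally show "(\<integral>\<^sup>+x\<in>E. ennreal \<bar>U (c *\<^sub>R x)\<bar> \<partial>lborel) \<le> ennreal (M * c powr (- (real DIM('a) / q)) * measure lborel E powr (1 - 1 / q))"
    by (simp add: a_def)
qed

text \<open>
  Completeness, in the only form used here: the series of differences converges absolutely almost
  everywhere because it is integrable on balls. On the exceptional null set the value of the limit
  is irrelevant.
\<close>

lemma weak_bound_geometric_limit:
  fixes V :: "nat \<Rightarrow> 'a::euclidean_space \<Rightarrow> real"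
  assumes V: "\<And>k. V k \<in> borel_measurable borel"
    and d: "\<And>k. weak_bound q (c * (1 / 2) ^ k) (\<lambda>x. V (Suc k) x - V k x)"
  shows "weak_bound q (2 * c * (1 / 2) ^ k) (\<lambda>x. lim (\<lambda>k. V k x) - V k x)"
proof -
  note [measurable] = V
  have c: "0 \<le> c" using weak_boundD(1)[OF d[of 0]] by simp
  \<comment> \<open>A majorant of \<open>|lim V - V k|\<close>; being a series of nonnegative terms it can be integrated termwise.\<close>
  define W where "W k x = (\<Sum>j. ennreal \<bar>V (Suc (k + j)) x - V (k + j) x\<bar>)" for k x
  have Wm[measurable]: "W k \<in> borel_measurable borel" for k unfolding W_def by measurable
  have Wint: "(\<integral>\<^sup>+x\<in>E. W k x \<partial>lborel) \<le> ennreal (2 * c * (1 / 2) ^ k * measure lborel E powr (1 - 1 / q))"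
    if E: "E \<in> sets borel" "emeasure lborel E < \<infinity>" for E k
  proof -
    note [measurable] = E(1)
    define a where "a = measure lborel E powr (1 - 1 / q)"
    have a: "0 \<le> a" by (simp add: a_def)
    have "(\<integral>\<^sup>+x\<in>E. W k x \<partial>lborel) = (\<integral>\<^sup>+x. (\<Sum>j. ennreal \<bar>V (Suc (k + j)) x - V (k + j) x\<bar> * indicator E x) \<partial>lborel)"
      unfolding W_def by (simp add: ennreal_suminf_multc)
    also have "\<dots> = (\<Sum>j. \<integral>\<^sup>+x\<in>E. ennreal \<bar>V (Suc (k + j)) x - V (k + j) x\<bar> \<partial>lborel)"
      by (rule nn_integral_suminf) measurable
    also have "\<dots> \<le> (\<Sum>j. ennreal (c * (1 / 2) ^ (k + j) * a))"
      unfolding a_def by (intro suminf_le summableI weak_boundD(3)[OF d E])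
    also have "\<dots> = ennreal (2 * c * (1 / 2) ^ k * a)"
    proof (rule suminf_ennreal_eq)
      show "0 \<le> c * (1 / 2) ^ (k + j) * a" for j using c a by simp
      have "(\<lambda>j. (c * (1 / 2) ^ k * a) * (1 / 2) ^ j) sums ((c * (1 / 2) ^ k * a) * (1 / (1 - 1 / 2)))"
        by (intro sums_mult geometric_sums) simp
      then show "(\<lambda>j. c * (1 / 2) ^ (k + j) * a) sums (2 * c * (1 / 2) ^ k * a)"
        by (simp add: power_add mult_ac)
    qed
    finally show ?thesis by (simp add: a_def)
  qed
  have "AE x in lborel. \<forall>n::nat. x \<in> ball 0 (real n) \<longrightarrow> W 0 x \<noteq> \<infinity>"
    unfolding AE_all_countable
  proof
    fix n :: nat
    have b: "ball (0::'a) (real n) \<in> sets borel" by simp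
    note [measurable] = b
    have "(\<integral>\<^sup>+x\<in>ball 0 (real n). W 0 x \<partial>lborel) \<noteq> \<infinity>"
      using Wint[OF b, of 0] by (auto simp: top_unique)
    then have "AE x in lborel. W 0 x * indicator (ball 0 (real n)) x \<noteq> \<infinity>"
      by (intro nn_integral_PInf_AE) measurable
    then show "AE x in lborel. x \<in> ball 0 (real n) \<longrightarrow> W 0 x \<noteq> \<infinity>"
      by eventually_elim auto
  qed
  then have fin: "AE x in lborel. W 0 x \<noteq> \<infinity>"
  proof eventually_elim
    case (elim x)
    obtain n :: nat where "norm x < real n" using reals_Archimedean2 by blast
    then show ?case using elim by (auto simp: dist_norm)
  qed
  have le: "AE x in lborel. ennreal \<bar>lim (\<lambda>k. V k x) - V k x\<bar> \<le> W k x" for k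
    using fin
  proof eventually_elim
    case (elim x)
    have s: "summable (\<lambda>j. \<bar>V (Suc j) x - V j x\<bar>)"
      using elim by (intro summable_suminf_not_top) (auto simp: W_def)
    then have "summable (\<lambda>j. V (Suc j) x - V j x)" by (rule summable_rabs_cancel)
    then have "convergent (\<lambda>n. \<Sum>j<n. V (Suc j) x - V j x)" by (simp add: summable_iff_convergent)
    then have "convergent (\<lambda>n. V n x - V 0 x)" by (simp only: sum_lessThan_telescope[of "\<lambda>j. V j x"])
    then have "convergent (\<lambda>n. V n x)" by (simp add: convergent_diff_const_right_iff)
    then have lm: "(\<lambda>n. V n x) \<longlonglongrightarrow> lim (\<lambda>k. V k x)" by (simp add: convergent_LIMSEQ_iff)
    have part: "ennreal \<bar>V (k + n) x - V k x\<bar> \<le> W k x" for n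
    proof -
      have "V (k + n) x - V k x = (\<Sum>j<n. V (Suc (k + j)) x - V (k + j) x)"
        using sum_lessThan_telescope[of "\<lambda>j. V (k + j) x" n] by simp
      then have "\<bar>V (k + n) x - V k x\<bar> \<le> (\<Sum>j<n. \<bar>V (Suc (k + j)) x - V (k + j) x\<bar>)" by simp
      then have "ennreal \<bar>V (k + n) x - V k x\<bar> \<le> ennreal (\<Sum>j<n. \<bar>V (Suc (k + j)) x - V (k + j) x\<bar>)" by (rule ennreal_leI)
      also have "\<dots> = (\<Sum>j<n. ennreal \<bar>V (Suc (k + j)) x - V (k + j) x\<bar>)" by (simp add: sum_ennreal)
      also have "\<dots> \<le> W k x" unfolding W_def by (rule sum_le_suminf) (auto intro: summableI)
      finally show ?thesis .
    qed
    have "(\<lambda>n. ennreal \<bar>V (n + k) x - V k x\<bar>) \<longlonglongrightarrow> ennreal \<bar>lim (\<lambda>k. V k x) - V k x\<bar>"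
      by (intro tendsto_ennrealI tendsto_rabs tendsto_diff tendsto_const LIMSEQ_ignore_initial_segment lm)
    then show "ennreal \<bar>lim (\<lambda>k. V k x) - V k x\<bar> \<le> W k x"
      by (rule LIMSEQ_le_const2) (use part in \<open>auto simp: add.commute\<close>)
  qed
  show ?thesis
    unfolding weak_bound_def
  proof (intro conjI ballI impI)
    show "0 \<le> 2 * c * (1 / 2) ^ k" using c by simp
    show "(\<lambda>x. lim (\<lambda>k. V k x) - V k x) \<in> borel_measurable borel" by measurable
    fix E :: "'a set" assume E: "E \<in> sets borel" "emeasure lborel E < \<infinity>"
    have "(\<integral>\<^sup>+x\<in>E. ennreal \<bar>lim (\<lambda>k. V k x) - V k x\<bar> \<partial>lborel) \<le> (\<integral>\<^sup>+x\<in>E. W k x \<partial>lborel)"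
      by (rule nn_integral_mono_AE) (use le[of k] in \<open>auto simp: indicator_def\<close>)
    also note Wint[OF E, of k]
    finally show "(\<integral>\<^sup>+x\<in>E. ennreal \<bar>lim (\<lambda>k. V k x) - V k x\<bar> \<partial>lborel) \<le> ennreal (2 * c * (1 / 2) ^ k * measure lborel E powr (1 - 1 / q))" .
  qed
qed

section \<open>The Hardy-Henon nonlinearity\<close>

text \<open>
  The kernel is kept abstract, so that all estimates live on Borel functions.
\<close>

locale hardy_henon = kernel_family g m G1 G2
  for g :: "real \<Rightarrow> 'a::euclidean_space \<Rightarrow> real" and m G1 G2 :: real +
  fixes \<alpha> p C :: real and F :: "real \<Rightarrow> real"
  assumes \<alpha>: "0 < \<alpha>" "\<alpha> < 2 * m" and dim: "2 * m < real DIM('a)"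
    and p_large: "(real DIM('a) - \<alpha>) / (real DIM('a) - 2 * m) < p"
    and F0: "F 0 = 0" and C: "0 < C"
    and F_lip: "\<And>a b. \<bar>F a - F b\<bar> \<le> C * \<bar>a - b\<bar> * (\<bar>a\<bar> powr (p - 1) + \<bar>b\<bar> powr (p - 1))"
    and F_hom: "\<And>l a. 0 < l \<Longrightarrow> F (l * a) = l powr p * F a"
begin

definition \<gamma> :: real where "\<gamma> = (2 * m - \<alpha>) / (p - 1)"
definition qc :: real where "qc = real DIM('a) * (p - 1) / (2 * m - \<alpha>)"

text \<open>
  The nonlinearity maps \<open>L^(q,\<infinity>)\<close>, with \<open>p - 1\<close> factors from \<open>L^(qc,\<infinity>)\<close>, into this exponent, and the Duhamel
  integral leads back to \<open>q\<close>.
\<close>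

definition rexp :: "real \<Rightarrow> real" where "rexp q = 1 / (1 / q + 1 / rate)"

text \<open>
  The exponent of the time weight under which self-similar functions are bounded in \<open>L^(q,\<infinity>)\<close>; it is
  \<open>\<delta>\<close> of the smoothing space, and it vanishes at the critical exponent.
\<close>

definition wt :: "real \<Rightarrow> real" where "wt q = rate * (1 / qc - 1 / q)"

lemma p_gt_1: "1 < p"
proof -
  have "1 < (real DIM('a) - \<alpha>) / (real DIM('a) - 2 * m)" using \<alpha> dim by (simp add: field_simps)
  then show ?thesis using p_large by linarith
qed

text \<open>
  The lower bound on \<open>p\<close> says exactly that the exponent into which the nonlinearity maps
  \<open>L^(qc,\<infinity>)\<close> exceeds 1.
\<close>

lemma qc_bounds: "1 < qc" "1 / qc + 1 / rate < 1"
proof -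
  define n where "n = real DIM('a)"
  have n: "2 * m < n" "0 < n" using dim m_pos by (auto simp: n_def)
  have "n - \<alpha> < p * (n - 2 * m)" using p_large n by (simp add: n_def field_simps)
  then have k: "2 * m - \<alpha> < (p - 1) * (n - 2 * m)" by (simp add: algebra_simps)
  have p1: "0 < p - 1" using p_gt_1 by simp
  have q: "1 / qc = (2 * m - \<alpha>) / (n * (p - 1))" by (simp add: qc_def n_def)
  have "(2 * m - \<alpha>) / (n * (p - 1)) < (n - 2 * m) / n"
    using k p1 n by (simp add: divide_simps mult_ac)
  moreover have "1 / rate = 2 * m / n" by (simp add: rate_def n_def)
  moreover have "(n - 2 * m) / n + 2 * m / n = 1" using n by (simp add: field_simps)
  ultimately show 1: "1 / qc + 1 / rate < 1" unfolding q by linarith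
  have "0 < 1 / qc" unfolding q using \<alpha> p1 n by simp
  moreover have "1 / qc < 1" using 1 rate_pos by (smt (verit) divide_pos_pos)
  ultimately show "1 < qc" by (simp add: divide_less_eq_1_pos zero_less_divide_1_iff)
qed

lemma qc_exponents: "\<gamma> / (2 * m) = rate / qc" "(p - 1) / qc = (2 * m - \<alpha>) / real DIM('a)" "0 < \<gamma>"
  using p_gt_1 m_pos \<alpha> by (auto simp: \<gamma>_def rate_def qc_def field_simps)

lemma rexp:
  assumes q: "qc \<le> q"
  shows "1 < rexp q" "1 / rexp q = 1 / q + 1 / rate" "0 < q" "1 < q"
proof -
  show q1: "1 < q" using q qc_bounds by linarith
  then show q0: "0 < q" by linarith
  have "1 / q \<le> 1 / qc" using q qc_bounds by (intro divide_left_mono) auto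
  then have lt: "1 / q + 1 / rate < 1" using qc_bounds by linarith
  have pos: "0 < 1 / q + 1 / rate" using q0 rate_pos by (intro add_pos_pos) auto
  show "1 < rexp q" unfolding rexp_def using lt pos by (simp add: less_divide_eq_1_pos)
  show "1 / rexp q = 1 / q + 1 / rate" unfolding rexp_def by simp
qed

lemma wt_nonneg: "qc \<le> q \<Longrightarrow> 0 \<le> wt q"
  using rate_pos qc_bounds by (simp add: wt_def frac_le)

lemma wt_qc [simp]: "wt qc = 0" by (simp add: wt_def)

definition nonlin :: "('a \<Rightarrow> real) \<Rightarrow> 'a \<Rightarrow> real" where
  "nonlin v y = norm y powr (- \<alpha>) * F (v y)"

text \<open>
  A homogeneous function on the line is determined by its values at \<open>\<plusminus>1\<close>.
\<close>

lemma F_measurable [measurable]: "F \<in> borel_measurable borel"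
proof -
  have "F = (\<lambda>a. if 0 < a then a powr p * F 1 else if a < 0 then (- a) powr p * F (- 1) else 0)"
  proof
    fix a show "F a = (if 0 < a then a powr p * F 1 else if a < 0 then (- a) powr p * F (- 1) else 0)"
      using F_hom[of a 1] F_hom[of "- a" "- 1"] F0 by auto
  qed
  then show ?thesis by (rule ssubst) measurable
qed

lemma nonlin_measurable [measurable]: "v \<in> borel_measurable borel \<Longrightarrow> nonlin v \<in> borel_measurable borel"
  unfolding nonlin_def by measurable

text \<open>
  The product of the constants of two applications of Hoelder's inequality and of the passage from
  level sets back to norms.
\<close>

definition nonlin_const :: "real \<Rightarrow> real" where
  "nonlin_const q = 2 * C * (rexp q / (rexp q - 1) * (2 powr (1 / rexp q) * (2 powr (\<alpha> / real DIM('a) + 1 / q)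
      * unit_ball_vol (real DIM('a)) powr (\<alpha> / real DIM('a)))))"

lemma nonlin_const_pos: "qc \<le> q \<Longrightarrow> 0 < nonlin_const q"
proof -
  assume "qc \<le> q"
  then have "1 < rexp q" by (rule rexp)
  moreover have "0 < unit_ball_vol (real DIM('a)) powr (\<alpha> / real DIM('a))"
    using unit_ball_vol_pos[of "real DIM('a)"] by (metis less_irrefl of_nat_0_le_iff powr_gt_zero)
  ultimately show "0 < nonlin_const q" unfolding nonlin_const_def using C by (intro mult_pos_pos divide_pos_pos) auto
qed

text \<open>
  Hoelder in weak spaces for \<open>|y|^(-\<alpha>) |a - b| |v|^(p-1)\<close> with \<open>v\<close> either \<open>a\<close> or \<open>b\<close>. The exponents add up:
  \<open>\<alpha>/n + 1/q + (p - 1)/qc = 1/q + 2m/n\<close>. The powers of \<open>v\<close> are always measured in the critical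
  space, so that the same smallness serves every \<open>q\<close> and only the single factor \<open>a - b\<close> carries a
  time weight.
\<close>

lemma nonlin_diff_bound:
  assumes q: "qc \<le> q" and A: "0 < A" and B: "0 < B"
    and ab: "weak_bound q A (\<lambda>y. a y - b y)" and a: "weak_bound qc B a" and b: "weak_bound qc B b"
  shows "weak_bound (rexp q) (nonlin_const q * B powr (p - 1) * A) (\<lambda>y. nonlin a y - nonlin b y)"
proof -
  define n where "n = real DIM('a)"
  have n: "0 < n" by (simp add: n_def)
  define c0 where "c0 = unit_ball_vol n powr (\<alpha> / n)"
  define r1 where "r1 = 1 / (\<alpha> / n + 1 / q)"
  note q0 = rexp(3)[OF q]
  have "0 < \<alpha> / n + 1 / q" using \<alpha> n q0 by (intro add_pos_pos) auto
  then have r1: "0 < r1" "1 / r1 = 1 / (n / \<alpha>) + 1 / q" by (auto simp: r1_def)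
  have p1: "0 < p - 1" using p_gt_1 by simp
  have lw: "level_bound (n / \<alpha>) c0 (\<lambda>y::'a. norm y powr (- \<alpha>))"
    unfolding n_def c0_def by (rule level_bound_norm_powr[OF \<alpha>(1)])
  have lab: "level_bound q A (\<lambda>y. a y - b y)" by (rule weak_bound_imp_level_bound[OF rexp(4)[OF q] ab A])
  have lp: "level_bound r1 (2 powr (1 / r1) * (c0 * A)) (\<lambda>y. norm y powr (- \<alpha>) * (a y - b y))"
    by (rule level_bound_mult[OF _ q0 lw lab r1(2)]) (use \<alpha> n in auto)
  have r: "1 / rexp q = 1 / r1 + 1 / (qc / (p - 1))"
  proof -
    have "1 / (qc / (p - 1)) = (2 * m - \<alpha>) / n" using qc_exponents(2) by (simp add: n_def)
    moreover have "1 / rate = 2 * m / n" by (simp add: rate_def n_def)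
    ultimately show ?thesis unfolding rexp(2)[OF q] r1(2) by (simp add: diff_divide_distrib)
  qed
  have piece: "weak_bound (rexp q) (rexp q / (rexp q - 1) * (2 powr (1 / rexp q) * ((2 powr (1 / r1) * (c0 * A)) * B powr (p - 1))))
       (\<lambda>y. (norm y powr (- \<alpha>) * (a y - b y)) * \<bar>v y\<bar> powr (p - 1))" if v: "weak_bound qc B v" for v
  proof -
    have "level_bound (qc / (p - 1)) (B powr (p - 1)) (\<lambda>y. \<bar>v y\<bar> powr (p - 1))"
      by (rule level_bound_powr[OF weak_bound_imp_level_bound[OF qc_bounds(1) v B] p1])
    from level_bound_mult[OF r1(1) _ lp this r] show ?thesis
      using qc_bounds(1) p1 by (intro level_bound_imp_weak_bound[OF rexp(1)[OF q]]) auto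
  qed
  define k where "k = rexp q / (rexp q - 1) * (2 powr (1 / rexp q) * ((2 powr (1 / r1) * (c0 * A)) * B powr (p - 1)))"
  have sum: "weak_bound (rexp q) (\<bar>C\<bar> * (k + k))
     (\<lambda>y. C * ((norm y powr (- \<alpha>) * (a y - b y)) * \<bar>a y\<bar> powr (p - 1) + (norm y powr (- \<alpha>) * (a y - b y)) * \<bar>b y\<bar> powr (p - 1)))"
    unfolding k_def by (intro weak_bound_cmult weak_bound_add piece a b)
  have c: "\<bar>C\<bar> * (k + k) = nonlin_const q * B powr (p - 1) * A"
    using C r1(2) by (simp add: k_def nonlin_const_def c0_def n_def mult_ac)
  note [measurable] = weak_boundD(2)[OF a] weak_boundD(2)[OF b]
  show ?thesis
    unfolding c[symmetric]
  proof (rule weak_bound_dominated[OF sum])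
    show "(\<lambda>y. nonlin a y - nonlin b y) \<in> borel_measurable borel" by measurable
    show "AE y in lborel. \<bar>nonlin a y - nonlin b y\<bar>
      \<le> \<bar>C * ((norm y powr (- \<alpha>) * (a y - b y)) * \<bar>a y\<bar> powr (p - 1) + (norm y powr (- \<alpha>) * (a y - b y)) * \<bar>b y\<bar> powr (p - 1))\<bar>"
    proof (rule AE_I2)
      fix y
      have "\<bar>nonlin a y - nonlin b y\<bar> = norm y powr (- \<alpha>) * \<bar>F (a y) - F (b y)\<bar>"
        unfolding nonlin_def by (simp add: abs_mult flip: right_diff_distrib)
      also have "\<dots> \<le> norm y powr (- \<alpha>) * (C * \<bar>a y - b y\<bar> * (\<bar>a y\<bar> powr (p - 1) + \<bar>b y\<bar> powr (p - 1)))"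
        by (intro mult_left_mono F_lip) simp
      also have "\<dots> = \<bar>C * (norm y powr (- \<alpha>) * (a y - b y)) * (\<bar>a y\<bar> powr (p - 1) + \<bar>b y\<bar> powr (p - 1))\<bar>"
        using C by (simp add: abs_mult mult_ac)
      finally show "\<bar>nonlin a y - nonlin b y\<bar>
        \<le> \<bar>C * ((norm y powr (- \<alpha>) * (a y - b y)) * \<bar>a y\<bar> powr (p - 1) + (norm y powr (- \<alpha>) * (a y - b y)) * \<bar>b y\<bar> powr (p - 1))\<bar>"
        by (simp add: distrib_left mult.assoc)
    qed
  qed
qed

lemma nonlin_zero: "nonlin (\<lambda>y. 0) = (\<lambda>y. 0)"
  by (simp add: nonlin_def F0 fun_eq_iff)

lemma nonlin_bound:
  assumes q: "qc \<le> q" and A: "0 < A" and B: "0 < B" and a: "weak_bound q A a" "weak_bound qc B a"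
  shows "weak_bound (rexp q) (nonlin_const q * B powr (p - 1) * A) (nonlin a)"
proof -
  have "weak_bound qc B (\<lambda>y. 0 :: real)" by (rule weak_bound_mono[OF weak_bound_zero]) (use B in simp)
  from nonlin_diff_bound[OF q A B _ a(2) this] a(1) show ?thesis by (simp add: nonlin_zero)
qed

lemma nonlin_cont_curve:
  assumes q: "qc \<le> q" and B: "0 < B" and v: "\<And>t. 0 < t \<Longrightarrow> weak_bound qc B (v t)" and cv: "cont_curve q v"
  shows "cont_curve (rexp q) (\<lambda>t. nonlin (v t))"
  unfolding cont_curve_def
proof (intro conjI allI impI)
  fix t :: real assume t: "0 < t"
  obtain M where M: "weak_bound q M (v t)" using cont_curve_bound[OF cv t] by blast
  have "weak_bound q (M + 1) (v t)" by (rule weak_bound_mono[OF M]) simp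
  then show "\<exists>M. weak_bound (rexp q) M (nonlin (v t))"
    using nonlin_bound[OF q _ B _ v[OF t], of "M + 1"] weak_boundD(1)[OF M] by fastforce
  fix e :: real assume e: "0 < e"
  define K where "K = nonlin_const q * B powr (p - 1)"
  have K: "0 < K" using nonlin_const_pos[OF q] B by (simp add: K_def)
  have eK: "0 < e / K" using e K by simp
  obtain d where d: "0 < d" "\<And>t'. 0 < t' \<Longrightarrow> \<bar>t' - t\<bar> < d \<Longrightarrow> weak_bound q (e / K) (\<lambda>y. v t' y - v t y)"
    using cont_curve_near[OF cv t eK] by blast
  show "\<exists>d>0. \<forall>t'>0. \<bar>t' - t\<bar> < d \<longrightarrow> weak_bound (rexp q) e (\<lambda>y. nonlin (v t') y - nonlin (v t) y)"
  proof (intro exI[of _ d] conjI allI impI d(1))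
    fix t' assume t': "0 < t'" "\<bar>t' - t\<bar> < d"
    have "weak_bound (rexp q) (nonlin_const q * B powr (p - 1) * (e / K)) (\<lambda>y. nonlin (v t') y - nonlin (v t) y)"
      by (rule nonlin_diff_bound[OF q eK B d(2)[OF t'] v[OF t'(1)] v[OF t]])
    also have "nonlin_const q * B powr (p - 1) * (e / K) = e" unfolding K_def[symmetric] using K by simp
    finally show "weak_bound (rexp q) e (\<lambda>y. nonlin (v t') y - nonlin (v t) y)" .
  qed
qed

text \<open>
  The contraction constant of one Picard step is \<open>step_const q\<close> times the \<open>(p - 1)\<close>-st power of the
  critical norm.
\<close>

definition step_const :: "real \<Rightarrow> real" where
  "step_const q = duhamel_const (rexp q) q (wt q) * nonlin_const q"

lemma step_const_pos: "qc \<le> q \<Longrightarrow> wt q < 1 \<Longrightarrow> 0 < step_const q"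
  unfolding step_const_def using duhamel_const_pos[OF rexp(1) rexp(3)] nonlin_const_pos by simp

lemma duhamel_nonlin_bound:
  assumes q: "qc \<le> q" "wt q < 1" and A: "0 < A" and B: "0 < B" and t: "0 < t"
    and v: "\<And>t. 0 < t \<Longrightarrow> weak_bound qc B (v t)" and cv: "cont_curve q v"
    and vq: "\<And>t. 0 < t \<Longrightarrow> weak_bound q (A * t powr (- wt q)) (v t)"
  shows "AE x in lborel. integrable lborel (\<lambda>s. indicator {0<..<t} s * conv (g s) (nonlin (v (t - s))) x)"
    and "weak_bound q (step_const q * B powr (p - 1) * A * t powr (- wt q)) (duhamel t (\<lambda>\<tau>. nonlin (v \<tau>)))"
    and "cont_curve q (\<lambda>t. duhamel t (\<lambda>\<tau>. nonlin (v \<tau>)))"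
proof -
  define M where "M = nonlin_const q * B powr (p - 1) * A"
  have M: "0 \<le> M" using nonlin_const_pos[OF q(1)] A by (simp add: M_def)
  have bd: "weak_bound (rexp q) (M * \<tau> powr (- wt q)) (nonlin (v \<tau>))" if "0 < \<tau>" for \<tau>
    using nonlin_bound[OF q(1) _ B vq[OF that] v[OF that]] A that by (simp add: M_def mult.assoc)
  note cn = nonlin_cont_curve[OF q(1) B v cv]
  show "AE x in lborel. integrable lborel (\<lambda>s. indicator {0<..<t} s * conv (g s) (nonlin (v (t - s))) x)"
    by (rule duhamel_bound(1)[OF rexp(1)[OF q(1)] cn rexp(3)[OF q(1)] rexp(2)[OF q(1)] wt_nonneg[OF q(1)] q(2) t M bd])
  have "weak_bound q (duhamel_const (rexp q) q (wt q) * M * t powr (- wt q)) (duhamel t (\<lambda>\<tau>. nonlin (v \<tau>)))"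
    by (rule duhamel_bound(2)[OF rexp(1)[OF q(1)] cn rexp(3)[OF q(1)] rexp(2)[OF q(1)] wt_nonneg[OF q(1)] q(2) t M bd])
  then show "weak_bound q (step_const q * B powr (p - 1) * A * t powr (- wt q)) (duhamel t (\<lambda>\<tau>. nonlin (v \<tau>)))"
    by (simp add: M_def step_const_def mult.assoc)
  show "cont_curve q (\<lambda>t. duhamel t (\<lambda>\<tau>. nonlin (v \<tau>)))"
    by (rule duhamel_cont_curve[OF rexp(1)[OF q(1)] cn rexp(3)[OF q(1)] rexp(2)[OF q(1)] wt_nonneg[OF q(1)] q(2) M bd])
qed

lemma duhamel_nonlin_integrable:
  assumes B: "0 < B" and t: "0 < t" and v: "\<And>t. 0 < t \<Longrightarrow> weak_bound qc B (v t)" and cv: "cont_curve qc v"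
  shows "AE x in lborel. integrable lborel (\<lambda>s. indicator {0<..<t} s * conv (g s) (nonlin (v (t - s))) x)"
  by (rule duhamel_nonlin_bound(1)[OF order_refl _ B B t v cv]) (use v in auto)

text \<open>
  Continuity in the critical space is assumed in addition because the difference of the two Duhamel
  integrals is the Duhamel integral of the difference only where both converge, and convergence is
  known from the critical bound.
\<close>

lemma duhamel_nonlin_contraction:
  assumes q: "qc \<le> q" "wt q < 1" and A: "0 < A" and B: "0 < B" and t: "0 < t"
    and v: "\<And>t. 0 < t \<Longrightarrow> weak_bound qc B (v t)" and cv: "cont_curve q v" "cont_curve qc v"
    and w: "\<And>t. 0 < t \<Longrightarrow> weak_bound qc B (w t)" and cw: "cont_curve q w" "cont_curve qc w"
    and vw: "\<And>t. 0 < t \<Longrightarrow> weak_bound q (A * t powr (- wt q)) (\<lambda>x. v t x - w t x)"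
  shows "weak_bound q (step_const q * B powr (p - 1) * A * t powr (- wt q))
     (\<lambda>x. duhamel t (\<lambda>\<tau>. nonlin (v \<tau>)) x - duhamel t (\<lambda>\<tau>. nonlin (w \<tau>)) x)"
proof -
  define M where "M = nonlin_const q * B powr (p - 1) * A"
  have M: "0 \<le> M" using nonlin_const_pos[OF q(1)] A by (simp add: M_def)
  have bd: "weak_bound (rexp q) (M * \<tau> powr (- wt q)) (\<lambda>y. nonlin (v \<tau>) y - nonlin (w \<tau>) y)" if "0 < \<tau>" for \<tau>
    using nonlin_diff_bound[OF q(1) _ B vw[OF that] v[OF that] w[OF that]] A that by (simp add: M_def mult.assoc)
  note cn = cont_curve_diff[OF nonlin_cont_curve[OF q(1) B v cv(1)] nonlin_cont_curve[OF q(1) B w cw(1)]]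
  have "weak_bound q (duhamel_const (rexp q) q (wt q) * M * t powr (- wt q)) (duhamel t (\<lambda>\<tau> y. nonlin (v \<tau>) y - nonlin (w \<tau>) y))"
    by (rule duhamel_bound(2)[OF rexp(1)[OF q(1)] cn rexp(3)[OF q(1)] rexp(2)[OF q(1)] wt_nonneg[OF q(1)] q(2) t M bd])
  then have wb: "weak_bound q (step_const q * B powr (p - 1) * A * t powr (- wt q)) (duhamel t (\<lambda>\<tau> y. nonlin (v \<tau>) y - nonlin (w \<tau>) y))"
    by (simp add: M_def step_const_def mult.assoc)
  have iv: "AE x in lborel. integrable lborel (\<lambda>s. indicator {0<..<t} s * conv (g s) (nonlin (v (t - s))) x)"
    by (rule duhamel_nonlin_integrable[OF B t v cv(2)])
  have iw: "AE x in lborel. integrable lborel (\<lambda>s. indicator {0<..<t} s * conv (g s) (nonlin (w (t - s))) x)"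
    by (rule duhamel_nonlin_integrable[OF B t w cw(2)])
  have q0: "qc \<le> qc" "wt qc < 1" by auto
  have "weak_bound qc (step_const qc * B powr (p - 1) * B * t powr (- wt qc)) (duhamel t (\<lambda>\<tau>. nonlin (v \<tau>)))"
    by (rule duhamel_nonlin_bound(2)[OF q0 B B t v cv(2)]) (use v in auto)
  moreover have "weak_bound qc (step_const qc * B powr (p - 1) * B * t powr (- wt qc)) (duhamel t (\<lambda>\<tau>. nonlin (w \<tau>)))"
    by (rule duhamel_nonlin_bound(2)[OF q0 B B t w cw(2)]) (use w in auto)
  ultimately have meas: "duhamel t (\<lambda>\<tau>. nonlin (v \<tau>)) \<in> borel_measurable borel" "duhamel t (\<lambda>\<tau>. nonlin (w \<tau>)) \<in> borel_measurable borel"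
    using weak_boundD(2) by auto
  show ?thesis
    by (rule weak_bound_AE_cong[OF wb _ duhamel_diff[OF rexp(1)[OF q(1)] nonlin_cont_curve[OF q(1) B v cv(1)] nonlin_cont_curve[OF q(1) B w cw(1)] iv iw]])
       (use meas in measurable)
qed

section \<open>Uniqueness of small mild solutions\<close>

text \<open>
  Each substitution into the equation halves the bound on the difference, which is at most \<open>2 B\<close> to
  begin with. Solutions are compared in the critical space alone.
\<close>

theorem mild_solution_unique:
  assumes B: "0 < B" and small: "step_const qc * B powr (p - 1) \<le> 1 / 2"
    and v: "\<And>t. 0 < t \<Longrightarrow> weak_bound qc B (v t)" and cv: "cont_curve qc v"
    and w: "\<And>t. 0 < t \<Longrightarrow> weak_bound qc B (w t)" and cw: "cont_curve qc w"
    and ev: "\<And>t. 0 < t \<Longrightarrow> AE x in lborel. v t x = conv (g t) u0 x + duhamel t (\<lambda>\<tau>. nonlin (v \<tau>)) x"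
    and ew: "\<And>t. 0 < t \<Longrightarrow> AE x in lborel. w t x = conv (g t) u0 x + duhamel t (\<lambda>\<tau>. nonlin (w \<tau>)) x"
    and t: "0 < t"
  shows "AE x in lborel. v t x = w t x"
proof -
  have iter: "weak_bound qc (2 * B * (1 / 2) ^ k) (\<lambda>x. v t x - w t x)" if "0 < t" for k t
    using that
  proof (induction k arbitrary: t)
    case 0
    show ?case using weak_bound_diff[OF v[OF 0] w[OF 0]] by simp
  next
    case (Suc k)
    have A: "0 < 2 * B * (1 / 2) ^ k" using B by simp
    have "weak_bound qc (step_const qc * B powr (p - 1) * (2 * B * (1 / 2) ^ k) * t powr (- wt qc))
       (\<lambda>x. duhamel t (\<lambda>\<tau>. nonlin (v \<tau>)) x - duhamel t (\<lambda>\<tau>. nonlin (w \<tau>)) x)"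
      by (rule duhamel_nonlin_contraction[OF order_refl _ A B Suc.prems v cv cv w cw cw]) (use Suc.IH in auto)
    then have "weak_bound qc (2 * B * (1 / 2) ^ Suc k) (\<lambda>x. duhamel t (\<lambda>\<tau>. nonlin (v \<tau>)) x - duhamel t (\<lambda>\<tau>. nonlin (w \<tau>)) x)"
    proof (rule weak_bound_mono)
      have "step_const qc * B powr (p - 1) * (2 * B * (1 / 2) ^ k) \<le> 1 / 2 * (2 * B * (1 / 2) ^ k)"
        using small A by (intro mult_right_mono) auto
      then show "step_const qc * B powr (p - 1) * (2 * B * (1 / 2) ^ k) * t powr (- wt qc) \<le> 2 * B * (1 / 2) ^ Suc k"
        using Suc.prems by simp
    qed
    then show ?case
    proof (rule weak_bound_AE_cong)
      note [measurable] = weak_boundD(2)[OF v[OF Suc.prems]] weak_boundD(2)[OF w[OF Suc.prems]]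
      show "(\<lambda>x. v t x - w t x) \<in> borel_measurable borel" by measurable
      show "AE x in lborel. duhamel t (\<lambda>\<tau>. nonlin (v \<tau>)) x - duhamel t (\<lambda>\<tau>. nonlin (w \<tau>)) x = v t x - w t x"
        using ev[OF Suc.prems] ew[OF Suc.prems] by eventually_elim simp
    qed
  qed
  have "weak_bound qc 0 (\<lambda>x. v t x - w t x)"
  proof (rule weak_bound_inf)
    fix e :: real assume e: "0 < e"
    have "(\<lambda>k. 2 * B * (1 / 2) ^ k) \<longlonglongrightarrow> 2 * B * 0" by (intro tendsto_mult tendsto_const LIMSEQ_power_zero) simp
    then have "eventually (\<lambda>k. 2 * B * (1 / 2) ^ k < e) sequentially" by (intro order_tendstoD(2)) (use e in auto)
    then obtain k where "2 * B * (1 / 2) ^ k < e" by (auto simp: eventually_sequentially)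
    then show "weak_bound qc (0 + e) (\<lambda>x. v t x - w t x)" using weak_bound_mono[OF iter[OF t, of k]] by simp
  qed simp
  from weak_bound_zero_AE[OF this] show ?thesis by eventually_elim simp
qed

section \<open>Self-similar mild solutions\<close>

text \<open>
  The curve \<open>t^(-\<gamma>/2m) U (t^(-1/2m) x)\<close> generated by a profile \<open>U\<close>, its value at time 1. It is invariant
  under the scaling of the equation at every point, not merely almost everywhere.
\<close>

definition selfsim :: "('a \<Rightarrow> real) \<Rightarrow> real \<Rightarrow> 'a \<Rightarrow> real" where
  "selfsim U t x = t powr (- (\<gamma> / (2 * m))) * U (t powr (- (1 / (2 * m))) *\<^sub>R x)"

lemma selfsim_bound:
  assumes U: "weak_bound q M U" and t: "0 < t"
  shows "weak_bound q (M * t powr (- wt q)) (selfsim U t)"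
proof -
  define c where "c = t powr (- (1 / (2 * m)))"
  have c: "0 < c" using t by (simp add: c_def)
  have "weak_bound q (\<bar>t powr (- (\<gamma> / (2 * m)))\<bar> * (M * c powr (- (real DIM('a) / q)))) (selfsim U t)"
    unfolding selfsim_def[abs_def] c_def[symmetric] by (intro weak_bound_cmult weak_bound_dilate[OF U c])
  moreover have "t powr (- (\<gamma> / (2 * m))) * c powr (- (real DIM('a) / q)) = t powr (- wt q)"
  proof -
    have "c powr (- (real DIM('a) / q)) = t powr (rate / q)" by (simp add: c_def powr_powr rate_def)
    then have "t powr (- (\<gamma> / (2 * m))) * c powr (- (real DIM('a) / q)) = t powr (- (rate / qc) + rate / q)"
      unfolding qc_exponents(1) by (simp flip: powr_add)
    also have "- (rate / qc) + rate / q = - wt q" by (simp add: wt_def algebra_simps)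
    finally show ?thesis .
  qed
  ultimately show ?thesis by (simp add: mult_ac)
qed

lemma selfsim_diff: "selfsim (\<lambda>x. U x - V x) t x = selfsim U t x - selfsim V t x"
  by (simp add: selfsim_def right_diff_distrib)

lemma selfsim_rescale:
  assumes \<sigma>: "0 < \<sigma>" and t: "0 < t"
  shows "selfsim U (\<sigma> powr (2 * m) * t) (\<sigma> *\<^sub>R x) = \<sigma> powr (- \<gamma>) * selfsim U t x"
proof -
  have m: "m \<noteq> 0" using m_pos by simp
  have 1: "(\<sigma> powr (2 * m) * t) powr (- (\<gamma> / (2 * m))) = \<sigma> powr (- \<gamma>) * t powr (- (\<gamma> / (2 * m)))"
    using \<sigma> t m by (simp add: powr_mult powr_powr)
  have 2: "(\<sigma> powr (2 * m) * t) powr (- (1 / (2 * m))) = t powr (- (1 / (2 * m))) / \<sigma>"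
    using \<sigma> t m by (simp add: powr_mult powr_powr powr_minus_divide)
  show ?thesis unfolding selfsim_def 1 2 using \<sigma> by simp
qed

text \<open>
  The exponent \<open>\<gamma>\<close> is chosen so that \<open>\<alpha> + \<gamma> p = \<gamma> + 2m\<close>: the forcing scales like \<open>\<partial>\<^sub>t u\<close>.
\<close>

lemma nonlin_selfsim_rescale:
  assumes \<sigma>: "0 < \<sigma>" and t: "0 < t"
  shows "nonlin (selfsim U (\<sigma> powr (2 * m) * t)) (\<sigma> *\<^sub>R x) = \<sigma> powr (- \<gamma> - 2 * m) * nonlin (selfsim U t) x"
proof -
  have "nonlin (selfsim U (\<sigma> powr (2 * m) * t)) (\<sigma> *\<^sub>R x)
     = (\<sigma> powr (- \<alpha>) * norm x powr (- \<alpha>)) * ((\<sigma> powr (- \<gamma>)) powr p * F (selfsim U t x))"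
    unfolding nonlin_def selfsim_rescale[OF \<sigma> t] using \<sigma> F_hom[of "\<sigma> powr (- \<gamma>)"] by (simp add: powr_mult)
  also have "\<dots> = (\<sigma> powr (- \<alpha>) * (\<sigma> powr (- \<gamma>)) powr p) * nonlin (selfsim U t) x"
    by (simp add: nonlin_def)
  also have "\<sigma> powr (- \<alpha>) * (\<sigma> powr (- \<gamma>)) powr p = \<sigma> powr (- \<alpha> - \<gamma> * p)"
    by (simp add: powr_powr flip: powr_add)
  also have "- \<alpha> - \<gamma> * p = - \<gamma> - 2 * m"
  proof -
    have "\<gamma> * (p - 1) = 2 * m - \<alpha>" using p_gt_1 by (simp add: \<gamma>_def)
    then show ?thesis by (simp add: algebra_simps)
  qed
  finally show ?thesis .
qed

text \<open>
  The right-hand side of the integral equation at \<open>t = 1\<close>.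
\<close>

definition profile_map :: "('a \<Rightarrow> real) \<Rightarrow> ('a \<Rightarrow> real) \<Rightarrow> 'a \<Rightarrow> real" where
  "profile_map u0 U x = conv (g 1) u0 x + duhamel 1 (\<lambda>\<tau>. nonlin (selfsim U \<tau>)) x"

text \<open>
  The integral operator commutes with the scaling, so its value at time 1 determines it at all
  times. Homogeneity of \<open>u0\<close> holds only almost everywhere, but the convolution does not see null
  sets, and the identity is pointwise.
\<close>

lemma selfsim_profile_map:
  assumes u0[measurable]: "u0 \<in> borel_measurable borel" and U[measurable]: "U \<in> borel_measurable borel"
    and hom: "\<And>\<sigma>. 0 < \<sigma> \<Longrightarrow> AE x in lborel. u0 (\<sigma> *\<^sub>R x) = \<sigma> powr (- \<gamma>) * u0 x"
    and t: "0 < t"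
  shows "selfsim (profile_map u0 U) t x = conv (g t) u0 x + duhamel t (\<lambda>\<tau>. nonlin (selfsim U \<tau>)) x"
proof -
  define \<sigma> where "\<sigma> = t powr (1 / (2 * m))"
  have \<sigma>: "0 < \<sigma>" using t by (simp add: \<sigma>_def)
  have \<sigma>t: "\<sigma> powr (2 * m) = t" using t m_pos by (simp add: \<sigma>_def powr_powr)
  have inv: "t powr (- (1 / (2 * m))) = 1 / \<sigma>" using t by (simp add: \<sigma>_def powr_minus_divide)
  have \<sigma>\<gamma>: "t powr (- (\<gamma> / (2 * m))) = \<sigma> powr (- \<gamma>)" by (simp add: \<sigma>_def powr_powr)
  define y where "y = (1 / \<sigma>) *\<^sub>R x"
  have x: "x = \<sigma> *\<^sub>R y" using \<sigma> by (simp add: y_def)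
  have gm: "g s \<in> borel_measurable borel" if "0 < s" for s by (rule kernel_measurable[OF that])
  have ssm[measurable]: "selfsim U \<tau> \<in> borel_measurable borel" for \<tau> unfolding selfsim_def[abs_def] by measurable
  have lin: "conv (g t) u0 x = \<sigma> powr (- \<gamma>) * conv (g 1) u0 y"
  proof -
    have "conv (g t) u0 x = conv (g 1) (\<lambda>z. u0 (\<sigma> *\<^sub>R z)) y"
      using conv_rescale[OF \<sigma> zero_less_one u0, of y] by (simp add: \<sigma>t x)
    also have "\<dots> = conv (g 1) (\<lambda>z. \<sigma> powr (- \<gamma>) * u0 z) y"
      by (rule conv_AE_cong[OF gm _ _ hom[OF \<sigma>]]) (simp, measurable)
    finally show ?thesis by (simp add: conv_cmult)
  qed
  have "duhamel t (\<lambda>\<tau>. nonlin (selfsim U \<tau>)) x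
     = \<bar>t\<bar> *\<^sub>R (\<integral>s. indicator {0<..<t} (0 + t * s) * conv (g (0 + t * s)) (nonlin (selfsim U (t - (0 + t * s)))) x \<partial>lborel)"
    unfolding duhamel_def by (rule lborel_integral_real_affine) (use t in simp)
  also have "\<dots> = t * (\<integral>s. \<sigma> powr (- \<gamma> - 2 * m) * (indicator {0<..<1} s * conv (g s) (nonlin (selfsim U (1 - s))) y) \<partial>lborel)"
  proof -
    have "indicator {0<..<t} (0 + t * s) * conv (g (0 + t * s)) (nonlin (selfsim U (t - (0 + t * s)))) x
       = \<sigma> powr (- \<gamma> - 2 * m) * (indicator {0<..<1} s * conv (g s) (nonlin (selfsim U (1 - s))) y)" for s
    proof (cases "0 < s \<and> s < 1")
      case True
      have "conv (g (t * s)) (nonlin (selfsim U (t * (1 - s)))) x = conv (g s) (\<lambda>z. nonlin (selfsim U (t * (1 - s))) (\<sigma> *\<^sub>R z)) y"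
        using conv_rescale[OF \<sigma> _ nonlin_measurable[OF ssm], of s "t * (1 - s)" y] True by (simp add: \<sigma>t x)
      also have "(\<lambda>z. nonlin (selfsim U (t * (1 - s))) (\<sigma> *\<^sub>R z)) = (\<lambda>z. \<sigma> powr (- \<gamma> - 2 * m) * nonlin (selfsim U (1 - s)) z)"
        using nonlin_selfsim_rescale[OF \<sigma>, of "1 - s" U] True by (simp add: \<sigma>t)
      finally have "conv (g (t * s)) (nonlin (selfsim U (t * (1 - s)))) x = \<sigma> powr (- \<gamma> - 2 * m) * conv (g s) (nonlin (selfsim U (1 - s))) y"
        by (simp add: conv_cmult)
      moreover have "t - t * s = t * (1 - s)" by (simp add: algebra_simps)
      moreover have "t * s < t" using True t by simp
      ultimately show ?thesis using True t by simp
    next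
      case False
      then have "\<not> (0 < t * s \<and> t * s < t)" using t by (auto simp: zero_less_mult_iff)
      then show ?thesis using False by auto
    qed
    then show ?thesis using t by simp
  qed
  also have "\<dots> = (t * \<sigma> powr (- \<gamma> - 2 * m)) * duhamel 1 (\<lambda>\<tau>. nonlin (selfsim U \<tau>)) y"
    by (simp add: duhamel_def)
  also have "t * \<sigma> powr (- \<gamma> - 2 * m) = \<sigma> powr (- \<gamma>)"
    unfolding \<sigma>t[symmetric] using \<sigma> by (simp flip: powr_add)
  finally have du: "duhamel t (\<lambda>\<tau>. nonlin (selfsim U \<tau>)) x = \<sigma> powr (- \<gamma>) * duhamel 1 (\<lambda>\<tau>. nonlin (selfsim U \<tau>)) y" .
  show ?thesis unfolding lin du selfsim_def profile_map_def inv \<sigma>\<gamma> y_def[symmetric] by (simp add: distrib_left)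
qed

text \<open>
  The norm bound for \<open>g\<^sub>1 *\<close> from \<open>L^(qc,\<infinity>)\<close> to \<open>L^(q,\<infinity>)\<close> given by \<open>heat_bound\<close>.
\<close>

definition heat_const :: "real \<Rightarrow> real" where
  "heat_const q = qc * (G1 powr (1 - (1 / qc - 1 / q)) * G2 powr (1 / qc - 1 / q))"

lemma heat_const_pos: "0 < heat_const q"
  unfolding heat_const_def using qc_bounds G_pos by simp

lemma gain_exponent:
  assumes q: "qc \<le> q"
  shows "0 \<le> 1 / qc - 1 / q" "1 / qc - 1 / q < 1" "1 / qc - 1 / q \<le> 1 / qc" "1 / q = 1 / qc - (1 / qc - 1 / q)"
proof -
  show "0 \<le> 1 / qc - 1 / q" using q qc_bounds by (simp add: frac_le)
  have "0 < 1 / q" using q qc_bounds by simp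
  moreover have "1 / qc < 1" using qc_bounds by simp
  ultimately show "1 / qc - 1 / q < 1" "1 / qc - 1 / q \<le> 1 / qc" by linarith+
qed simp

primrec picard :: "('a \<Rightarrow> real) \<Rightarrow> nat \<Rightarrow> 'a \<Rightarrow> real" where
  "picard u0 0 = (\<lambda>x. 0)"
| "picard u0 (Suc k) = profile_map u0 (picard u0 k)"

text \<open>
  Picard iteration for the profile. As the iterates generate self-similar curves, a bound on the
  profile is a bound on the whole curve with weight \<open>t^(-wt q)\<close>, and the contraction estimate at
  \<open>t = 1\<close> closes the iteration. It is run in the critical space and in \<open>L^(q,\<infinity>)\<close> at the same time, so
  that one limit \<open>U\<close> serves both.
\<close>

theorem selfsimilar_solution_exists:
  assumes q: "qc \<le> q" "wt q < 1" and u0: "weak_bound qc \<epsilon> u0" and \<epsilon>: "0 < \<epsilon>"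
    and hom: "\<And>\<sigma>. 0 < \<sigma> \<Longrightarrow> AE x in lborel. u0 (\<sigma> *\<^sub>R x) = \<sigma> powr (- \<gamma>) * u0 x"
    and small: "step_const qc * (2 * heat_const qc * \<epsilon>) powr (p - 1) \<le> 1 / 2"
      "step_const q * (2 * heat_const qc * \<epsilon>) powr (p - 1) \<le> 1 / 2"
  obtains U where "weak_bound qc (2 * heat_const qc * \<epsilon>) U" "weak_bound q (2 * heat_const q * \<epsilon>) U"
    "cont_curve qc (selfsim U)" "cont_curve q (selfsim U)"
    "\<And>t. 0 < t \<Longrightarrow> AE x in lborel. selfsim U t x = conv (g t) u0 x + duhamel t (\<lambda>\<tau>. nonlin (selfsim U \<tau>)) x"
proof -
  note u0m[measurable] = weak_boundD(2)[OF u0]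
  define B where "B = 2 * heat_const qc * \<epsilon>"
  have B: "0 < B" using heat_const_pos \<epsilon> by (simp add: B_def)
  define V where "V = picard u0"
  have V0: "V 0 = (\<lambda>x. 0)" and VS: "V (Suc k) = profile_map u0 (V k)" for k by (auto simp: V_def)
  have ss0: "selfsim (\<lambda>x. 0) = (\<lambda>t x. 0)" by (auto simp: selfsim_def fun_eq_iff)
  have heat1: "weak_bound q' (heat_const q' * \<epsilon>) (conv (g 1) u0)" if q': "qc \<le> q'" for q'
  proof -
    note e = gain_exponent[OF q']
    show ?thesis
      using heat_bound[OF qc_bounds(1) u0 zero_less_one e(1,3,4)] by (simp add: heat_const_def mult_ac)
  qed
  have zero: "weak_bound q' e (\<lambda>x::'a. 0)" if "0 \<le> e" for q' e
    by (rule weak_bound_mono[OF weak_bound_zero that])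
  have const0: "cont_curve q' (\<lambda>t (x::'a). 0)" for q' :: real
    unfolding cont_curve_def using zero by (auto intro!: exI[of _ 1])
  \<comment> \<open>The increments halve at each step, so the partial sums \<open>1 - (1/2)^k\<close> of the geometric series keep
    all iterates in the ball of radius \<open>B\<close> on which the contraction estimate holds.\<close>
  have good: "V k \<in> borel_measurable borel \<and> weak_bound qc (B * (1 - (1 / 2) ^ k)) (V k)
      \<and> (\<forall>q'\<in>{qc, q}. cont_curve q' (selfsim (V k)) \<and> weak_bound q' (heat_const q' * \<epsilon> * (1 / 2) ^ k) (\<lambda>x. V (Suc k) x - V k x)
         \<and> weak_bound q' (2 * heat_const q' * \<epsilon> * (1 - (1 / 2) ^ k)) (V k))" for k
  proof (induction k)
    case 0
    have "profile_map u0 (\<lambda>x. 0) = conv (g 1) u0"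
      unfolding profile_map_def ss0 nonlin_zero duhamel_def conv_def by simp
    then have "V (Suc 0) = conv (g 1) u0" by (simp only: VS V0)
    then show ?case using heat1 q(1) const0 by (auto simp: V0 ss0 weak_bound_zero)
  next
    case (Suc k)
    have IHm[measurable]: "V k \<in> borel_measurable borel" using Suc by blast
    have IHb: "weak_bound qc B (V k)"
    proof (rule weak_bound_mono)
      show "weak_bound qc (B * (1 - (1 / 2) ^ k)) (V k)" using Suc by blast
      show "B * (1 - (1 / 2) ^ k) \<le> B" using B by (simp add: mult_le_cancel_left1)
    qed
    have next_bd: "weak_bound q' (2 * heat_const q' * \<epsilon> * (1 - (1 / 2) ^ Suc k)) (V (Suc k))" if q': "q' \<in> {qc, q}" for q'
    proof -
      have "weak_bound q' (2 * heat_const q' * \<epsilon> * (1 - (1 / 2) ^ k) + heat_const q' * \<epsilon> * (1 / 2) ^ k) (\<lambda>x. V k x + (V (Suc k) x - V k x))"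
        using Suc q' by (intro weak_bound_add) blast+
      then show ?thesis by (simp add: algebra_simps)
    qed
    have nb: "weak_bound qc (B * (1 - (1 / 2) ^ Suc k)) (V (Suc k))" using next_bd[of qc] by (simp add: B_def)
    have nB: "weak_bound qc B (V (Suc k))"
      by (rule weak_bound_mono[OF nb]) (use B in \<open>simp add: mult_le_cancel_left1 del: power_Suc\<close>)
    have nm[measurable]: "V (Suc k) \<in> borel_measurable borel" by (rule weak_boundD(2)[OF nb])
    have ss_eq: "selfsim (V (Suc k)) t x = conv (g t) u0 x + duhamel t (\<lambda>\<tau>. nonlin (selfsim (V k) \<tau>)) x" if "0 < t" for t x
      unfolding VS by (rule selfsim_profile_map[OF u0m IHm hom that])
    have bk: "weak_bound qc B (selfsim (V k) t)" "weak_bound qc B (selfsim (V (Suc k)) t)" if "0 < t" for t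
      using selfsim_bound[OF IHb that] selfsim_bound[OF nB that] that by simp_all
    have cc: "cont_curve q' (selfsim (V (Suc k)))" if q': "q' \<in> {qc, q}" for q'
    proof -
      have q1: "qc \<le> q'" "wt q' < 1" using q' q by auto
      define A where "A = 2 * heat_const q' * \<epsilon>"
      have A: "0 < A" using heat_const_pos[of q'] \<epsilon> by (simp add: A_def)
      have "weak_bound q' A (V k)"
      proof (rule weak_bound_mono)
        show "weak_bound q' (A * (1 - (1 / 2) ^ k)) (V k)" unfolding A_def using Suc q' by blast
        show "A * (1 - (1 / 2) ^ k) \<le> A" using A by (simp add: mult_le_cancel_left1)
      qed
      then have vq: "weak_bound q' (A * t powr (- wt q')) (selfsim (V k) t)" if "0 < t" for t
        using selfsim_bound that by blast
      have ck: "cont_curve q' (selfsim (V k))" using Suc q' by blast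
      have d: "cont_curve q' (\<lambda>t. duhamel t (\<lambda>\<tau>. nonlin (selfsim (V k) \<tau>)))"
        by (rule duhamel_nonlin_bound(3)[OF q1 A B zero_less_one bk(1) ck vq])
      note e = gain_exponent[OF q1(1)]
      have "cont_curve q' (\<lambda>t. conv (g t) u0)"
        by (rule heat_cont_curve[OF qc_bounds(1) u0 e])
      from cont_curve_add[OF this d] show ?thesis
        by (rule cont_curve_cong) (use ss_eq in \<open>intro ext\<close>)
    qed
    have dd: "weak_bound q' (heat_const q' * \<epsilon> * (1 / 2) ^ Suc k) (\<lambda>x. V (Suc (Suc k)) x - V (Suc k) x)" if q': "q' \<in> {qc, q}" for q'
    proof -
      have q1: "qc \<le> q'" "wt q' < 1" using q' q by auto
      define A where "A = heat_const q' * \<epsilon> * (1 / 2) ^ k"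
      have A: "0 < A" using heat_const_pos[of q'] \<epsilon> by (simp add: A_def)
      have "weak_bound q' A (\<lambda>x. V (Suc k) x - V k x)" unfolding A_def using Suc q' by blast
      then have vw: "weak_bound q' (A * t powr (- wt q')) (\<lambda>x. selfsim (V (Suc k)) t x - selfsim (V k) t x)" if "0 < t" for t
        using selfsim_bound[OF _ that] by (simp flip: selfsim_diff)
      have ck: "cont_curve q' (selfsim (V k))" "cont_curve qc (selfsim (V k))" using Suc q' by blast+
      have "weak_bound q' (step_const q' * B powr (p - 1) * A * 1 powr (- wt q'))
         (\<lambda>x. duhamel 1 (\<lambda>\<tau>. nonlin (selfsim (V (Suc k)) \<tau>)) x - duhamel 1 (\<lambda>\<tau>. nonlin (selfsim (V k) \<tau>)) x)"
        by (rule duhamel_nonlin_contraction[OF q1 A B zero_less_one bk(2) cc[OF q'] cc[of qc] bk(1) ck vw]) auto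
      moreover have "(\<lambda>x. duhamel 1 (\<lambda>\<tau>. nonlin (selfsim (V (Suc k)) \<tau>)) x - duhamel 1 (\<lambda>\<tau>. nonlin (selfsim (V k) \<tau>)) x)
         = (\<lambda>x. V (Suc (Suc k)) x - V (Suc k) x)"
        unfolding VS[of "Suc k"] by (subst (2) VS) (simp add: profile_map_def)
      ultimately have "weak_bound q' (step_const q' * B powr (p - 1) * A) (\<lambda>x. V (Suc (Suc k)) x - V (Suc k) x)" by simp
      moreover have "step_const q' * B powr (p - 1) * A \<le> 1 / 2 * A"
        using q' small A unfolding B_def by (intro mult_right_mono) auto
      ultimately show ?thesis by (rule weak_bound_mono[THEN weak_bound_mono]) (simp add: A_def)
    qed
    show ?case using nm nb cc dd next_bd by blast
  qed
  define U where "U x = lim (\<lambda>k. V k x)" for x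
  have Vm: "V k \<in> borel_measurable borel" for k using good by blast
  have lim: "weak_bound q' (2 * (heat_const q' * \<epsilon>) * (1 / 2) ^ k) (\<lambda>x. U x - V k x)" if "q' \<in> {qc, q}" for q' k
    unfolding U_def by (rule weak_bound_geometric_limit[OF Vm]) (use good that in blast)
  have Ub: "weak_bound q' (2 * heat_const q' * \<epsilon>) U" if "q' \<in> {qc, q}" for q'
    using lim[OF that, of 0] by (simp add: V0 mult.assoc)
  have UB: "weak_bound qc B U" using Ub[of qc] by (simp add: B_def)
  have Um[measurable]: "U \<in> borel_measurable borel" by (rule weak_boundD(2)[OF UB])
  have VB: "weak_bound qc B (V k)" for k
  proof (rule weak_bound_mono)
    show "weak_bound qc (B * (1 - (1 / 2) ^ k)) (V k)" using good by blast
    show "B * (1 - (1 / 2) ^ k) \<le> B" using B by (simp add: mult_le_cancel_left1)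
  qed
  have e0: "(\<lambda>k. c * (1 / 2) ^ k) \<longlonglongrightarrow> 0" for c :: real
  proof -
    have "(\<lambda>k. c * (1 / 2) ^ k) \<longlonglongrightarrow> c * 0" by (intro tendsto_mult tendsto_const LIMSEQ_power_zero) simp
    then show ?thesis by simp
  qed
  have limt: "weak_bound q' (2 * (heat_const q' * \<epsilon>) * (1 / 2) ^ k * t powr (- wt q')) (\<lambda>x. selfsim U t x - selfsim (V k) t x)"
    if "q' \<in> {qc, q}" "0 < t" for q' k t
    using selfsim_bound[OF lim[OF that(1), of k] that(2)] by (simp flip: selfsim_diff)
  have cU: "cont_curve q' (selfsim U)" if q': "q' \<in> {qc, q}" for q'
  proof (rule cont_curve_limit[where v = "\<lambda>k. selfsim (V k)" and \<delta> = "wt q'" and e = "\<lambda>k. 2 * (heat_const q' * \<epsilon>) * (1 / 2) ^ k"])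
    show "cont_curve q' (selfsim (V k))" for k using good q' by blast
    show "0 \<le> wt q'" using q' q(1) wt_nonneg by auto
    show "selfsim U t \<in> borel_measurable borel" for t unfolding selfsim_def[abs_def] by measurable
  qed (rule limt[OF q'], assumption, rule e0)
  have UBt: "weak_bound qc B (selfsim U t)" "weak_bound qc B (selfsim (V k) t)" if "0 < t" for t k
    using selfsim_bound[OF UB that] selfsim_bound[OF VB that] that by simp_all
  \<comment> \<open>Both \<open>U - V (k + 1)\<close> and \<open>V (k + 1) - profile_map u0 U\<close> are of order \<open>(1/2)^k\<close>.\<close>
  have "weak_bound qc 0 (\<lambda>x. U x - profile_map u0 U x)"
  proof (rule weak_bound_inf)
    fix e :: real assume e: "0 < e"
    define c where "c = 2 * (heat_const qc * \<epsilon>)"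
    have c: "0 < c" using heat_const_pos[of qc] \<epsilon> by (simp add: c_def)
    have "eventually (\<lambda>k. (2 * c) * (1 / 2) ^ k < e) sequentially" by (rule order_tendstoD(2)[OF e0 e])
    then obtain k where k: "(2 * c) * (1 / 2) ^ k < e" by (auto simp: eventually_sequentially)
    define A where "A = c * (1 / 2) ^ k"
    have A: "0 < A" using c by (simp add: A_def)
    have "weak_bound qc (step_const qc * B powr (p - 1) * A * 1 powr (- wt qc))
         (\<lambda>x. duhamel 1 (\<lambda>\<tau>. nonlin (selfsim (V k) \<tau>)) x - duhamel 1 (\<lambda>\<tau>. nonlin (selfsim U \<tau>)) x)"
    proof (rule duhamel_nonlin_contraction[OF order_refl _ A B zero_less_one UBt(2) _ _ UBt(1)])
      show "cont_curve qc (selfsim (V k))" "cont_curve qc (selfsim (V k))" using good by blast+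
      show "cont_curve qc (selfsim U)" "cont_curve qc (selfsim U)" using cU by blast+
      show "weak_bound qc (A * t powr (- wt qc)) (\<lambda>x. selfsim (V k) t x - selfsim U t x)" if "0 < t" for t
        unfolding A_def c_def by (rule weak_bound_minus_commute) (rule limt, use that in auto)
    qed auto
    then have "weak_bound qc (1 / 2 * A) (\<lambda>x. V (Suc k) x - profile_map u0 U x)"
    proof (rule weak_bound_mono[THEN weak_bound_AE_cong])
      show "step_const qc * B powr (p - 1) * A * 1 powr (- wt qc) \<le> 1 / 2 * A"
        using small(1) A unfolding B_def by simp
      show "AE x in lborel. duhamel 1 (\<lambda>\<tau>. nonlin (selfsim (V k) \<tau>)) x - duhamel 1 (\<lambda>\<tau>. nonlin (selfsim U \<tau>)) x
         = V (Suc k) x - profile_map u0 U x" by (simp add: VS profile_map_def)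
      have "duhamel 1 (\<lambda>\<tau>. nonlin (selfsim U \<tau>)) \<in> borel_measurable borel"
        by (rule weak_boundD(2)[OF duhamel_nonlin_bound(2)[OF order_refl _ B B zero_less_one UBt(1) cU]]) (use UBt(1) in auto)
      moreover have "g 1 \<in> borel_measurable borel" by (rule kernel_measurable) simp
      ultimately show "(\<lambda>x. V (Suc k) x - profile_map u0 U x) \<in> borel_measurable borel"
        unfolding profile_map_def using Vm[of "Suc k"] by measurable
    qed
    from weak_bound_add[OF lim[of qc "Suc k"] this]
    have "weak_bound qc (c * (1 / 2) ^ Suc k + 1 / 2 * A) (\<lambda>x. U x - profile_map u0 U x)" by (simp add: c_def)
    then show "weak_bound qc (0 + e) (\<lambda>x. U x - profile_map u0 U x)"
    proof (rule weak_bound_mono)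
      have "0 < c * (1 / 2) ^ k" using c by simp
      then show "c * (1 / 2) ^ Suc k + 1 / 2 * A \<le> 0 + e" using k by (simp add: A_def)
    qed
  qed simp
  from weak_bound_zero_AE[OF this] have fix1: "AE x in lborel. U x = profile_map u0 U x" by eventually_elim simp
  have eqn: "AE x in lborel. selfsim U t x = conv (g t) u0 x + duhamel t (\<lambda>\<tau>. nonlin (selfsim U \<tau>)) x" if t: "0 < t" for t
  proof -
    have "t powr (- (1 / (2 * m))) \<noteq> 0" using t by simp
    from AE_lborel_affine[OF this fix1, of 0]
    have "AE x in lborel. selfsim U t x = selfsim (profile_map u0 U) t x"
      by eventually_elim (simp add: selfsim_def)
    then show ?thesis using selfsim_profile_map[OF u0m Um hom t] by simp
  qed
  show thesis by (rule that[OF _ _ _ _ eqn]) (use Ub cU in auto)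
qed

end

section \<open>Passage to Lebesgue classes\<close>

lemma borel_imp_lebesgue_measurable:
  fixes f :: "'a::euclidean_space \<Rightarrow> 'b::topological_space"
  shows "f \<in> borel_measurable borel \<Longrightarrow> f \<in> borel_measurable lebesgue"
  by (rule measurable_completion) simp

lemma borel_representative:
  fixes f :: "'a::euclidean_space \<Rightarrow> real"
  assumes "f \<in> borel_measurable lebesgue"
  obtains f' where "f' \<in> borel_measurable borel" "AE x in lebesgue. f x = f' x"
  using completion_ex_borel_measurable_real[OF assms] by (auto simp: AE_completion_iff)

lemma max_rearrangement_cong:
  fixes f g :: "real^'n \<Rightarrow> real"
  assumes [measurable]: "f \<in> borel_measurable lebesgue" "g \<in> borel_measurable lebesgue"
    and eq: "AE x in lebesgue. f x = g x"
  shows "max_rearrangement f = max_rearrangement g"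
proof -
  have "{x\<in>space lebesgue. \<tau> < \<bar>f x\<bar>} \<in> sets lebesgue" "{x\<in>space lebesgue. \<tau> < \<bar>g x\<bar>} \<in> sets lebesgue" for \<tau>
    by measurable
  then have m: "{x. \<tau> < \<bar>f x\<bar>} \<in> sets lebesgue" "{x. \<tau> < \<bar>g x\<bar>} \<in> sets lebesgue" for \<tau>
    by simp_all
  have "emeasure lebesgue {x. \<tau> < \<bar>f x\<bar>} = emeasure lebesgue {x. \<tau> < \<bar>g x\<bar>}" for \<tau>
  proof (rule emeasure_eq_AE)
    show "AE x in lebesgue. (x \<in> {x. \<tau> < \<bar>f x\<bar>}) = (x \<in> {x. \<tau> < \<bar>g x\<bar>})" using eq by eventually_elim simp
  qed (rule m)+
  then show ?thesis by (intro ext) (simp add: max_rearrangement_def rearrangement_def)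
qed

lemma weak_norm_AE_cong:
  fixes f g :: "real^'n \<Rightarrow> real"
  assumes "f \<in> borel_measurable lebesgue" "g \<in> borel_measurable lebesgue" "AE x in lebesgue. f x = g x"
  shows "weak_norm q f = weak_norm q g"
  using max_rearrangement_cong[OF assms] by (simp add: weak_norm_def)

lemma Lorentz_one_AE_cong:
  fixes f g :: "real^'n \<Rightarrow> real"
  assumes "f \<in> borel_measurable lebesgue" "g \<in> borel_measurable lebesgue" "AE x in lebesgue. f x = g x"
  shows "f \<in> Lorentz_one r \<longleftrightarrow> g \<in> Lorentz_one r"
  using max_rearrangement_cong[OF assms] assms by (simp add: Lorentz_one_def)

lemma weak_bound_imp_weak_Lebesgue:
  fixes f :: "real^'n \<Rightarrow> real"
  assumes "1 < q" "weak_bound q M f"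
  shows "f \<in> weak_Lebesgue q"
proof -
  have "weak_norm q f < \<infinity>" using weak_norm_le[OF assms] by (rule le_less_trans) simp
  then show ?thesis
    unfolding weak_Lebesgue_def using borel_imp_lebesgue_measurable[OF weak_boundD(2)[OF assms(2)]] by simp
qed

lemma weak_norm_tendsto_zero:
  fixes v :: "real \<Rightarrow> real^'n \<Rightarrow> real"
  assumes q: "1 < q" and v: "cont_curve q v" and s: "0 < s"
  shows "((\<lambda>t. weak_norm q (\<lambda>x. v t x - v s x)) \<longlongrightarrow> 0) (at s)"
proof (rule order_tendstoI)
  fix a :: ennreal assume "0 < a"
  then obtain e :: real where e: "0 < e" "ennreal e < a"
  proof (cases a rule: ennreal_cases)
    case (real r)
    then have "0 < r" using \<open>0 < a\<close> by simp
    then show thesis using real by (intro that[of "r / 2"]) (auto simp: ennreal_less_iff)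
  next
    case top
    then show thesis by (intro that[of 1]) auto
  qed
  have e': "0 < (q - 1) / q * e" using q e by simp
  obtain d where d: "0 < d" "\<And>t. 0 < t \<Longrightarrow> \<bar>t - s\<bar> < d \<Longrightarrow> weak_bound q ((q - 1) / q * e) (\<lambda>y. v t y - v s y)"
    using cont_curve_near[OF v s e'] by blast
  show "eventually (\<lambda>t. weak_norm q (\<lambda>x. v t x - v s x) < a) (at s)"
    unfolding eventually_at
  proof (intro exI[of _ "min d s"] conjI ballI impI)
    show "0 < min d s" using d s by simp
    fix t assume "t \<noteq> s \<and> dist t s < min d s"
    then have t: "0 < t" "\<bar>t - s\<bar> < d" by (auto simp: dist_real_def)
    have "weak_norm q (\<lambda>x. v t x - v s x) \<le> ennreal (q / (q - 1) * ((q - 1) / q * e))"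
      by (rule weak_norm_le[OF q d(2)[OF t]])
    also have "q / (q - 1) * ((q - 1) / q * e) = e" using q by simp
    finally show "weak_norm q (\<lambda>x. v t x - v s x) < a" using e(2) by simp
  qed
qed simp

lemma cont_curve_in_Cb_pos:
  fixes v :: "real \<Rightarrow> real^'n \<Rightarrow> real"
  assumes q: "1 < q" and v: "cont_curve q v" and b: "\<And>t. 0 < t \<Longrightarrow> weak_bound q M (v t)"
  shows "v \<in> Cb_pos q" "sup_norm q v \<le> ennreal (q / (q - 1) * M)"
proof -
  show s: "sup_norm q v \<le> ennreal (q / (q - 1) * M)"
    unfolding sup_norm_def by (intro SUP_least weak_norm_le[OF q b]) simp
  then have "sup_norm q v < \<infinity>" by (rule le_less_trans) simp
  then show "v \<in> Cb_pos q"
    unfolding Cb_pos_def using weak_bound_imp_weak_Lebesgue[OF q b] weak_norm_tendsto_zero[OF q v] by simp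
qed

text \<open>
  Replace each value of the curve by a Borel function in its class; the constant of the bound is
  unchanged because \<open>weak_bound_of_weak_norm\<close> loses nothing.
\<close>

lemma Cb_representative:
  fixes v :: "real \<Rightarrow> real^'n \<Rightarrow> real"
  assumes q: "1 < q" and v: "v \<in> Cb q" and s: "sup_norm q v \<le> ennreal B" and B: "0 \<le> B"
  obtains v' where "\<And>t. 0 < t \<Longrightarrow> AE x in lebesgue. v t x = v' t x"
    "\<And>t. 0 < t \<Longrightarrow> weak_bound q B (v' t)" "cont_curve q v'"
proof -
  have vm: "v t \<in> borel_measurable lebesgue" if "0 < t" for t
    using v that unfolding Cb_def Cb_pos_def weak_Lebesgue_def by blast
  have "\<forall>t. \<exists>f. 0 < t \<longrightarrow> f \<in> borel_measurable borel \<and> (AE x in lebesgue. v t x = f x)"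
    using borel_representative[OF vm] by metis
  then obtain v' where v': "\<And>t. 0 < t \<Longrightarrow> v' t \<in> borel_measurable borel" "\<And>t. 0 < t \<Longrightarrow> AE x in lebesgue. v t x = v' t x"
    by metis
  have b: "weak_bound q B (v' t)" if t: "0 < t" for t
  proof (rule weak_bound_of_weak_norm[OF v'(1)[OF t] _ B])
    have "weak_norm q (v' t) = weak_norm q (v t)"
      by (rule weak_norm_AE_cong[OF vm[OF t] borel_imp_lebesgue_measurable[OF v'(1)[OF t]] v'(2)[OF t], symmetric])
    also have "\<dots> \<le> sup_norm q v" unfolding sup_norm_def using t by (intro SUP_upper) simp
    finally show "weak_norm q (v' t) \<le> ennreal B" using s by simp
  qed
  have "cont_curve q v'"
    unfolding cont_curve_def
  proof (intro conjI allI impI)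
    fix \<tau> :: real assume t: "0 < \<tau>"
    show "\<exists>M. weak_bound q M (v' \<tau>)" using b[OF t] by blast
    fix e :: real assume e: "0 < e"
    have "((\<lambda>t. weak_norm q (\<lambda>x. v t x - v \<tau> x)) \<longlongrightarrow> 0) (at \<tau>)"
      using v t unfolding Cb_def Cb_pos_def by blast
    then have "eventually (\<lambda>t. weak_norm q (\<lambda>x. v t x - v \<tau> x) < ennreal e) (at \<tau>)"
      by (rule order_tendstoD(2)) (use e in simp)
    then obtain d where d: "0 < d" "\<And>t. t \<noteq> \<tau> \<Longrightarrow> dist t \<tau> < d \<Longrightarrow> weak_norm q (\<lambda>x. v t x - v \<tau> x) < ennreal e"
      unfolding eventually_at by blast
    show "\<exists>d>0. \<forall>\<tau>'>0. \<bar>\<tau>' - \<tau>\<bar> < d \<longrightarrow> weak_bound q e (\<lambda>y. v' \<tau>' y - v' \<tau> y)"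
    proof (intro exI[of _ d] conjI allI impI d(1))
      fix \<tau>' assume t': "0 < \<tau>'" "\<bar>\<tau>' - \<tau>\<bar> < d"
      note [measurable] = v'(1)[OF t] v'(1)[OF t'(1)]
      have m: "(\<lambda>y. v' \<tau>' y - v' \<tau> y) \<in> borel_measurable borel" by measurable
      show "weak_bound q e (\<lambda>y. v' \<tau>' y - v' \<tau> y)"
      proof (cases "\<tau>' = \<tau>")
        case True
        then show ?thesis using weak_bound_mono[OF weak_bound_zero, of e] e by simp
      next
        case False
        have "weak_norm q (\<lambda>y. v' \<tau>' y - v' \<tau> y) = weak_norm q (\<lambda>y. v \<tau>' y - v \<tau> y)"
        proof (rule weak_norm_AE_cong)
          show "(\<lambda>y. v \<tau>' y - v \<tau> y) \<in> borel_measurable lebesgue"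
            using vm[OF t] vm[OF t'(1)] by (rule borel_measurable_diff[rotated])
          show "AE x in lebesgue. v' \<tau>' x - v' \<tau> x = v \<tau>' x - v \<tau> x"
            using v'(2)[OF t] v'(2)[OF t'(1)] by eventually_elim simp
        qed (rule borel_imp_lebesgue_measurable[OF m])
        also have "\<dots> < ennreal e" by (rule d(2)[OF False]) (use t' in \<open>simp add: dist_real_def\<close>)
        finally show ?thesis by (intro weak_bound_of_weak_norm[OF m]) (use e in auto)
      qed
    qed
  qed
  with v'(2) b show thesis by (rule that)
qed

section \<open>The integral equation for the heat semigroup\<close>

locale heat_problem = hardy_henon "heat_kernel m :: real \<Rightarrow> real^'n \<Rightarrow> real" m G1 G2 \<alpha> p C F
  for m G1 G2 \<alpha> p C :: real and F :: "real \<Rightarrow> real"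
begin

lemma heat_semigroup_eq_conv:
  fixes f :: "real^'n \<Rightarrow> real"
  assumes t: "0 < t" and f: "f \<in> borel_measurable lebesgue" and f': "f' \<in> borel_measurable borel"
    and eq: "AE y in lebesgue. f y = f' y"
  shows "heat_semigroup m t f x = conv (heat_kernel m t) f' x"
proof -
  note km[measurable] = kernel_measurable[OF t]
  note f'[measurable]
  have bm: "(\<lambda>y. heat_kernel m t (x - y)) \<in> borel_measurable borel" "(\<lambda>y. heat_kernel m t (x - y) * f' y) \<in> borel_measurable borel"
    by measurable
  have "heat_semigroup m t f x = (\<integral>y. heat_kernel m t (x - y) * f' y \<partial>lebesgue)"
    unfolding heat_semigroup_def
  proof (rule integral_cong_AE)
    show "(\<lambda>y. heat_kernel m t (x - y) * f y) \<in> borel_measurable lebesgue"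
      by (rule borel_measurable_times[OF borel_imp_lebesgue_measurable[OF bm(1)] f])
    show "(\<lambda>y. heat_kernel m t (x - y) * f' y) \<in> borel_measurable lebesgue"
      by (rule borel_imp_lebesgue_measurable[OF bm(2)])
    show "AE y in lebesgue. heat_kernel m t (x - y) * f y = heat_kernel m t (x - y) * f' y"
      using eq by eventually_elim simp
  qed
  also have "\<dots> = (\<integral>y. heat_kernel m t (x - y) * f' y \<partial>lborel)"
    by (rule integral_completion) (use bm(2) in simp)
  finally show ?thesis by (simp add: conv_def)
qed

text \<open>
  The substitution \<open>\<tau> = t - s\<close>; measurability in \<open>s\<close> comes from joint continuity.
\<close>

lemma duhamel_eq_LINT:
  fixes f :: "real \<Rightarrow> real^'n \<Rightarrow> real"
  assumes r: "1 < r" and f: "cont_curve r f"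
  shows "set_integrable lebesgue {0<..<t} (\<lambda>\<tau>. conv (heat_kernel m (t - \<tau>)) (f \<tau>) x)
       \<longleftrightarrow> integrable lborel (\<lambda>s. indicator {0<..<t} s * conv (heat_kernel m s) (f (t - s)) x)"
    and "(LINT \<tau>:{0<..<t}|lebesgue. conv (heat_kernel m (t - \<tau>)) (f \<tau>) x) = duhamel t f x"
proof -
  define k where "k s = indicator {0<..<t} s * conv (heat_kernel m s) (f (t - s)) x" for s
  have "(\<lambda>s. (s, x)) \<in> borel \<rightarrow>\<^sub>M borel \<Otimes>\<^sub>M borel" by measurable
  from measurable_compose[OF this conv_curve_measurable[OF r f, of t]]
  have km[measurable]: "k \<in> borel_measurable borel" by (simp add: k_def[abs_def])
  have eq: "(\<lambda>\<tau>. indicator {0<..<t} \<tau> *\<^sub>R conv (heat_kernel m (t - \<tau>)) (f \<tau>) x) = (\<lambda>\<tau>. k (t + (- 1) * \<tau>))"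
    by (auto simp: k_def fun_eq_iff indicator_def)
  have m: "(\<lambda>\<tau>. k (t + (- 1) * \<tau>)) \<in> borel_measurable lborel" by measurable
  show "set_integrable lebesgue {0<..<t} (\<lambda>\<tau>. conv (heat_kernel m (t - \<tau>)) (f \<tau>) x)
       \<longleftrightarrow> integrable lborel (\<lambda>s. indicator {0<..<t} s * conv (heat_kernel m s) (f (t - s)) x)"
    unfolding set_integrable_def eq integrable_completion[OF m] k_def[symmetric]
    by (rule lborel_integrable_real_affine_iff) simp
  show "(LINT \<tau>:{0<..<t}|lebesgue. conv (heat_kernel m (t - \<tau>)) (f \<tau>) x) = duhamel t f x"
    unfolding set_lebesgue_integral_def eq integral_completion[OF m] duhamel_def k_def[symmetric]
    using lborel_integral_real_affine[of "-1" k t] by simp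
qed

lemma integrand_eq:
  fixes v v' :: "real \<Rightarrow> real^'n \<Rightarrow> real"
  assumes v: "\<And>t. 0 < t \<Longrightarrow> v t \<in> borel_measurable lebesgue" and v': "\<And>t. 0 < t \<Longrightarrow> v' t \<in> borel_measurable borel"
    and eq: "\<And>t. 0 < t \<Longrightarrow> AE x in lebesgue. v t x = v' t x"
    and \<tau>: "0 < \<tau>" "\<tau> < t"
  shows "heat_semigroup m (t - \<tau>) (\<lambda>y. norm y powr (- \<alpha>) * F (v \<tau> y)) x = conv (heat_kernel m (t - \<tau>)) (nonlin (v' \<tau>)) x"
proof (rule heat_semigroup_eq_conv)
  have w: "(\<lambda>y::real^'n. norm y powr (- \<alpha>)) \<in> borel_measurable borel" by measurable
  show "(\<lambda>y. norm y powr (- \<alpha>) * F (v \<tau> y)) \<in> borel_measurable lebesgue"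
    by (rule borel_measurable_times[OF borel_imp_lebesgue_measurable[OF w] measurable_compose[OF v[OF \<tau>(1)] F_measurable]])
  show "nonlin (v' \<tau>) \<in> borel_measurable borel" by (rule nonlin_measurable[OF v'[OF \<tau>(1)]])
  show "AE y in lebesgue. norm y powr (- \<alpha>) * F (v \<tau> y) = nonlin (v' \<tau>) y"
    using eq[OF \<tau>(1)] by eventually_elim (simp add: nonlin_def)
qed (use \<tau> in simp)

lemma solves_iff_mild:
  fixes v v' :: "real \<Rightarrow> real^'n \<Rightarrow> real"
  assumes v: "\<And>t. 0 < t \<Longrightarrow> v t \<in> borel_measurable lebesgue" and v': "\<And>t. 0 < t \<Longrightarrow> v' t \<in> borel_measurable borel"
    and eq: "\<And>t. 0 < t \<Longrightarrow> AE x in lebesgue. v t x = v' t x"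
    and u0: "u0 \<in> borel_measurable lebesgue" and u0': "u0' \<in> borel_measurable borel"
    and equ0: "AE x in lebesgue. u0 x = u0' x"
    and f: "cont_curve (rexp qc) (\<lambda>t. nonlin (v' t))"
  shows "solves_integral_equation m \<alpha> F u0 v \<longleftrightarrow> (AE x in lebesgue. v 0 x = u0 x) \<and>
    (\<forall>t>0. AE x in lborel. integrable lborel (\<lambda>s. indicator {0<..<t} s * conv (heat_kernel m s) (nonlin (v' (t - s))) x)
       \<and> v' t x = conv (heat_kernel m t) u0' x + duhamel t (\<lambda>\<tau>. nonlin (v' \<tau>)) x)"
proof -
  have r: "1 < rexp qc" by (rule rexp) simp
  have "(AE x in lebesgue.
        set_integrable lebesgue {0<..<t} (\<lambda>\<tau>. heat_semigroup m (t - \<tau>) (\<lambda>y. norm y powr (- \<alpha>) * F (v \<tau> y)) x) \<and>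
        v t x = heat_semigroup m t u0 x +
          (LINT \<tau>:{0<..<t}|lebesgue. heat_semigroup m (t - \<tau>) (\<lambda>y. norm y powr (- \<alpha>) * F (v \<tau> y)) x))
    \<longleftrightarrow> (AE x in lborel. integrable lborel (\<lambda>s. indicator {0<..<t} s * conv (heat_kernel m s) (nonlin (v' (t - s))) x)
       \<and> v' t x = conv (heat_kernel m t) u0' x + duhamel t (\<lambda>\<tau>. nonlin (v' \<tau>)) x)" (is "?L \<longleftrightarrow> ?R") if t: "0 < t" for t
  proof -
    have ie: "heat_semigroup m (t - \<tau>) (\<lambda>y. norm y powr (- \<alpha>) * F (v \<tau> y)) x = conv (heat_kernel m (t - \<tau>)) (nonlin (v' \<tau>)) x"
      if "0 < \<tau>" "\<tau> < t" for \<tau> x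
      by (rule integrand_eq[OF _ _ _ that]) (use v v' eq in auto)
    have i: "indicator {0<..<t} \<tau> *\<^sub>R heat_semigroup m (t - \<tau>) (\<lambda>y. norm y powr (- \<alpha>) * F (v \<tau> y)) x
       = indicator {0<..<t} \<tau> *\<^sub>R conv (heat_kernel m (t - \<tau>)) (nonlin (v' \<tau>)) x" for \<tau> x
      using ie[of \<tau> x] by (cases "\<tau> \<in> {0<..<t}") auto
    have si: "set_integrable lebesgue {0<..<t} (\<lambda>\<tau>. heat_semigroup m (t - \<tau>) (\<lambda>y. norm y powr (- \<alpha>) * F (v \<tau> y)) x)
       \<longleftrightarrow> integrable lborel (\<lambda>s. indicator {0<..<t} s * conv (heat_kernel m s) (nonlin (v' (t - s))) x)" for x
      using duhamel_eq_LINT(1)[OF r f, of t x] unfolding set_integrable_def i by simp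
    have li: "(LINT \<tau>:{0<..<t}|lebesgue. heat_semigroup m (t - \<tau>) (\<lambda>y. norm y powr (- \<alpha>) * F (v \<tau> y)) x)
       = duhamel t (\<lambda>\<tau>. nonlin (v' \<tau>)) x" for x
      using duhamel_eq_LINT(2)[OF r f, of t x] unfolding set_lebesgue_integral_def i by simp
    have h: "heat_semigroup m t u0 x = conv (heat_kernel m t) u0' x" for x
      by (rule heat_semigroup_eq_conv[OF t u0 u0' equ0])
    have e: "AE x in lborel. v t x = v' t x" using eq[OF t] by (simp add: AE_completion_iff)
    show ?thesis unfolding si li h AE_completion_iff
    proof
      assume "AE x in lborel. integrable lborel (\<lambda>s. indicator {0<..<t} s * conv (heat_kernel m s) (nonlin (v' (t - s))) x)
        \<and> v t x = conv (heat_kernel m t) u0' x + duhamel t (\<lambda>\<tau>. nonlin (v' \<tau>)) x"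
      with e show "AE x in lborel. integrable lborel (\<lambda>s. indicator {0<..<t} s * conv (heat_kernel m s) (nonlin (v' (t - s))) x)
        \<and> v' t x = conv (heat_kernel m t) u0' x + duhamel t (\<lambda>\<tau>. nonlin (v' \<tau>)) x"
        by eventually_elim simp
    next
      assume "AE x in lborel. integrable lborel (\<lambda>s. indicator {0<..<t} s * conv (heat_kernel m s) (nonlin (v' (t - s))) x)
        \<and> v' t x = conv (heat_kernel m t) u0' x + duhamel t (\<lambda>\<tau>. nonlin (v' \<tau>)) x"
      with e show "AE x in lborel. integrable lborel (\<lambda>s. indicator {0<..<t} s * conv (heat_kernel m s) (nonlin (v' (t - s))) x)
        \<and> v t x = conv (heat_kernel m t) u0' x + duhamel t (\<lambda>\<tau>. nonlin (v' \<tau>)) x"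
        by eventually_elim simp
    qed
  qed
  then show ?thesis unfolding solves_integral_equation_def by simp
qed

text \<open>
  Choose Borel representatives; they satisfy the equation between Borel functions, to which
  \<open>mild_solution_unique\<close> applies.
\<close>

lemma solutions_same_curve:
  fixes v w :: "real \<Rightarrow> real^'n \<Rightarrow> real"
  assumes B: "0 < B" and small: "step_const qc * B powr (p - 1) \<le> 1 / 2"
    and u0: "u0 \<in> weak_Lebesgue qc"
    and v: "v \<in> Cb qc" "solves_integral_equation m \<alpha> F u0 v" "sup_norm qc v \<le> ennreal B"
    and w: "w \<in> Cb qc" "solves_integral_equation m \<alpha> F u0 w" "sup_norm qc w \<le> ennreal B"
  shows "same_curve v w"
proof -
  have u0m: "u0 \<in> borel_measurable lebesgue" using u0 by (simp add: weak_Lebesgue_def)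
  obtain u0' where u0': "u0' \<in> borel_measurable borel" "AE x in lebesgue. u0 x = u0' x"
    by (rule borel_representative[OF u0m])
  have rep: "\<exists>x'. (\<forall>t>0. AE y in lebesgue. x t y = x' t y) \<and> (\<forall>t>0. weak_bound qc B (x' t)) \<and> cont_curve qc x' \<and>
     (\<forall>t>0. AE y in lborel. x' t y = conv (heat_kernel m t) u0' y + duhamel t (\<lambda>\<tau>. nonlin (x' \<tau>)) y) \<and> (AE y in lebesgue. x 0 y = u0 y)"
    if x: "x \<in> Cb qc" "solves_integral_equation m \<alpha> F u0 x" "sup_norm qc x \<le> ennreal B" for x
  proof -
    have xm: "x t \<in> borel_measurable lebesgue" if "0 < t" for t
      using x(1) that unfolding Cb_def Cb_pos_def weak_Lebesgue_def by blast
    obtain x' where x': "\<And>t. 0 < t \<Longrightarrow> AE y in lebesgue. x t y = x' t y" "\<And>t. 0 < t \<Longrightarrow> weak_bound qc B (x' t)" "cont_curve qc x'"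
      using Cb_representative[OF qc_bounds(1) x(1,3) less_imp_le[OF B]] by blast
    have "cont_curve (rexp qc) (\<lambda>t. nonlin (x' t))" by (rule nonlin_cont_curve[OF order_refl B x'(2,3)])
    note iff = solves_iff_mild[OF xm weak_boundD(2)[OF x'(2)] x'(1) u0m u0' this]
    have sol: "AE y in lebesgue. x 0 y = u0 y" "\<forall>t>0. AE y in lborel. integrable lborel (\<lambda>s. indicator {0<..<t} s * conv (heat_kernel m s) (nonlin (x' (t - s))) y)
       \<and> x' t y = conv (heat_kernel m t) u0' y + duhamel t (\<lambda>\<tau>. nonlin (x' \<tau>)) y"
      using x(2) iff by blast+
    have "\<forall>t>0. AE y in lborel. x' t y = conv (heat_kernel m t) u0' y + duhamel t (\<lambda>\<tau>. nonlin (x' \<tau>)) y"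
    proof (intro allI impI)
      fix t :: real assume "0 < t"
      with sol(2) have "AE y in lborel. integrable lborel (\<lambda>s. indicator {0<..<t} s * conv (heat_kernel m s) (nonlin (x' (t - s))) y)
       \<and> x' t y = conv (heat_kernel m t) u0' y + duhamel t (\<lambda>\<tau>. nonlin (x' \<tau>)) y" by blast
      then show "AE y in lborel. x' t y = conv (heat_kernel m t) u0' y + duhamel t (\<lambda>\<tau>. nonlin (x' \<tau>)) y"
        by eventually_elim simp
    qed
    with x' sol(1) show ?thesis by blast
  qed
  obtain v' where v': "\<And>t. 0 < t \<Longrightarrow> AE y in lebesgue. v t y = v' t y" "\<And>t. 0 < t \<Longrightarrow> weak_bound qc B (v' t)" "cont_curve qc v'"
    "\<And>t. 0 < t \<Longrightarrow> AE y in lborel. v' t y = conv (heat_kernel m t) u0' y + duhamel t (\<lambda>\<tau>. nonlin (v' \<tau>)) y" "AE y in lebesgue. v 0 y = u0 y"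
    using rep[OF v] by blast
  obtain w' where w': "\<And>t. 0 < t \<Longrightarrow> AE y in lebesgue. w t y = w' t y" "\<And>t. 0 < t \<Longrightarrow> weak_bound qc B (w' t)" "cont_curve qc w'"
    "\<And>t. 0 < t \<Longrightarrow> AE y in lborel. w' t y = conv (heat_kernel m t) u0' y + duhamel t (\<lambda>\<tau>. nonlin (w' \<tau>)) y" "AE y in lebesgue. w 0 y = u0 y"
    using rep[OF w] by blast
  show ?thesis
    unfolding same_curve_def
  proof (intro allI impI)
    fix t :: real assume "0 \<le> t"
    then consider "t = 0" | "0 < t" by linarith
    then show "AE x in lebesgue. v t x = w t x"
    proof cases
      case 1
      show ?thesis unfolding 1 using v'(5) w'(5) by eventually_elim simp
    next
      case 2
      have "AE x in lborel. v' t x = w' t x"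
        by (rule mild_solution_unique[OF B small v'(2,3) w'(2,3) v'(4) w'(4) 2])
      then have "AE x in lebesgue. v' t x = w' t x" by (rule AE_completion)
      then show ?thesis using v'(1)[OF 2] w'(1)[OF 2] by eventually_elim simp
    qed
  qed
qed

text \<open>
  On sets of finite measure the heat flow of \<open>u0\<close> tends to \<open>u0\<close> in \<open>L\<^sup>1\<close> and the Duhamel term is
  \<open>O(t)\<close>. Together with the uniform bound this gives convergence of the pairing with any \<open>\<phi>\<close> in the
  predual \<open>L^(q',1)\<close>, by \<open>weak_bound_Lorentz_pairing\<close>.
\<close>

lemma mild_solution_weak_star:
  fixes v :: "real \<Rightarrow> real^'n \<Rightarrow> real"
  assumes B: "0 < B" and v: "\<And>t. 0 < t \<Longrightarrow> weak_bound qc B (v t)" and cv: "cont_curve qc v"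
    and u0: "weak_bound qc \<epsilon> u0"
    and ev: "\<And>t. 0 < t \<Longrightarrow> AE x in lborel. v t x = conv (heat_kernel m t) u0 x + duhamel t (\<lambda>\<tau>. nonlin (v \<tau>)) x"
    and \<phi>: "\<phi> \<in> borel_measurable borel" "\<phi> \<in> Lorentz_one (qc / (qc - 1))"
    and s: "\<And>j::nat. 0 < s j" "s \<longlonglongrightarrow> 0"
  shows "(\<lambda>j. \<integral>x. v (s j) x * \<phi> x \<partial>lborel) \<longlonglongrightarrow> (\<integral>x. u0 x * \<phi> x \<partial>lborel)"
proof -
  note [measurable] = \<phi>(1) weak_boundD(2)[OF u0] weak_boundD(2)[OF v[OF s(1)]]
  note L = weak_bound_Lorentz_pairing[OF qc_bounds(1) \<phi>]
  define h where "h j x = v (s j) x - u0 x" for j x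
  have hb: "weak_bound qc (B + \<epsilon>) (h j)" for j unfolding h_def by (rule weak_bound_diff[OF v[OF s(1)] u0])
  note [measurable] = weak_boundD(2)[OF hb]
  have int: "integrable lborel (\<lambda>x. f x * \<phi> x)" if "weak_bound qc M f" for f M
  proof -
    note [measurable] = weak_boundD(2)[OF that]
    have "(\<integral>\<^sup>+x. ennreal (norm (f x * \<phi> x)) \<partial>lborel) = (\<integral>\<^sup>+x. ennreal \<bar>\<phi> x\<bar> * ennreal \<bar>f x\<bar> \<partial>lborel)"
      by (simp add: abs_mult ennreal_mult mult.commute)
    also have "\<dots> < \<infinity>" using L(1)[of M "\<lambda>_. f"] that by simp
    finally show ?thesis by (simp add: integrable_iff_bounded)
  qed
  define M where "M = nonlin_const qc * B powr (p - 1) * B"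
  have M: "0 \<le> M" using nonlin_const_pos[OF order_refl] B by (simp add: M_def)
  have r: "1 < rexp qc" by (rule rexp) simp
  have cn: "cont_curve (rexp qc) (\<lambda>t. nonlin (v t))" by (rule nonlin_cont_curve[OF order_refl B v cv])
  have nb: "weak_bound (rexp qc) M (nonlin (v \<tau>))" if "0 < \<tau>" for \<tau>
    unfolding M_def by (rule nonlin_bound[OF order_refl B B v[OF that] v[OF that]])
  have small: "weak_bound (rexp qc) (rexp qc * G1 * M * s j) (duhamel (s j) (\<lambda>\<tau>. nonlin (v \<tau>)))" for j
    by (rule duhamel_small_time[OF r cn s(1) M nb])
  have z0: "(\<lambda>j. \<integral>\<^sup>+x. ennreal \<bar>\<phi> x\<bar> * ennreal \<bar>h j x\<bar> \<partial>lborel) \<longlonglongrightarrow> 0"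
  proof (rule L(2)[OF hb])
    fix E :: "(real^'n) set" assume E: "E \<in> sets borel" "emeasure lborel E < \<infinity>"
    note [measurable] = E(1) weak_boundD(2)[OF small] kernel_measurable[OF s(1)]
    define a where "a = measure lborel E powr (1 - 1 / rexp qc)"
    have le: "(\<integral>\<^sup>+x\<in>E. ennreal \<bar>h j x\<bar> \<partial>lborel) \<le> (\<integral>\<^sup>+x\<in>E. ennreal \<bar>conv (heat_kernel m (s j)) u0 x - u0 x\<bar> \<partial>lborel) + ennreal (rexp qc * G1 * M * s j * a)" for j
    proof -
      have "(\<integral>\<^sup>+x\<in>E. ennreal \<bar>h j x\<bar> \<partial>lborel)
        \<le> (\<integral>\<^sup>+x. ennreal \<bar>conv (heat_kernel m (s j)) u0 x - u0 x\<bar> * indicator E x + ennreal \<bar>duhamel (s j) (\<lambda>\<tau>. nonlin (v \<tau>)) x\<bar> * indicator E x \<partial>lborel)"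
      proof (rule nn_integral_mono_AE)
        show "AE x in lborel. ennreal \<bar>h j x\<bar> * indicator E x
          \<le> ennreal \<bar>conv (heat_kernel m (s j)) u0 x - u0 x\<bar> * indicator E x + ennreal \<bar>duhamel (s j) (\<lambda>\<tau>. nonlin (v \<tau>)) x\<bar> * indicator E x"
          using ev[OF s(1)[of j]]
        proof eventually_elim
          case (elim x)
          have "\<bar>h j x\<bar> \<le> \<bar>conv (heat_kernel m (s j)) u0 x - u0 x\<bar> + \<bar>duhamel (s j) (\<lambda>\<tau>. nonlin (v \<tau>)) x\<bar>"
            unfolding h_def elim by linarith
          then show ?case by (auto simp: indicator_def simp flip: ennreal_plus intro!: ennreal_leI)
        qed
      qed
      also have "\<dots> = (\<integral>\<^sup>+x\<in>E. ennreal \<bar>conv (heat_kernel m (s j)) u0 x - u0 x\<bar> \<partial>lborel) + (\<integral>\<^sup>+x\<in>E. ennreal \<bar>duhamel (s j) (\<lambda>\<tau>. nonlin (v \<tau>)) x\<bar> \<partial>lborel)"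
        by (rule nn_integral_add) measurable
      also have "(\<integral>\<^sup>+x\<in>E. ennreal \<bar>duhamel (s j) (\<lambda>\<tau>. nonlin (v \<tau>)) x\<bar> \<partial>lborel) \<le> ennreal (rexp qc * G1 * M * s j * a)"
        unfolding a_def by (rule weak_boundD(3)[OF small E])
      finally show ?thesis by (simp add: add_left_mono)
    qed
    have "(\<lambda>j. rexp qc * G1 * M * s j * a) \<longlonglongrightarrow> rexp qc * G1 * M * 0 * a" by (intro tendsto_mult tendsto_const s(2))
    then have "(\<lambda>j. ennreal (rexp qc * G1 * M * s j * a)) \<longlonglongrightarrow> ennreal (rexp qc * G1 * M * 0 * a)" by (rule tendsto_ennrealI)
    then have "(\<lambda>j. (\<integral>\<^sup>+x\<in>E. ennreal \<bar>conv (heat_kernel m (s j)) u0 x - u0 x\<bar> \<partial>lborel) + ennreal (rexp qc * G1 * M * s j * a)) \<longlonglongrightarrow> 0 + ennreal (rexp qc * G1 * M * 0 * a)"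
      by (intro tendsto_add heat_initial_local[OF qc_bounds(1) u0 E s])
    then have z: "(\<lambda>j. (\<integral>\<^sup>+x\<in>E. ennreal \<bar>conv (heat_kernel m (s j)) u0 x - u0 x\<bar> \<partial>lborel) + ennreal (rexp qc * G1 * M * s j * a)) \<longlonglongrightarrow> 0" by simp
    show "(\<lambda>j. \<integral>\<^sup>+x\<in>E. ennreal \<bar>h j x\<bar> \<partial>lborel) \<longlonglongrightarrow> 0"
      by (rule tendsto_sandwich[OF _ _ tendsto_const z]) (simp_all add: le)
  qed
  have le0: "ennreal \<bar>(\<integral>x. v (s j) x * \<phi> x \<partial>lborel) - (\<integral>x. u0 x * \<phi> x \<partial>lborel)\<bar> \<le> (\<integral>\<^sup>+x. ennreal \<bar>\<phi> x\<bar> * ennreal \<bar>h j x\<bar> \<partial>lborel)" for j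
  proof -
    have "(\<integral>x. v (s j) x * \<phi> x \<partial>lborel) - (\<integral>x. u0 x * \<phi> x \<partial>lborel) = (\<integral>x. h j x * \<phi> x \<partial>lborel)"
      unfolding h_def left_diff_distrib using int[OF v[OF s(1)]] int[OF u0] by simp
    then show ?thesis
      using integral_norm_bound_ennreal[OF int[OF hb[of j]]] by (simp add: abs_mult ennreal_mult mult.commute)
  qed
  have "(\<lambda>j. ennreal \<bar>(\<integral>x. v (s j) x * \<phi> x \<partial>lborel) - (\<integral>x. u0 x * \<phi> x \<partial>lborel)\<bar>) \<longlonglongrightarrow> 0"
    by (rule tendsto_sandwich[OF _ _ tendsto_const z0]) (simp_all add: le0)
  then have "(\<lambda>j. ennreal \<bar>(\<integral>x. v (s j) x * \<phi> x \<partial>lborel) - (\<integral>x. u0 x * \<phi> x \<partial>lborel)\<bar>) \<longlonglongrightarrow> ennreal 0" by simp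
  then have "(\<lambda>j. \<bar>(\<integral>x. v (s j) x * \<phi> x \<partial>lborel) - (\<integral>x. u0 x * \<phi> x \<partial>lborel)\<bar>) \<longlonglongrightarrow> 0"
    by (subst (asm) tendsto_ennreal_iff) auto
  then have "(\<lambda>j. (\<integral>x. v (s j) x * \<phi> x \<partial>lborel) - (\<integral>x. u0 x * \<phi> x \<partial>lborel)) \<longlonglongrightarrow> 0"
    by (rule tendsto_rabs_zero_cancel)
  then show ?thesis by (rule LIM_zero_cancel)
qed

lemma cont_curve_powr_weight:
  assumes q: "cont_curve q v"
  shows "cont_curve q (\<lambda>t x. t powr d * v t x)"
  unfolding cont_curve_def
proof (intro conjI allI impI)
  fix t :: real assume t: "0 < t"
  obtain M where M: "weak_bound q M (v t)" using cont_curve_bound[OF q t] by blast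
  then show "\<exists>M. weak_bound q M (\<lambda>x. t powr d * v t x)" using weak_bound_cmult by blast
  have M0: "0 \<le> M" by (rule weak_boundD(1)[OF M])
  fix e :: real assume e: "0 < e"
  define w where "w = t powr d + 1"
  have w: "0 < w" by (simp add: w_def add_nonneg_pos)
  have e1: "0 < e / (2 * w)" using e w by simp
  obtain d1 where d1: "0 < d1" "\<And>t'. 0 < t' \<Longrightarrow> \<bar>t' - t\<bar> < d1 \<Longrightarrow> weak_bound q (e / (2 * w)) (\<lambda>x. v t' x - v t x)"
    using cont_curve_near[OF q t e1] by blast
  define e2 where "e2 = min 1 (e / (2 * (M + 1)))"
  have e2: "0 < e2" "e2 \<le> 1" "e2 * M \<le> e / 2"
  proof -
    show "0 < e2" "e2 \<le> 1" using e M0 by (auto simp: e2_def)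
    have "e2 * M \<le> e / (2 * (M + 1)) * M" using M0 by (intro mult_right_mono) (auto simp: e2_def)
    also have "\<dots> \<le> e / 2" using M0 e by (simp add: field_simps)
    finally show "e2 * M \<le> e / 2" .
  qed
  have "isCont (\<lambda>t. t powr d) t" using t by (intro continuous_intros) auto
  then obtain d2 where d2: "0 < d2" "\<And>t'. dist t' t < d2 \<Longrightarrow> dist (t' powr d) (t powr d) < e2"
    unfolding continuous_at_eps_delta using e2(1) by blast
  show "\<exists>d'>0. \<forall>t'>0. \<bar>t' - t\<bar> < d' \<longrightarrow> weak_bound q e (\<lambda>x. t' powr d * v t' x - t powr d * v t x)"
  proof (intro exI[of _ "min d1 d2"] conjI allI impI)
    fix t' assume t': "0 < t'" "\<bar>t' - t\<bar> < min d1 d2"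
    then have c: "\<bar>t' powr d - t powr d\<bar> < e2" using d2(2)[of t'] by (simp add: dist_real_def)
    have "weak_bound q (\<bar>t' powr d\<bar> * (e / (2 * w)) + \<bar>t' powr d - t powr d\<bar> * M)
       (\<lambda>x. t' powr d * (v t' x - v t x) + (t' powr d - t powr d) * v t x)"
      using t' by (intro weak_bound_add weak_bound_cmult d1(2) M) auto
    then have "weak_bound q (\<bar>t' powr d\<bar> * (e / (2 * w)) + \<bar>t' powr d - t powr d\<bar> * M) (\<lambda>x. t' powr d * v t' x - t powr d * v t x)"
      by (simp add: algebra_simps)
    then show "weak_bound q e (\<lambda>x. t' powr d * v t' x - t powr d * v t x)"
    proof (rule weak_bound_mono)
      have "\<bar>t' powr d\<bar> \<le> w"
        using c e2(2) powr_ge_zero[of t d] powr_ge_zero[of t' d] unfolding w_def by linarith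
      then have "\<bar>t' powr d\<bar> * (e / (2 * w)) \<le> w * (e / (2 * w))" using e w by (intro mult_right_mono) auto
      also have "\<dots> = e / 2" using w by simp
      finally have "\<bar>t' powr d\<bar> * (e / (2 * w)) \<le> e / 2" .
      moreover have "\<bar>t' powr d - t powr d\<bar> * M \<le> e2 * M" using c M0 by (intro mult_right_mono) auto
      ultimately show "\<bar>t' powr d\<bar> * (e / (2 * w)) + \<bar>t' powr d - t powr d\<bar> * M \<le> e" using e2(3) by linarith
    qed
  qed (use d1 d2 in auto)
qed

text \<open>
  Take the self-similar curve of the profile for \<open>t > 0\<close> and \<open>u0\<close> itself at \<open>t = 0\<close>. The scaling
  identity then holds at every point with \<open>t > 0\<close>, so no question about the measurability of the
  exceptional set in space-time arises.
\<close>

theorem selfsimilar_solution: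
  fixes u0 :: "real^'n \<Rightarrow> real"
  assumes q: "qc \<le> q" "wt q < 1" and \<epsilon>: "0 < \<epsilon>"
    and u0: "u0 \<in> weak_Lebesgue qc" "homogeneous (- \<gamma>) u0" "weak_norm qc u0 < ennreal \<epsilon>"
    and small: "step_const qc * (2 * heat_const qc * \<epsilon>) powr (p - 1) \<le> 1 / 2"
      "step_const q * (2 * heat_const qc * \<epsilon>) powr (p - 1) \<le> 1 / 2"
  obtains u where "u \<in> S_space qc q (wt q)" "solves_integral_equation m \<alpha> F u0 u" "u 0 = u0"
    "sup_norm qc u \<le> ennreal (qc / (qc - 1) * (2 * heat_const qc * \<epsilon>))"
    "(SUP t\<in>{0<..}. ennreal (t powr wt q) * weak_norm q (u t)) \<le> ennreal (q / (q - 1) * (2 * heat_const q * \<epsilon>))"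
    "\<And>\<sigma> t x. 0 < \<sigma> \<Longrightarrow> 0 < t \<Longrightarrow> u t x = rescale m \<alpha> p \<sigma> u t x"
proof -
  have u0m: "u0 \<in> borel_measurable lebesgue" using u0 by (simp add: weak_Lebesgue_def)
  obtain u0' where u0'[measurable]: "u0' \<in> borel_measurable borel" and eq0: "AE x in lebesgue. u0 x = u0' x"
    by (rule borel_representative[OF u0m])
  have eq0b: "AE x in lborel. u0 x = u0' x" using eq0 by (simp add: AE_completion_iff)
  have "weak_norm qc u0' = weak_norm qc u0"
    by (rule weak_norm_AE_cong[OF u0m borel_imp_lebesgue_measurable[OF u0'] eq0, symmetric])
  then have b0: "weak_bound qc \<epsilon> u0'" using u0(3) \<epsilon> by (intro weak_bound_of_weak_norm[OF u0']) auto
  have hom: "AE x in lborel. u0' (\<sigma> *\<^sub>R x) = \<sigma> powr (- \<gamma>) * u0' x" if \<sigma>: "0 < \<sigma>" for \<sigma>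
  proof -
    have "AE x in lborel. u0 (\<sigma> *\<^sub>R x) = \<sigma> powr (- \<gamma>) * u0 x"
      using u0(2) \<sigma> by (simp add: homogeneous_def AE_completion_iff)
    moreover have "AE x in lborel. u0 (0 + \<sigma> *\<^sub>R x) = u0' (0 + \<sigma> *\<^sub>R x)"
      by (rule AE_lborel_affine[OF _ eq0b]) (use \<sigma> in simp)
    ultimately show ?thesis using eq0b by eventually_elim simp
  qed
  define B where "B = 2 * heat_const qc * \<epsilon>"
  have B: "0 < B" using heat_const_pos[of qc] \<epsilon> by (simp add: B_def)
  obtain U where U: "weak_bound qc B U" "weak_bound q (2 * heat_const q * \<epsilon>) U"
    "cont_curve qc (selfsim U)" "cont_curve q (selfsim U)"
    "\<And>t. 0 < t \<Longrightarrow> AE x in lborel. selfsim U t x = conv (heat_kernel m t) u0' x + duhamel t (\<lambda>\<tau>. nonlin (selfsim U \<tau>)) x"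
    by (rule selfsimilar_solution_exists[OF q b0 \<epsilon> _ small, folded B_def]) (erule hom, rule that)
  have Ub: "weak_bound qc B (selfsim U t)" if "0 < t" for t using selfsim_bound[OF U(1) that] that by simp
  define u where "u t = (if 0 < t then selfsim U t else u0)" for t
  have u_pos: "u t = selfsim U t" if "0 < t" for t using that by (simp add: u_def)
  have u_zero: "u 0 = u0" by (simp add: u_def)
  have q1: "1 < q" by (rule rexp(4)[OF q(1)])
  have cu: "cont_curve qc u" by (rule cont_curve_cong[OF U(3) u_pos])
  have Cbp: "u \<in> Cb_pos qc" "sup_norm qc u \<le> ennreal (qc / (qc - 1) * B)"
    using cont_curve_in_Cb_pos[OF qc_bounds(1) cu, of B] Ub u_pos by auto
  have ws: "weak_star_tendsto qc u (u 0) (at_right 0)"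
    unfolding weak_star_tendsto_def
  proof (intro ballI)
    fix \<phi> :: "real^'n \<Rightarrow> real" assume \<phi>: "\<phi> \<in> Lorentz_one (qc / (qc - 1))"
    then have \<phi>m: "\<phi> \<in> borel_measurable lebesgue" by (simp add: Lorentz_one_def)
    obtain \<phi>' where \<phi>'[measurable]: "\<phi>' \<in> borel_measurable borel" and eq\<phi>: "AE x in lebesgue. \<phi> x = \<phi>' x"
      by (rule borel_representative[OF \<phi>m])
    have \<phi>'L: "\<phi>' \<in> Lorentz_one (qc / (qc - 1))"
      using \<phi> Lorentz_one_AE_cong[OF \<phi>m borel_imp_lebesgue_measurable[OF \<phi>'] eq\<phi>] by simp
    have int: "(\<integral>x. f x * \<phi> x \<partial>lebesgue) = (\<integral>x. f' x * \<phi>' x \<partial>lborel)"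
      if f: "f \<in> borel_measurable lebesgue" and f'[measurable]: "f' \<in> borel_measurable borel" and eq: "AE x in lebesgue. f x = f' x" for f f'
    proof -
      have m: "(\<lambda>x. f' x * \<phi>' x) \<in> borel_measurable borel" by measurable
      have "(\<integral>x. f x * \<phi> x \<partial>lebesgue) = (\<integral>x. f' x * \<phi>' x \<partial>lebesgue)"
        by (rule integral_cong_AE[OF borel_measurable_times[OF f \<phi>m] borel_imp_lebesgue_measurable[OF m]])
           (use eq eq\<phi> in eventually_elim, simp)
      also have "\<dots> = (\<integral>x. f' x * \<phi>' x \<partial>lborel)" by (rule integral_completion) (use m in simp)
      finally show ?thesis .
    qed
    have i0: "(\<integral>x. u 0 x * \<phi> x \<partial>lebesgue) = (\<integral>x. u0' x * \<phi>' x \<partial>lborel)"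
      unfolding u_zero by (rule int[OF u0m u0' eq0])
    have it: "(\<integral>x. u t x * \<phi> x \<partial>lebesgue) = (\<integral>x. selfsim U t x * \<phi>' x \<partial>lborel)" if t: "0 < t" for t
      unfolding u_pos[OF t]
      by (rule int[OF borel_imp_lebesgue_measurable[OF weak_boundD(2)[OF Ub[OF t]]] weak_boundD(2)[OF Ub[OF t]]]) simp
    show "((\<lambda>t. \<integral>x. u t x * \<phi> x \<partial>lebesgue) \<longlongrightarrow> (\<integral>x. u 0 x * \<phi> x \<partial>lebesgue)) (at_right 0)"
      unfolding tendsto_at_iff_sequentially i0
    proof (intro allI impI)
      fix X :: "nat \<Rightarrow> real" assume X: "\<forall>i. X i \<in> {0<..} - {0}" "X \<longlonglongrightarrow> 0"
      have Xp: "0 < X i" for i using X(1) by auto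
      have "(\<lambda>j. \<integral>x. selfsim U (X j) x * \<phi>' x \<partial>lborel) \<longlonglongrightarrow> (\<integral>x. u0' x * \<phi>' x \<partial>lborel)"
        by (rule mild_solution_weak_star[OF B Ub U(3) b0 U(5) \<phi>' \<phi>'L Xp X(2)])
      then show "((\<lambda>t. \<integral>x. u t x * \<phi> x \<partial>lebesgue) \<circ> X) \<longlonglongrightarrow> (\<integral>x. u0' x * \<phi>' x \<partial>lborel)"
        unfolding o_def it[OF Xp] .
    qed
  qed
  have uCb: "u \<in> Cb qc" unfolding Cb_def using Cbp(1) ws u0(1) by (simp add: u_zero)
  have Uq: "weak_bound q (2 * heat_const q * \<epsilon>) (\<lambda>x. t powr wt q * u t x)" if t: "0 < t" for t
  proof -
    have "weak_bound q (\<bar>t powr wt q\<bar> * (2 * heat_const q * \<epsilon> * t powr (- wt q))) (\<lambda>x. t powr wt q * u t x)"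
      unfolding u_pos[OF t] by (rule weak_bound_cmult[OF selfsim_bound[OF U(2) t]])
    moreover have "t powr wt q * t powr (- wt q) = 1" using t by (simp flip: powr_add)
    ultimately show ?thesis by (simp add: mult_ac)
  qed
  have cq: "cont_curve q u" by (rule cont_curve_cong[OF U(4) u_pos])
  have "(\<lambda>t x. t powr wt q * u t x) \<in> Cb_pos q"
    by (rule cont_curve_in_Cb_pos(1)[OF q1 cont_curve_powr_weight[OF cq] Uq])
  then have S: "u \<in> S_space qc q (wt q)" unfolding S_space_def using uCb by simp
  have sup: "(SUP t\<in>{0<..}. ennreal (t powr wt q) * weak_norm q (u t)) \<le> ennreal (q / (q - 1) * (2 * heat_const q * \<epsilon>))"
  proof (rule SUP_least)
    fix t :: real assume "t \<in> {0<..}"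
    then have t: "0 < t" by simp
    define A where "A = 2 * heat_const q * \<epsilon>"
    have A: "0 \<le> A" using heat_const_pos[of q] \<epsilon> by (simp add: A_def)
    have "weak_norm q (u t) \<le> ennreal (q / (q - 1) * (A * t powr (- wt q)))"
      unfolding u_pos[OF t] A_def by (rule weak_norm_le[OF q1 selfsim_bound[OF U(2) t]])
    then have "ennreal (t powr wt q) * weak_norm q (u t) \<le> ennreal (t powr wt q) * ennreal (q / (q - 1) * (A * t powr (- wt q)))"
      by (rule mult_left_mono) simp
    also have "\<dots> = ennreal (q / (q - 1) * A * (t powr wt q * t powr (- wt q)))"
      using A q1 by (simp add: mult_ac flip: ennreal_mult)
    also have "t powr wt q * t powr (- wt q) = 1" using t by (simp flip: powr_add)
    finally show "ennreal (t powr wt q) * weak_norm q (u t) \<le> ennreal (q / (q - 1) * (2 * heat_const q * \<epsilon>))"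
      by (simp add: A_def)
  qed
  have um: "u t \<in> borel_measurable borel" if "0 < t" for t
    unfolding u_pos[OF that] by (rule weak_boundD(2)[OF Ub[OF that]])
  have nc: "cont_curve (rexp qc) (\<lambda>t. nonlin (u t))"
    by (rule nonlin_cont_curve[OF order_refl B _ cu]) (use Ub u_pos in simp)
  have sol: "solves_integral_equation m \<alpha> F u0 u"
  proof (rule solves_iff_mild[where v = u and v' = u and u0' = u0', OF _ _ _ u0m u0' eq0 nc, THEN iffD2], goal_cases)
    case (1 t)
    then show ?case by (rule borel_imp_lebesgue_measurable[OF um])
  next
    case (2 t)
    then show ?case by (rule um)
  next
    case (3 t)
    show ?case by simp
  next
    case 4
    show ?case
  proof (intro conjI allI impI)
    show "AE x in lebesgue. u 0 x = u0 x" by (simp add: u_zero)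
    fix t :: real assume t: "0 < t"
    have i: "AE x in lborel. integrable lborel (\<lambda>s. indicator {0<..<t} s * conv (heat_kernel m s) (nonlin (u (t - s))) x)"
      by (rule duhamel_nonlin_integrable[OF B t _ cu]) (use Ub u_pos in simp)
    have d: "duhamel t (\<lambda>\<tau>. nonlin (u \<tau>)) x = duhamel t (\<lambda>\<tau>. nonlin (selfsim U \<tau>)) x" for x
      unfolding duhamel_def by (rule Bochner_Integration.integral_cong) (auto simp: indicator_def u_pos)
    show "AE x in lborel. integrable lborel (\<lambda>s. indicator {0<..<t} s * conv (heat_kernel m s) (nonlin (u (t - s))) x)
       \<and> u t x = conv (heat_kernel m t) u0' x + duhamel t (\<lambda>\<tau>. nonlin (u \<tau>)) x"
      unfolding u_pos[OF t] d using i U(5)[OF t] by eventually_elim simp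
  qed
  qed
  have resc: "u t x = rescale m \<alpha> p \<sigma> u t x" if \<sigma>: "0 < \<sigma>" and t: "0 < t" for \<sigma> t x
  proof -
    have pos: "0 < \<sigma> powr (2 * m) * t" using \<sigma> t by simp
    have "rescale m \<alpha> p \<sigma> u t x = \<sigma> powr \<gamma> * selfsim U (\<sigma> powr (2 * m) * t) (\<sigma> *\<^sub>R x)"
      unfolding rescale_def u_pos[OF pos] by (simp add: \<gamma>_def)
    also have "\<dots> = (\<sigma> powr \<gamma> * \<sigma> powr (- \<gamma>)) * selfsim U t x" unfolding selfsim_rescale[OF \<sigma> t] by simp
    also have "\<sigma> powr \<gamma> * \<sigma> powr (- \<gamma>) = 1" using \<sigma> by (simp flip: powr_add)
    finally show ?thesis by (simp add: u_pos[OF t])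
  qed
  show thesis by (rule that[OF S sol u_zero _ sup resc]) (use Cbp(2) in \<open>simp_all add: B_def\<close>)
qed

end

lemma exists_small_radius:
  fixes K :: real
  assumes "0 < K" "1 < p"
  obtains r where "0 < r" "\<And>s. 0 < s \<Longrightarrow> s \<le> r \<Longrightarrow> K * s powr (p - 1) \<le> 1 / 2"
proof
  define r where "r = (1 / (2 * K)) powr (1 / (p - 1))"
  show "0 < r" using assms by (simp add: r_def)
  fix s :: real assume s: "0 < s" "s \<le> r"
  have "s powr (p - 1) \<le> r powr (p - 1)" using s assms by (intro powr_mono2) auto
  also have "\<dots> = 1 / (2 * K)" using assms by (simp add: r_def powr_powr)
  finally show "K * s powr (p - 1) \<le> 1 / 2" using assms by (simp add: field_simps)
qed

section \<open>Self-similar solutions for small homogeneous data\<close>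

lemma AE_time_nonzero: "AE z in (lebesgue :: ((real^'n) \<times> real) measure). snd z \<noteq> 0"
proof -
  have "negligible {z :: (real^'n) \<times> real. (0, 1) \<bullet> z = 0}"
    by (rule negligible_hyperplane) (simp add: zero_prod_def)
  then have "{z :: (real^'n) \<times> real. (0, 1) \<bullet> z = 0} \<in> null_sets lebesgue"
    by (simp add: negligible_iff_null_sets)
  then show ?thesis by (rule AE_I') (auto simp: inner_prod_def)
qed

theorem theorem5p2:
  fixes m \<alpha> p C n qc :: real and F :: "real \<Rightarrow> real"
  defines "n \<equiv> real CARD('n::finite)"
  defines "qc \<equiv> n * (p - 1) / (2 * m - \<alpha>)"
  assumes "m \<in> {0<..<1} \<union> \<nat>"
    and "0 < \<alpha>" and "\<alpha> < 2 * m" and "2 * m < n"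
    and "(n - \<alpha>) / (n - 2 * m) < p"
    and "F 0 = 0"
    and "0 < C"
    and "\<And>a b. \<bar>F a - F b\<bar> \<le> C * \<bar>a - b\<bar> * (\<bar>a\<bar> powr (p - 1) + \<bar>b\<bar> powr (p - 1))"
    and "\<And>l a. 0 < l \<Longrightarrow> F (l * a) = l powr p * F a"
  shows "\<exists>\<epsilon>>0. \<exists>\<theta>>0.
    (\<forall>u0 :: real^'n \<Rightarrow> real.
       u0 \<in> weak_Lebesgue qc \<longrightarrow> homogeneous (- ((2 * m - \<alpha>) / (p - 1))) u0 \<longrightarrow>
       weak_norm qc u0 < ennreal \<epsilon> \<longrightarrow>
       (\<exists>u. u \<in> Cb qc \<and> solves_integral_equation m \<alpha> F u0 u \<and> sup_norm qc u \<le> ennreal (2 * \<theta>) \<and>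
          (\<forall>v. v \<in> Cb qc \<and> solves_integral_equation m \<alpha> F u0 v \<and> sup_norm qc v \<le> ennreal (2 * \<theta>)
             \<longrightarrow> same_curve v u) \<and>
          (\<forall>\<sigma>>0. AE (x, t) in (lebesgue :: ((real^'n) \<times> real) measure).
             0 \<le> t \<longrightarrow> u t x = rescale m \<alpha> p \<sigma> u t x))) \<and>
    (2 * m + \<alpha> < n \<longrightarrow> p < 2 * m / \<alpha> \<longrightarrow>
      (\<forall>q \<delta>. qc < q \<and> q < n * p * (p - 1) / (2 * m - \<alpha> * p) \<and> \<delta> = n / (2 * m) * (1 / qc - 1 / q) \<longrightarrow>
        (\<exists>\<epsilon>q \<theta>q. 0 < \<epsilon>q \<and> \<epsilon>q < \<epsilon> \<and> 0 < \<theta>q \<and>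
          (\<forall>u0 :: real^'n \<Rightarrow> real.
             u0 \<in> weak_Lebesgue qc \<longrightarrow> homogeneous (- ((2 * m - \<alpha>) / (p - 1))) u0 \<longrightarrow>
             weak_norm qc u0 < ennreal \<epsilon>q \<longrightarrow>
             (\<exists>u. u \<in> S_space qc q \<delta> \<and> solves_integral_equation m \<alpha> F u0 u \<and>
                S_norm qc q \<delta> u \<le> ennreal (2 * \<theta>q) \<and>
                (\<forall>v. v \<in> S_space qc q \<delta> \<and> solves_integral_equation m \<alpha> F u0 v \<and>
                   S_norm qc q \<delta> v \<le> ennreal (2 * \<theta>q) \<longrightarrow> same_curve v u) \<and>
                (\<forall>\<sigma>>0. same_curve u (rescale m \<alpha> p \<sigma> u)))))))"
proof -
  have m0: "0 < m" using \<open>0 < \<alpha>\<close> \<open>\<alpha> < 2 * m\<close> by linarith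
  obtain G1 G2 where ker: "kernel_family (heat_kernel m :: real \<Rightarrow> real^'n \<Rightarrow> real) m G1 G2"
    using heat_kernel_family[OF m0] by blast
  interpret K: kernel_family "heat_kernel m :: real \<Rightarrow> real^'n \<Rightarrow> real" m G1 G2 by (rule ker)
  interpret H: heat_problem m G1 G2 \<alpha> p C F
    by unfold_locales (use assms in \<open>simp_all add: n_def\<close>)
  have qc: "H.qc = qc" by (simp add: H.qc_def qc_def n_def)
  have \<gamma>: "H.\<gamma> = (2 * m - \<alpha>) / (p - 1)" by (rule H.\<gamma>_def)
  note p1 = H.p_gt_1
  note qcb = H.qc_bounds(1)[unfolded qc]
  define hc where "hc = H.heat_const qc"
  have hc: "0 < hc" unfolding hc_def by (rule H.heat_const_pos)
  have sc: "0 < H.step_const qc" using H.step_const_pos[of qc] H.wt_qc by (simp add: qc)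
  obtain B where B: "0 < B" "\<And>s. 0 < s \<Longrightarrow> s \<le> B \<Longrightarrow> H.step_const qc * s powr (p - 1) \<le> 1 / 2"
    by (rule exists_small_radius[OF sc p1]) (rule that)
  define \<theta> where "\<theta> = B / 2"
  have \<theta>: "0 < \<theta>" "2 * \<theta> = B" using B by (auto simp: \<theta>_def)
  \<comment> \<open>The solution has critical bound \<open>2 hc \<epsilon>\<close> in the integral form of the norm, and the factor
    \<open>qc / (qc - 1)\<close> is the price of returning to the norm of the theorem.\<close>
  define \<epsilon> where "\<epsilon> = (qc - 1) / qc * B / (2 * hc)"
  have \<epsilon>: "0 < \<epsilon>" using B hc qcb by (simp add: \<epsilon>_def)
  have \<epsilon>B: "qc / (qc - 1) * (2 * hc * \<epsilon>) = B" using hc qcb by (simp add: \<epsilon>_def)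
  have small: "2 * hc * \<epsilon>' \<le> B" if "0 < \<epsilon>'" "\<epsilon>' \<le> \<epsilon>" for \<epsilon>'
  proof -
    have "2 * hc * \<epsilon>' \<le> 2 * hc * \<epsilon>" using that hc by simp
    also have "\<dots> = (qc - 1) / qc * B" using hc by (simp add: \<epsilon>_def)
    also have "\<dots> \<le> 1 * B" using B qcb by (intro mult_right_mono) (auto simp: field_simps)
    finally show ?thesis by simp
  qed
  have uniq: "same_curve v w" if "u0 \<in> weak_Lebesgue qc"
      "v \<in> Cb qc" "solves_integral_equation m \<alpha> F u0 v" "sup_norm qc v \<le> ennreal B"
      "w \<in> Cb qc" "solves_integral_equation m \<alpha> F u0 w" "sup_norm qc w \<le> ennreal B" for u0 :: "real^'n \<Rightarrow> real" and v w
    by (rule H.solutions_same_curve[OF B(1) _ that[folded qc]]) (use B(2)[OF B(1) order_refl] in \<open>simp add: qc\<close>)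
  show ?thesis
  proof (intro exI conjI)
    show "0 < \<epsilon>" "0 < \<theta>" by (fact \<epsilon>) (fact \<theta>(1))
    show "\<forall>u0 :: real^'n \<Rightarrow> real.
       u0 \<in> weak_Lebesgue qc \<longrightarrow> homogeneous (- ((2 * m - \<alpha>) / (p - 1))) u0 \<longrightarrow>
       weak_norm qc u0 < ennreal \<epsilon> \<longrightarrow>
       (\<exists>u. u \<in> Cb qc \<and> solves_integral_equation m \<alpha> F u0 u \<and> sup_norm qc u \<le> ennreal (2 * \<theta>) \<and>
          (\<forall>v. v \<in> Cb qc \<and> solves_integral_equation m \<alpha> F u0 v \<and> sup_norm qc v \<le> ennreal (2 * \<theta>)
             \<longrightarrow> same_curve v u) \<and>
          (\<forall>\<sigma>>0. AE (x, t) in (lebesgue :: ((real^'n) \<times> real) measure).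
             0 \<le> t \<longrightarrow> u t x = rescale m \<alpha> p \<sigma> u t x))"
    proof (intro allI impI)
      fix u0 :: "real^'n \<Rightarrow> real"
      assume u0: "u0 \<in> weak_Lebesgue qc" "homogeneous (- ((2 * m - \<alpha>) / (p - 1))) u0" "weak_norm qc u0 < ennreal \<epsilon>"
      have sm: "H.step_const H.qc * (2 * H.heat_const H.qc * \<epsilon>) powr (p - 1) \<le> 1 / 2"
        using B(2)[of "2 * hc * \<epsilon>"] small[OF \<epsilon> order_refl] hc \<epsilon> by (simp add: hc_def qc)
      have w1: "H.wt H.qc < 1" by simp
      obtain u where u: "u \<in> S_space H.qc H.qc (H.wt H.qc)" "solves_integral_equation m \<alpha> F u0 u" "u 0 = u0"
        "sup_norm H.qc u \<le> ennreal (H.qc / (H.qc - 1) * (2 * H.heat_const H.qc * \<epsilon>))"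
        "\<And>\<sigma> t x. 0 < \<sigma> \<Longrightarrow> 0 < t \<Longrightarrow> u t x = rescale m \<alpha> p \<sigma> u t x"
        by (rule H.selfsimilar_solution[OF order_refl w1 \<epsilon> u0[folded qc \<gamma>] sm sm]) (rule that)
      have uCb: "u \<in> Cb qc" using u(1) by (simp add: S_space_def qc)
      have us: "sup_norm qc u \<le> ennreal B" using u(4) \<epsilon>B by (simp add: qc hc_def)
      have ae: "AE (x, t) in (lebesgue :: ((real^'n) \<times> real) measure). 0 \<le> t \<longrightarrow> u t x = rescale m \<alpha> p \<sigma> u t x" if "0 < \<sigma>" for \<sigma>
        using AE_time_nonzero
      proof eventually_elim
        case (elim z)
        obtain x t where z: "z = (x, t)" by (cases z)
        show ?case using elim u(5)[OF that, of t x] by (auto simp: z)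
      qed
      show "\<exists>u. u \<in> Cb qc \<and> solves_integral_equation m \<alpha> F u0 u \<and> sup_norm qc u \<le> ennreal (2 * \<theta>) \<and>
          (\<forall>v. v \<in> Cb qc \<and> solves_integral_equation m \<alpha> F u0 v \<and> sup_norm qc v \<le> ennreal (2 * \<theta>)
             \<longrightarrow> same_curve v u) \<and>
          (\<forall>\<sigma>>0. AE (x, t) in (lebesgue :: ((real^'n) \<times> real) measure).
             0 \<le> t \<longrightarrow> u t x = rescale m \<alpha> p \<sigma> u t x)"
        unfolding \<theta>(2) using uCb u(2) us uniq[OF u0(1) _ _ _ uCb u(2) us] ae by blast
    qed
    show "2 * m + \<alpha> < n \<longrightarrow> p < 2 * m / \<alpha> \<longrightarrow>
      (\<forall>q \<delta>. qc < q \<and> q < n * p * (p - 1) / (2 * m - \<alpha> * p) \<and> \<delta> = n / (2 * m) * (1 / qc - 1 / q) \<longrightarrow>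
        (\<exists>\<epsilon>q \<theta>q. 0 < \<epsilon>q \<and> \<epsilon>q < \<epsilon> \<and> 0 < \<theta>q \<and>
          (\<forall>u0 :: real^'n \<Rightarrow> real.
             u0 \<in> weak_Lebesgue qc \<longrightarrow> homogeneous (- ((2 * m - \<alpha>) / (p - 1))) u0 \<longrightarrow>
             weak_norm qc u0 < ennreal \<epsilon>q \<longrightarrow>
             (\<exists>u. u \<in> S_space qc q \<delta> \<and> solves_integral_equation m \<alpha> F u0 u \<and>
                S_norm qc q \<delta> u \<le> ennreal (2 * \<theta>q) \<and>
                (\<forall>v. v \<in> S_space qc q \<delta> \<and> solves_integral_equation m \<alpha> F u0 v \<and>
                   S_norm qc q \<delta> v \<le> ennreal (2 * \<theta>q) \<longrightarrow> same_curve v u) \<and>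
                (\<forall>\<sigma>>0. same_curve u (rescale m \<alpha> p \<sigma> u))))))"
    proof (intro impI allI, elim conjE)
      fix q \<delta> :: real
      assume p\<alpha>: "p < 2 * m / \<alpha>" and q: "qc < q" "q < n * p * (p - 1) / (2 * m - \<alpha> * p)"
        and \<delta>: "\<delta> = n / (2 * m) * (1 / qc - 1 / q)"
      have \<delta>w: "\<delta> = H.wt q" unfolding \<delta> H.wt_def by (simp add: K.rate_def n_def qc)
      have q': "H.qc \<le> q" using q by (simp add: qc)
      have q0: "1 < q" using q qcb by linarith
      have n0: "0 < n" using \<open>2 * m < n\<close> m0 by linarith
      \<comment> \<open>The upper bound on \<open>q\<close> is equivalent to \<open>\<delta> < 1 / p\<close>.\<close>
      have w1: "H.wt q < 1"
      proof -
        have pos: "0 < 2 * m - \<alpha> * p" using p\<alpha> \<open>0 < \<alpha>\<close> by (simp add: field_simps)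
        have "(2 * m - \<alpha> * p) / (n * p * (p - 1)) < 1 / q"
          using q(2) pos q0 n0 p1 by (simp add: field_simps)
        then have "1 / qc - 1 / q < (2 * m - \<alpha>) / (n * (p - 1)) - (2 * m - \<alpha> * p) / (n * p * (p - 1))"
          by (simp add: qc_def)
        also have "\<dots> = 2 * m / (n * p)"
        proof -
          have "a / (n * d) - b / (n * p * d) = (a * p - b) / (n * p * d)" if "0 < d" for a b d :: real
            using that n0 p1 by (simp add: field_simps)
          then have "(2 * m - \<alpha>) / (n * (p - 1)) - (2 * m - \<alpha> * p) / (n * p * (p - 1))
              = ((2 * m - \<alpha>) * p - (2 * m - \<alpha> * p)) / (n * p * (p - 1))" using p1 by simp
          also have "(2 * m - \<alpha>) * p - (2 * m - \<alpha> * p) = 2 * m * (p - 1)" by (simp add: algebra_simps)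
          finally show ?thesis using p1 by simp
        qed
        finally have "n / (2 * m) * (1 / qc - 1 / q) < n / (2 * m) * (2 * m / (n * p))"
          using n0 m0 by (intro mult_strict_left_mono) auto
        also have "\<dots> = 1 / p" using n0 m0 by simp
        also have "\<dots> < 1" using p1 by simp
        finally show ?thesis using \<delta>w \<delta> by simp
      qed
      have hq: "0 < H.heat_const q" by (rule H.heat_const_pos)
      obtain Bq where Bq: "0 < Bq" "\<And>s. 0 < s \<Longrightarrow> s \<le> Bq \<Longrightarrow> H.step_const q * s powr (p - 1) \<le> 1 / 2"
        by (rule exists_small_radius[OF H.step_const_pos[OF q' w1] p1]) (rule that)
      define S where "S = qc / (qc - 1) * (2 * hc) + q / (q - 1) * (2 * H.heat_const q)"
      have S: "0 < S" unfolding S_def using hc hq q0 qcb by (intro add_pos_pos mult_pos_pos) auto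
      \<comment> \<open>In turn: strictly below \<open>\<epsilon>\<close>; the contraction in \<open>L^(q,\<infinity>)\<close>; the norm of the solution in the smaller
        space stays within the radius \<open>B\<close> in which uniqueness is known. Hence \<open>\<theta>q = \<theta>\<close> works.\<close>
      define \<epsilon>q where "\<epsilon>q = min (\<epsilon> / 2) (min (Bq / (2 * hc)) (B / S))"
      have \<epsilon>q: "0 < \<epsilon>q" "\<epsilon>q < \<epsilon>" "\<epsilon>q \<le> \<epsilon>" using \<epsilon> Bq B hc S by (auto simp: \<epsilon>q_def)
      have "\<epsilon>q \<le> Bq / (2 * hc)" by (simp add: \<epsilon>q_def)
      then have \<epsilon>q1: "2 * hc * \<epsilon>q \<le> Bq" using hc by (simp add: field_simps)
      have "\<epsilon>q \<le> B / S" by (simp add: \<epsilon>q_def)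
      then have \<epsilon>q2: "S * \<epsilon>q \<le> B" using S by (simp add: field_simps)
      show "\<exists>\<epsilon>q \<theta>q. 0 < \<epsilon>q \<and> \<epsilon>q < \<epsilon> \<and> 0 < \<theta>q \<and>
          (\<forall>u0 :: real^'n \<Rightarrow> real.
             u0 \<in> weak_Lebesgue qc \<longrightarrow> homogeneous (- ((2 * m - \<alpha>) / (p - 1))) u0 \<longrightarrow>
             weak_norm qc u0 < ennreal \<epsilon>q \<longrightarrow>
             (\<exists>u. u \<in> S_space qc q \<delta> \<and> solves_integral_equation m \<alpha> F u0 u \<and>
                S_norm qc q \<delta> u \<le> ennreal (2 * \<theta>q) \<and>
                (\<forall>v. v \<in> S_space qc q \<delta> \<and> solves_integral_equation m \<alpha> F u0 v \<and>
                   S_norm qc q \<delta> v \<le> ennreal (2 * \<theta>q) \<longrightarrow> same_curve v u) \<and>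
                (\<forall>\<sigma>>0. same_curve u (rescale m \<alpha> p \<sigma> u))))"
      proof (rule exI[of _ \<epsilon>q], rule exI[of _ \<theta>], intro conjI allI impI)
        show "0 < \<epsilon>q" "\<epsilon>q < \<epsilon>" "0 < \<theta>" by (fact \<epsilon>q(1)) (fact \<epsilon>q(2), fact \<theta>(1))
        fix u0 :: "real^'n \<Rightarrow> real"
        assume u0: "u0 \<in> weak_Lebesgue qc" "homogeneous (- ((2 * m - \<alpha>) / (p - 1))) u0" "weak_norm qc u0 < ennreal \<epsilon>q"
        have sm: "H.step_const H.qc * (2 * H.heat_const H.qc * \<epsilon>q) powr (p - 1) \<le> 1 / 2"
          using B(2)[of "2 * hc * \<epsilon>q"] small[OF \<epsilon>q(1,3)] hc \<epsilon>q by (simp add: hc_def qc)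
        have smq: "H.step_const q * (2 * H.heat_const H.qc * \<epsilon>q) powr (p - 1) \<le> 1 / 2"
          using Bq(2)[of "2 * hc * \<epsilon>q"] \<epsilon>q1 hc \<epsilon>q by (simp add: hc_def qc)
        obtain u where u: "u \<in> S_space H.qc q (H.wt q)" "solves_integral_equation m \<alpha> F u0 u" "u 0 = u0"
          "sup_norm H.qc u \<le> ennreal (H.qc / (H.qc - 1) * (2 * H.heat_const H.qc * \<epsilon>q))"
          "(SUP t\<in>{0<..}. ennreal (t powr H.wt q) * weak_norm q (u t)) \<le> ennreal (q / (q - 1) * (2 * H.heat_const q * \<epsilon>q))"
          "\<And>\<sigma> t x. 0 < \<sigma> \<Longrightarrow> 0 < t \<Longrightarrow> u t x = rescale m \<alpha> p \<sigma> u t x"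
          by (rule H.selfsimilar_solution[OF q' w1 \<epsilon>q(1) u0[folded qc \<gamma>] sm smq]) (rule that)
        have uS: "u \<in> S_space qc q \<delta>" using u(1) by (simp add: qc \<delta>w)
        have uCb: "u \<in> Cb qc" using uS by (simp add: S_space_def)
        have "S_norm qc q \<delta> u \<le> ennreal (qc / (qc - 1) * (2 * hc * \<epsilon>q)) + ennreal (q / (q - 1) * (2 * H.heat_const q * \<epsilon>q))"
          unfolding S_norm_def \<delta>w using u(4,5) by (intro add_mono) (auto simp: qc hc_def)
        also have "\<dots> = ennreal (S * \<epsilon>q)"
          using hc hq q0 qcb \<epsilon>q(1) by (simp add: S_def algebra_simps flip: ennreal_plus)
        also have "\<dots> \<le> ennreal B" by (rule ennreal_leI[OF \<epsilon>q2])
        finally have Sn: "S_norm qc q \<delta> u \<le> ennreal B" .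
        have sup_le: "sup_norm qc v \<le> ennreal B" if "S_norm qc q \<delta> v \<le> ennreal B" for v :: "real \<Rightarrow> real^'n \<Rightarrow> real"
        proof -
          have "sup_norm qc v \<le> S_norm qc q \<delta> v" unfolding S_norm_def by simp
          then show ?thesis using that by (rule order_trans)
        qed
        have sc: "same_curve u (rescale m \<alpha> p \<sigma> u)" if \<sigma>: "0 < \<sigma>" for \<sigma>
          unfolding same_curve_def
        proof (intro allI impI)
          fix t :: real assume "0 \<le> t"
          then consider "t = 0" | "0 < t" by linarith
          then show "AE x in lebesgue. u t x = rescale m \<alpha> p \<sigma> u t x"
          proof cases
            case 1
            have "AE x in lebesgue. u0 (\<sigma> *\<^sub>R x) = \<sigma> powr (- H.\<gamma>) * u0 x"
              using u0(2) \<sigma> by (simp add: homogeneous_def \<gamma>)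
            then show ?thesis
            proof eventually_elim
              case (elim x)
              have "\<sigma> powr H.\<gamma> * (\<sigma> powr (- H.\<gamma>) * u0 x) = (\<sigma> powr H.\<gamma> * \<sigma> powr (- H.\<gamma>)) * u0 x" by simp
              also have "\<sigma> powr H.\<gamma> * \<sigma> powr (- H.\<gamma>) = 1" using \<sigma> by (simp flip: powr_add)
              finally show ?case unfolding 1 rescale_def by (simp add: u(3) elim flip: \<gamma>)
            qed
          next
            case 2
            show ?thesis using u(6)[OF \<sigma> 2] by (intro AE_I2)
          qed
        qed
        have un: "same_curve v u" if "v \<in> S_space qc q \<delta> \<and> solves_integral_equation m \<alpha> F u0 v \<and> S_norm qc q \<delta> v \<le> ennreal B" for v
          using that uniq[OF u0(1) _ _ _ uCb u(2) sup_le[OF Sn], of v] sup_le[of v] by (auto simp: S_space_def)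
        show "\<exists>u. u \<in> S_space qc q \<delta> \<and> solves_integral_equation m \<alpha> F u0 u \<and>
                S_norm qc q \<delta> u \<le> ennreal (2 * \<theta>) \<and>
                (\<forall>v. v \<in> S_space qc q \<delta> \<and> solves_integral_equation m \<alpha> F u0 v \<and>
                   S_norm qc q \<delta> v \<le> ennreal (2 * \<theta>) \<longrightarrow> same_curve v u) \<and>
                (\<forall>\<sigma>>0. same_curve u (rescale m \<alpha> p \<sigma> u))"
          unfolding \<theta>(2) using uS u(2) Sn un sc by blast
      qed
    qed
  qed
qed

end
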